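(* Let $(Q,\omega,\Upsilon_+)$ be a $6$-manifold with an $\mathrm{SU}(3)$-structure whose torsion forms satisfy $\sigma_2=\pi_2=0$ and $\pi_1=2\nu_1$, and let $M$ be a principal $S^1$-bundle over $Q$ with connection form $\eta$ such that $d\eta\in\Lambda^2_8$. Let $A$ be an $\mathrm{SU}(3)$-instanton on $Q$ with gauge group $G$, and assume that $(\omega,\Upsilon_+,A)$ solves the $\mathrm{SU}(3)$ heterotic Bianchi identity $$dT_\omega=\langle F_A\wedge F_A\rangle_{\mathfrak g}.$$ Define, for $t\in[0,2\pi)$, $$\varphi_t=\eta\wedge\omega+\mathrm{Re}\big(e^{it}(\Upsilon_++i\Upsilon_-)\big).$$ Then $(\varphi_t,\eta\oplus A)$ is a solution of the heterotic $\mathrm G_2$-system on $M$ for any $t\in[0,2\pi)$.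
   Context: $\mathrm{SU}(3)$-structures. An $\mathrm{SU}(3)$-structure on $Q^6$ is a tuple $(g_\omega,J,\omega,\Upsilon)$ with $J$ an almost complex structure compatible with the metric $g_\omega$, $\omega=g_\omega(J\cdot,\cdot)$, and $\Upsilon=\Upsilon_++i\Upsilon_-$ a complex $(3,0)$-form with $\omega\wedge\Upsilon=0$ and $\frac i2\Upsilon\wedge\overline\Upsilon=\frac23\omega^3=4\,\mathrm{vol}_\omega$; it is determined by $(\omega,\Upsilon_+)$. Put $\Lambda^2_8=\{\alpha\in\Lambda^2: J\alpha=\alpha,\ \alpha\wedge\omega^2=0\}$, $\Lambda^3_{12}=\{\gamma\in\Lambda^3:\gamma\wedge\omega=0,\ \gamma\wedge\Upsilon_\pm=0\}$, where $(J\alpha)(X_1,\dots,X_k)=\alpha(JX_1,\dots,JX_k)$. The torsion forms $\pi_0,\sigma_0\in C^\infty(Q)$, $\pi_1,\nu_1\in\Lambda^1$, $\pi_2,\sigma_2\in\Lambda^2_8$, $\nu_3\in\Lambda^3_{12}$ are defined by $$d\omega=-\tfrac32\sigma_0\Upsilon_++\tfrac32\pi_0\Upsilon_-+\nu_1\wedge\omega+\nu_3,$$ $$d\Upsilon_+=\pi_0\omega^2+\pi_1\wedge\Upsilon_+-\pi_2\wedge\omega,\qquad d\Upsilon_-=\sigma_0\omega^2+\pi_1\wedge\Upsilon_--\sigma_2\wedge\omega.$$ When $\pi_2=\sigma_2=0$ and $\pi_1=2\nu_1$, set $T_\omega=\frac{\pi_0}2\Upsilon_++\frac{\sigma_0}2\Upsilon_-+J\nu_1\wedge\omega+J\nu_3$.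 A connection $A$ with curvature $F_A$ on a principal $G$-bundle over $Q$ is an $\mathrm{SU}(3)$-instanton if $F_A\wedge\omega^2=F_A\wedge\Upsilon_+=0$. In the $\mathrm{SU}(3)$ heterotic Bianchi identity, $\langle\cdot,\cdot\rangle_{\mathfrak g}$ is some non-degenerate symmetric bilinear form on $\mathfrak g=\mathrm{Lie}(G)$ that is $\mathrm{ad}$-invariant. Here $\eta$ is a real-valued connection $1$-form on $M$; forms and connections on $Q$ are identified with their pullbacks to $M$, and $d\eta$ is regarded as a $2$-form on $Q$. $\eta\oplus A$ denotes the product connection with gauge group $\mathrm U(1)\times G$, with curvature $d\eta\oplus F_A$. Heterotic $\mathrm G_2$-system. A $\mathrm G_2$-structure $\varphi$ on $M^7$ determines $g_\varphi,\mathrm{vol}_\varphi$ by $6g_\varphi(X,Y)\mathrm{vol}_\varphi=(X\lrcorner\varphi)\wedge(Y\lrcorner\varphi)\wedge\varphi$, and Hodge star $\star$. Put $\psi=\star\varphi$, $\tau_1=\frac1{12}\star(\varphi\wedge\star d\varphi)$, $T_\varphi=\frac16\star(d\varphi\wedge\varphi)\varphi-\star d\varphi+\star(4\tau_1\wedge\varphi)$. A pair $(\varphi,B)$, with $B$ a connection with structure group $H$, $\mathfrak h=\mathrm{Lie}(H)$, solves the heterotic $\mathrm G_2$-system if $d\psi=4\tau_1\wedge\psi$, $F_B\wedge\psi=0$, and $dT_\varphi=\langle F_B\wedge F_B\rangle_{\mathfrak h}$ for some $\mathrm{ad}$-invariant non-degenerate symmetric bilinear form on $\mathfrak h$. *)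

theory Defs
  imports "HOL-Analysis.Analysis" "HOL-Algebra.Group"
begin

section \<open>Finite-dimensional model spaces and smooth maps between them\<close>

text \<open>Unlike \<^class>\<open>euclidean_space\<close>, this class admits the zero space, so that Lie groups of
  dimension 0 are not excluded.\<close>

class findim_normed_vector = real_normed_vector +
  assumes finite_spanning': "\<exists>B. finite B \<and> (\<forall>x. \<exists>r. x = (\<Sum>b\<in>B. scaleR (r b) b))"

lemma finite_spanning: "\<exists>B::'a::findim_normed_vector set. finite B \<and> span B = UNIV"
proof -
  obtain B :: "'a set" where B: "finite B" "\<And>x. \<exists>r. x = (\<Sum>b\<in>B. r b *\<^sub>R b)"
    using finite_spanning' by blast
  have "x \<in> span B" for x
  proof -
    obtain r where "x = (\<Sum>b\<in>B. r b *\<^sub>R b)" using B(2) by blast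
    then show ?thesis by (simp add: span_sum span_scale span_base)
  qed
  then show ?thesis using B(1) by auto
qed

lemma span_finite_witness:
  assumes "finite (B::'a::real_vector set)" "span B = UNIV"
  shows "\<exists>B::'a set. finite B \<and> (\<forall>x. \<exists>r. x = (\<Sum>b\<in>B. r b *\<^sub>R b))"
proof (intro exI[of _ B] conjI allI)
  fix x :: 'a
  have "x \<in> span B" using assms by simp
  then show "\<exists>r. x = (\<Sum>b\<in>B. r b *\<^sub>R b)"
    unfolding span_finite[OF assms(1)] by auto
qed fact

instance prod :: (findim_normed_vector, findim_normed_vector) findim_normed_vector
proof
  obtain B :: "'a set" where B: "finite B" "span B = UNIV"
    using finite_spanning by blast
  obtain C :: "'b set" where C: "finite C" "span C = UNIV"
    using finite_spanning by blast
  let ?D = "B \<times> {0} \<union> {0} \<times> C :: ('a \<times> 'b) set"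
  have 1: "(x, 0) \<in> span ?D" for x :: 'a
  proof -
    have "x \<in> span B" using B by simp
    then show ?thesis
    proof (induction rule: span_induct_alt)
      case base
      then show ?case by (simp add: span_zero flip: zero_prod_def)
    next
      case (step c b y)
      have "c *\<^sub>R (b, 0) + (y, 0) \<in> span ?D"
        by (intro span_add span_scale step span_base) (use step in auto)
      then show ?case by simp
    qed
  qed
  have 2: "(0, x) \<in> span ?D" for x :: 'b
  proof -
    have "x \<in> span C" using C by simp
    then show ?thesis
    proof (induction rule: span_induct_alt)
      case base
      then show ?case by (simp add: span_zero flip: zero_prod_def)
    next
      case (step c b y)
      have "c *\<^sub>R (0, b) + (0, y) \<in> span ?D"
        by (intro span_add span_scale step span_base) (use step in auto)
      then show ?case by simp
    qed
  qed
  have "z \<in> span ?D" for z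
    using span_add[OF 1[of "fst z"] 2[of "snd z"]] by simp
  then have "span ?D = UNIV" by auto
  moreover have "finite ?D" using B C by simp
  ultimately show "\<exists>D::('a \<times> 'b) set. finite D \<and> (\<forall>x. \<exists>r. x = (\<Sum>b\<in>D. r b *\<^sub>R b))"
    by (intro span_finite_witness)
qed

instance euclidean_space \<subseteq> findim_normed_vector
  by standard (rule span_finite_witness[OF finite_Basis span_Basis])

text \<open>\<open>C\<^sup>k\<close> on an open subset of a finite-dimensional space: all iterated directional derivatives
  up to order \<open>k\<close> exist and are continuous.\<close>

primrec ck_on :: "nat \<Rightarrow> 'a::findim_normed_vector set \<Rightarrow> ('a \<Rightarrow> 'b::real_normed_vector) \<Rightarrow> bool" where
  "ck_on 0 S f \<longleftrightarrow> continuous_on S f"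
| "ck_on (Suc k) S f \<longleftrightarrow>
     (\<forall>x\<in>S. f differentiable (at x)) \<and> (\<forall>v. ck_on k S (\<lambda>x. frechet_derivative f (at x) v))"

definition smooth_on :: "'a::findim_normed_vector set \<Rightarrow> ('a \<Rightarrow> 'b::real_normed_vector) \<Rightarrow> bool" where
  "smooth_on S f \<longleftrightarrow> (\<forall>k. ck_on k S f)"


section \<open>Smooth manifolds\<close>

text \<open>A manifold is presented by an atlas indexed by its points, \<open>chart M p\<close> being a chart around
  \<open>p\<close> with domain \<open>chart_dom M p\<close>.  The indexing also selects a preferred chart at every point,
  through which the tangent space at \<open>p\<close> is identified with the model space \<^typ>\<open>'e\<close>.\<close>

record ('m, 'e) mfd =
  points :: "'m set"
  chart_dom :: "'m \<Rightarrow> 'm set"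
  chart :: "'m \<Rightarrow> 'm \<Rightarrow> 'e"

definition chart_img :: "('m, 'e) mfd \<Rightarrow> 'm \<Rightarrow> 'e set" where
  "chart_img M p = chart M p ` chart_dom M p"

definition param :: "('m, 'e) mfd \<Rightarrow> 'm \<Rightarrow> 'e \<Rightarrow> 'm" where
  "param M p = inv_into (chart_dom M p) (chart M p)"

definition mfd_topology :: "('m, 'e::topological_space) mfd \<Rightarrow> 'm topology" where
  "mfd_topology M = topology (\<lambda>U. U \<subseteq> points M \<and>
     (\<forall>p\<in>points M. open (chart M p ` (U \<inter> chart_dom M p))))"

definition smooth_manifold :: "('m, 'e::findim_normed_vector) mfd \<Rightarrow> bool" where
  "smooth_manifold M \<longleftrightarrow>
     (\<forall>p\<in>points M. p \<in> chart_dom M p \<and> chart_dom M p \<subseteq> points M \<and>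
        inj_on (chart M p) (chart_dom M p) \<and> open (chart_img M p)) \<and>
     (\<forall>p\<in>points M. \<forall>q\<in>points M.
        open (chart M p ` (chart_dom M p \<inter> chart_dom M q)) \<and>
        smooth_on (chart M p ` (chart_dom M p \<inter> chart_dom M q)) (chart M q \<circ> param M p)) \<and>
     Hausdorff_space (mfd_topology M) \<and> second_countable (mfd_topology M)"

definition smooth_map ::
  "('m, 'e::findim_normed_vector) mfd \<Rightarrow> ('n, 'f::findim_normed_vector) mfd \<Rightarrow> ('m \<Rightarrow> 'n) \<Rightarrow> bool" where
  "smooth_map M N f \<longleftrightarrow> f ` points M \<subseteq> points N \<and>
     (\<forall>p\<in>points M. \<forall>q\<in>points N.
        open (chart M p ` {x \<in> chart_dom M p. f x \<in> chart_dom N q}) \<and>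
        smooth_on (chart M p ` {x \<in> chart_dom M p. f x \<in> chart_dom N q})
          (chart N q \<circ> f \<circ> param M p))"

definition diffeomorphism ::
  "('m, 'e::findim_normed_vector) mfd \<Rightarrow> ('n, 'f::findim_normed_vector) mfd \<Rightarrow> ('m \<Rightarrow> 'n) \<Rightarrow> bool" where
  "diffeomorphism M N f \<longleftrightarrow> smooth_map M N f \<and> bij_betw f (points M) (points N) \<and>
     smooth_map N M (inv_into (points M) f)"

text \<open>The differential of \<open>f\<close> at \<open>p\<close>, in the preferred charts at \<open>p\<close> and \<open>f p\<close>.\<close>

definition tangent_map ::
  "('m, 'e::real_normed_vector) mfd \<Rightarrow> ('n, 'f::real_normed_vector) mfd \<Rightarrow> ('m \<Rightarrow> 'n) \<Rightarrow> 'm \<Rightarrow> 'e \<Rightarrow> 'f" where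
  "tangent_map M N f p = frechet_derivative (chart N (f p) \<circ> f \<circ> param M p) (at (chart M p p))"

definition open_submfd :: "('m, 'e) mfd \<Rightarrow> 'm set \<Rightarrow> ('m, 'e) mfd" where
  "open_submfd M U = \<lparr>points = points M \<inter> U, chart_dom = (\<lambda>p. chart_dom M p \<inter> U), chart = chart M\<rparr>"

definition prod_mfd :: "('m, 'e) mfd \<Rightarrow> ('n, 'f) mfd \<Rightarrow> ('m \<times> 'n, 'e \<times> 'f) mfd" where
  "prod_mfd M N = \<lparr>points = points M \<times> points N,
     chart_dom = (\<lambda>(p, q). chart_dom M p \<times> chart_dom N q),
     chart = (\<lambda>(p, q) (x, y). (chart M p x, chart N q y))\<rparr>"

definition smooth_fun :: "('m, 'e::findim_normed_vector) mfd \<Rightarrow> ('m \<Rightarrow> real) \<Rightarrow> bool" where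
  "smooth_fun M f \<longleftrightarrow> (\<forall>p\<in>points M. smooth_on (chart_img M p) (f \<circ> param M p))"


section \<open>Multilinear algebra\<close>

text \<open>A \<open>k\<close>-form on a vector space is a function on lists of vectors that vanishes on all lists of
  length other than \<open>k\<close>.  Thus the operations below need not be told the degree.\<close>

definition alt_form :: "nat \<Rightarrow> ('e::real_vector list \<Rightarrow> 'v::real_vector) \<Rightarrow> bool" where
  "alt_form k a \<longleftrightarrow>
     (\<forall>vs. length vs \<noteq> k \<longrightarrow> a vs = 0) \<and>
     (\<forall>us ws. length us + length ws + 1 = k \<longrightarrow> linear (\<lambda>v. a (us @ v # ws))) \<and>
     (\<forall>vs. length vs = k \<and> \<not> distinct vs \<longrightarrow> a vs = 0)"

text \<open>Shuffle formula for the wedge product of vector-valued forms with respect to a bilinear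
  map \<open>b\<close>: \<open>A\<close> is the set of positions inserted into the first factor, and the sign is that
  of the corresponding shuffle.  In particular \<open>(e\<^sup>1 \<and> e\<^sup>2)(e\<^sub>1, e\<^sub>2) = 1\<close>.\<close>

definition wedge_with ::
  "('u \<Rightarrow> 'v \<Rightarrow> 'w::real_vector) \<Rightarrow> ('e list \<Rightarrow> 'u) \<Rightarrow> ('e list \<Rightarrow> 'v) \<Rightarrow> 'e list \<Rightarrow> 'w" where
  "wedge_with b a c vs = (\<Sum>A\<in>Pow {..<length vs}.
     (-1) ^ card {(i, j). i \<in> A \<and> j \<notin> A \<and> j < i} *\<^sub>R b (a (nths vs A)) (c (nths vs (- A))))"

abbreviation wedge :: "('e list \<Rightarrow> real) \<Rightarrow> ('e list \<Rightarrow> real) \<Rightarrow> 'e list \<Rightarrow> real"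
    (infixr "\<^bold>\<and>" 70) where
  "a \<^bold>\<and> c \<equiv> wedge_with (*) a c"

definition contraction :: "'e \<Rightarrow> ('e list \<Rightarrow> 'v) \<Rightarrow> 'e list \<Rightarrow> 'v" (infixr "\<lrcorner>" 75) where
  "X \<lrcorner> a = (\<lambda>vs. a (X # vs))"

definition inner_product :: "('e::real_vector \<Rightarrow> 'e \<Rightarrow> real) \<Rightarrow> bool" where
  "inner_product g \<longleftrightarrow> bilinear g \<and> (\<forall>X Y. g X Y = g Y X) \<and> (\<forall>X. X \<noteq> 0 \<longrightarrow> g X X > 0)"

definition orthonormal_frame :: "('e::euclidean_space \<Rightarrow> 'e \<Rightarrow> real) \<Rightarrow> 'e list \<Rightarrow> bool" where
  "orthonormal_frame g es \<longleftrightarrow> length es = DIM('e) \<and>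
     (\<forall>i<length es. \<forall>j<length es. g (es ! i) (es ! j) = of_bool (i = j))"

text \<open>\<open>\<star>a\<close> is the sum of \<open>a(e\<^sub>A) e\<^sub>A \<lrcorner> vol\<close> over increasing multi-indices \<open>A\<close>, for any
  \<open>g\<close>-orthonormal frame \<open>e\<close>; equivalently \<open>c \<and> \<star>a = g(c, a) vol\<close>.\<close>

definition hodge ::
  "('e::euclidean_space \<Rightarrow> 'e \<Rightarrow> real) \<Rightarrow> ('e list \<Rightarrow> real) \<Rightarrow> ('e list \<Rightarrow> real) \<Rightarrow> 'e list \<Rightarrow> real" where
  "hodge g vol a ws = (let es = (SOME es. orthonormal_frame g es) in
     \<Sum>A\<in>Pow {..<length es}. a (nths es A) * vol (nths es A @ ws))"


section \<open>Differential forms\<close>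

text \<open>\<open>in_chart M p \<alpha>\<close> is the coordinate expression of \<open>\<alpha>\<close> in the chart \<open>chart M p\<close>: the pullback of
  \<open>\<alpha>\<close> by \<open>param M p\<close>.\<close>

definition in_chart ::
  "('m, 'e::real_normed_vector) mfd \<Rightarrow> 'm \<Rightarrow> ('m \<Rightarrow> 'e list \<Rightarrow> 'v) \<Rightarrow> 'e \<Rightarrow> 'e list \<Rightarrow> 'v" where
  "in_chart M p \<alpha> x ws = (let y = param M p x in
     \<alpha> y (map (frechet_derivative (chart M y \<circ> param M p) (at x)) ws))"

definition smooth_form ::
  "('m, 'e::findim_normed_vector) mfd \<Rightarrow> nat \<Rightarrow> ('m \<Rightarrow> 'e list \<Rightarrow> 'v::real_normed_vector) \<Rightarrow> bool" where
  "smooth_form M k \<alpha> \<longleftrightarrow> (\<forall>p\<in>points M. alt_form k (\<alpha> p) \<and>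
     (\<forall>ws. smooth_on (chart_img M p) (\<lambda>x. in_chart M p \<alpha> x ws)))"

definition pullback ::
  "('m, 'e::real_normed_vector) mfd \<Rightarrow> ('n, 'f::real_normed_vector) mfd \<Rightarrow> ('m \<Rightarrow> 'n) \<Rightarrow>
   ('n \<Rightarrow> 'f list \<Rightarrow> 'v) \<Rightarrow> 'm \<Rightarrow> 'e list \<Rightarrow> 'v" where
  "pullback M N f \<alpha> p vs = \<alpha> (f p) (map (tangent_map M N f p) vs)"

definition flat_d ::
  "('e::real_normed_vector \<Rightarrow> 'e list \<Rightarrow> 'v::real_normed_vector) \<Rightarrow> 'e \<Rightarrow> 'e list \<Rightarrow> 'v" where
  "flat_d a x vs = (\<Sum>i<length vs.
     (-1) ^ i *\<^sub>R frechet_derivative (\<lambda>y. a y (take i vs @ drop (Suc i) vs)) (at x) (vs ! i))"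

definition ext_d ::
  "('m, 'e::real_normed_vector) mfd \<Rightarrow> ('m \<Rightarrow> 'e list \<Rightarrow> 'v::real_normed_vector) \<Rightarrow> 'm \<Rightarrow> 'e list \<Rightarrow> 'v" where
  "ext_d M \<alpha> p = flat_d (in_chart M p \<alpha>) (chart M p p)"

definition riemannian_metric ::
  "('m, 'e::findim_normed_vector) mfd \<Rightarrow> ('m \<Rightarrow> 'e \<Rightarrow> 'e \<Rightarrow> real) \<Rightarrow> bool" where
  "riemannian_metric M g \<longleftrightarrow> (\<forall>p\<in>points M. inner_product (g p) \<and>
     (\<forall>u v. smooth_on (chart_img M p)
        (\<lambda>x. in_chart M p (\<lambda>q vs. g q (vs ! 0) (vs ! 1)) x [u, v])))"

definition almost_complex_structure ::
  "('m, 'e::findim_normed_vector) mfd \<Rightarrow> ('m \<Rightarrow> 'e \<Rightarrow> 'e) \<Rightarrow> bool" where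
  "almost_complex_structure M J \<longleftrightarrow> (\<forall>p\<in>points M. linear (J p) \<and> (\<forall>X. J p (J p X) = - X) \<and>
     (\<forall>u. smooth_on (chart_img M p) (\<lambda>x. let y = param M p x in
        frechet_derivative (chart M p \<circ> param M y) (at (chart M y y))
          (J y (frechet_derivative (chart M y \<circ> param M p) (at x) u)))))"


section \<open>Lie groups\<close>

record ('g, 'e) lie =
  lgroup :: "'g monoid"
  lmfd :: "('g, 'e) mfd"

definition lie_group :: "('g, 'e::findim_normed_vector) lie \<Rightarrow> bool" where
  "lie_group G \<longleftrightarrow> group (lgroup G) \<and> smooth_manifold (lmfd G) \<and>
     points (lmfd G) = carrier (lgroup G) \<and>
     smooth_map (prod_mfd (lmfd G) (lmfd G)) (lmfd G) (\<lambda>(x, y). x \<otimes>\<^bsub>lgroup G\<^esub> y) \<and>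
     smooth_map (lmfd G) (lmfd G) (\<lambda>x. inv\<^bsub>lgroup G\<^esub> x)"

text \<open>The Lie algebra is the tangent space at the identity, hence identified with \<^typ>\<open>'e\<close> by the
  preferred chart there.  \<open>left_inv_field G X\<close> is the coordinate expression, in that chart, of the
  left-invariant vector field with value \<open>X\<close> at the identity, and the Lie bracket is
  the commutator of left-invariant vector fields.\<close>

definition left_inv_field :: "('g, 'e::real_normed_vector) lie \<Rightarrow> 'e \<Rightarrow> 'e \<Rightarrow> 'e" where
  "left_inv_field G X x = (let M = lmfd G; e = \<one>\<^bsub>lgroup G\<^esub> in
     frechet_derivative (\<lambda>z. chart M e (param M e x \<otimes>\<^bsub>lgroup G\<^esub> param M e z)) (at (chart M e e)) X)"

definition lie_bracket :: "('g, 'e::real_normed_vector) lie \<Rightarrow> 'e \<Rightarrow> 'e \<Rightarrow> 'e" where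
  "lie_bracket G X Y = (let x0 = chart (lmfd G) \<one>\<^bsub>lgroup G\<^esub> \<one>\<^bsub>lgroup G\<^esub> in
     frechet_derivative (left_inv_field G Y) (at x0) (left_inv_field G X x0) -
     frechet_derivative (left_inv_field G X) (at x0) (left_inv_field G Y x0))"

definition Ad :: "('g, 'e::real_normed_vector) lie \<Rightarrow> 'g \<Rightarrow> 'e \<Rightarrow> 'e" where
  "Ad G a = tangent_map (lmfd G) (lmfd G)
     (\<lambda>x. a \<otimes>\<^bsub>lgroup G\<^esub> x \<otimes>\<^bsub>lgroup G\<^esub> inv\<^bsub>lgroup G\<^esub> a) \<one>\<^bsub>lgroup G\<^esub>"

definition invariant_pairing :: "('g, 'e::real_normed_vector) lie \<Rightarrow> ('e \<Rightarrow> 'e \<Rightarrow> real) \<Rightarrow> bool" where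
  "invariant_pairing G b \<longleftrightarrow> bilinear b \<and> (\<forall>X Y. b X Y = b Y X) \<and>
     (\<forall>X. (\<forall>Y. b X Y = 0) \<longrightarrow> X = 0) \<and>
     (\<forall>X Y Z. b (lie_bracket G X Y) Z + b Y (lie_bracket G X Z) = 0)"

text \<open>The charts are angle coordinates, so the Lie algebra of the circle is \<^typ>\<open>real\<close>, the
  number \<open>s\<close> corresponding to the velocity at 0 of \<open>t \<mapsto> cis (s t)\<close>.\<close>

definition circle_lie :: "(complex, real) lie" where
  "circle_lie = \<lparr>lgroup = \<lparr>carrier = sphere 0 1, mult = (*), one = 1\<rparr>,
     lmfd = \<lparr>points = sphere 0 1, chart_dom = (\<lambda>z. sphere 0 1 - {- z}), chart = (\<lambda>z w. Arg (w / z))\<rparr>\<rparr>"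

definition prod_lie :: "('g, 'e) lie \<Rightarrow> ('h, 'f) lie \<Rightarrow> ('g \<times> 'h, 'e \<times> 'f) lie" where
  "prod_lie G H = \<lparr>lgroup = lgroup G \<times>\<times> lgroup H, lmfd = prod_mfd (lmfd G) (lmfd H)\<rparr>"


section \<open>Principal bundles and connections\<close>

record ('p, 'pe, 'q, 'qe, 'g, 'ge) pbundle =
  total :: "('p, 'pe) mfd"
  base :: "('q, 'qe) mfd"
  sgroup :: "('g, 'ge) lie"
  proj :: "'p \<Rightarrow> 'q"
  act :: "'p \<Rightarrow> 'g \<Rightarrow> 'p"

text \<open>\<open>p \<mapsto> (proj P p, h p)\<close> is an equivariant trivialisation over \<open>U\<close>.\<close>

definition local_triv ::
  "('p, 'pe::findim_normed_vector, 'q, 'qe::findim_normed_vector, 'g, 'ge::findim_normed_vector) pbundle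
   \<Rightarrow> 'q set \<Rightarrow> ('p \<Rightarrow> 'g) \<Rightarrow> bool" where
  "local_triv P U h \<longleftrightarrow> openin (mfd_topology (base P)) U \<and>
     diffeomorphism (open_submfd (total P) {p \<in> points (total P). proj P p \<in> U})
       (prod_mfd (open_submfd (base P) U) (lmfd (sgroup P))) (\<lambda>p. (proj P p, h p)) \<and>
     (\<forall>p\<in>points (total P). \<forall>a\<in>carrier (lgroup (sgroup P)).
        proj P p \<in> U \<longrightarrow> h (act P p a) = h p \<otimes>\<^bsub>lgroup (sgroup P)\<^esub> a)"

definition principal_bundle ::
  "('p, 'pe::findim_normed_vector, 'q, 'qe::findim_normed_vector, 'g, 'ge::findim_normed_vector) pbundle
   \<Rightarrow> bool" where
  "principal_bundle P \<longleftrightarrow>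
     smooth_manifold (total P) \<and> smooth_manifold (base P) \<and> lie_group (sgroup P) \<and>
     smooth_map (total P) (base P) (proj P) \<and>
     smooth_map (prod_mfd (total P) (lmfd (sgroup P))) (total P) (\<lambda>(p, a). act P p a) \<and>
     (\<forall>p\<in>points (total P). act P p \<one>\<^bsub>lgroup (sgroup P)\<^esub> = p) \<and>
     (\<forall>p\<in>points (total P). \<forall>a\<in>carrier (lgroup (sgroup P)). \<forall>b\<in>carrier (lgroup (sgroup P)).
        act P (act P p a) b = act P p (a \<otimes>\<^bsub>lgroup (sgroup P)\<^esub> b)) \<and>
     (\<forall>p\<in>points (total P). \<forall>a\<in>carrier (lgroup (sgroup P)). proj P (act P p a) = proj P p) \<and>
     (\<forall>x\<in>points (base P). \<exists>U h. x \<in> U \<and> local_triv P U h)"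

text \<open>A connection form \<open>\<theta>\<close>, valued in the Lie algebra: it reproduces the generators of the right
  action and satisfies \<open>R\<^sub>a\<^sup>* \<theta> = Ad(a\<^sup>-\<^sup>1) \<theta>\<close>.\<close>

definition principal_connection ::
  "('p, 'pe::findim_normed_vector, 'q, 'qe::findim_normed_vector, 'g, 'ge::findim_normed_vector) pbundle
   \<Rightarrow> ('p \<Rightarrow> 'pe list \<Rightarrow> 'ge) \<Rightarrow> bool" where
  "principal_connection P \<theta> \<longleftrightarrow> smooth_form (total P) 1 \<theta> \<and>
     (\<forall>p\<in>points (total P). \<forall>X.
        \<theta> p [tangent_map (lmfd (sgroup P)) (total P) (act P p) \<one>\<^bsub>lgroup (sgroup P)\<^esub> X] = X) \<and>
     (\<forall>p\<in>points (total P). \<forall>a\<in>carrier (lgroup (sgroup P)). \<forall>v.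
        pullback (total P) (total P) (\<lambda>p. act P p a) \<theta> p [v] =
        Ad (sgroup P) (inv\<^bsub>lgroup (sgroup P)\<^esub> a) (\<theta> p [v]))"

text \<open>The curvature is kept as a form on the total space (horizontal and equivariant), rather than as
  a form on the base with values in the adjoint bundle.\<close>

definition curvature ::
  "('p, 'pe::real_normed_vector, 'q, 'qe, 'g, 'ge::real_normed_vector) pbundle
   \<Rightarrow> ('p \<Rightarrow> 'pe list \<Rightarrow> 'ge) \<Rightarrow> 'p \<Rightarrow> 'pe list \<Rightarrow> 'ge" where
  "curvature P \<theta> p vs = ext_d (total P) \<theta> p vs +
     (1/2) *\<^sub>R wedge_with (lie_bracket (sgroup P)) (\<theta> p) (\<theta> p) vs"

definition lift_form ::
  "('p, 'pe::real_normed_vector, 'q, 'qe::real_normed_vector, 'g, 'ge) pbundle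
   \<Rightarrow> ('q \<Rightarrow> 'qe list \<Rightarrow> 'v) \<Rightarrow> 'p \<Rightarrow> 'pe list \<Rightarrow> 'v" where
  "lift_form P = pullback (total P) (base P) (proj P)"

text \<open>\<open>F \<and> \<beta> = 0\<close> for the curvature \<open>F\<close> of \<open>\<theta>\<close> and a form \<open>\<beta>\<close> on the base.\<close>

definition curvature_wedge_vanishes ::
  "('p, 'pe::real_normed_vector, 'q, 'qe::real_normed_vector, 'g, 'ge::real_normed_vector) pbundle
   \<Rightarrow> ('p \<Rightarrow> 'pe list \<Rightarrow> 'ge) \<Rightarrow> ('q \<Rightarrow> 'qe list \<Rightarrow> real) \<Rightarrow> bool" where
  "curvature_wedge_vanishes P \<theta> \<beta> \<longleftrightarrow> (\<forall>p\<in>points (total P). \<forall>vs.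
     wedge_with (\<lambda>X r. r *\<^sub>R X) (curvature P \<theta> p) (lift_form P \<beta> p) vs = 0)"

text \<open>\<open>dT = \<langle>F \<and> F\<rangle>\<close>, compared after pulling back to the total space; nothing is lost, the
  projection being a surjective submersion.\<close>

definition bianchi_identity ::
  "('p, 'pe::real_normed_vector, 'q, 'qe::real_normed_vector, 'g, 'ge::real_normed_vector) pbundle
   \<Rightarrow> ('p \<Rightarrow> 'pe list \<Rightarrow> 'ge) \<Rightarrow> ('ge \<Rightarrow> 'ge \<Rightarrow> real) \<Rightarrow> ('q \<Rightarrow> 'qe list \<Rightarrow> real) \<Rightarrow> bool" where
  "bianchi_identity P \<theta> b T \<longleftrightarrow> (\<forall>p\<in>points (total P). \<forall>vs.
     lift_form P (ext_d (base P) T) p vs = wedge_with b (curvature P \<theta> p) (curvature P \<theta> p) vs)"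


section \<open>Pulled back bundles and the product connection\<close>

text \<open>The submanifold \<open>{(n, p). f n = proj P p}\<close> of \<open>N \<times> P\<close>.  A trivialisation of \<open>P\<close> near \<open>f n\<close>
  gives charts modelled on (model of \<open>N\<close>) \<open>\<times>\<close> (model of the group).\<close>

definition triv_at ::
  "('p, 'pe::findim_normed_vector, 'q, 'qe::findim_normed_vector, 'g, 'ge::findim_normed_vector) pbundle
   \<Rightarrow> 'q \<Rightarrow> 'q set \<times> ('p \<Rightarrow> 'g)" where
  "triv_at P x = (SOME (U, h). x \<in> U \<and> local_triv P U h)"

definition fibre_product ::
  "('n, 'ne) mfd \<Rightarrow> ('n \<Rightarrow> 'q) \<Rightarrow>
   ('p, 'pe::findim_normed_vector, 'q, 'qe::findim_normed_vector, 'g, 'ge::findim_normed_vector) pbundle \<Rightarrow>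
   ('n \<times> 'p, 'ne \<times> 'ge) mfd" where
  "fibre_product N f P =
     (let E = {(n, p). n \<in> points N \<and> p \<in> points (total P) \<and> f n = proj P p} in
      \<lparr>points = E,
       chart_dom = (\<lambda>(n0, p0). case triv_at P (f n0) of (U, h) \<Rightarrow>
          {(n, p) \<in> E. n \<in> chart_dom N n0 \<and> f n \<in> U \<and> h p \<in> chart_dom (lmfd (sgroup P)) (h p0)}),
       chart = (\<lambda>(n0, p0) (n, p). case triv_at P (f n0) of (U, h) \<Rightarrow>
          (chart N n0 n, chart (lmfd (sgroup P)) (h p0) (h p)))\<rparr>)"

definition pullback_bundle ::
  "('n, 'ne) mfd \<Rightarrow> ('n \<Rightarrow> 'q) \<Rightarrow>
   ('p, 'pe::findim_normed_vector, 'q, 'qe::findim_normed_vector, 'g, 'ge::findim_normed_vector) pbundle \<Rightarrow>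
   ('n \<times> 'p, 'ne \<times> 'ge, 'n, 'ne, 'g, 'ge) pbundle" where
  "pullback_bundle N f P = \<lparr>total = fibre_product N f P, base = N, sgroup = sgroup P,
     proj = fst, act = (\<lambda>(n, p) a. (n, act P p a))\<rparr>"

definition pullback_connection ::
  "('n, 'ne::real_normed_vector) mfd \<Rightarrow> ('n \<Rightarrow> 'q) \<Rightarrow>
   ('p, 'pe::findim_normed_vector, 'q, 'qe::findim_normed_vector, 'g, 'ge::findim_normed_vector) pbundle \<Rightarrow>
   ('p \<Rightarrow> 'pe list \<Rightarrow> 'ge) \<Rightarrow> 'n \<times> 'p \<Rightarrow> ('ne \<times> 'ge) list \<Rightarrow> 'ge" where
  "pullback_connection N f P \<theta> = pullback (fibre_product N f P) (total P) snd \<theta>"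

text \<open>For bundles \<open>S\<close>, \<open>P\<close> over the same base: the fibre product \<open>S \<times> P\<close> over the base, a
  principal bundle for the product group, and the connection on it determined by two
  connections.  For a circle bundle \<open>S\<close> with connection \<open>\<eta>\<close> and \<open>A\<close> on \<open>P\<close>, the pullback of this
  connection to the manifold \<open>total S\<close> is \<open>\<eta> \<oplus> A\<close>, with curvature \<open>d\<eta> \<oplus> F\<^sub>A\<close>.\<close>

definition product_bundle ::
  "('s, 'se, 'q, 'qe::findim_normed_vector, 'h, 'he) pbundle \<Rightarrow>
   ('p, 'pe::findim_normed_vector, 'q, 'qe, 'g, 'ge::findim_normed_vector) pbundle \<Rightarrow>
   ('s \<times> 'p, 'se \<times> 'ge, 'q, 'qe, 'h \<times> 'g, 'he \<times> 'ge) pbundle" where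
  "product_bundle S P = \<lparr>total = fibre_product (total S) (proj S) P, base = base S,
     sgroup = prod_lie (sgroup S) (sgroup P), proj = proj S \<circ> fst,
     act = (\<lambda>(s, p) (a, c). (act S s a, act P p c))\<rparr>"

definition product_connection ::
  "('s, 'se::real_normed_vector, 'q, 'qe::findim_normed_vector, 'h, 'he) pbundle \<Rightarrow>
   ('p, 'pe::findim_normed_vector, 'q, 'qe, 'g, 'ge::findim_normed_vector) pbundle \<Rightarrow>
   ('s \<Rightarrow> 'se list \<Rightarrow> 'he) \<Rightarrow> ('p \<Rightarrow> 'pe list \<Rightarrow> 'ge) \<Rightarrow>
   's \<times> 'p \<Rightarrow> ('se \<times> 'ge) list \<Rightarrow> 'he \<times> 'ge" where
  "product_connection S P \<eta> \<theta> z vs = (let E = fibre_product (total S) (proj S) P in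
     (pullback E (total S) fst \<eta> z vs, pullback E (total P) snd \<theta> z vs))"


section \<open>SU(3)-structures\<close>

definition J_form :: "('e \<Rightarrow> 'e) \<Rightarrow> ('e list \<Rightarrow> real) \<Rightarrow> 'e list \<Rightarrow> real" where
  "J_form J a vs = a (map J vs)"

definition in_Lambda2_8 :: "('e::real_vector \<Rightarrow> 'e) \<Rightarrow> ('e list \<Rightarrow> real) \<Rightarrow> ('e list \<Rightarrow> real) \<Rightarrow> bool" where
  "in_Lambda2_8 J \<omega> a \<longleftrightarrow> alt_form 2 a \<and> J_form J a = a \<and> (\<forall>vs. (a \<^bold>\<and> \<omega> \<^bold>\<and> \<omega>) vs = 0)"

definition in_Lambda3_12 :: "('e::real_vector list \<Rightarrow> real) \<Rightarrow> ('e list \<Rightarrow> complex) \<Rightarrow> ('e list \<Rightarrow> real) \<Rightarrow> bool" where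
  "in_Lambda3_12 \<omega> \<Upsilon> a \<longleftrightarrow> alt_form 3 a \<and> (\<forall>vs. (a \<^bold>\<and> \<omega>) vs = 0) \<and>
     (\<forall>vs. (a \<^bold>\<and> (\<lambda>ws. Re (\<Upsilon> ws))) vs = 0) \<and> (\<forall>vs. (a \<^bold>\<and> (\<lambda>ws. Im (\<Upsilon> ws))) vs = 0)"

text \<open>The (3,0) condition is complex linearity in the first argument, hence in every argument.
  The volume form of the structure is \<open>\<omega>\<^sup>3 / 6\<close>, so \<open>(2/3) \<omega>\<^sup>3 = 4 vol\<close>.\<close>

definition su3_structure ::
  "('q, real^6) mfd \<Rightarrow> ('q \<Rightarrow> real^6 \<Rightarrow> real^6 \<Rightarrow> real) \<Rightarrow> ('q \<Rightarrow> real^6 \<Rightarrow> real^6) \<Rightarrow>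
   ('q \<Rightarrow> (real^6) list \<Rightarrow> real) \<Rightarrow> ('q \<Rightarrow> (real^6) list \<Rightarrow> complex) \<Rightarrow> bool" where
  "su3_structure Q g J \<omega> \<Upsilon> \<longleftrightarrow>
     riemannian_metric Q g \<and> almost_complex_structure Q J \<and>
     smooth_form Q 2 \<omega> \<and> smooth_form Q 3 \<Upsilon> \<and>
     (\<forall>q\<in>points Q.
        (\<forall>X Y. g q (J q X) (J q Y) = g q X Y) \<and>
        (\<forall>X Y. \<omega> q [X, Y] = g q (J q X) Y) \<and>
        (\<forall>X vs. \<Upsilon> q (J q X # vs) = \<i> * \<Upsilon> q (X # vs)) \<and>
        (\<forall>vs. wedge_with (\<lambda>r z. complex_of_real r * z) (\<omega> q) (\<Upsilon> q) vs = 0) \<and>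
        (\<forall>vs. (\<i> / 2) * wedge_with (*) (\<Upsilon> q) (\<lambda>ws. cnj (\<Upsilon> q ws)) vs =
               complex_of_real ((2/3) * (\<omega> q \<^bold>\<and> \<omega> q \<^bold>\<and> \<omega> q) vs)))"

definition su3_torsion_forms ::
  "('q, real^6) mfd \<Rightarrow> ('q \<Rightarrow> real^6 \<Rightarrow> real^6) \<Rightarrow>
   ('q \<Rightarrow> (real^6) list \<Rightarrow> real) \<Rightarrow> ('q \<Rightarrow> (real^6) list \<Rightarrow> complex) \<Rightarrow>
   ('q \<Rightarrow> real) \<Rightarrow> ('q \<Rightarrow> real) \<Rightarrow>
   ('q \<Rightarrow> (real^6) list \<Rightarrow> real) \<Rightarrow> ('q \<Rightarrow> (real^6) list \<Rightarrow> real) \<Rightarrow>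
   ('q \<Rightarrow> (real^6) list \<Rightarrow> real) \<Rightarrow> ('q \<Rightarrow> (real^6) list \<Rightarrow> real) \<Rightarrow>
   ('q \<Rightarrow> (real^6) list \<Rightarrow> real) \<Rightarrow> bool" where
  "su3_torsion_forms Q J \<omega> \<Upsilon> \<pi>0 \<sigma>0 \<pi>1 \<nu>1 \<pi>2 \<sigma>2 \<nu>3 \<longleftrightarrow>
     smooth_fun Q \<pi>0 \<and> smooth_fun Q \<sigma>0 \<and> smooth_form Q 1 \<pi>1 \<and> smooth_form Q 1 \<nu>1 \<and>
     smooth_form Q 2 \<pi>2 \<and> smooth_form Q 2 \<sigma>2 \<and> smooth_form Q 3 \<nu>3 \<and>
     (\<forall>q\<in>points Q.
        in_Lambda2_8 (J q) (\<omega> q) (\<pi>2 q) \<and> in_Lambda2_8 (J q) (\<omega> q) (\<sigma>2 q) \<and>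
        in_Lambda3_12 (\<omega> q) (\<Upsilon> q) (\<nu>3 q) \<and>
        (\<forall>vs. ext_d Q \<omega> q vs =
           - (3/2) * \<sigma>0 q * Re (\<Upsilon> q vs) + (3/2) * \<pi>0 q * Im (\<Upsilon> q vs) +
           (\<nu>1 q \<^bold>\<and> \<omega> q) vs + \<nu>3 q vs) \<and>
        (\<forall>vs. ext_d Q (\<lambda>x ws. Re (\<Upsilon> x ws)) q vs =
           \<pi>0 q * (\<omega> q \<^bold>\<and> \<omega> q) vs + (\<pi>1 q \<^bold>\<and> (\<lambda>ws. Re (\<Upsilon> q ws))) vs - (\<pi>2 q \<^bold>\<and> \<omega> q) vs) \<and>
        (\<forall>vs. ext_d Q (\<lambda>x ws. Im (\<Upsilon> x ws)) q vs =
           \<sigma>0 q * (\<omega> q \<^bold>\<and> \<omega> q) vs + (\<pi>1 q \<^bold>\<and> (\<lambda>ws. Im (\<Upsilon> q ws))) vs - (\<sigma>2 q \<^bold>\<and> \<omega> q) vs))"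

definition su3_T ::
  "('q \<Rightarrow> 'e \<Rightarrow> 'e) \<Rightarrow> ('q \<Rightarrow> 'e list \<Rightarrow> real) \<Rightarrow> ('q \<Rightarrow> 'e list \<Rightarrow> complex) \<Rightarrow>
   ('q \<Rightarrow> real) \<Rightarrow> ('q \<Rightarrow> real) \<Rightarrow> ('q \<Rightarrow> 'e list \<Rightarrow> real) \<Rightarrow> ('q \<Rightarrow> 'e list \<Rightarrow> real) \<Rightarrow>
   'q \<Rightarrow> 'e list \<Rightarrow> real" where
  "su3_T J \<omega> \<Upsilon> \<pi>0 \<sigma>0 \<nu>1 \<nu>3 q vs =
     \<pi>0 q / 2 * Re (\<Upsilon> q vs) + \<sigma>0 q / 2 * Im (\<Upsilon> q vs) +
     (J_form (J q) (\<nu>1 q) \<^bold>\<and> \<omega> q) vs + J_form (J q) (\<nu>3 q) vs"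

definition su3_instanton ::
  "('p, 'pe::findim_normed_vector, 'q, real^6, 'g, 'ge::findim_normed_vector) pbundle \<Rightarrow>
   ('q \<Rightarrow> (real^6) list \<Rightarrow> real) \<Rightarrow> ('q \<Rightarrow> (real^6) list \<Rightarrow> complex) \<Rightarrow>
   ('p \<Rightarrow> 'pe list \<Rightarrow> 'ge) \<Rightarrow> bool" where
  "su3_instanton P \<omega> \<Upsilon> A \<longleftrightarrow> principal_connection P A \<and>
     curvature_wedge_vanishes P A (\<lambda>q. \<omega> q \<^bold>\<and> \<omega> q) \<and>
     curvature_wedge_vanishes P A (\<lambda>q ws. Re (\<Upsilon> q ws))"


section \<open>G2-structures\<close>

text \<open>In a suitable coframe the form is
  \<open>e\<^sup>0\<^sup>1\<^sup>2 + e\<^sup>0\<^sup>3\<^sup>4 + e\<^sup>0\<^sup>5\<^sup>6 + e\<^sup>1\<^sup>3\<^sup>5 - e\<^sup>1\<^sup>4\<^sup>6 - e\<^sup>2\<^sup>3\<^sup>6 - e\<^sup>2\<^sup>4\<^sup>5\<close>.\<close>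

definition is_g2_form :: "((real^7) list \<Rightarrow> real) \<Rightarrow> bool" where
  "is_g2_form a \<longleftrightarrow> alt_form 3 a \<and>
     (\<exists>es. length es = 7 \<and> distinct es \<and> independent (set es) \<and> span (set es) = UNIV \<and>
       (\<forall>i j k. i < j \<and> j < k \<and> k < 7 \<longrightarrow> a [es ! i, es ! j, es ! k] =
          (if (i, j, k) \<in> {(0,1,2), (0,3,4), (0,5,6), (1,3,5)} then 1
           else if (i, j, k) \<in> {(1,4,6), (2,3,6), (2,4,5)} then -1 else 0)))"

definition g2_metric_vol ::
  "((real^7) list \<Rightarrow> real) \<Rightarrow> (real^7 \<Rightarrow> real^7 \<Rightarrow> real) \<times> ((real^7) list \<Rightarrow> real)" where
  "g2_metric_vol a = (THE (g, v). inner_product g \<and> alt_form 7 v \<and>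
     (\<forall>es. orthonormal_frame g es \<longrightarrow> \<bar>v es\<bar> = 1) \<and>
     (\<forall>X Y vs. 6 * g X Y * v vs = ((X \<lrcorner> a) \<^bold>\<and> (Y \<lrcorner> a) \<^bold>\<and> a) vs))"

definition g2_star :: "((real^7) list \<Rightarrow> real) \<Rightarrow> ((real^7) list \<Rightarrow> real) \<Rightarrow> (real^7) list \<Rightarrow> real" where
  "g2_star a = hodge (fst (g2_metric_vol a)) (snd (g2_metric_vol a))"

definition g2_psi :: "('m \<Rightarrow> (real^7) list \<Rightarrow> real) \<Rightarrow> 'm \<Rightarrow> (real^7) list \<Rightarrow> real" where
  "g2_psi \<phi> p = g2_star (\<phi> p) (\<phi> p)"

definition g2_tau1 ::
  "('m, real^7) mfd \<Rightarrow> ('m \<Rightarrow> (real^7) list \<Rightarrow> real) \<Rightarrow> 'm \<Rightarrow> (real^7) list \<Rightarrow> real" where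
  "g2_tau1 M \<phi> p vs = (1/12) * g2_star (\<phi> p) (\<phi> p \<^bold>\<and> g2_star (\<phi> p) (ext_d M \<phi> p)) vs"

text \<open>The 0-form \<open>\<star>(d\<phi> \<and> \<phi>)\<close> is evaluated at the empty list.\<close>

definition g2_T ::
  "('m, real^7) mfd \<Rightarrow> ('m \<Rightarrow> (real^7) list \<Rightarrow> real) \<Rightarrow> 'm \<Rightarrow> (real^7) list \<Rightarrow> real" where
  "g2_T M \<phi> p vs =
     (1/6) * g2_star (\<phi> p) (ext_d M \<phi> p \<^bold>\<and> \<phi> p) [] * \<phi> p vs
     - g2_star (\<phi> p) (ext_d M \<phi> p) vs
     + g2_star (\<phi> p) ((\<lambda>ws. 4 * g2_tau1 M \<phi> p ws) \<^bold>\<and> \<phi> p) vs"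

definition heterotic_g2_system ::
  "('m, real^7) mfd \<Rightarrow> ('m \<Rightarrow> (real^7) list \<Rightarrow> real) \<Rightarrow>
   ('r, 're::findim_normed_vector, 'm, real^7, 'h, 'he::findim_normed_vector) pbundle \<Rightarrow>
   ('r \<Rightarrow> 're list \<Rightarrow> 'he) \<Rightarrow> bool" where
  "heterotic_g2_system M \<phi> R B \<longleftrightarrow>
     smooth_manifold M \<and> smooth_form M 3 \<phi> \<and> (\<forall>p\<in>points M. is_g2_form (\<phi> p)) \<and>
     principal_bundle R \<and> base R = M \<and> principal_connection R B \<and>
     (\<forall>p\<in>points M. \<forall>vs.
        ext_d M (g2_psi \<phi>) p vs = ((\<lambda>ws. 4 * g2_tau1 M \<phi> p ws) \<^bold>\<and> g2_psi \<phi> p) vs) \<and>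
     curvature_wedge_vanishes R B (g2_psi \<phi>) \<and>
     (\<exists>b. invariant_pairing (sgroup R) b \<and> bianchi_identity R B b (g2_T M \<phi>))"

text \<open>\<open>\<phi>\<^sub>t = \<eta> \<and> \<omega> + Re(e\<^sup>i\<^sup>t \<Upsilon>)\<close> on the total space of \<open>S\<close>.\<close>

definition phi_t ::
  "('m, real^7, 'q, real^6, complex, real) pbundle \<Rightarrow> ('m \<Rightarrow> (real^7) list \<Rightarrow> real) \<Rightarrow>
   ('q \<Rightarrow> (real^6) list \<Rightarrow> real) \<Rightarrow> ('q \<Rightarrow> (real^6) list \<Rightarrow> complex) \<Rightarrow> real \<Rightarrow>
   'm \<Rightarrow> (real^7) list \<Rightarrow> real" where
  "phi_t S \<eta> \<omega> \<Upsilon> t p vs = (\<eta> p \<^bold>\<and> lift_form S \<omega> p) vs + Re (cis t * lift_form S \<Upsilon> p vs)"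

end

theory Submission
 imports Defs
begin

text \<open>At every point of the circle bundle choose a vertical vector \<open>f\<^sub>0\<close> with \<open>\<eta>(f\<^sub>0) = 1\<close> and \<open>\<eta>\<close>-horizontal
  lifts \<open>f\<^sub>1, \<dots>, f\<^sub>6\<close> of a unitary frame in which \<open>e\<^sup>i\<^sup>t\<Upsilon> = (e\<^sup>1 + i e\<^sup>2)(e\<^sup>3 + i e\<^sup>4)(e\<^sup>5 + i e\<^sup>6)\<close>.  This frame is
  orthonormal for the metric of \<open>\<phi>\<^sub>t\<close>.  The rotation by \<open>e\<^sup>i\<^sup>t\<close> of \<open>\<Upsilon>\<close> is compensated by a rotation of \<open>(\<pi>\<^sub>0, \<sigma>\<^sub>0)\<close>,
  under which the torsion equations and \<open>T\<^sub>\<omega>\<close> keep their form.  Evaluated in the frame, the torsion equations and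
  the membership conditions of \<open>d\<eta>\<close> and \<open>\<nu>\<^sub>3\<close> become linear relations between finitely many components,
  from which \<open>\<psi> = \<omega>\<^sup>2/2 - \<eta> \<and> Im(e\<^sup>i\<^sup>t\<Upsilon>)\<close>, \<open>\<tau>\<^sub>1 = (\<nu>\<^sub>1 + \<sigma>\<^sub>0 \<eta>)/2\<close> (with \<open>\<sigma>\<^sub>0\<close> rotated) and \<open>T\<^sub>\<phi> = \<eta> \<and> d\<eta> + T\<^sub>\<omega>\<close>.
  Hence \<open>dT\<^sub>\<phi> = d\<eta> \<and> d\<eta> + dT\<^sub>\<omega>\<close>, and the pairing on \<open>\<real> \<times> \<gg>\<close> is the orthogonal sum
  of multiplication and \<open>\<langle>\<cdot>, \<cdot>\<rangle>\<close>.  The curvature is horizontal, so \<open>F \<and> Re \<Upsilon> = 0\<close> says that it is of type \<open>(1,1)\<close>,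
  which gives \<open>F \<and> Im \<Upsilon> = 0\<close> and with \<open>F \<and> \<omega>\<^sup>2 = 0\<close> the instanton equation \<open>F \<and> \<psi> = 0\<close>.\<close>

section \<open>Alternating forms and the wedge product\<close>

text \<open>Three features of the definitions shape the proof. The Hodge star is taken in a frame
  picked by \<open>SOME\<close> and the metric of \<phi> is given by \<open>THE\<close>, so no
  component can be computed until the star is known to be independent of the frame and the pair of
  metric and volume form to be unique. Forms are functions on lists and the wedge product is a sum
  over subsets of positions; peeling off the first vector turns wedge product, exterior derivative
  and pairing of forms into recursions, with signs carried by \<open>grade_sgn\<close>, which reads
  the degree off the length of the list. Manifolds store each tangent space in the preferred chart
  of its point, so derivatives have to be converted between charts before forms at different points
  can be compared. A further difficulty is the gauge bundle: it is a fibre product over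
  \<open>Q\<close>, pulled back to the circle bundle, and its atlas, topology, group action and
  connection have to be built before its curvature can be split.\<close>

definition grade_sgn :: "('e list => 'v::real_vector) => 'e list => 'v" where
 "grade_sgn a vs = (-1) ^ length vs *\<^sub>R a vs"

section \<open>Sets of positions, split by whether they contain the first one\<close>

lemma nths_Cons_Suc: "nths (v # vs) (Suc ` B) = nths vs B"
proof -
 have "{j. Suc j \<in> Suc ` B} = B" by auto
 then show ?thesis by (simp add: nths_Cons)
qed

lemma nths_Cons_insert: "nths (v # vs) (insert 0 (Suc ` B)) = v # nths vs B"
proof -
 have "{j. Suc j \<in> insert 0 (Suc ` B)} = B" by auto
 then show ?thesis by (simp add: nths_Cons)
qed

lemma nths_Cons_Compl_Suc: "nths (v # vs) (- Suc ` B) = v # nths vs (- B)"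
proof -
 have "{j. Suc j \<in> - Suc ` B} = - B" by auto
 moreover have "0 \<in> - Suc ` B" by auto
 ultimately show ?thesis by (simp add: nths_Cons)
qed

lemma nths_Cons_Compl_insert: "nths (v # vs) (- insert 0 (Suc ` B)) = nths vs (- B)"
proof -
 have "{j. Suc j \<in> - insert 0 (Suc ` B)} = - B" by auto
 moreover have "0 \<notin> - insert 0 (Suc ` B)" by auto
 ultimately show ?thesis by (simp add: nths_Cons)
qed

lemma length_nths_subset: "B \<subseteq> {..<length vs} ==> length (nths vs B) = card B"
 by (simp add: length_nths, rule arg_cong[where f = card]) auto

lemma inversions_finite: "finite B ==> finite {(i, j). i \<in> B \<and> j \<notin> B \<and> j < (i::nat)}"
proof -
 assume "finite B"
 then obtain n where n: "B \<subseteq> {..<n}" using finite_nat_iff_bounded by blast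
 have "{(i, j). i \<in> B \<and> j \<notin> B \<and> j < i} \<subseteq> {..<n} \<times> {..<n}" using n by auto
 then show ?thesis by (rule finite_subset) auto
qed

text \<open>The new member 0 has no position below it, so it creates no inversion; the remaining
  inversions are the old ones shifted by one.\<close>

lemma inversions_insert:
 "card {(i, j). i \<in> insert 0 (Suc ` B) \<and> j \<notin> insert 0 (Suc ` B) \<and> j < i} =
  card {(i, j). i \<in> B \<and> j \<notin> B \<and> j < (i::nat)}"
proof -
 have "{(i, j). i \<in> insert 0 (Suc ` B) \<and> j \<notin> insert 0 (Suc ` B) \<and> j < i} =
    (%(i, j). (Suc i, Suc j)) ` {(i, j). i \<in> B \<and> j \<notin> B \<and> j < i}" (is "?L = ?R")
 proof
  show "?L \<subseteq> ?R"
  proof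
   fix x assume "x \<in> ?L"
   then obtain i j where ij: "x = (i, j)" "i \<in> insert 0 (Suc ` B)" "j \<notin> insert 0 (Suc ` B)" "j < i" by auto
   then obtain i' where "i = Suc i'" "i' \<in> B" by auto
   moreover obtain j' where "j = Suc j'" using ij by (cases j) auto
   ultimately show "x \<in> ?R" using ij by force
  qed
  show "?R \<subseteq> ?L" by auto
 qed
 moreover have "inj_on (%(i, j). (Suc i, Suc j)) X" for X by (auto simp: inj_on_def)
 ultimately show ?thesis by (simp add: card_image)
qed

text \<open>Every member of the shifted set now also exceeds the omitted position 0. This gives the
  extra \<open>card B\<close>, the source of the sign in the recursion for the wedge
  product.\<close>

lemma inversions_Suc:
 assumes "finite B"
 shows "card {(i, j). i \<in> Suc ` B \<and> j \<notin> Suc ` B \<and> j < i} =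
  card B + card {(i, j). i \<in> B \<and> j \<notin> B \<and> j < (i::nat)}"
proof -
 let ?I = "{(i, j). i \<in> B \<and> j \<notin> B \<and> j < i}"
 have eq: "{(i, j). i \<in> Suc ` B \<and> j \<notin> Suc ` B \<and> j < i} =
    (%i. (Suc i, 0)) ` B \<union> (%(i, j). (Suc i, Suc j)) ` ?I" (is "?L = ?R")
 proof
  show "?L \<subseteq> ?R"
  proof
   fix x assume "x \<in> ?L"
   then obtain i j where ij: "x = (i, j)" "i \<in> Suc ` B" "j \<notin> Suc ` B" "j < i" by auto
   then obtain i' where "i = Suc i'" "i' \<in> B" by auto
   then show "x \<in> ?R" using ij by (cases j) force+
  qed
  show "?R \<subseteq> ?L" by auto
 qed
 have "card ?R = card ((%i. (Suc i, 0::nat)) ` B) + card ((%(i, j). (Suc i, Suc j)) ` ?I)"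
  by (rule card_Un_disjoint) (use assms inversions_finite[OF assms] in auto)
 also have "card ((%i. (Suc i, 0::nat)) ` B) = card B"
  by (rule card_image) (auto simp: inj_on_def)
 also have "card ((%(i, j). (Suc i, Suc j)) ` ?I) = card ?I"
  by (rule card_image) (auto simp: inj_on_def)
 finally show ?thesis unfolding eq .
qed

lemma sum_Pow_Suc:
 "(\<Sum>A\<in>Pow {..<Suc n}. f A) = (\<Sum>B\<in>Pow {..<n}. f (insert 0 (Suc ` B))) + (\<Sum>B\<in>Pow {..<n}. f (Suc ` B))"
 for f :: "nat set => 'a::comm_monoid_add"
proof -
 have e: "{..<Suc n} = insert 0 (Suc ` {..<n})" by (rule lessThan_Suc_eq_insert_0)
 have inj: "inj_on (image Suc) X" for X by (auto simp: inj_on_def)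
 have "Pow {..<Suc n} = Pow (Suc ` {..<n}) \<union> insert 0 ` Pow (Suc ` {..<n})"
  unfolding e Pow_insert ..
 also have "Pow (Suc ` {..<n}) = image Suc ` Pow {..<n}" by (simp add: image_Pow_surj)
 finally have P: "Pow {..<Suc n} = image Suc ` Pow {..<n} \<union> (%B. insert 0 (Suc ` B)) ` Pow {..<n}"
  by (simp add: image_image)
 have inj2: "inj_on (%B. insert 0 (Suc ` B)) (Pow {..<n})"
  by (rule inj_onI) (metis (no_types, lifting) Diff_insert_absorb Zero_not_Suc imageE inj_Suc inj_image_eq_iff)
 have "(\<Sum>A\<in>Pow {..<Suc n}. f A) = sum f (image Suc ` Pow {..<n}) + sum f ((%B. insert 0 (Suc ` B)) ` Pow {..<n})"
  unfolding P by (rule sum.union_disjoint) auto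
 then show ?thesis by (simp add: sum.reindex[OF inj] sum.reindex[OF inj2] add.commute)
qed

lemma wedge_with_Nil [simp]: "wedge_with b a c [] = b (a []) (c [])"
 by (simp add: wedge_with_def)

text \<open>Contraction is an antiderivation: the first vector enters one of the two factors, and on
  its way to the second it passes all arguments of the first. Their number is the length of the list
  given to \<open>a\<close>, so the sign goes into \<open>grade_sgn a\<close> and no degree has to
  be known. Most identities about wedge products below are inductions with this recursion.\<close>

lemma wedge_with_Cons:
 assumes "bilinear b"
 shows "wedge_with b a c (v # vs) =
  wedge_with b (v \<lrcorner> a) c vs + wedge_with b (grade_sgn a) (v \<lrcorner> c) vs"
proof -
 interpret b1: linear "%x. b x y" for y using assms by (simp add: bilinear_def)
 have "wedge_with b a c (v # vs) = (\<Sum>A\<in>Pow {..<Suc (length vs)}.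
   (-1) ^ card {(i, j). i \<in> A \<and> j \<notin> A \<and> j < i} *\<^sub>R b (a (nths (v # vs) A)) (c (nths (v # vs) (- A))))"
  by (simp add: wedge_with_def)
 also have "\<dots> = wedge_with b (v \<lrcorner> a) c vs + (\<Sum>B\<in>Pow {..<length vs}.
   (-1) ^ card {(i, j). i \<in> Suc ` B \<and> j \<notin> Suc ` B \<and> j < i} *\<^sub>R b (a (nths vs B)) (c (v # nths vs (- B))))"
  unfolding sum_Pow_Suc
  by (simp only: nths_Cons_insert nths_Cons_Compl_insert nths_Cons_Suc nths_Cons_Compl_Suc
    inversions_insert wedge_with_def contraction_def)
 also have "(\<Sum>B\<in>Pow {..<length vs}.
   (-1) ^ card {(i, j). i \<in> Suc ` B \<and> j \<notin> Suc ` B \<and> j < i} *\<^sub>R b (a (nths vs B)) (c (v # nths vs (- B)))) =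
   wedge_with b (grade_sgn a) (v \<lrcorner> c) vs"
  unfolding wedge_with_def
 proof (rule sum.cong)
  fix B assume "B \<in> Pow {..<length vs}"
  then have B: "B \<subseteq> {..<length vs}" "finite B" using finite_subset by auto
  show "(-1) ^ card {(i, j). i \<in> Suc ` B \<and> j \<notin> Suc ` B \<and> j < i} *\<^sub>R b (a (nths vs B)) (c (v # nths vs (- B)))
   = (- 1) ^ card {(i, j). i \<in> B \<and> j \<notin> B \<and> j < i} *\<^sub>R b (grade_sgn a (nths vs B)) ((v \<lrcorner> c) (nths vs (- B)))"
   unfolding inversions_Suc[OF B(2)]
   by (simp add: grade_sgn_def length_nths_subset[OF B(1)] b1.scale power_add contraction_def)
 qed simp
 finally show ?thesis .
qed

lemma bilinear_mult_real: "bilinear ((*) :: real => real => real)"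
 by (simp add: bilinear_def linear_iff algebra_simps)

lemma contraction_apply: "(v \<lrcorner> a) vs = a (v # vs)"
 by (simp add: contraction_def)

lemma contraction_grade_sgn: "v \<lrcorner> grade_sgn a = (%vs. - grade_sgn (v \<lrcorner> a) vs)"
 by (rule ext) (simp add: grade_sgn_def contraction_def)

lemma grade_sgn_grade_sgn [simp]: "grade_sgn (grade_sgn a) = a"
 by (rule ext) (simp add: grade_sgn_def flip: power_add)

context
 fixes b :: "'u::real_vector => 'v::real_vector => 'w::real_vector"
 assumes b: "bilinear b"

begin

lemma wedge_with_cong_bilinear_facts:
 "b (x + y) z = b x z + b y z" "b x (y' + z') = b x y' + b x z'"
 "b (r *\<^sub>R x) z = r *\<^sub>R b x z" "b x (r *\<^sub>R z) = r *\<^sub>R b x z"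
 "b (- x) z = - b x z" "b x (- z) = - b x z" "b 0 z = 0" "b x 0 = 0"
 "b (x - y) z = b x z - b y z" "b x (y' - z') = b x y' - b x z'"
 using bilinear_ladd[OF b] bilinear_radd[OF b] bilinear_lmul[OF b] bilinear_rmul[OF b]
  bilinear_lneg[OF b] bilinear_rneg[OF b] bilinear_lzero[OF b] bilinear_rzero[OF b]
  bilinear_lsub[OF b] bilinear_rsub[OF b]
 by auto

lemmas wb = wedge_with_cong_bilinear_facts

lemma wedge_with_add_left: "wedge_with b (%vs. a vs + a' vs) c ws = wedge_with b a c ws + wedge_with b a' c ws"
 by (simp add: wedge_with_def wb scaleR_add_right sum.distrib)

lemma wedge_with_add_right: "wedge_with b a (%vs. c vs + c' vs) ws = wedge_with b a c ws + wedge_with b a c' ws"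
 by (simp add: wedge_with_def wb scaleR_add_right sum.distrib)

lemma wedge_with_scale_left: "wedge_with b (%vs. r *\<^sub>R a vs) c ws = r *\<^sub>R wedge_with b a c ws"
 by (simp add: wedge_with_def wb scaleR_sum_right mult.commute)

lemma wedge_with_scale_right: "wedge_with b a (%vs. r *\<^sub>R c vs) ws = r *\<^sub>R wedge_with b a c ws"
 by (simp add: wedge_with_def wb scaleR_sum_right mult.commute)

lemma wedge_with_minus_left: "wedge_with b (%vs. - a vs) c ws = - wedge_with b a c ws"
 using wedge_with_scale_left[of "-1" a c ws] by simp

lemma wedge_with_minus_right: "wedge_with b a (%vs. - c vs) ws = - wedge_with b a c ws"
 using wedge_with_scale_right[of a "-1" c ws] by simp

lemma wedge_with_diff_left: "wedge_with b (%vs. a vs - a' vs) c ws = wedge_with b a c ws - wedge_with b a' c ws"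
 using wedge_with_add_left[of a "%vs. - a' vs"] by (simp add: wedge_with_minus_left)

lemma wedge_with_diff_right: "wedge_with b a (%vs. c vs - c' vs) ws = wedge_with b a c ws - wedge_with b a c' ws"
 using wedge_with_add_right[of a c "%vs. - c' vs"] by (simp add: wedge_with_minus_right)

lemma wedge_with_zero_left: "wedge_with b (%vs. 0) c ws = 0"
 by (simp add: wedge_with_def wb)

lemma wedge_with_zero_right: "wedge_with b a (%vs. 0) ws = 0"
 by (simp add: wedge_with_def wb)

text \<open>The lists given to the two factors have lengths that add up to the length of the whole
  list.\<close>

lemma grade_sgn_wedge_with: "grade_sgn (wedge_with b a c) = wedge_with b (grade_sgn a) (grade_sgn c)"
proof
 fix ws
 show "grade_sgn (wedge_with b a c) ws = wedge_with b (grade_sgn a) (grade_sgn c) ws"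
  unfolding grade_sgn_def[of "wedge_with b a c"] wedge_with_def scaleR_sum_right
 proof (rule sum.cong[OF refl])
  fix A assume "A \<in> Pow {..<length ws}"
  then have A: "A \<subseteq> {..<length ws}" by simp
  have "length (nths ws (- A)) = card ({..<length ws} - A)"
   by (simp add: length_nths, rule arg_cong[where f = card]) auto
  moreover have "card A + card ({..<length ws} - A) = length ws"
   using A by (metis card_Diff_subset card_lessThan card_mono finite_lessThan finite_subset
     le_add_diff_inverse)
  ultimately have "length (nths ws A) + length (nths ws (- A)) = length ws"
   by (simp add: length_nths_subset[OF A])
  then have "(-1::real) ^ length ws = (-1) ^ length (nths ws A) * (-1) ^ length (nths ws (- A))"
   by (metis power_add)
  then show "(- 1) ^ length ws *\<^sub>R (- 1) ^ card {(i, j). i \<in> A \<and> j \<notin> A \<and> j < i} *\<^sub>R b (a (nths ws A)) (c (nths ws (- A))) =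
   (- 1) ^ card {(i, j). i \<in> A \<and> j \<notin> A \<and> j < i} *\<^sub>R b (grade_sgn a (nths ws A)) (grade_sgn c (nths ws (- A)))"
   by (simp add: grade_sgn_def wb mult.commute)
 qed
qed

lemma contraction_wedge_with:
 "v \<lrcorner> wedge_with b a c = (%vs. wedge_with b (v \<lrcorner> a) c vs + wedge_with b (grade_sgn a) (v \<lrcorner> c) vs)"
 by (rule ext) (simp add: wedge_with_Cons[OF b] contraction_apply)

end

lemma wedge_with_map: "wedge_with b (%ws. a (map L ws)) (%ws. c (map L ws)) vs = wedge_with b a c (map L vs)"
 by (simp add: wedge_with_def nths_map)

text \<open>Four bilinear maps are allowed because the factors may have different value spaces; the
  use is a curvature with values in the Lie algebra, wedged with two real forms. The induction over
  the argument list generalises all three forms, since the recursion changes each of them.\<close>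

lemma wedge_with_assoc:
 fixes b1 :: "'u::real_vector => 'v::real_vector => 'x::real_vector"
  and b2 :: "'x => 'w::real_vector => 'z::real_vector"
  and b3 :: "'v => 'w => 'y::real_vector" and b4 :: "'u => 'y => 'z"
 assumes b: "bilinear b1" "bilinear b2" "bilinear b3" "bilinear b4"
  and assoc: "\<And>x y z. b2 (b1 x y) z = b4 x (b3 y z)"
 shows "wedge_with b2 (wedge_with b1 a c) d vs = wedge_with b4 a (wedge_with b3 c d) vs"
proof (induction vs arbitrary: a c d)
 case Nil
 then show ?case by (simp add: assoc)
next
 case (Cons v vs)
 have "wedge_with b2 (wedge_with b1 a c) d (v # vs) =
  wedge_with b2 (wedge_with b1 (v \<lrcorner> a) c) d vs + wedge_with b2 (wedge_with b1 (grade_sgn a) (v \<lrcorner> c)) d vs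
  + wedge_with b2 (wedge_with b1 (grade_sgn a) (grade_sgn c)) (v \<lrcorner> d) vs"
  by (simp add: wedge_with_Cons[OF b(2)] contraction_wedge_with[OF b(1)] wedge_with_add_left[OF b(2)]
    grade_sgn_wedge_with[OF b(1)])
 also have "\<dots> = wedge_with b4 a (wedge_with b3 c d) (v # vs)"
  by (simp add: wedge_with_Cons[OF b(4)] contraction_wedge_with[OF b(3)] wedge_with_add_right[OF b(4)]
    grade_sgn_wedge_with[OF b(3)] Cons)
 finally show ?case .
qed

section \<open>Degree and graded commutativity\<close>

definition homog :: "nat => ('e list => 'v::zero) => bool" where
 "homog k a \<longleftrightarrow> (\<forall>vs. length vs \<noteq> k \<longrightarrow> a vs = 0)"

lemma homog_contraction: "homog (Suc k) a ==> homog k (v \<lrcorner> a)"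
 by (simp add: homog_def contraction_def)

lemma homog_0_contraction: "homog 0 a ==> v \<lrcorner> a = (%_. 0)"
 by (rule ext) (simp add: homog_def contraction_def)

lemma homog_grade_sgn: "homog k a ==> grade_sgn a = (%vs. (-1) ^ k *\<^sub>R a vs)"
proof
 fix vs assume "homog k a"
 then show "grade_sgn a vs = (-1) ^ k *\<^sub>R a vs"
  by (cases "length vs = k") (simp_all add: grade_sgn_def homog_def)
qed

text \<open>Contracting the first factor lowers \<open>k\<close>, contracting the second lowers
  \<open>l\<close>, and the two terms of the recursion trade places under the exchange. The change
  of the exponent \<open>k * l\<close> is the sign of passing the other factor.\<close>

lemma wedge_with_commute:
 fixes b :: "'u::real_vector => 'v::real_vector => 'w::real_vector"
 assumes b: "bilinear b" and "homog k a" "homog l c"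
 shows "wedge_with b a c vs = (-1) ^ (k * l) *\<^sub>R wedge_with (%x y. b y x) c a vs"
proof -
 have b': "bilinear (%x y. b y x)" using b by (simp add: bilinear_def)
 show ?thesis using assms(2,3)
 proof (induction vs arbitrary: a c k l)
  case Nil
  have "b (a []) (c []) = 0" if "k \<noteq> 0 \<or> l \<noteq> 0"
   using that Nil bilinear_lzero[OF b] bilinear_rzero[OF b] by (auto simp: homog_def)
  then show ?case by (cases "k = 0 \<and> l = 0") auto
 next
  case (Cons v vs)
  note sg = homog_grade_sgn[OF Cons.prems(1)] homog_grade_sgn[OF Cons.prems(2)]
  \<comment> \<open>For \<open>k = 0\<close> the contraction vanishes. Otherwise the induction
    hypothesis has the exponent \<open>k' * l\<close> with \<open>k = Suc k'\<close>, which differs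
    from \<open>k * l\<close> by \<open>l\<close>.\<close>
  have 1: "wedge_with b (v \<lrcorner> a) c vs = ((-1) ^ (k * l) * (-1) ^ l) *\<^sub>R wedge_with (%x y. b y x) c (v \<lrcorner> a) vs"
  proof (cases k)
   case 0
   then show ?thesis using Cons.prems homog_0_contraction[of a v]
    by (simp add: wedge_with_zero_left[OF b] wedge_with_zero_right[OF b'])
  next
   case (Suc k')
   have "(-1::real) ^ (k * l) * (-1) ^ l = (-1) ^ l * ((-1) ^ l * (-1) ^ (k' * l))"
    unfolding Suc by (simp add: power_add)
   then have "(-1::real) ^ (k * l) * (-1) ^ l = (-1) ^ (k' * l)" by simp
   moreover have "homog k' (v \<lrcorner> a)" using Cons.prems(1) Suc by (simp add: homog_contraction)
   ultimately show ?thesis using Cons.IH[of k' "v \<lrcorner> a" l c] Cons.prems(2) by (simp only:)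
  qed
  have 2: "(-1) ^ k *\<^sub>R wedge_with b a (v \<lrcorner> c) vs = (-1) ^ (k * l) *\<^sub>R wedge_with (%x y. b y x) (v \<lrcorner> c) a vs"
  proof (cases l)
   case 0
   then show ?thesis using Cons.prems homog_0_contraction[of c v]
    by (simp add: wedge_with_zero_left[OF b'] wedge_with_zero_right[OF b])
  next
   case (Suc l')
   then have "homog l' (v \<lrcorner> c)" using Cons.prems(2) by (simp add: homog_contraction)
   then have "wedge_with b a (v \<lrcorner> c) vs = (-1) ^ (k * l') *\<^sub>R wedge_with (%x y. b y x) (v \<lrcorner> c) a vs"
    using Cons.IH[of k a l' "v \<lrcorner> c"] Cons.prems(1) by blast
   then show ?thesis by (simp only: Suc mult_Suc_right power_add scaleR_scaleR)
  qed
  have "wedge_with b a c (v # vs) = wedge_with b (v \<lrcorner> a) c vs + (-1) ^ k *\<^sub>R wedge_with b a (v \<lrcorner> c) vs"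
   by (simp only: wedge_with_Cons[OF b] sg wedge_with_scale_left[OF b])
  also have "\<dots> = (-1) ^ (k * l) *\<^sub>R (wedge_with (%x y. b y x) (v \<lrcorner> c) a vs +
    (-1) ^ l *\<^sub>R wedge_with (%x y. b y x) c (v \<lrcorner> a) vs)"
   unfolding 1 2 scaleR_add_right scaleR_scaleR by (rule add.commute)
  also have "\<dots> = (-1) ^ (k * l) *\<^sub>R wedge_with (%x y. b y x) c a (v # vs)"
   by (simp only: wedge_with_Cons[OF b'] sg wedge_with_scale_left[OF b'])
  finally show ?case .
 qed
qed

lemma alt_form_homog: "alt_form k a ==> homog k a"
 by (simp add: alt_form_def homog_def)

section \<open>Multilinear and alternating functions on lists\<close>

definition multilin :: "('e::real_vector list => 'v::real_vector) => bool" where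
 "multilin a \<longleftrightarrow> (\<forall>us ws. linear (%v. a (us @ v # ws)))"

text \<open>Equal neighbours are enough: with multilinearity this forces vanishing on every list
  with a repetition, and it passes through contraction and list induction more easily than a
  condition on \<open>distinct\<close>.\<close>

definition adj_alt :: "('e list => 'v::zero) => bool" where
 "adj_alt a \<longleftrightarrow> (\<forall>us v ws. a (us @ v # v # ws) = 0)"

text \<open>Polarisation: the value on the repeated entry \<open>v + w\<close> is zero and expands
  into the two orders.\<close>

lemma adj_alt_swap:
 assumes "multilin a" "adj_alt a"
 shows "a (us @ v # w # ws) = - a (us @ w # v # ws)"
proof -
 have l: "linear (%x. a (us @ x # y # ws))" "linear (%x. a (us @ y # x # ws))" for y
  using assms(1)[unfolded multilin_def, rule_format, of us "y # ws"]
   assms(1)[unfolded multilin_def, rule_format, of "us @ [y]" ws] by simp_all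
 have "0 = a (us @ (v + w) # (v + w) # ws)" using assms by (simp add: adj_alt_def)
 also have "\<dots> = a (us @ v # w # ws) + a (us @ w # v # ws)"
  using assms(2)[unfolded adj_alt_def, rule_format, of us v ws] assms(2)[unfolded adj_alt_def, rule_format, of us w ws]
  by (simp add: linear_add[OF l(1)] linear_add[OF l(2)])
 finally show ?thesis by (simp add: eq_neg_iff_add_eq_0)
qed

lemma adj_alt_move:
 assumes "multilin a" "adj_alt a"
 shows "a (us @ v # ms @ ws) = (-1) ^ length ms *\<^sub>R a (us @ ms @ v # ws)"
proof (induction ms arbitrary: us)
 case (Cons m ms)
 have "a (us @ v # (m # ms) @ ws) = - a ((us @ [m]) @ v # ms @ ws)"
  using adj_alt_swap[OF assms, of us v m "ms @ ws"] by simp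
 then show ?case by (simp only: Cons) simp
qed simp

lemma adj_alt_not_distinct:
 assumes "multilin a" "adj_alt a" "\<not> distinct vs"
 shows "a vs = 0"
proof -
 obtain xs ys zs y where "vs = xs @ [y] @ ys @ [y] @ zs" using not_distinct_decomp[OF assms(3)] by blast
 then have "a vs = a (xs @ y # ys @ y # zs)" by simp
 also have "\<dots> = (-1) ^ length ys *\<^sub>R a ((xs @ ys) @ y # y # zs)"
  unfolding adj_alt_move[OF assms(1,2)] by simp
 also have "\<dots> = 0" using assms(2) by (simp only: adj_alt_def) simp
 finally show ?thesis .
qed

text \<open>Degree, multilinearity and alternation are inherited by contractions and wedge products
  separately, so closure of \<open>alt_form\<close> is proved one condition at a time.\<close>

lemma alt_form_iff: "alt_form k a \<longleftrightarrow> homog k a \<and> multilin a \<and> adj_alt a"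
proof
 assume a: "alt_form k a"
 have "linear (%v. a (us @ v # ws))" for us ws
 proof (cases "length us + length ws + 1 = k")
  case False
  then have "(%v. a (us @ v # ws)) = (%_. 0)" using a by (auto simp: alt_form_def)
  then show ?thesis by (simp add: linear_iff)
 qed (use a in \<open>simp add: alt_form_def\<close>)
 moreover have "a (us @ v # v # ws) = 0" for us v ws
  using a unfolding alt_form_def by (cases "length (us @ v # v # ws) = k") auto
 ultimately show "homog k a \<and> multilin a \<and> adj_alt a"
  using a by (simp add: alt_form_homog multilin_def adj_alt_def)
next
 assume "homog k a \<and> multilin a \<and> adj_alt a"
 then show "alt_form k a"
  using adj_alt_not_distinct by (auto simp: alt_form_def homog_def multilin_def)
qed

lemma multilin_contraction: "multilin a ==> multilin (v \<lrcorner> a)"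
 unfolding multilin_def contraction_def append_Cons[symmetric] by blast

lemma adj_alt_contraction: "adj_alt a ==> adj_alt (v \<lrcorner> a)"
 unfolding adj_alt_def contraction_def append_Cons[symmetric] by blast

lemma multilin_grade_sgn: "multilin a ==> multilin (grade_sgn a)"
 unfolding multilin_def grade_sgn_def length_append length_Cons
 by (intro allI linear_compose_scale_right) blast

lemma adj_alt_grade_sgn: "adj_alt a ==> adj_alt (grade_sgn a)"
 by (simp add: adj_alt_def grade_sgn_def)

lemma alt_form_contraction: "alt_form (Suc k) a ==> alt_form k (v \<lrcorner> a)"
 by (simp add: alt_form_iff homog_contraction multilin_contraction adj_alt_contraction)

lemma homog_wedge_with:
 fixes b :: "'u::real_vector => 'v::real_vector => 'w::real_vector"
 assumes b: "bilinear b" and "homog k a" "homog l c"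
 shows "homog (k + l) (wedge_with b a c)"
proof -
 have "length vs = k + l" if "wedge_with b a c vs \<noteq> 0" for vs
  using that assms(2,3)
 proof (induction vs arbitrary: a c k l)
  case Nil
  then show ?case by (auto simp: homog_def wedge_with_cong_bilinear_facts[OF b])
 next
  case (Cons v vs)
  have "wedge_with b (v \<lrcorner> a) c vs \<noteq> 0 \<or> wedge_with b a (v \<lrcorner> c) vs \<noteq> 0"
   using Cons.prems(1) homog_grade_sgn[OF Cons.prems(2)]
   by (auto simp: wedge_with_Cons[OF b] wedge_with_scale_left[OF b])
  then show ?case
  proof
   assume n: "wedge_with b (v \<lrcorner> a) c vs \<noteq> 0"
   then obtain k' where "k = Suc k'"
    using homog_0_contraction[of a v] Cons.prems(2) by (cases k) (auto simp: wedge_with_zero_left[OF b])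
   then show ?thesis using Cons.IH[OF n, of k' l] Cons.prems by (simp add: homog_contraction)
  next
   assume n: "wedge_with b a (v \<lrcorner> c) vs \<noteq> 0"
   then obtain l' where "l = Suc l'"
    using homog_0_contraction[of c v] Cons.prems(3) by (cases l) (auto simp: wedge_with_zero_right[OF b])
   then show ?thesis using Cons.IH[OF n, of k l'] Cons.prems by (simp add: homog_contraction)
  qed
 qed
 then show ?thesis unfolding homog_def by blast
qed

lemma linear_head: "multilin a ==> linear (%v. a (v # ws))"
 using multilin_def[of a, THEN iffD1, rule_format, of "[]"] by simp

lemma multilin_wedge_with:
 fixes b :: "'u::real_vector => 'v::real_vector => 'w::real_vector"
 assumes b: "bilinear b" and "multilin a" "multilin c"
 shows "multilin (wedge_with b a c)"
proof -
 have "linear (%v. wedge_with b a c (us @ v # ws))" for us ws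
  using assms(2,3)
 proof (induction us arbitrary: a c)
  case Nil
  have a: "(v + w) \<lrcorner> a = (%vs. (v \<lrcorner> a) vs + (w \<lrcorner> a) vs)" "(v + w) \<lrcorner> c = (%vs. (v \<lrcorner> c) vs + (w \<lrcorner> c) vs)"
   "(r *\<^sub>R v) \<lrcorner> a = (%vs. r *\<^sub>R (v \<lrcorner> a) vs)" "(r *\<^sub>R v) \<lrcorner> c = (%vs. r *\<^sub>R (v \<lrcorner> c) vs)" for v w r
   using linear_head[OF Nil(1)] linear_head[OF Nil(2)] by (auto simp: linear_iff fun_eq_iff contraction_def)
  show ?case
   unfolding append_Nil wedge_with_Cons[OF b]
   by (rule linearI) (simp_all only: a wedge_with_add_left[OF b] wedge_with_add_right[OF b]
     wedge_with_scale_left[OF b] wedge_with_scale_right[OF b] scaleR_add_right ac_simps)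
 next
  case (Cons u us)
  show ?case
   unfolding append_Cons wedge_with_Cons[OF b]
   by (intro linear_compose_add Cons multilin_contraction multilin_grade_sgn)
 qed
 then show ?thesis unfolding multilin_def by blast
qed

lemma adj_alt_contraction_twice:
 assumes "adj_alt a" shows "v \<lrcorner> v \<lrcorner> a = (%_. 0)"
proof
 fix ws show "(v \<lrcorner> v \<lrcorner> a) ws = 0"
  using assms[unfolded adj_alt_def, rule_format, of "[]" v ws] by (simp only: contraction_def append_Nil)
qed

lemma adj_alt_wedge_with:
 fixes b :: "'u::real_vector => 'v::real_vector => 'w::real_vector"
 assumes b: "bilinear b" and "adj_alt a" "adj_alt c"
 shows "adj_alt (wedge_with b a c)"
proof -
 have "wedge_with b a c (us @ v # v # ws) = 0" for us v ws
  using assms(2,3)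
 proof (induction us arbitrary: a c)
  case Nil
  \<comment> \<open>The first and last terms contain a double contraction with \<open>v\<close>. The
    two mixed terms cancel, because contraction and \<open>grade_sgn\<close> anticommute.\<close>
  have "wedge_with b a c ([] @ v # v # ws) = wedge_with b (v \<lrcorner> v \<lrcorner> a) c ws
   + wedge_with b (grade_sgn (v \<lrcorner> a)) (v \<lrcorner> c) ws
   + (wedge_with b (v \<lrcorner> grade_sgn a) (v \<lrcorner> c) ws + wedge_with b (grade_sgn (grade_sgn a)) (v \<lrcorner> v \<lrcorner> c) ws)"
   by (simp only: append_Nil wedge_with_Cons[OF b])
  also have "\<dots> = 0"
   by (simp only: adj_alt_contraction_twice[OF Nil(1)] adj_alt_contraction_twice[OF Nil(2)] contraction_grade_sgn wedge_with_minus_left[OF b]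
    wedge_with_zero_left[OF b] wedge_with_zero_right[OF b]) simp
  finally show ?case .
 next
  case (Cons u us)
  show ?case
   unfolding append_Cons wedge_with_Cons[OF b]
   using Cons.IH[OF adj_alt_contraction Cons.prems(2)] Cons.IH[OF adj_alt_grade_sgn adj_alt_contraction] Cons.prems
   by simp
 qed
 then show ?thesis unfolding adj_alt_def by blast
qed

lemma alt_form_wedge_with:
 fixes b :: "'u::real_vector => 'v::real_vector => 'w::real_vector"
 assumes "bilinear b" "alt_form k a" "alt_form l c"
 shows "alt_form (k + l) (wedge_with b a c)"
 using assms by (simp add: alt_form_iff homog_wedge_with multilin_wedge_with adj_alt_wedge_with)

lemmas alt_form_wedge = alt_form_wedge_with[OF bilinear_mult_real]

lemma alt_form_map:
 assumes "alt_form k a" "linear L" shows "alt_form k (%vs. a (map L vs))"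
proof -
 have "multilin (%vs. a (map L vs))"
  unfolding multilin_def
 proof (intro allI)
  fix us ws
  have "linear (%v. a (map L us @ v # map L ws))"
   using assms(1) by (simp add: alt_form_iff multilin_def)
  from linear_compose[OF assms(2) this] show "linear (%v. a (map L (us @ v # ws)))"
   by (simp add: o_def)
 qed
 then show ?thesis using assms(1) by (auto simp: alt_form_iff homog_def adj_alt_def)
qed

lemma alt_form_add: "alt_form k a ==> alt_form k c ==> alt_form k (%vs. a vs + c vs)"
 by (simp add: alt_form_def linear_compose_add)

lemma alt_form_scale: "alt_form k a ==> alt_form k (%vs. r *\<^sub>R a vs)"
 by (simp add: alt_form_def linear_compose_scale_right)

lemma alt_form_linear:
 assumes a: "alt_form k a" and L: "linear L" shows "alt_form k (%vs. L (a vs))"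
proof -
 have "linear (%v. L (a (us @ v # ws)))" if "length us + length ws + 1 = k" for us ws
 proof -
  have "linear (%v. a (us @ v # ws))" using a that by (simp add: alt_form_def)
  from linear_compose[OF this L] show ?thesis by (simp add: o_def)
 qed
 then show ?thesis using a linear_0[OF L] by (auto simp: alt_form_def)
qed

section \<open>Smooth functions on open sets\<close>

text \<open>A substitute for the equivalence of norms, for a class without an inner product. The new
  basis vector \<open>b\<close> keeps a positive distance \<open>d\<close> from the span of
  \<open>B\<close>: otherwise combinations of \<open>B\<close> would converge to \<open>b\<close>,
  their coefficients would be Cauchy by the induction hypothesis, and the limits would express
  \<open>b\<close> in that span.\<close>

lemma coordinates_bounded:
 fixes B :: "'a::real_normed_vector set"
 assumes "finite B" "independent B"
 shows "\<exists>C>0. \<forall>r. \<forall>b\<in>B. \<bar>r b\<bar> \<le> C * norm (\<Sum>b\<in>B. r b *\<^sub>R b)"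
 using assms
proof (induction B)
 case empty
 then show ?case by (auto intro: exI[of _ 1])
next
 case (insert b B)
 then have ind: "independent B" and bs: "b \<notin> span B"
  using independent_insert[of b B] by simp_all
 obtain C where C: "C > 0" "\<And>r c. c \<in> B ==> \<bar>r c\<bar> \<le> C * norm (\<Sum>b\<in>B. r b *\<^sub>R b)"
  using insert.IH[OF ind] by blast
 have "\<exists>d>0. \<forall>r. d \<le> norm (b - (\<Sum>c\<in>B. r c *\<^sub>R c))"
 proof (rule ccontr)
  assume "\<not> ?thesis"
  then have "\<exists>r. norm (b - (\<Sum>c\<in>B. r c *\<^sub>R c)) < inverse (Suc n)" for n
   by (meson inverse_positive_iff_positive not_le of_nat_0_less_iff zero_less_Suc)
  then obtain r where r: "\<And>n. norm (b - (\<Sum>c\<in>B. r n c *\<^sub>R c)) < inverse (Suc n)" by metis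
  let ?y = "%n. \<Sum>c\<in>B. r n c *\<^sub>R c"
  have "(%n. b - ?y n) \<longlonglongrightarrow> 0"
   by (rule Lim_null_comparison[OF _ LIMSEQ_inverse_real_of_nat])
    (use r in \<open>auto intro!: always_eventually less_imp_le\<close>)
  from tendsto_diff[OF tendsto_const[of b] this] have y: "?y \<longlonglongrightarrow> b" by simp
  have "Cauchy (%n. r n c)" if c: "c \<in> B" for c
  proof (rule metric_CauchyI)
   fix e :: real assume "0 < e"
   have "Cauchy ?y" using y by (intro LIMSEQ_imp_Cauchy)
   moreover have "0 < e / C" using \<open>0 < e\<close> C(1) by simp
   ultimately obtain N where
    N: "\<And>m n. m \<ge> N ==> n \<ge> N ==> dist (?y m) (?y n) < e / C"
    using metric_CauchyD[of ?y "e / C"] by blast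
   have "dist (r m c) (r n c) < e" if "m \<ge> N" "n \<ge> N" for m n
   proof -
    have "dist (r m c) (r n c) \<le> C * norm (\<Sum>b\<in>B. (r m b - r n b) *\<^sub>R b)"
     using C(2)[OF c, of "%b. r m b - r n b"] by (simp add: dist_real_def)
    also have "\<dots> = C * dist (?y m) (?y n)"
     by (simp add: dist_norm scaleR_diff_left sum_subtractf)
    also have "\<dots> < C * (e / C)" using N[OF that] C by (intro mult_strict_left_mono)
    finally show ?thesis using C by simp
   qed
   then show "\<exists>N. \<forall>m\<ge>N. \<forall>n\<ge>N. dist (r m c) (r n c) < e" by blast
  qed
  then have "\<forall>c\<in>B. \<exists>L. (%n. r n c) \<longlonglongrightarrow> L"
   by (simp add: Cauchy_convergent convergentD)
  then obtain L where L: "\<And>c. c \<in> B ==> (%n. r n c) \<longlonglongrightarrow> L c" by metis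
  then have "?y \<longlonglongrightarrow> (\<Sum>c\<in>B. L c *\<^sub>R c)"
   by (intro tendsto_sum tendsto_scaleR tendsto_const)
  then have "b = (\<Sum>c\<in>B. L c *\<^sub>R c)" using y LIMSEQ_unique by blast
  then have "b \<in> span B" by (simp add: span_base span_scale span_sum)
  then show False using bs by simp
 qed
 then obtain d where d: "d > 0" "\<And>r. d \<le> norm (b - (\<Sum>c\<in>B. r c *\<^sub>R c))" by blast
 \<comment> \<open>Dividing by the coefficient of \<open>b\<close> turns the vector into
   \<open>b\<close> minus a combination of \<open>B\<close>, to which the distance bound
   applies.\<close>
 have b: "\<bar>r b\<bar> \<le> norm (r b *\<^sub>R b + (\<Sum>c\<in>B. r c *\<^sub>R c)) / d" for r
 proof (cases "r b = 0")
  case False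
  have "\<bar>r b\<bar> * d \<le> \<bar>r b\<bar> * norm (b - (\<Sum>c\<in>B. (- r c / r b) *\<^sub>R c))"
   by (intro mult_left_mono d) auto
  also have "\<dots> = norm (r b *\<^sub>R (b - (\<Sum>c\<in>B. (- r c / r b) *\<^sub>R c)))" by simp
  also have "r b *\<^sub>R (b - (\<Sum>c\<in>B. (- r c / r b) *\<^sub>R c)) = r b *\<^sub>R b + (\<Sum>c\<in>B. r c *\<^sub>R c)"
   using False by (simp add: scaleR_diff_right scaleR_add_right scaleR_sum_right sum_negf)
  finally show ?thesis using d(1) by (simp add: pos_le_divide_eq)
 qed (use d in simp)
 \<comment> \<open>\<open>1 / d\<close> bounds the coefficient of \<open>b\<close>. The other
   coefficients see the vector without its \<open>b\<close>-part, whose norm is at most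
   \<open>1 + norm b / d\<close> times the norm of the vector.\<close>
 let ?D = "1 / d + C * (1 + norm b / d)"
 have "\<bar>r c\<bar> \<le> ?D * norm (\<Sum>c\<in>insert b B. r c *\<^sub>R c)" if "c \<in> insert b B" for r c
 proof -
  let ?x = "r b *\<^sub>R b + (\<Sum>c\<in>B. r c *\<^sub>R c)"
  have x: "(\<Sum>c\<in>insert b B. r c *\<^sub>R c) = ?x" using insert by simp
  have D: "1 / d * norm ?x \<le> ?D * norm ?x" "C * (1 + norm b / d) * norm ?x \<le> ?D * norm ?x"
   by (rule mult_right_mono; use C d in simp)+
  show ?thesis
  proof (cases "c = b")
   case True
   then show ?thesis using b[of r] D(1) by (simp add: x)
  next
   case False
   then have "\<bar>r c\<bar> \<le> C * norm (\<Sum>b\<in>B. r b *\<^sub>R b)" using C that by auto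
   also have "(\<Sum>b\<in>B. r b *\<^sub>R b) = ?x - r b *\<^sub>R b" by simp
   also have "norm \<dots> \<le> norm ?x + \<bar>r b\<bar> * norm b"
    using norm_triangle_ineq4[of ?x "r b *\<^sub>R b"] by simp
   also have "\<dots> \<le> norm ?x + norm ?x / d * norm b"
    by (intro add_left_mono mult_right_mono b) auto
   finally have "\<bar>r c\<bar> \<le> C * (1 + norm b / d) * norm ?x"
    using C by (simp add: algebra_simps)
   then show ?thesis using D(2) by (simp add: x)
  qed
 qed
 moreover have "?D > 0" using C d by (simp add: add_pos_nonneg)
 ultimately show ?case by blast
qed

lemma linear_findim_bounded:
 fixes f :: "'a::findim_normed_vector => 'b::real_normed_vector"
 assumes "linear f" shows "bounded_linear f"
proof -
 obtain B0 :: "'a set" where B0: "finite B0" "span B0 = UNIV" using finite_spanning by blast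
 obtain B where B: "B \<subseteq> B0" "independent B" "B0 \<subseteq> span B"
  using maximal_independent_subset[of B0] by blast
 have fB: "finite B" using B0 B finite_subset by blast
 have sB: "span B = UNIV" using B0(2) B(3) span_minimal[OF B(3) subspace_span] by auto
 obtain C where C: "C > 0" "\<And>r b. b \<in> B ==> \<bar>r b\<bar> \<le> C * norm (\<Sum>b\<in>B. r b *\<^sub>R b)"
  using coordinates_bounded[OF fB B(2)] by blast
 have "norm (f x) \<le> norm x * (\<Sum>b\<in>B. C * norm (f b))" for x
 proof -
  obtain r where x: "x = (\<Sum>b\<in>B. r b *\<^sub>R b)"
   using sB span_finite[OF fB] by (metis (no_types, lifting) UNIV_I imageE)
  have "norm (f x) = norm (\<Sum>b\<in>B. r b *\<^sub>R f b)"
   unfolding x by (simp add: linear_sum[OF assms] linear_scale[OF assms])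
  also have "\<dots> \<le> (\<Sum>b\<in>B. (C * norm x) * norm (f b))"
   by (rule sum_norm_le) (use C(2)[of _ r] in \<open>auto simp: x intro!: mult_right_mono\<close>)
  finally show ?thesis by (simp add: sum_distrib_left mult_ac)
 qed
 then show ?thesis using assms by (intro bounded_linear_intro[where K = "\<Sum>b\<in>B. C * norm (f b)"])
   (auto simp: linear_add linear_scale)
qed

lemma findim_coordinates:
 "\<exists>(B::'a::findim_normed_vector set) u. finite B \<and> (\<forall>b. bounded_linear (u b)) \<and> (\<forall>x. x = (\<Sum>b\<in>B. u b x *\<^sub>R b))"
proof -
 obtain B0 :: "'a set" where B0: "finite B0" "span B0 = UNIV" using finite_spanning by blast
 obtain B where B: "B \<subseteq> B0" "independent B" "B0 \<subseteq> span B"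
  using maximal_independent_subset[of B0] by blast
 have fB: "finite B" using B0 B finite_subset by blast
 have sB: "span B = UNIV" using B0(2) B(3) span_minimal[OF B(3) subspace_span] by auto
 have "linear (%x. representation B x b)" for b
  by (rule linearI) (use B(2) sB in \<open>auto simp: representation_add representation_scale\<close>)
 then have "bounded_linear (%x. representation B x b)" for b by (rule linear_findim_bounded)
 moreover have "x = (\<Sum>b\<in>B. representation B x b *\<^sub>R b)" for x
  using sum_representation_eq[OF B(2) _ fB, of x] sB by simp
 ultimately show ?thesis using fB by (intro exI[of _ B] exI[of _ "%b x. representation B x b"]) auto
qed

text \<open>Chosen once for each type. Expanding arguments in these coordinates reduces smoothness
  of multilinear expressions to sums of smooth coefficients times values at fixed vectors.\<close>

definition cbasis :: "'a::findim_normed_vector set" where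
 "cbasis = (SOME B. \<exists>u. finite B \<and> (\<forall>b. bounded_linear (u b)) \<and> (\<forall>x. x = (\<Sum>b\<in>B. u b x *\<^sub>R b)))"

definition coord :: "'a::findim_normed_vector => 'a => real" where
 "coord = (SOME u. (\<forall>b. bounded_linear (u b)) \<and> (\<forall>x. x = (\<Sum>b\<in>cbasis. u b x *\<^sub>R b)))"

lemma cbasis_ex: "finite (cbasis::'a::findim_normed_vector set) \<and>
  (\<exists>u. (\<forall>b. bounded_linear (u b)) \<and> (\<forall>x::'a. x = (\<Sum>b\<in>cbasis. u b x *\<^sub>R b)))"
 unfolding cbasis_def using someI_ex[OF findim_coordinates[where 'a='a]] by blast

lemma finite_cbasis [simp]: "finite cbasis" using cbasis_ex by blast

lemma bounded_linear_coord: "bounded_linear (coord b)"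
 and coord_sum: "(\<Sum>b\<in>cbasis. coord b x *\<^sub>R b) = x"
 using someI_ex[OF conjunct2[OF cbasis_ex]] unfolding coord_def[symmetric] by metis+

section \<open>The calculus of \<open>ck_on\<close> and \<open>smooth_on\<close>\<close>

lemma ck_on_subset: "ck_on k S f ==> T \<subseteq> S ==> ck_on k T f"
 by (induction k arbitrary: f) (auto intro: continuous_on_subset)

lemma ck_on_Suc_D: "ck_on (Suc k) S f ==> ck_on k S f"
proof (induction k arbitrary: f)
 case 0
 then show ?case
  by (auto simp: continuous_on_eq_continuous_within intro!: continuous_at_imp_continuous_within[OF differentiable_imp_continuous_within])
next
 case (Suc k)
 have "ck_on k S (%x. frechet_derivative f (at x) v)" for v
  using Suc.IH Suc.prems ck_on.simps(2)[of "Suc k" S f] by blast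
 then show ?case using Suc.prems unfolding ck_on.simps(2) by blast
qed

lemma frechet_derivative_cong_open:
 assumes "open S" "x \<in> S" "\<And>y. y \<in> S ==> f y = g y"
 shows "frechet_derivative f (at x) = frechet_derivative g (at x)"
proof -
 have "(f has_derivative D) (at x) \<longleftrightarrow> (g has_derivative D) (at x)" for D
  using has_derivative_transform_within_open[OF _ assms(1,2)] assms(3) by metis
 then show ?thesis by (simp add: frechet_derivative_def)
qed

lemma differentiable_cong_open:
 assumes "open S" "x \<in> S" "\<And>y. y \<in> S ==> f y = g y" "f differentiable (at x)"
 shows "g differentiable (at x)"
 using assms has_derivative_transform_within_open[OF _ assms(1,2)] unfolding differentiable_def by metis

lemma ck_on_cong:
 assumes "open S" "\<And>y. y \<in> S ==> f y = g y" "ck_on k S f"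
 shows "ck_on k S g"
 using assms(2,3)
proof (induction k arbitrary: f g)
 case 0
 then show ?case using continuous_on_cong by force
next
 case (Suc k)
 have "ck_on k S (%x. frechet_derivative g (at x) v)" for v
  by (rule Suc.IH[of "%x. frechet_derivative f (at x) v"])
   (use Suc.prems frechet_derivative_cong_open[OF assms(1), of _ f g] in auto)
 moreover have "\<forall>x\<in>S. g differentiable (at x)"
  using differentiable_cong_open[OF assms(1), of _ f g] Suc.prems by auto
 ultimately show ?case by simp
qed

lemma smooth_on_cong: "open S ==> smooth_on S f ==> (\<And>y. y \<in> S ==> f y = g y) ==> smooth_on S g"
 unfolding smooth_on_def using ck_on_cong by blast

lemma smooth_on_subset: "smooth_on S f ==> T \<subseteq> S ==> smooth_on T f"
 unfolding smooth_on_def using ck_on_subset by blast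

lemma smooth_on_differentiable: "smooth_on S f ==> x \<in> S ==> f differentiable (at x)"
 using ck_on.simps(2)[of 0 S f] unfolding smooth_on_def by blast

lemma smooth_on_has_derivative:
 "smooth_on S f ==> x \<in> S ==> (f has_derivative frechet_derivative f (at x)) (at x)"
 using smooth_on_differentiable[of S f x] frechet_derivative_works[of f "at x"] by blast

lemma smooth_on_frechet_derivative: "smooth_on S f ==> smooth_on S (%x. frechet_derivative f (at x) v)"
 unfolding smooth_on_def
proof
 fix k assume "\<forall>k. ck_on k S f"
 then have "ck_on (Suc k) S f" by blast
 then show "ck_on k S (%x. frechet_derivative f (at x) v)" by simp
qed

lemma smooth_on_continuous_on: "smooth_on S f ==> continuous_on S f"
 using ck_on.simps(1)[of S f] unfolding smooth_on_def by blast

lemma ck_on_const: "ck_on k S (%x. c)"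
 by (induction k arbitrary: c) auto

lemma frechet_derivative_eqI: "(f has_derivative f') (at x) ==> frechet_derivative f (at x) = f'"
 using frechet_derivative_at by metis

lemma ck_on_differentiable_has_derivative:
 "ck_on (Suc k) S f ==> x \<in> S ==> (f has_derivative frechet_derivative f (at x)) (at x)"
 using frechet_derivative_works by auto

lemma ck_on_SucI:
 assumes "open S" "\<And>x. x \<in> S ==> (f has_derivative f' x) (at x)" "\<And>v. ck_on k S (%x. f' x v)"
 shows "ck_on (Suc k) S f"
proof -
 have "ck_on k S (%x. frechet_derivative f (at x) v)" for v
  by (rule ck_on_cong[OF assms(1) _ assms(3)[of v]]) (simp add: frechet_derivative_eqI[OF assms(2)])
 then show ?thesis using assms(2) by (auto simp: differentiable_def)
qed

lemma ck_on_add: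
 assumes "open S" "ck_on k S f" "ck_on k S g"
 shows "ck_on k S (%x. f x + g x)"
 using assms(2,3)
proof (induction k arbitrary: f g)
 case (Suc k)
 show ?case
  by (rule ck_on_SucI[OF assms(1) has_derivative_add[OF ck_on_differentiable_has_derivative[OF Suc.prems(1)] ck_on_differentiable_has_derivative[OF Suc.prems(2)]]])
   (use Suc in auto)
qed (auto intro: continuous_intros)

lemma ck_on_bounded_linear:
 assumes "open S" "bounded_linear L" "ck_on k S f"
 shows "ck_on k S (%x. L (f x))"
 using assms(3)
proof (induction k arbitrary: f)
 case 0
 then show ?case using bounded_linear.continuous_on[OF assms(2)] by simp
next
 case (Suc k)
 show ?case
  by (rule ck_on_SucI[OF assms(1) bounded_linear.has_derivative[OF assms(2) ck_on_differentiable_has_derivative[OF Suc.prems]]])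
   (use Suc in auto)
qed

lemma ck_on_sum:
 assumes "open S" "\<And>i. i \<in> I ==> ck_on k S (f i)"
 shows "ck_on k S (%x. \<Sum>i\<in>I. f i x)"
proof (cases "finite I")
 case True
 then show ?thesis using assms(2)
  by (induction I) (simp_all add: ck_on_const ck_on_add[OF assms(1)])
qed (simp add: ck_on_const)

lemma ck_on_bilinear:
 assumes "open S" "bounded_bilinear p" "ck_on k S f" "ck_on k S g"
 shows "ck_on k S (%x. p (f x) (g x))"
 using assms(3,4)
proof (induction k arbitrary: f g)
 case 0
 then show ?case using bounded_bilinear.continuous_on[OF assms(2)] by simp
next
 case (Suc k)
 show ?case
  by (rule ck_on_SucI[OF assms(1) bounded_bilinear.FDERIV[OF assms(2) ck_on_differentiable_has_derivative[OF Suc.prems(1)] ck_on_differentiable_has_derivative[OF Suc.prems(2)]]])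
   (assumption | rule ck_on_add[OF assms(1) Suc.IH Suc.IH];
    use Suc.prems ck_on_Suc_D[OF Suc.prems(1)] ck_on_Suc_D[OF Suc.prems(2)] in simp)+
qed

lemma linear_coord_expand:
 assumes "linear f" shows "f x = (\<Sum>b\<in>cbasis. coord b x *\<^sub>R f b)"
proof -
 have "f x = f (\<Sum>b\<in>cbasis. coord b x *\<^sub>R b)" by (simp add: coord_sum)
 then show ?thesis by (simp add: linear_sum[OF assms] linear_scale[OF assms])
qed

text \<open>In the chain rule the derivative of \<open>g\<close> is taken in a direction that itself
  depends on \<open>x\<close>, while the induction hypothesis speaks of fixed directions only.
  Expanding the moving direction in coordinates leaves sums of products of a coordinate with a
  directional derivative of \<open>g\<close> along a basis vector, composed with
  \<open>f\<close>.\<close>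

lemma ck_on_compose:
 assumes "open S" "open T" "f ` S \<subseteq> T" "ck_on k T g" "ck_on k S f"
 shows "ck_on k S (%x. g (f x))"
 using assms(4,5)
proof (induction k arbitrary: g)
 case 0
 then show ?case using continuous_on_compose2[of T g S f] assms(3) by simp
next
 case (Suc k)
 have d: "((%x. g (f x)) has_derivative (%v. frechet_derivative g (at (f x)) (frechet_derivative f (at x) v))) (at x)" if "x \<in> S" for x
  using diff_chain_at[OF ck_on_differentiable_has_derivative[OF Suc.prems(2) that] ck_on_differentiable_has_derivative[OF Suc.prems(1), of "f x"]]
   assms(3) that by (auto simp: o_def)
 have e: "frechet_derivative g (at (f x)) w = (\<Sum>b\<in>cbasis. coord b w *\<^sub>R frechet_derivative g (at (f x)) b)"
  if "x \<in> S" for x w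
  by (rule linear_coord_expand) (use Suc.prems that assms(3) in \<open>auto intro: linear_frechet_derivative\<close>)
 have c: "ck_on k S (%x. coord b (frechet_derivative f (at x) v) *\<^sub>R frechet_derivative g (at (f x)) b)" for b v
 proof (rule ck_on_bilinear[OF assms(1) bounded_bilinear_scaleR])
  show "ck_on k S (%x. coord b (frechet_derivative f (at x) v))"
   by (rule ck_on_bounded_linear[OF assms(1) bounded_linear_coord]) (use Suc.prems(2) in simp)
  show "ck_on k S (%x. frechet_derivative g (at (f x)) b)"
   by (rule Suc.IH[of "%y. frechet_derivative g (at y) b"])
    (use Suc.prems(1) ck_on_Suc_D[OF Suc.prems(2)] in simp_all)
 qed
 show ?case
 proof (rule ck_on_SucI[OF assms(1) d])
  fix v
  show "ck_on k S (%x. frechet_derivative g (at (f x)) (frechet_derivative f (at x) v))"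
   by (rule ck_on_cong[OF assms(1) _ ck_on_sum[OF assms(1) c[of _ v]]]) (rule e[symmetric])
 qed
qed

lemma smooth_on_const [simp]: "smooth_on S (%x. c)" by (simp add: smooth_on_def ck_on_const)

lemma smooth_on_add: "open S ==> smooth_on S f ==> smooth_on S g ==> smooth_on S (%x. f x + g x)"
 by (simp add: smooth_on_def ck_on_add)

lemma smooth_on_bounded_linear: "open S ==> bounded_linear L ==> smooth_on S f ==> smooth_on S (%x. L (f x))"
 by (simp add: smooth_on_def ck_on_bounded_linear)

lemma smooth_on_sum: "open S ==> (\<And>i. i \<in> I ==> smooth_on S (f i)) ==> smooth_on S (%x. \<Sum>i\<in>I. f i x)"
 by (simp add: smooth_on_def ck_on_sum)

lemma smooth_on_bilinear: "open S ==> bounded_bilinear p ==> smooth_on S f ==> smooth_on S g ==> smooth_on S (%x. p (f x) (g x))"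
 by (simp add: smooth_on_def ck_on_bilinear)

lemma smooth_on_scaleR: "open S ==> smooth_on S f ==> smooth_on S g ==> smooth_on S (%x. f x *\<^sub>R g x)"
 by (rule smooth_on_bilinear[OF _ bounded_bilinear_scaleR])

lemma smooth_on_compose:
 "open S ==> open T ==> f ` S \<subseteq> T ==> smooth_on T g ==> smooth_on S f ==> smooth_on S (%x. g (f x))"
 by (simp add: smooth_on_def ck_on_compose)

lemma smooth_on_id [simp]: "smooth_on S (%x. x)"
proof -
 have "ck_on k UNIV (%x::'a. x)" for k
 proof (cases k)
  case (Suc k')
  have "ck_on (Suc k') UNIV (%x::'a. x)"
   by (rule ck_on_SucI[OF open_UNIV has_derivative_ident]) (simp add: ck_on_const)
  then show ?thesis using Suc by simp
 qed (simp add: continuous_on_id)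
 then show ?thesis unfolding smooth_on_def using ck_on_subset by blast
qed

lemma smooth_on_Pair:
 assumes "open S" "smooth_on S f" "smooth_on S g"
 shows "smooth_on S (%x. (f x, g x))"
proof -
 have "bounded_linear (%y. (y, 0))" "bounded_linear (%z. (0, z))"
  by (intro bounded_linear_Pair bounded_linear_ident bounded_linear_zero)+
 from smooth_on_add[OF assms(1) smooth_on_bounded_linear[OF assms(1) this(1) assms(2)]
   smooth_on_bounded_linear[OF assms(1) this(2) assms(3)]]
 show ?thesis by simp
qed

lemma ck_on_local:
 assumes "\<And>x. x \<in> S ==> \<exists>U. open U \<and> x \<in> U \<and> ck_on k U f"
 shows "ck_on k S f"
 using assms
proof (induction k arbitrary: f)
 case 0
 have "isCont f x" if "x \<in> S" for x
  using 0[OF that] by (auto simp: continuous_on_eq_continuous_at)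
 then show ?case by (simp add: continuous_at_imp_continuous_on)
next
 case (Suc k)
 have "f differentiable (at x)" if "x \<in> S" for x
  using Suc.prems[OF that] by auto
 moreover have "ck_on k S (%x. frechet_derivative f (at x) v)" for v
 proof (rule Suc.IH)
  fix x assume "x \<in> S"
  then obtain U where "open U" "x \<in> U" "ck_on (Suc k) U f" using Suc.prems by blast
  then show "\<exists>U. open U \<and> x \<in> U \<and> ck_on k U (%x. frechet_derivative f (at x) v)" by auto
 qed
 ultimately show ?case by simp
qed

lemma smooth_on_local:
 assumes "\<And>x. x \<in> S ==> \<exists>U. open U \<and> x \<in> U \<and> smooth_on U f"
 shows "smooth_on S f"
 unfolding smooth_on_def
proof
 fix k show "ck_on k S f"
  by (rule ck_on_local) (use assms in \<open>auto simp: smooth_on_def\<close>)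
qed

lemma frechet_derivative_chain:
 assumes "f differentiable (at x)" "g differentiable (at (f x))"
 shows "frechet_derivative (%y. g (f y)) (at x) = (%v. frechet_derivative g (at (f x)) (frechet_derivative f (at x) v))"
 using diff_chain_at[OF assms[unfolded frechet_derivative_works]]
 by (intro frechet_derivative_eqI) (simp add: o_def)

text \<open>The mean value theorem is used twice: along \<open>v\<close> for the difference of
  \<open>f\<close> under the shift by \<open>s w\<close>, then along \<open>w\<close> for the
  derivative of \<open>f\<close> in direction \<open>v\<close>. The point found lies in the
  parallelogram, hence close to \<open>x\<close> when \<open>s\<close> is small.\<close>

lemma second_difference_mean_value:
 fixes f :: "'a::findim_normed_vector => real"
 assumes f: "smooth_on S f" and s: "s > 0"
  and S: "\<And>a b. 0 \<le> a ==> a \<le> s ==> 0 \<le> b ==> b \<le> s ==> x + a *\<^sub>R v + b *\<^sub>R w \<in> S"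
 shows "\<exists>\<sigma> \<tau>. 0 < \<sigma> \<and> \<sigma> < s \<and> 0 < \<tau> \<and> \<tau> < s \<and>
  f (x + s *\<^sub>R v + s *\<^sub>R w) - f (x + s *\<^sub>R v) - f (x + s *\<^sub>R w) + f x =
  s * s * frechet_derivative (%y. frechet_derivative f (at y) v) (at (x + \<sigma> *\<^sub>R v + \<tau> *\<^sub>R w)) w"
proof -
 have lin: "linear (frechet_derivative h (at y))" if "smooth_on S h" "y \<in> S" for h :: "'a => real" and y
  using that by (intro linear_frechet_derivative smooth_on_differentiable)
 have dv: "((%a. h (x + a *\<^sub>R v + b *\<^sub>R w)) has_real_derivative
   frechet_derivative h (at (x + a *\<^sub>R v + b *\<^sub>R w)) v) (at a)"
  if "smooth_on S h" "0 \<le> a" "a \<le> s" "0 \<le> b" "b \<le> s" for h a b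
 proof -
  have "((%a. x + a *\<^sub>R v + b *\<^sub>R w) has_derivative (%t. t *\<^sub>R v)) (at a)"
   by (auto intro!: derivative_eq_intros)
  from diff_chain_at[OF this smooth_on_has_derivative[OF that(1) S[OF that(2-5)]], unfolded o_def]
  show ?thesis unfolding has_field_derivative_def
   by (rule has_derivative_eq_rhs)
    (simp add: fun_eq_iff linear_scale[OF lin[OF that(1) S[OF that(2-5)]]])
 qed
 have dw: "((%b. h (x + a *\<^sub>R v + b *\<^sub>R w)) has_real_derivative
   frechet_derivative h (at (x + a *\<^sub>R v + b *\<^sub>R w)) w) (at b)"
  if "smooth_on S h" "0 \<le> a" "a \<le> s" "0 \<le> b" "b \<le> s" for h a b
 proof -
  have "((%b. x + a *\<^sub>R v + b *\<^sub>R w) has_derivative (%t. t *\<^sub>R w)) (at b)"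
   by (auto intro!: derivative_eq_intros)
  from diff_chain_at[OF this smooth_on_has_derivative[OF that(1) S[OF that(2-5)]], unfolded o_def]
  show ?thesis unfolding has_field_derivative_def
   by (rule has_derivative_eq_rhs)
    (simp add: fun_eq_iff linear_scale[OF lin[OF that(1) S[OF that(2-5)]]])
 qed
 have "\<exists>\<sigma>>0. \<sigma> < s \<and> (f (x + s *\<^sub>R v + s *\<^sub>R w) - f (x + s *\<^sub>R v + 0 *\<^sub>R w))
   - (f (x + 0 *\<^sub>R v + s *\<^sub>R w) - f (x + 0 *\<^sub>R v + 0 *\<^sub>R w)) =
  (s - 0) * (frechet_derivative f (at (x + \<sigma> *\<^sub>R v + s *\<^sub>R w)) v - frechet_derivative f (at (x + \<sigma> *\<^sub>R v + 0 *\<^sub>R w)) v)"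
 proof (rule MVT2[of 0 s "%a. f (x + a *\<^sub>R v + s *\<^sub>R w) - f (x + a *\<^sub>R v + 0 *\<^sub>R w)"])
  fix a assume "0 \<le> a" "a \<le> s"
  then show "((%a. f (x + a *\<^sub>R v + s *\<^sub>R w) - f (x + a *\<^sub>R v + 0 *\<^sub>R w)) has_real_derivative
   (frechet_derivative f (at (x + a *\<^sub>R v + s *\<^sub>R w)) v - frechet_derivative f (at (x + a *\<^sub>R v + 0 *\<^sub>R w)) v)) (at a)"
   using s by (intro DERIV_diff dv[OF f]) simp_all
 qed (rule s)
 then obtain \<sigma> where \<sigma>: "0 < \<sigma>" "\<sigma> < s" and e0: "(f (x + s *\<^sub>R v + s *\<^sub>R w) - f (x + s *\<^sub>R v + 0 *\<^sub>R w))
   - (f (x + 0 *\<^sub>R v + s *\<^sub>R w) - f (x + 0 *\<^sub>R v + 0 *\<^sub>R w)) =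
  (s - 0) * (frechet_derivative f (at (x + \<sigma> *\<^sub>R v + s *\<^sub>R w)) v - frechet_derivative f (at (x + \<sigma> *\<^sub>R v + 0 *\<^sub>R w)) v)"
  by blast
 have e1:
  "f (x + s *\<^sub>R v + s *\<^sub>R w) - f (x + s *\<^sub>R v) - f (x + s *\<^sub>R w) + f x =
   s * (frechet_derivative f (at (x + \<sigma> *\<^sub>R v + s *\<^sub>R w)) v - frechet_derivative f (at (x + \<sigma> *\<^sub>R v + 0 *\<^sub>R w)) v)"
  using e0 by simp
 have "\<exists>\<tau>>0. \<tau> < s \<and> frechet_derivative f (at (x + \<sigma> *\<^sub>R v + s *\<^sub>R w)) v - frechet_derivative f (at (x + \<sigma> *\<^sub>R v + 0 *\<^sub>R w)) v
  = (s - 0) * frechet_derivative (%y. frechet_derivative f (at y) v) (at (x + \<sigma> *\<^sub>R v + \<tau> *\<^sub>R w)) w"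
 proof (rule MVT2[of 0 s "%b. frechet_derivative f (at (x + \<sigma> *\<^sub>R v + b *\<^sub>R w)) v"])
  fix b assume "0 \<le> b" "b \<le> s"
  then show "((%b. frechet_derivative f (at (x + \<sigma> *\<^sub>R v + b *\<^sub>R w)) v) has_real_derivative
   frechet_derivative (%y. frechet_derivative f (at y) v) (at (x + \<sigma> *\<^sub>R v + b *\<^sub>R w)) w) (at b)"
   using \<sigma> by (intro dw[OF smooth_on_frechet_derivative[OF f, of v]]) simp_all
 qed (rule s)
 then obtain \<tau> where \<tau>: "0 < \<tau>" "\<tau> < s" "frechet_derivative f (at (x + \<sigma> *\<^sub>R v + s *\<^sub>R w)) v - frechet_derivative f (at (x + \<sigma> *\<^sub>R v + 0 *\<^sub>R w)) v
  = s * frechet_derivative (%y. frechet_derivative f (at y) v) (at (x + \<sigma> *\<^sub>R v + \<tau> *\<^sub>R w)) w" by auto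
 show ?thesis using \<sigma> \<tau>(1,2) e1[unfolded \<tau>(3)] unfolding mult.assoc by blast
qed

text \<open>The second difference is symmetric in \<open>v\<close> and \<open>w\<close>. Taken in
  both orders it gives the two mixed derivatives at points that tend to \<open>x\<close>, and
  continuity of the second derivatives carries the equality over to \<open>x\<close>.\<close>

lemma symmetric_second_derivative_real:
 fixes f :: "'a::findim_normed_vector => real"
 assumes "open S" "smooth_on S f" "x \<in> S"
 shows "frechet_derivative (%y. frechet_derivative f (at y) v) (at x) w =
     frechet_derivative (%y. frechet_derivative f (at y) w) (at x) v"
proof -
 obtain e where e: "e > 0" "ball x e \<subseteq> S" using assms(1,3) open_contains_ball by blast
 \<comment> \<open>Sized so that the parallelogram with sides \<open>d v\<close> and
   \<open>d w\<close> stays inside the ball of radius \<open>e\<close>; the summand 1 covers the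
   case that both vectors are zero.\<close>
 define d where "d = e / (norm v + norm w + 1)"
 have nv: "norm v + norm w + 1 > 0" by (simp add: add_nonneg_pos)
 have d: "d > 0" using e nv by (simp add: d_def)
 have inS: "x + a *\<^sub>R v + b *\<^sub>R w \<in> S" if "0 \<le> a" "a \<le> d" "0 \<le> b" "b \<le> d" for a b
 proof -
  have "norm (a *\<^sub>R v + b *\<^sub>R w) \<le> a * norm v + b * norm w"
   using that by (intro order_trans[OF norm_triangle_ineq]) auto
  also have "\<dots> \<le> d * norm v + d * norm w" using that by (intro add_mono mult_right_mono) auto
  also have "\<dots> < d * (norm v + norm w + 1)" using d by (simp add: algebra_simps)
  also have "\<dots> = e" using nv by (simp add: d_def)
  finally have "dist x (x + a *\<^sub>R v + b *\<^sub>R w) < e" by (simp add: dist_norm norm_minus_commute add.assoc add.commute[of "b *\<^sub>R w"])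
  then show ?thesis using e by auto
 qed
 define s where "s n = d / real (Suc n)" for n
 have s: "0 < s n" "s n \<le> d" for n using d by (auto simp: s_def divide_le_eq mult_le_cancel_left1)
 have s0: "s \<longlonglongrightarrow> 0" unfolding s_def
  using tendsto_mult[OF tendsto_const[of d] LIMSEQ_inverse_real_of_nat] by (simp add: divide_inverse)
 have A: "\<exists>\<sigma> \<tau>. 0 < \<sigma> \<and> \<sigma> < s n \<and> 0 < \<tau> \<and> \<tau> < s n \<and>
  f (x + s n *\<^sub>R v + s n *\<^sub>R w) - f (x + s n *\<^sub>R v) - f (x + s n *\<^sub>R w) + f x =
  s n * s n * frechet_derivative (%y. frechet_derivative f (at y) v) (at (x + \<sigma> *\<^sub>R v + \<tau> *\<^sub>R w)) w" for n
  by (rule second_difference_mean_value[OF assms(2) s(1)]) (use inS s(2)[of n] in auto)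
 have B: "\<exists>\<sigma> \<tau>. 0 < \<sigma> \<and> \<sigma> < s n \<and> 0 < \<tau> \<and> \<tau> < s n \<and>
  f (x + s n *\<^sub>R w + s n *\<^sub>R v) - f (x + s n *\<^sub>R w) - f (x + s n *\<^sub>R v) + f x =
  s n * s n * frechet_derivative (%y. frechet_derivative f (at y) w) (at (x + \<sigma> *\<^sub>R w + \<tau> *\<^sub>R v)) v" for n
 proof (rule second_difference_mean_value[OF assms(2) s(1)])
  fix a b assume "0 \<le> a" "a \<le> s n" "0 \<le> b" "b \<le> s n"
  then show "x + a *\<^sub>R w + b *\<^sub>R v \<in> S" using inS[of b a] s(2)[of n] by (simp add: ac_simps)
 qed
 obtain \<sigma> \<tau> where st: "\<And>n. 0 < \<sigma> n \<and> \<sigma> n < s n \<and> 0 < \<tau> n \<and> \<tau> n < s n \<and>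
  f (x + s n *\<^sub>R v + s n *\<^sub>R w) - f (x + s n *\<^sub>R v) - f (x + s n *\<^sub>R w) + f x =
  s n * s n * frechet_derivative (%y. frechet_derivative f (at y) v) (at (x + \<sigma> n *\<^sub>R v + \<tau> n *\<^sub>R w)) w"
  using A by metis
 obtain \<sigma>' \<tau>' where st': "\<And>n. 0 < \<sigma>' n \<and> \<sigma>' n < s n \<and> 0 < \<tau>' n \<and> \<tau>' n < s n \<and>
  f (x + s n *\<^sub>R w + s n *\<^sub>R v) - f (x + s n *\<^sub>R w) - f (x + s n *\<^sub>R v) + f x =
  s n * s n * frechet_derivative (%y. frechet_derivative f (at y) w) (at (x + \<sigma>' n *\<^sub>R w + \<tau>' n *\<^sub>R v)) v"
  using B by metis
 have to0: "r \<longlonglongrightarrow> 0" if "\<And>n. 0 < r n \<and> r n < s n" for r :: "nat => real"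
  by (rule tendsto_sandwich[OF _ _ tendsto_const s0]) (use that in \<open>auto intro!: always_eventually less_imp_le\<close>)
 have lim: "(%n. frechet_derivative (%y. frechet_derivative f (at y) a) (at (x + p n *\<^sub>R a + q n *\<^sub>R b)) b)
   \<longlonglongrightarrow> frechet_derivative (%y. frechet_derivative f (at y) a) (at x) b"
  if "p \<longlonglongrightarrow> 0" "q \<longlonglongrightarrow> 0" for p q :: "nat => real" and a b
 proof -
  have "continuous_on S (%z. frechet_derivative (%y. frechet_derivative f (at y) a) (at z) b)"
   by (intro smooth_on_continuous_on smooth_on_frechet_derivative assms)
  then have "isCont (%z. frechet_derivative (%y. frechet_derivative f (at y) a) (at z) b) x"
   using assms by (simp add: continuous_on_eq_continuous_at)
  moreover have "(%n. x + p n *\<^sub>R a + q n *\<^sub>R b) \<longlonglongrightarrow> x + 0 *\<^sub>R a + 0 *\<^sub>R b"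
   by (intro tendsto_intros that)
  ultimately show ?thesis
   using isCont_tendsto_compose[of x "%z. frechet_derivative (%y. frechet_derivative f (at y) a) (at z) b"] by simp
 qed
 have eq: "frechet_derivative (%y. frechet_derivative f (at y) v) (at (x + \<sigma> n *\<^sub>R v + \<tau> n *\<^sub>R w)) w =
   frechet_derivative (%y. frechet_derivative f (at y) w) (at (x + \<sigma>' n *\<^sub>R w + \<tau>' n *\<^sub>R v)) v" for n
 proof -
  have "f (x + s n *\<^sub>R w + s n *\<^sub>R v) = f (x + s n *\<^sub>R v + s n *\<^sub>R w)" by (simp add: ac_simps)
  then have "s n * s n * frechet_derivative (%y. frechet_derivative f (at y) v) (at (x + \<sigma> n *\<^sub>R v + \<tau> n *\<^sub>R w)) w =
   s n * s n * frechet_derivative (%y. frechet_derivative f (at y) w) (at (x + \<sigma>' n *\<^sub>R w + \<tau>' n *\<^sub>R v)) v"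
   using st[of n] st'[of n] by linarith
  moreover have "s n * s n \<noteq> 0" using s(1)[of n] by simp
  ultimately show ?thesis by (simp only: mult_cancel_left) blast
 qed
 have "(%n. frechet_derivative (%y. frechet_derivative f (at y) v) (at (x + \<sigma> n *\<^sub>R v + \<tau> n *\<^sub>R w)) w)
  \<longlonglongrightarrow> frechet_derivative (%y. frechet_derivative f (at y) v) (at x) w"
  by (rule lim) (use st in \<open>auto intro: to0\<close>)
 moreover have "(%n. frechet_derivative (%y. frechet_derivative f (at y) v) (at (x + \<sigma> n *\<^sub>R v + \<tau> n *\<^sub>R w)) w)
  \<longlonglongrightarrow> frechet_derivative (%y. frechet_derivative f (at y) w) (at x) v"
  unfolding eq by (rule lim) (use st' in \<open>auto intro: to0\<close>)
 ultimately show ?thesis by (rule LIMSEQ_unique)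
qed

lemma frechet_derivative_bounded_linear:
 assumes "bounded_linear L" "f differentiable (at x)"
 shows "frechet_derivative (%y. L (f y)) (at x) v = L (frechet_derivative f (at x) v)"
 by (rule fun_cong[OF frechet_derivative_eqI[OF bounded_linear.has_derivative[OF assms(1) assms(2)[unfolded frechet_derivative_works]]]])

lemma symmetric_second_derivative:
 fixes f :: "'a::findim_normed_vector => 'b::findim_normed_vector"
 assumes S: "open S" and f: "smooth_on S f" and x: "x \<in> S"
 shows "frechet_derivative (%y. frechet_derivative f (at y) v) (at x) w =
     frechet_derivative (%y. frechet_derivative f (at y) w) (at x) v"
proof -
 have c: "coord b (frechet_derivative (%y. frechet_derivative f (at y) v) (at x) w) =
  frechet_derivative (%y. frechet_derivative (%z. coord b (f z)) (at y) v) (at x) w" for b v w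
 proof -
  have "coord b (frechet_derivative (%y. frechet_derivative f (at y) v) (at x) w) =
   frechet_derivative (%y. coord b (frechet_derivative f (at y) v)) (at x) w"
   by (rule frechet_derivative_bounded_linear[symmetric, OF bounded_linear_coord])
    (rule smooth_on_differentiable[OF smooth_on_frechet_derivative[OF f] x])
  also have "frechet_derivative (%y. coord b (frechet_derivative f (at y) v)) (at x) =
   frechet_derivative (%y. frechet_derivative (%z. coord b (f z)) (at y) v) (at x)"
   by (rule frechet_derivative_cong_open[OF S x])
    (simp add: frechet_derivative_bounded_linear[OF bounded_linear_coord smooth_on_differentiable[OF f]])
  finally show ?thesis .
 qed
 have "coord b (frechet_derivative (%y. frechet_derivative f (at y) v) (at x) w) =
  coord b (frechet_derivative (%y. frechet_derivative f (at y) w) (at x) v)" for b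
  unfolding c
  by (rule symmetric_second_derivative_real[OF S _ x]) (rule smooth_on_bounded_linear[OF S bounded_linear_coord f])
 then have "(\<Sum>b\<in>cbasis. coord b (frechet_derivative (%y. frechet_derivative f (at y) v) (at x) w) *\<^sub>R b) =
  (\<Sum>b\<in>cbasis. coord b (frechet_derivative (%y. frechet_derivative f (at y) w) (at x) v) *\<^sub>R b)"
  by simp
 then show ?thesis unfolding coord_sum .
qed

section \<open>The exterior derivative in coordinates\<close>

text \<open>Cartan's formula for the constant vector field \<open>v\<close>, whose Lie derivative is
  the directional derivative of the coefficients.\<close>

lemma flat_d_Cons:
 "flat_d a x (v # vs) = frechet_derivative (%y. a y vs) (at x) v - flat_d (%y. v \<lrcorner> a y) x vs"
 unfolding flat_d_def
 by (simp add: sum.lessThan_Suc_shift contraction_def sum_negf del: sum.lessThan_Suc)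

lemma flat_d_Nil [simp]: "flat_d a x [] = 0"
 by (simp add: flat_d_def)

lemma flat_d_cong_open:
 assumes "open S" "x \<in> S" "\<And>y ws. y \<in> S ==> a y ws = c y ws"
 shows "flat_d a x vs = flat_d c x vs"
proof -
 have "frechet_derivative (%y. a y ws) (at x) = frechet_derivative (%y. c y ws) (at x)" for ws
  by (rule frechet_derivative_cong_open[OF assms(1,2)]) (rule assms(3))
 then show ?thesis by (simp add: flat_d_def)
qed

lemma frechet_derivative_plus:
 "f differentiable (at x) ==> g differentiable (at x) ==>
  frechet_derivative (%y. f y + g y) (at x) = (%v. frechet_derivative f (at x) v + frechet_derivative g (at x) v)"
 by (rule frechet_derivative_eqI) (auto simp: frechet_derivative_works intro: has_derivative_add)

lemma frechet_derivative_scale: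
 "f differentiable (at x) ==>
  frechet_derivative (%y. r *\<^sub>R f y) (at x) = (%v. r *\<^sub>R frechet_derivative f (at x) v)"
 by (rule frechet_derivative_eqI) (auto simp: frechet_derivative_works intro: has_derivative_scaleR_right)

lemma flat_d_add:
 assumes "\<And>ws. (%y. a y ws) differentiable (at x)" "\<And>ws. (%y. c y ws) differentiable (at x)"
 shows "flat_d (%y ws. a y ws + c y ws) x vs = flat_d a x vs + flat_d c x vs"
 unfolding flat_d_def
 by (simp add: frechet_derivative_plus assms scaleR_add_right sum.distrib)

text \<open>The derivative raises the degree by one, so reading the sign off the longer list costs
  one factor -1.\<close>

lemma flat_d_grade_sgn:
 assumes "\<And>ws. (%y. a y ws) differentiable (at x)"
 shows "flat_d (%y. grade_sgn (a y)) x = (%vs. - grade_sgn (flat_d a x) vs)"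
proof
 fix vs :: "'a list"
 show "flat_d (%y. grade_sgn (a y)) x vs = - grade_sgn (flat_d a x) vs"
 proof (cases vs)
  case (Cons v ws)
  have len: "(-1::real) ^ length (take i vs @ drop (Suc i) vs) = - ((-1) ^ length vs)" if "i < length vs" for i
   using that Cons by (simp add: min_def)
  have D: "frechet_derivative (%y. (-1::real) ^ length (take i vs @ drop (Suc i) vs) *\<^sub>R a y ws) (at x) w =
   (- ((-1) ^ length vs)) *\<^sub>R frechet_derivative (%y. a y ws) (at x) w" if "i < length vs" for i w ws
   unfolding len[OF that] frechet_derivative_scale[OF assms] ..
  have "flat_d (%y. grade_sgn (a y)) x vs = (\<Sum>i<length vs. (-1) ^ i *\<^sub>R
   (- ((-1) ^ length vs)) *\<^sub>R frechet_derivative (%y. a y (take i vs @ drop (Suc i) vs)) (at x) (vs ! i))"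
   unfolding flat_d_def grade_sgn_def by (intro sum.cong refl arg_cong[where f = "%z. _ *\<^sub>R z"] D) simp
  then show ?thesis
   unfolding flat_d_def grade_sgn_def by (simp add: scaleR_sum_right sum_negf mult.commute)
 qed (simp add: grade_sgn_def)
qed

lemma bounded_bilinear_imp_bilinear: "bounded_bilinear b ==> bilinear b"
 unfolding bilinear_def
 by (metis bounded_bilinear.bounded_linear_left bounded_bilinear.bounded_linear_right bounded_linear.linear)

lemma wedge_with_has_derivative:
 fixes a :: "'a::real_normed_vector => 'e list => 'u::real_normed_vector"
  and c :: "'a => 'e list => 'v::real_normed_vector"
  and b :: "'u => 'v => 'w::real_normed_vector"
 assumes b: "bounded_bilinear b"
  and "\<And>ws. (%y. a y ws) differentiable (at x)" "\<And>ws. (%y. c y ws) differentiable (at x)"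
 shows "((%y. wedge_with b (a y) (c y) ws) has_derivative
  (%v. wedge_with b (%ws. frechet_derivative (%y. a y ws) (at x) v) (c x) ws +
     wedge_with b (a x) (%ws. frechet_derivative (%y. c y ws) (at x) v) ws)) (at x)"
proof -
 note D = bounded_bilinear.FDERIV[OF b assms(2)[unfolded frechet_derivative_works] assms(3)[unfolded frechet_derivative_works]]
 show ?thesis unfolding wedge_with_def
  by (rule has_derivative_eq_rhs[OF has_derivative_sum[OF has_derivative_scaleR_right[OF D]]])
   (simp add: fun_eq_iff scaleR_add_right sum.distrib add.commute)
qed

text \<open>The Leibniz rule compares the recursions of \<open>flat_d\<close> and of the wedge
  product in the first argument. Contraction and derivative each change a sign when they pass
  \<open>grade_sgn\<close>, and these signs make the terms of the two recursions match.\<close>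

lemma flat_d_wedge_with:
 fixes a :: "'a::real_normed_vector => 'a list => 'u::real_normed_vector"
  and c :: "'a => 'a list => 'v::real_normed_vector"
  and b :: "'u => 'v => 'w::real_normed_vector"
 assumes b: "bounded_bilinear b"
  and "\<And>ws. (%y. a y ws) differentiable (at x)" "\<And>ws. (%y. c y ws) differentiable (at x)"
 shows "flat_d (%y. wedge_with b (a y) (c y)) x vs =
   wedge_with b (flat_d a x) (c x) vs + wedge_with b (grade_sgn (a x)) (flat_d c x) vs"
proof -
 note bl = bounded_bilinear_imp_bilinear[OF b]
 show ?thesis using assms(2,3)
 proof (induction vs arbitrary: a c)
  case Nil
  then show ?case by (simp add: bilinear_lzero[OF bl] bilinear_rzero[OF bl])
 next
  case (Cons v vs)
  note d = Cons.prems
  have dc: "\<And>ws. (%y. (v \<lrcorner> a y) ws) differentiable (at x)" "\<And>ws. (%y. (v \<lrcorner> c y) ws) differentiable (at x)"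
   using d by (simp_all add: contraction_def)
  have ds: "\<And>ws. (%y. grade_sgn (a y) ws) differentiable (at x)"
   unfolding grade_sgn_def using has_derivative_scaleR_right[OF d(1)[unfolded frechet_derivative_works]]
   unfolding differentiable_def by blast
  have w: "(%y. wedge_with b (f y) (g y) ws) differentiable (at x)"
   if "\<And>ws. (%y. f y ws) differentiable (at x)" "\<And>ws. (%y. g y ws) differentiable (at x)" for f g ws
   using wedge_with_has_derivative[of b f x g ws, OF b that] unfolding differentiable_def by blast
  have "flat_d (%y. wedge_with b (a y) (c y)) x (v # vs) =
   wedge_with b (%ws. frechet_derivative (%y. a y ws) (at x) v) (c x) vs +
   wedge_with b (a x) (%ws. frechet_derivative (%y. c y ws) (at x) v) vs -
   flat_d (%y vs. wedge_with b (v \<lrcorner> a y) (c y) vs + wedge_with b (grade_sgn (a y)) (v \<lrcorner> c y) vs) x vs"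
   unfolding flat_d_Cons contraction_wedge_with[OF bl]
    frechet_derivative_eqI[OF wedge_with_has_derivative[OF b d]] ..
  also have "flat_d (%y vs. wedge_with b (v \<lrcorner> a y) (c y) vs + wedge_with b (grade_sgn (a y)) (v \<lrcorner> c y) vs) x vs =
   flat_d (%y. wedge_with b (v \<lrcorner> a y) (c y)) x vs + flat_d (%y. wedge_with b (grade_sgn (a y)) (v \<lrcorner> c y)) x vs"
   by (rule flat_d_add[OF w[OF dc(1) d(2)] w[OF ds dc(2)]])
  also have "flat_d (%y. wedge_with b (v \<lrcorner> a y) (c y)) x vs =
   wedge_with b (flat_d (%y. v \<lrcorner> a y) x) (c x) vs - wedge_with b (v \<lrcorner> grade_sgn (a x)) (flat_d c x) vs"
   unfolding Cons.IH[OF dc(1) d(2)] contraction_grade_sgn by (simp add: wedge_with_minus_left[OF bl])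
  also have "flat_d (%y. wedge_with b (grade_sgn (a y)) (v \<lrcorner> c y)) x vs =
   - wedge_with b (grade_sgn (flat_d a x)) (v \<lrcorner> c x) vs + wedge_with b (a x) (flat_d (%y. v \<lrcorner> c y) x) vs"
   unfolding Cons.IH[OF ds dc(2)] flat_d_grade_sgn[OF d(1)] by (simp add: wedge_with_minus_left[OF bl])
  finally have L: "flat_d (%y. wedge_with b (a y) (c y)) x (v # vs) =
   wedge_with b (%ws. frechet_derivative (%y. a y ws) (at x) v) (c x) vs +
   wedge_with b (a x) (%ws. frechet_derivative (%y. c y ws) (at x) v) vs -
   (wedge_with b (flat_d (%y. v \<lrcorner> a y) x) (c x) vs - wedge_with b (v \<lrcorner> grade_sgn (a x)) (flat_d c x) vs +
    (- wedge_with b (grade_sgn (flat_d a x)) (v \<lrcorner> c x) vs + wedge_with b (a x) (flat_d (%y. v \<lrcorner> c y) x) vs))" .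
  have f: "v \<lrcorner> flat_d f x = (%vs. frechet_derivative (%y. f y vs) (at x) v - flat_d (%y. v \<lrcorner> f y) x vs)"
   for f :: "'a => 'a list => 'z::real_normed_vector"
   by (simp add: contraction_def fun_eq_iff flat_d_Cons)
  show ?case unfolding L wedge_with_Cons[OF bl] f grade_sgn_grade_sgn
   by (simp add: wedge_with_diff_left[OF bl] wedge_with_diff_right[OF bl])
 qed
qed

section \<open>Smooth families of forms and their pullback\<close>

definition smooth_flat_form :: "'a::findim_normed_vector set => nat => ('a => 'a list => 'v::real_normed_vector) => bool" where
 "smooth_flat_form S k a \<longleftrightarrow> (\<forall>x\<in>S. alt_form k (a x)) \<and> (\<forall>ws. smooth_on S (%x. a x ws))"

lemma multilin_expand:
 fixes a :: "'a::findim_normed_vector list => 'v::real_vector"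
 assumes "alt_form k a"
 shows "a (us @ v # ws) = (\<Sum>b\<in>cbasis. coord b v *\<^sub>R a (us @ b # ws))"
proof -
 have "linear (%v. a (us @ v # ws))" using assms by (simp add: alt_form_iff multilin_def)
 then show ?thesis by (rule linear_coord_expand)
qed

text \<open>Arguments that depend on \<open>x\<close> are expanded in coordinates one after the
  other; the prefix \<open>us\<close> collects the constant basis vectors that have replaced
  them.\<close>

lemma smooth_on_form_apply:
 assumes S: "open S" "open T" "F ` S \<subseteq> T" and a: "smooth_flat_form T k a"
  and F: "smooth_on S F" and w: "\<And>w. w \<in> set wfs ==> smooth_on S w"
 shows "smooth_on S (%x. a (F x) (us @ map (%w. w x) wfs))"
 using w
proof (induction wfs arbitrary: us)
 case Nil
 have "smooth_on T (%y. a y us)" using a by (simp add: smooth_flat_form_def)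
 from smooth_on_compose[OF S this F] show ?case by simp
next
 case (Cons w wfs)
 have "smooth_on S (%x. \<Sum>b\<in>cbasis. coord b (w x) *\<^sub>R a (F x) (us @ b # map (%w. w x) wfs))"
 proof (rule smooth_on_sum[OF S(1)], rule smooth_on_scaleR[OF S(1)])
  fix b
  show "smooth_on S (%x. coord b (w x))"
   by (rule smooth_on_bounded_linear[OF S(1) bounded_linear_coord]) (simp add: Cons.prems)
  show "smooth_on S (%x. a (F x) (us @ b # map (%w. w x) wfs))"
   using Cons.IH[of "us @ [b]"] Cons.prems by simp
 qed
 then show ?case
 proof (rule smooth_on_cong[OF S(1)])
  fix x assume "x \<in> S"
  then have "alt_form k (a (F x))" using a S(3) by (auto simp: smooth_flat_form_def)
  from multilin_expand[OF this, symmetric]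
  show "(\<Sum>b\<in>cbasis. coord b (w x) *\<^sub>R a (F x) (us @ b # map (%w. w x) wfs)) =
   a (F x) (us @ map (%w. w x) (w # wfs))" by simp
 qed
qed

text \<open>A product rule for a form whose base point and arguments all move: one term
  differentiates the coefficients along \<open>F\<close>, each of the others replaces one argument
  by its derivative. As before, moving arguments are traded for constant basis vectors in
  \<open>us\<close>.\<close>

lemma form_apply_has_derivative:
 assumes S: "open S" "open T" "F ` S \<subseteq> T" and a: "smooth_flat_form T k a" and x: "x \<in> S"
  and F: "(F has_derivative F') (at x)" and w: "\<And>w. w \<in> set wfs ==> w differentiable (at x)"
 shows "((%y. a (F y) (us @ map (%w. w y) wfs)) has_derivative
  (%h. frechet_derivative (%z. a z (us @ map (%w. w x) wfs)) (at (F x)) (F' h) +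
   (\<Sum>j<length wfs. a (F x) (us @ (map (%w. w x) wfs)[j := frechet_derivative (wfs ! j) (at x) h])))) (at x)"
 using w
proof (induction wfs arbitrary: us)
 case Nil
 have "(%y. a y us) differentiable (at (F x))"
  using a x S smooth_on_differentiable[of T "%y. a y us" "F x"] by (auto simp: smooth_flat_form_def)
 from diff_chain_at[OF F this[unfolded frechet_derivative_works]] show ?case by (simp add: o_def)
next
 case (Cons w wfs)
 have alt: "alt_form k (a z)" if "z \<in> T" for z using a that by (auto simp: smooth_flat_form_def)
 have FT: "F x \<in> T" using S x by blast
 have dz: "((%z. a z ws) has_derivative frechet_derivative (%z. a z ws) (at (F x))) (at (F x))" for ws
  using a FT by (auto simp: smooth_flat_form_def intro: smooth_on_has_derivative)
 let ?R = "%y. map (%w. w y) wfs"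
 let ?w' = "frechet_derivative w (at x)"
 have w': "(w has_derivative ?w') (at x)" using Cons.prems[of w] by (simp add: frechet_derivative_works)
 have cw: "((%y. coord b (w y)) has_derivative (%h. coord b (?w' h))) (at x)" for b
  by (rule bounded_linear.has_derivative[OF bounded_linear_coord w'])
 have IH: "((%y. a (F y) (us @ b # ?R y)) has_derivative
  (%h. frechet_derivative (%z. a z (us @ b # ?R x)) (at (F x)) (F' h) +
   (\<Sum>j<length wfs. a (F x) (us @ b # (?R x)[j := frechet_derivative (wfs ! j) (at x) h])))) (at x)" for b
  using Cons.IH[of "us @ [b]"] Cons.prems by simp
 have D: "((%y. \<Sum>b\<in>cbasis. coord b (w y) *\<^sub>R a (F y) (us @ b # ?R y)) has_derivative
  (%h. \<Sum>b\<in>cbasis. coord b (w x) *\<^sub>R (frechet_derivative (%z. a z (us @ b # ?R x)) (at (F x)) (F' h) +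
   (\<Sum>j<length wfs. a (F x) (us @ b # (?R x)[j := frechet_derivative (wfs ! j) (at x) h]))) +
   coord b (?w' h) *\<^sub>R a (F x) (us @ b # ?R x))) (at x)"
  by (rule has_derivative_sum) (rule has_derivative_scaleR[OF cw IH])
 have fz: "frechet_derivative (%z. a z (us @ w x # ?R x)) (at (F x)) =
  (%v. \<Sum>b\<in>cbasis. coord b (w x) *\<^sub>R frechet_derivative (%z. a z (us @ b # ?R x)) (at (F x)) v)"
 proof -
  have "((%z. \<Sum>b\<in>cbasis. coord b (w x) *\<^sub>R a z (us @ b # ?R x)) has_derivative
   (%v. \<Sum>b\<in>cbasis. coord b (w x) *\<^sub>R frechet_derivative (%z. a z (us @ b # ?R x)) (at (F x)) v)) (at (F x))"
   by (intro has_derivative_sum has_derivative_scaleR_right dz)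
  then have "((%z. a z (us @ w x # ?R x)) has_derivative
   (%v. \<Sum>b\<in>cbasis. coord b (w x) *\<^sub>R frechet_derivative (%z. a z (us @ b # ?R x)) (at (F x)) v)) (at (F x))"
   by (rule has_derivative_transform_within_open[OF _ S(2) FT]) (rule multilin_expand[OF alt, symmetric])
  then show ?thesis by (rule frechet_derivative_eqI)
 qed
 have eq: "(\<Sum>b\<in>cbasis. coord b (w x) *\<^sub>R (frechet_derivative (%z. a z (us @ b # ?R x)) (at (F x)) (F' h) +
   (\<Sum>j<length wfs. a (F x) (us @ b # (?R x)[j := frechet_derivative (wfs ! j) (at x) h]))) +
   coord b (?w' h) *\<^sub>R a (F x) (us @ b # ?R x)) =
   frechet_derivative (%z. a z (us @ w x # ?R x)) (at (F x)) (F' h) +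
   (a (F x) (us @ ?w' h # ?R x) +
   (\<Sum>j<length wfs. a (F x) (us @ w x # (?R x)[j := frechet_derivative (wfs ! j) (at x) h])))" for h
 proof -
  have "(\<Sum>b\<in>cbasis. coord b (w x) *\<^sub>R (\<Sum>j<length wfs. a (F x) (us @ b # (?R x)[j := frechet_derivative (wfs ! j) (at x) h])))
   = (\<Sum>j<length wfs. a (F x) (us @ w x # (?R x)[j := frechet_derivative (wfs ! j) (at x) h]))"
   unfolding multilin_expand[OF alt[OF FT], of us "w x"] scaleR_sum_right by (rule sum.swap)
  then show ?thesis unfolding fz multilin_expand[OF alt[OF FT], of us "?w' h"]
   by (simp add: scaleR_add_right sum.distrib)
 qed
 have "((%y. a (F y) (us @ w y # ?R y)) has_derivative
  (%h. frechet_derivative (%z. a z (us @ w x # ?R x)) (at (F x)) (F' h) +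
   (a (F x) (us @ ?w' h # ?R x) +
   (\<Sum>j<length wfs. a (F x) (us @ w x # (?R x)[j := frechet_derivative (wfs ! j) (at x) h]))))) (at x)"
  using D unfolding eq
 proof (rule has_derivative_transform_within_open[OF _ S(1) x])
  fix y assume "y \<in> S"
  then have "F y \<in> T" using S by blast
  from multilin_expand[OF alt[OF this], symmetric]
  show "(\<Sum>b\<in>cbasis. coord b (w y) *\<^sub>R a (F y) (us @ b # ?R y)) = a (F y) (us @ w y # ?R y)" .
 qed
 then show ?case by (simp add: sum.lessThan_Suc_shift del: sum.lessThan_Suc)
qed

text \<open>The second derivatives of \<open>F\<close> that appear in \<open>d(F\<^sup>* a)\<close> cancel in pairs.\<close>

lemma alternating_symmetric_cancel:
 assumes a: "multilin a" "adj_alt a" and H: "\<And>u v. H u v = H v u" and n: "n = length vs"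
 shows "(\<Sum>i<n. (-1) ^ i *\<^sub>R (\<Sum>j<n - 1. a ((map L (take i vs @ drop (Suc i) vs))
      [j := H (vs ! i) ((take i vs @ drop (Suc i) vs) ! j)]))) = (0::'v::real_vector)"
proof -
 define r where "r i = take i vs @ drop (Suc i) vs" for i
 define t where "t i j = (-1) ^ i *\<^sub>R a ((map L (r i))[j := H (vs ! i) (r i ! j)])" for i j
 \<comment> \<open>Deleting entry \<open>i\<close> and putting the second derivative into slot
   \<open>j < i\<close> gives the same entries as deleting \<open>j\<close> and putting it into slot
   \<open>i - 1\<close>; the index drops by one because an earlier entry is gone. The inserted
   vector only has to be moved across the entries in between.\<close>
 have pair: "t i j = - t j (i - 1)" if "j < i" "i < n" for i j
 proof -
  define A where "A = take j vs"
  define M where "M = take (i - j - 1) (drop (Suc j) vs)"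
  define C where "C = drop (Suc i) vs"
  have lA: "length A = j" and lM: "length M = i - j - 1" using that n by (simp_all add: A_def M_def)
  have "drop (Suc j) vs = M @ drop (i - j - 1) (drop (Suc j) vs)" unfolding M_def by (simp only: append_take_drop_id)
  also have "drop (i - j - 1) (drop (Suc j) vs) = drop i vs" using that by simp
  also have "drop i vs = vs ! i # C" unfolding C_def using that n by (simp add: Cons_nth_drop_Suc)
  finally have dj: "drop (Suc j) vs = M @ vs ! i # C" .
  have vs: "vs = A @ vs ! j # M @ vs ! i # C"
   unfolding dj[symmetric] A_def using that n by (simp add: id_take_nth_drop[symmetric])
  have ti: "take i vs = A @ vs ! j # M"
  proof -
   have "take i vs = take (length (A @ vs ! j # M)) vs" using lA lM that by simp
   also have "\<dots> = A @ vs ! j # M" by (subst (2) vs) simp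
   finally show ?thesis .
  qed
  have ri: "r i = A @ vs ! j # M @ C" unfolding r_def ti C_def by simp
  have rj: "r j = A @ M @ vs ! i # C" unfolding r_def dj A_def ..
  have 1: "(map L (r i))[j := H (vs ! i) (r i ! j)] = map L A @ H (vs ! i) (vs ! j) # map L M @ map L C"
   unfolding ri using lA by (simp add: nth_append list_update_append)
  have 2: "(map L (r j))[i - 1 := H (vs ! j) (r j ! (i - 1))] = map L A @ map L M @ H (vs ! i) (vs ! j) # map L C"
  proof -
   have "i - 1 = length (A @ M)" using lA lM that by simp
   then show ?thesis unfolding rj H[of "vs ! i"]
    using nth_append_length[of "A @ M" "vs ! i" C] list_update_length[of "map L A @ map L M" "L (vs ! i)" "map L C"]
    by simp
  qed
  have "t i j = (-1) ^ i *\<^sub>R (-1) ^ length (map L M) *\<^sub>R a (map L A @ map L M @ H (vs ! i) (vs ! j) # map L C)"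
   unfolding t_def 1 adj_alt_move[OF a] ..
  also have "(-1::real) ^ i = - ((-1) ^ j * (-1) ^ length (map L M))"
  proof -
   have "i = Suc (j + length (map L M))" using lM that by simp
   then have "(-1::real) ^ i = (-1) ^ Suc (j + length (map L M))" by (rule arg_cong)
   then show ?thesis by (simp add: power_add)
  qed
  also have "(- ((-1) ^ j * (-1) ^ length (map L M))) *\<^sub>R (-1) ^ length (map L M) *\<^sub>R a (map L A @ map L M @ H (vs ! i) (vs ! j) # map L C)
   = - t j (i - 1)"
   unfolding t_def 2 by (simp add: mult.assoc)
  finally show ?thesis .
 qed
 let ?P = "SIGMA i:{..<n}. {..<n - 1}"
 let ?L = "{(i, j). j < i \<and> i < n}" and ?U = "{(i, j). i \<le> j \<and> j < n - 1}"
 have P: "?P = ?L \<union> ?U" by auto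
 have fin: "finite ?L" "finite ?U"
  by (rule finite_subset[of _ "{..<n} \<times> {..<n}"]; auto)+
 have "(\<Sum>i<n. (-1) ^ i *\<^sub>R (\<Sum>j<n - 1. a ((map L (r i))[j := H (vs ! i) (r i ! j)]))) = (\<Sum>(i, j)\<in>?P. t i j)"
  by (simp add: t_def scaleR_sum_right sum.Sigma)
 also have "\<dots> = (\<Sum>(i, j)\<in>?L. t i j) + (\<Sum>(i, j)\<in>?U. t i j)"
  unfolding P by (rule sum.union_disjoint[OF fin]) auto
 also have "(\<Sum>(i, j)\<in>?U. t i j) = (\<Sum>(i, j)\<in>?L. t j (i - 1))"
  by (rule sum.reindex_bij_witness[of _ "%(i, j). (j, i - 1)" "%(i, j). (j + 1, i)"]) auto
 also have "(\<Sum>(i, j)\<in>?L. t i j) = (\<Sum>(i, j)\<in>?L. - t j (i - 1))"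
  by (rule sum.cong) (auto simp: pair)
 also have "\<dots> + (\<Sum>(i, j)\<in>?L. t j (i - 1)) = 0"
  unfolding sum.distrib[symmetric] by (rule sum.neutral) auto
 finally show ?thesis unfolding r_def .
qed

lemma flat_d_pullback:
 fixes F :: "'a::findim_normed_vector => 'b::findim_normed_vector"
 assumes S: "open S" "open T" "F ` S \<subseteq> T" and a: "smooth_flat_form T k a" and x: "x \<in> S"
  and F: "smooth_on S F"
 shows "flat_d (%y ws. a (F y) (map (frechet_derivative F (at y)) ws)) x vs =
  flat_d a (F x) (map (frechet_derivative F (at x)) vs)"
proof -
 let ?L = "frechet_derivative F (at x)"
 define H where "H h u = frechet_derivative (%y. frechet_derivative F (at y) u) (at x) h" for h u
 define r where "r i = take i vs @ drop (Suc i) vs" for i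
 have FT: "F x \<in> T" using S x by blast
 have alt: "alt_form k (a (F x))" using a FT by (auto simp: smooth_flat_form_def)
 have D: "frechet_derivative (%y. a (F y) (map (frechet_derivative F (at y)) us)) (at x) h =
  frechet_derivative (%z. a z (map ?L us)) (at (F x)) (?L h) +
  (\<Sum>j<length us. a (F x) ((map ?L us)[j := H h (us ! j)]))" for us h
 proof -
  let ?wfs = "map (%u y. frechet_derivative F (at y) u) us"
  have m: "map (%w. w y) ?wfs = map (frechet_derivative F (at y)) us" for y by simp
  have "\<And>w. w \<in> set ?wfs ==> w differentiable (at x)"
   using smooth_on_differentiable[OF smooth_on_frechet_derivative[OF F] x] by auto
  from form_apply_has_derivative[where wfs = ?wfs and us = "[]", OF S a x smooth_on_has_derivative[OF F x] this, unfolded m append_Nil]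
  have "frechet_derivative (%y. a (F y) (map (frechet_derivative F (at y)) us)) (at x) h =
   frechet_derivative (%z. a z (map ?L us)) (at (F x)) (?L h) +
   (\<Sum>j<length ?wfs. a (F x) ((map ?L us)[j := frechet_derivative (?wfs ! j) (at x) h]))"
   by (rule fun_cong[OF frechet_derivative_eqI])
  then show ?thesis by (simp add: H_def)
 qed
 have "H u v = H v u" for u v
  unfolding H_def by (rule symmetric_second_derivative[OF S(1) F x])
 then have z: "(\<Sum>i<length vs. (-1) ^ i *\<^sub>R (\<Sum>j<length vs - 1. a (F x) ((map ?L (r i))[j := H (vs ! i) (r i ! j)]))) = 0"
  unfolding r_def using alternating_symmetric_cancel[of "a (F x)" H "length vs" vs ?L] alt by (simp add: alt_form_iff)
 have "flat_d (%y ws. a (F y) (map (frechet_derivative F (at y)) ws)) x vs =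
  (\<Sum>i<length vs. (-1) ^ i *\<^sub>R (frechet_derivative (%z. a z (map ?L (r i))) (at (F x)) (?L (vs ! i)) +
  (\<Sum>j<length vs - 1. a (F x) ((map ?L (r i))[j := H (vs ! i) (r i ! j)]))))"
  unfolding flat_d_def D r_def[symmetric] by (intro sum.cong refl) (simp add: r_def min_def)
 also have "\<dots> = (\<Sum>i<length vs. (-1) ^ i *\<^sub>R frechet_derivative (%z. a z (map ?L (r i))) (at (F x)) (?L (vs ! i)))"
  unfolding scaleR_add_right sum.distrib z by simp
 also have "\<dots> = flat_d a (F x) (map ?L vs)"
  unfolding flat_d_def r_def by (intro sum.cong) (simp_all add: take_map drop_map)
 finally show ?thesis .
qed

text \<open>The six mixed second derivatives of the coefficients cancel in pairs by symmetry. Degree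
  1 is the case of a connection form on the circle bundle.\<close>

lemma flat_d_flat_d_1form:
 fixes a :: "'a::findim_normed_vector => 'a list => 'v::findim_normed_vector"
 assumes S: "open S" and a: "smooth_flat_form S 1 a" and x: "x \<in> S"
 shows "flat_d (flat_d a) x vs = 0"
proof -
 have sm: "smooth_on S (%y. a y ws)" for ws using a by (simp add: smooth_flat_form_def)
 define D where "D u w y = frechet_derivative (%z. a z [u]) (at y) w" for u w y
 define D2 where "D2 u w h = frechet_derivative (D u w) (at x) h" for u w h
 have sD: "smooth_on S (D u w)" for u w unfolding D_def by (rule smooth_on_frechet_derivative[OF sm])
 have sym: "D2 u w h = D2 u h w" for u w h
  unfolding D2_def D_def by (rule symmetric_second_derivative[OF S sm x])
 have d2: "flat_d a y [u, v] = D v u y - D u v y" for u v y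
  by (simp add: flat_d_Cons D_def contraction_def)
 have dn: "flat_d a y ws = 0" if "y \<in> S" "length ws \<noteq> 2" for y ws
 proof -
  have "frechet_derivative (%z. a z (take i ws @ drop (Suc i) ws)) (at y) h = 0" if "i < length ws" for i h
  proof -
   have "length (take i ws @ drop (Suc i) ws) \<noteq> 1" using that \<open>length ws \<noteq> 2\<close> by auto
   then have "a z (take i ws @ drop (Suc i) ws) = 0" if "z \<in> S" for z
    using a that by (auto simp: smooth_flat_form_def alt_form_def)
   from frechet_derivative_cong_open[OF S \<open>y \<in> S\<close>, of "%z. a z (take i ws @ drop (Suc i) ws)" "%z. 0", OF this]
   show ?thesis by simp
  qed
  then show ?thesis by (simp add: flat_d_def)
 qed
 show ?thesis
 proof (cases "length vs = 3")
  case True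
  then obtain u v w where vs: "vs = [u, v, w]"
   by (auto simp: numeral_3_eq_3 length_Suc_conv)
  have e: "frechet_derivative (%y. flat_d a y [p, q]) (at x) h = D2 q p h - D2 p q h" for p q h
   unfolding d2 D2_def
   by (rule fun_cong[OF frechet_derivative_eqI[OF has_derivative_diff[OF smooth_on_has_derivative[OF sD x] smooth_on_has_derivative[OF sD x]]]])
  have "flat_d (flat_d a) x vs = (D2 w v u - D2 v w u) - ((D2 w u v - D2 u w v) - (D2 v u w - D2 u v w))"
   by (simp only: vs flat_d_Cons[where a = "flat_d a"] flat_d_Cons[where a = "%y. u \<lrcorner> flat_d a y"]
    flat_d_Cons[where a = "%y. v \<lrcorner> u \<lrcorner> flat_d a y"] contraction_apply e flat_d_Nil) simp
  also have "\<dots> = 0" by (simp add: sym[of w v u] sym[of v w u] sym[of u w v])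
  finally show ?thesis .
 next
  case False
  have "frechet_derivative (%z. flat_d a z (take i vs @ drop (Suc i) vs)) (at x) h = 0" if "i < length vs" for i h
  proof -
   have "length (take i vs @ drop (Suc i) vs) \<noteq> 2" using that False by auto
   from frechet_derivative_cong_open[OF S x, of "%z. flat_d a z (take i vs @ drop (Suc i) vs)" "%z. 0", OF dn[OF _ this]]
   show ?thesis by simp
  qed
  then show ?thesis by (simp add: flat_d_def[of "flat_d a"])
 qed
qed

section \<open>Atlases and smooth maps\<close>

text \<open>The chart conditions of \<open>smooth_manifold\<close> without the Hausdorff property
  and second countability. All calculus rests on this part alone, so it can be used on products and
  fibre products before their topology has been examined.\<close>

definition mfd_atlas :: "('m, 'e::findim_normed_vector) mfd => bool" where
 "mfd_atlas M \<longleftrightarrow>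
   (\<forall>p\<in>points M. p \<in> chart_dom M p \<and> chart_dom M p \<subseteq> points M \<and>
    inj_on (chart M p) (chart_dom M p) \<and> open (chart_img M p)) \<and>
   (\<forall>p\<in>points M. \<forall>q\<in>points M.
    open (chart M p ` (chart_dom M p \<inter> chart_dom M q)) \<and>
    smooth_on (chart M p ` (chart_dom M p \<inter> chart_dom M q)) (chart M q \<circ> param M p))"

lemma smooth_manifold_iff: "smooth_manifold M \<longleftrightarrow>
  mfd_atlas M \<and> Hausdorff_space (mfd_topology M) \<and> second_countable (mfd_topology M)"
 by (simp add: smooth_manifold_def mfd_atlas_def)

lemma smooth_manifold_atlas: "smooth_manifold M ==> mfd_atlas M"
 by (simp add: smooth_manifold_iff)

context
 fixes M :: "('m, 'e::findim_normed_vector) mfd"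
 assumes M: "mfd_atlas M"

begin

lemma atlas_dom: "p \<in> points M ==> p \<in> chart_dom M p"
 and atlas_dom_points: "p \<in> points M ==> x \<in> chart_dom M p ==> x \<in> points M"
 and atlas_inj: "p \<in> points M ==> inj_on (chart M p) (chart_dom M p)"
 and atlas_open: "p \<in> points M ==> open (chart_img M p)"
 and atlas_open_overlap: "p \<in> points M ==> q \<in> points M ==> open (chart M p ` (chart_dom M p \<inter> chart_dom M q))"
 and atlas_smooth: "p \<in> points M ==> q \<in> points M ==>
   smooth_on (chart M p ` (chart_dom M p \<inter> chart_dom M q)) (chart M q \<circ> param M p)"
 using M unfolding mfd_atlas_def by blast+

lemma param_chart: "p \<in> points M ==> x \<in> chart_dom M p ==> param M p (chart M p x) = x"
 unfolding param_def using atlas_inj by (rule inv_into_f_f)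

lemma chart_param: "y \<in> chart_img M p ==> chart M p (param M p y) = y"
 unfolding param_def chart_img_def by (rule f_inv_into_f)

lemma param_dom: "y \<in> chart_img M p ==> param M p y \<in> chart_dom M p"
 unfolding param_def chart_img_def by (rule inv_into_into)

lemma param_points: "p \<in> points M ==> y \<in> chart_img M p ==> param M p y \<in> points M"
 using param_dom atlas_dom_points by blast

lemma chart_in_img: "x \<in> chart_dom M p ==> chart M p x \<in> chart_img M p"
 unfolding chart_img_def by (rule imageI)

lemma chart_center_img: "p \<in> points M ==> chart M p p \<in> chart_img M p"
 using chart_in_img atlas_dom by blast

lemma param_center: "p \<in> points M ==> param M p (chart M p p) = p"
 using param_chart atlas_dom by blast

text \<open>The predicate inside \<open>mfd_topology\<close> must be a topology before
  \<open>topology\<close> can be inverted; intersections are preserved because charts are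
  injective.\<close>

lemma openin_mfd_topology:
 "openin (mfd_topology M) U \<longleftrightarrow> U \<subseteq> points M \<and> (\<forall>p\<in>points M. open (chart M p ` (U \<inter> chart_dom M p)))"
proof -
 have "istopology (%U. U \<subseteq> points M \<and> (\<forall>p\<in>points M. open (chart M p ` (U \<inter> chart_dom M p))))"
  unfolding istopology_def
 proof (intro conjI allI impI ballI)
  fix S T p assume A: "S \<subseteq> points M \<and> (\<forall>p\<in>points M. open (chart M p ` (S \<inter> chart_dom M p)))"
   "T \<subseteq> points M \<and> (\<forall>p\<in>points M. open (chart M p ` (T \<inter> chart_dom M p)))" and p: "p \<in> points M"
  have "chart M p ` (S \<inter> T \<inter> chart_dom M p) = chart M p ` ((S \<inter> chart_dom M p) \<inter> (T \<inter> chart_dom M p))"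
   by (rule arg_cong[where f = "image _"]) blast
  also have "\<dots> = chart M p ` (S \<inter> chart_dom M p) \<inter> chart M p ` (T \<inter> chart_dom M p)"
   by (rule inj_on_image_Int[OF atlas_inj[OF p]]) auto
  finally show "open (chart M p ` (S \<inter> T \<inter> chart_dom M p))" using A p by auto
 next
  fix K p assume A: "\<forall>S\<in>K. S \<subseteq> points M \<and> (\<forall>p\<in>points M. open (chart M p ` (S \<inter> chart_dom M p)))" and p: "p \<in> points M"
  have "chart M p ` (\<Union>K \<inter> chart_dom M p) = (\<Union>S\<in>K. chart M p ` (S \<inter> chart_dom M p))" by blast
  then show "open (chart M p ` (\<Union>K \<inter> chart_dom M p))" using A p by auto
 qed blast+
 then show ?thesis unfolding mfd_topology_def by (simp add: topology_inverse')
qed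

lemma topspace_mfd_topology: "topspace (mfd_topology M) = points M"
proof
 show "topspace (mfd_topology M) \<subseteq> points M"
  unfolding topspace_def by (auto simp: openin_mfd_topology)
 have "openin (mfd_topology M) (points M)"
  unfolding openin_mfd_topology
 proof (intro conjI ballI)
  fix p assume p: "p \<in> points M"
  then have "points M \<inter> chart_dom M p = chart_dom M p" using atlas_dom_points by blast
  then show "open (chart M p ` (points M \<inter> chart_dom M p))"
   using atlas_open[OF p] by (simp add: chart_img_def)
 qed simp
 then show "points M \<subseteq> topspace (mfd_topology M)" by (rule openin_subset)
qed

lemma openin_chart_dom: "p \<in> points M ==> openin (mfd_topology M) (chart_dom M p)"
 unfolding openin_mfd_topology using atlas_dom_points atlas_open_overlap by (auto simp: Int_commute)

end

text \<open>The neighbourhood \<open>V\<close> belongs to the notion: \<open>f\<close> must map it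
  into the domain of the target chart, so continuity is included and composition only has to
  intersect neighbourhoods.\<close>

definition rep_smooth :: "('m, 'e::findim_normed_vector) mfd => ('n, 'f::findim_normed_vector) mfd =>
  ('m => 'n) => 'm => 'n => 'e => bool" where
 "rep_smooth M N f p q y \<longleftrightarrow> (\<exists>V. open V \<and> y \<in> V \<and> V \<subseteq> chart_img M p \<and>
   (\<forall>z\<in>V. f (param M p z) \<in> chart_dom N q) \<and> smooth_on V (%z. chart N q (f (param M p z))))"

definition smooth_at :: "('m, 'e::findim_normed_vector) mfd => ('n, 'f::findim_normed_vector) mfd =>
  ('m => 'n) => 'm => bool" where
 "smooth_at M N f x \<longleftrightarrow> x \<in> points M \<and> f x \<in> points N \<and> rep_smooth M N f x (f x) (chart M x x)"

lemma smooth_at_points: "smooth_at M N f x ==> x \<in> points M" "smooth_at M N f x ==> f x \<in> points N"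
 by (simp_all add: smooth_at_def)

lemma rep_smooth_transition:
 assumes M: "mfd_atlas M" and p: "p \<in> points M" "q \<in> points M" and x: "x \<in> chart_dom M p" "x \<in> chart_dom M q"
 shows "rep_smooth M M (%z. z) p q (chart M p x)"
 unfolding rep_smooth_def
proof (intro exI conjI ballI)
 let ?V = "chart M p ` (chart_dom M p \<inter> chart_dom M q)"
 show "open ?V" by (rule atlas_open_overlap[OF M p])
 show "chart M p x \<in> ?V" using x by blast
 show "?V \<subseteq> chart_img M p" unfolding chart_img_def by blast
 show "param M p z \<in> chart_dom M q" if "z \<in> ?V" for z
  using that param_chart[OF M p(1)] by auto
 show "smooth_on ?V (%z. chart M q (param M p z))"
  using atlas_smooth[OF M p] by (simp add: o_def)
qed

lemma open_smooth_vimage: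
 assumes "open V" "smooth_on V F" "open A" shows "open (V \<inter> F -` A)"
proof -
 have "open (F -` A \<inter> V)"
  using continuous_on_open_vimage[OF assms(1), of F] smooth_on_continuous_on[OF assms(2)] assms(3) by blast
 then show ?thesis by (simp add: Int_commute)
qed

lemma rep_smooth_compose:
 assumes N: "inj_on (chart N q) (chart_dom N q)"
  and f: "rep_smooth M N f p q y" and g: "rep_smooth N K g q r (chart N q (f (param M p y)))"
 shows "rep_smooth M K (%z. g (f z)) p r y"
proof -
 let ?F = "%z. chart N q (f (param M p z))"
 obtain V where V: "open V" "y \<in> V" "V \<subseteq> chart_img M p" "\<forall>z\<in>V. f (param M p z) \<in> chart_dom N q" "smooth_on V ?F"
  using f unfolding rep_smooth_def by blast
 obtain W where W: "open W" "?F y \<in> W" "W \<subseteq> chart_img N q" "\<forall>z\<in>W. g (param N q z) \<in> chart_dom K r"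
  "smooth_on W (%z. chart K r (g (param N q z)))"
  using g unfolding rep_smooth_def by blast
 let ?U = "V \<inter> ?F -` W"
 have U: "open ?U"
  by (rule open_smooth_vimage[OF V(1,5) W(1)])
 have eq: "param N q (?F z) = f (param M p z)" if "z \<in> V" for z
  using that V(4) N unfolding param_def[of N] by (simp add: inv_into_f_f)
 show ?thesis unfolding rep_smooth_def
 proof (intro exI conjI ballI)
  show "open ?U" by (rule U)
  show "y \<in> ?U" using V W by auto
  show "?U \<subseteq> chart_img M p" using V by auto
  show "g (f (param M p z)) \<in> chart_dom K r" if "z \<in> ?U" for z
   using that W(4) eq[of z] by auto
  have "smooth_on ?U (%z. chart K r (g (param N q (?F z))))"
   by (rule smooth_on_compose[OF U W(1) _ W(5) smooth_on_subset[OF V(5)]]) auto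
  then show "smooth_on ?U (%z. chart K r (g (f (param M p z))))"
   by (rule smooth_on_cong[OF U]) (simp add: eq)
 qed
qed

text \<open>Both preferred charts are exchanged by composing with transition maps on the two sides;
  \<open>smooth_at\<close> thus implies smoothness in all charts around the points.\<close>

lemma smooth_at_rep:
 assumes M: "mfd_atlas M" and N: "mfd_atlas N" and f: "smooth_at M N f x"
  and p: "p \<in> points M" "x \<in> chart_dom M p" and q: "q \<in> points N" "f x \<in> chart_dom N q"
 shows "rep_smooth M N f p q (chart M p x)"
proof -
 have x: "x \<in> points M" "f x \<in> points N" using f by (simp_all add: smooth_at_def)
 have 1: "rep_smooth M M (%z. z) p x (chart M p x)"
  by (rule rep_smooth_transition[OF M p(1) x(1) p(2) atlas_dom[OF M x(1)]])
 have 2: "rep_smooth N N (%z. z) (f x) q (chart N (f x) (f x))"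
  by (rule rep_smooth_transition[OF N x(2) q(1) atlas_dom[OF N x(2)] q(2)])
 have "rep_smooth M N (%z. f z) x q (chart M x x)"
  by (rule rep_smooth_compose[OF atlas_inj[OF N x(2)], of M f x "chart M x x" N "%z. z"])
   (use f 2 x in \<open>simp_all add: smooth_at_def param_center[OF M]\<close>)
 then have "rep_smooth M N (%z. f z) p q (chart M p x)"
  using rep_smooth_compose[OF atlas_inj[OF M x(1)] 1, of N f q] param_chart[OF M p] by simp
 then show ?thesis .
qed

lemma smooth_at_compose:
 assumes M: "mfd_atlas M" and N: "mfd_atlas N" and f: "smooth_at M N f x" and g: "smooth_at N K g (f x)"
 shows "smooth_at M K (%z. g (f z)) x"
proof -
 have x: "x \<in> points M" "f x \<in> points N" using f by (simp_all add: smooth_at_def)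
 show ?thesis
  using rep_smooth_compose[OF atlas_inj[OF N x(2)], of M f x "chart M x x" K g "g (f x)"] f g x
  by (simp add: smooth_at_def param_center[OF M])
qed

lemma smooth_at_id: "mfd_atlas M ==> x \<in> points M ==> smooth_at M M (%z. z) x"
 unfolding smooth_at_def using rep_smooth_transition[of M x x x] atlas_dom[of M x] by simp

lemma rep_smooth_const:
 assumes "mfd_atlas M" "p \<in> points M" "x \<in> chart_dom M p" "c \<in> chart_dom N q"
 shows "rep_smooth M N (%z. c) p q (chart M p x)"
 unfolding rep_smooth_def
 by (rule exI[of _ "chart_img M p"]) (use assms in \<open>auto simp: atlas_open chart_in_img\<close>)

lemma smooth_at_const:
 assumes "mfd_atlas M" "mfd_atlas N" "x \<in> points M" "c \<in> points N"
 shows "smooth_at M N (%z. c) x"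
 unfolding smooth_at_def
 using assms(3,4) rep_smooth_const[OF assms(1,3) atlas_dom[OF assms(1,3)] atlas_dom[OF assms(2,4)]] by blast

text \<open>Openness of a set and \<open>smooth_on\<close> are both local, so the conditions of
  \<open>smooth_map\<close> on whole chart domains can be checked near each point. Maps are treated
  pointwise from here on, which simplifies composition and restriction.\<close>

lemma smooth_map_iff_smooth_at:
 assumes M: "mfd_atlas M" and N: "mfd_atlas N"
 shows "smooth_map M N f \<longleftrightarrow> (\<forall>x\<in>points M. smooth_at M N f x)"
proof
 assume f: "smooth_map M N f"
 show "\<forall>x\<in>points M. smooth_at M N f x"
 proof
  fix x assume x: "x \<in> points M"
  then have fx: "f x \<in> points N" using f unfolding smooth_map_def by blast
  let ?V = "chart M x ` {y \<in> chart_dom M x. f y \<in> chart_dom N (f x)}"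
  have "open ?V" "smooth_on ?V (chart N (f x) \<circ> f \<circ> param M x)"
   using f x fx unfolding smooth_map_def by blast+
  moreover have "chart M x x \<in> ?V" using atlas_dom[OF M x] atlas_dom[OF N fx] by blast
  moreover have "?V \<subseteq> chart_img M x" unfolding chart_img_def by blast
  moreover have "\<forall>z\<in>?V. f (param M x z) \<in> chart_dom N (f x)"
   by (auto simp: param_chart[OF M x])
  ultimately show "smooth_at M N f x"
   unfolding smooth_at_def rep_smooth_def using x fx by (auto simp: o_def)
 qed
next
 assume f: "\<forall>x\<in>points M. smooth_at M N f x"
 show "smooth_map M N f" unfolding smooth_map_def
 proof (intro conjI ballI)
  show "f ` points M \<subseteq> points N" using f by (auto simp: smooth_at_def)
  fix p q assume p: "p \<in> points M" and q: "q \<in> points N"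
  let ?V = "chart M p ` {y \<in> chart_dom M p. f y \<in> chart_dom N q}"
  have ex: "\<exists>V. open V \<and> y \<in> V \<and> V \<subseteq> ?V \<and> smooth_on V (chart N q \<circ> f \<circ> param M p)" if y: "y \<in> ?V" for y
  proof -
   obtain x where x: "x \<in> chart_dom M p" "f x \<in> chart_dom N q" "y = chart M p x" using y by blast
   have "smooth_at M N f x" using f atlas_dom_points[OF M p x(1)] by blast
   from smooth_at_rep[OF M N this p x(1) q x(2)] obtain V where
    V: "open V" "y \<in> V" "V \<subseteq> chart_img M p" "\<forall>z\<in>V. f (param M p z) \<in> chart_dom N q"
     "smooth_on V (%z. chart N q (f (param M p z)))"
    unfolding rep_smooth_def x(3) by blast
   have "V \<subseteq> ?V"
   proof
    fix z assume z: "z \<in> V"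
    then have "z = chart M p (param M p z)" "param M p z \<in> chart_dom M p"
     using V(3) chart_param[OF M, of z p] param_dom[OF M, of z p] by auto
    then show "z \<in> ?V" using V(4) z by blast
   qed
   then show ?thesis using V by (auto simp: o_def)
  qed
  show "open ?V" by (subst open_subopen) (use ex in blast)
  show "smooth_on ?V (chart N q \<circ> f \<circ> param M p)"
   by (rule smooth_on_local) (use ex in blast)
 qed
qed

section \<open>The manifold topology, tested in the preferred chart of each point\<close>

lemma openin_mfdI:
 assumes M: "mfd_atlas M" and U: "\<And>x. x \<in> U ==> x \<in> points M \<and>
  (\<exists>V. open V \<and> chart M x x \<in> V \<and> V \<subseteq> chart_img M x \<and> param M x ` V \<subseteq> U)"
 shows "openin (mfd_topology M) U"
 unfolding openin_mfd_topology[OF M]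
proof (intro conjI ballI)
 show "U \<subseteq> points M" using U by blast
 fix p assume p: "p \<in> points M"
 show "open (chart M p ` (U \<inter> chart_dom M p))"
 proof (subst open_subopen, intro ballI)
  fix y assume "y \<in> chart M p ` (U \<inter> chart_dom M p)"
  then obtain x where x: "x \<in> U" "x \<in> chart_dom M p" "y = chart M p x" by blast
  have xM: "x \<in> points M" using U x(1) by blast
  obtain V where V: "open V" "chart M x x \<in> V" "V \<subseteq> chart_img M x" "param M x ` V \<subseteq> U"
   using U[OF x(1)] by blast
  have "rep_smooth M M (%z. z) p x y"
   unfolding x(3) by (rule rep_smooth_transition[OF M p xM x(2) atlas_dom[OF M xM]])
  then obtain W where W: "open W" "y \<in> W" "W \<subseteq> chart_img M p" "\<forall>z\<in>W. param M p z \<in> chart_dom M x"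
   "smooth_on W (%z. chart M x (param M p z))"
   unfolding rep_smooth_def by blast
  let ?T = "W \<inter> (%z. chart M x (param M p z)) -` V"
  have "open ?T"
   by (rule open_smooth_vimage[OF W(1,5) V(1)])
  moreover have "y \<in> ?T" using W V x param_chart[OF M p x(2)] by simp
  moreover have "?T \<subseteq> chart M p ` (U \<inter> chart_dom M p)"
  proof
   fix z assume z: "z \<in> ?T"
   have "param M p z = param M x (chart M x (param M p z))"
    using z W(4) param_chart[OF M xM] by auto
   then have "param M p z \<in> U" using z V(4) by auto
   moreover have "param M p z \<in> chart_dom M p" "z = chart M p (param M p z)"
    using z W(3) chart_param[OF M, of z p] param_dom[OF M, of z p] by auto
   ultimately show "z \<in> chart M p ` (U \<inter> chart_dom M p)" by blast
  qed
  ultimately show "\<exists>T. open T \<and> y \<in> T \<and> T \<subseteq> chart M p ` (U \<inter> chart_dom M p)" by blast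
 qed
qed

lemma openin_mfdD:
 assumes M: "mfd_atlas M" and U: "openin (mfd_topology M) U" and x: "x \<in> U"
 shows "\<exists>V. open V \<and> chart M x x \<in> V \<and> V \<subseteq> chart_img M x \<and> param M x ` V \<subseteq> U"
proof -
 have xM: "x \<in> points M" using U x unfolding openin_mfd_topology[OF M] by blast
 show ?thesis
 proof (intro exI[of _ "chart M x ` (U \<inter> chart_dom M x)"] conjI)
  show "open (chart M x ` (U \<inter> chart_dom M x))" using U xM unfolding openin_mfd_topology[OF M] by blast
  show "param M x ` chart M x ` (U \<inter> chart_dom M x) \<subseteq> U" using param_chart[OF M xM] by auto
 qed (use x atlas_dom[OF M xM] in \<open>auto simp: chart_img_def\<close>)
qed

lemma rep_smooth_shrink:
 assumes "rep_smooth M N f p q y" "open W" "y \<in> W"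
 shows "\<exists>V. open V \<and> y \<in> V \<and> V \<subseteq> W \<and> V \<subseteq> chart_img M p \<and>
   (\<forall>z\<in>V. f (param M p z) \<in> chart_dom N q) \<and> smooth_on V (%z. chart N q (f (param M p z)))"
proof -
 obtain V where "open V" "y \<in> V" "V \<subseteq> chart_img M p"
   "\<forall>z\<in>V. f (param M p z) \<in> chart_dom N q" "smooth_on V (%z. chart N q (f (param M p z)))"
  using assms(1) unfolding rep_smooth_def by blast
 then show ?thesis using assms by (intro exI[of _ "V \<inter> W"]) (auto intro: smooth_on_subset)
qed

lemma smooth_at_cong:
 assumes M: "mfd_atlas M" and U: "openin (mfd_topology M) U" "x \<in> U" and f: "smooth_at M N f x"
  and eq: "\<And>y. y \<in> U ==> f y = g y"
 shows "smooth_at M N g x"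
proof -
 obtain W where W: "open W" "chart M x x \<in> W" "W \<subseteq> chart_img M x" "param M x ` W \<subseteq> U"
  using openin_mfdD[OF M U] by blast
 have "rep_smooth M N f x (f x) (chart M x x)" using f by (simp add: smooth_at_def)
 from rep_smooth_shrink[OF this W(1,2)] obtain V where V: "open V" "chart M x x \<in> V" "V \<subseteq> W" "V \<subseteq> chart_img M x"
   "\<forall>z\<in>V. f (param M x z) \<in> chart_dom N (f x)" "smooth_on V (%z. chart N (f x) (f (param M x z)))"
  by blast
 have e: "f (param M x z) = g (param M x z)" if "z \<in> V" for z
  using eq that V(3) W(4) by blast
 have "rep_smooth M N g x (f x) (chart M x x)"
  unfolding rep_smooth_def using V e smooth_on_cong[OF V(1,6), of "%z. chart N (f x) (g (param M x z))"]
  by (intro exI[of _ V]) auto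
 then show ?thesis using f eq[OF U(2)] by (simp add: smooth_at_def)
qed

text \<open>Continuity of smooth maps, also for maps that are smooth only on an open part
  \<open>W\<close>, such as the group coordinate of a local trivialisation.\<close>

lemma openin_smooth_preimage:
 assumes M: "mfd_atlas M" and N: "mfd_atlas N" and W: "openin (mfd_topology M) W"
  and f: "\<And>x. x \<in> W ==> smooth_at M N f x" and U: "openin (mfd_topology N) U"
 shows "openin (mfd_topology M) {x \<in> W. f x \<in> U}"
proof (rule openin_mfdI[OF M], intro conjI)
 fix x assume x: "x \<in> {x \<in> W. f x \<in> U}"
 then have fx: "smooth_at M N f x" using f by blast
 then show xM: "x \<in> points M" by (simp add: smooth_at_def)
 have fN: "f x \<in> points N" using fx by (simp add: smooth_at_def)
 obtain A where A: "open A" "chart N (f x) (f x) \<in> A" "A \<subseteq> chart_img N (f x)" "param N (f x) ` A \<subseteq> U"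
  using openin_mfdD[OF N U] x by blast
 obtain B where B: "open B" "chart M x x \<in> B" "B \<subseteq> chart_img M x" "param M x ` B \<subseteq> W"
  using openin_mfdD[OF M W] x by blast
 have "rep_smooth M N f x (f x) (chart M x x)" using fx by (simp add: smooth_at_def)
 from rep_smooth_shrink[OF this B(1,2)] obtain V where V: "open V" "chart M x x \<in> V" "V \<subseteq> B" "V \<subseteq> chart_img M x"
   "\<forall>z\<in>V. f (param M x z) \<in> chart_dom N (f x)" "smooth_on V (%z. chart N (f x) (f (param M x z)))"
  by blast
 let ?T = "V \<inter> (%z. chart N (f x) (f (param M x z))) -` A"
 have "open ?T"
  by (rule open_smooth_vimage[OF V(1,6) A(1)])
 moreover have "chart M x x \<in> ?T" using V A param_center[OF M xM] by simp
 moreover have "param M x ` ?T \<subseteq> {x \<in> W. f x \<in> U}"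
 proof
  fix y assume "y \<in> param M x ` ?T"
  then obtain z where z: "z \<in> ?T" "y = param M x z" by blast
  have "f y = param N (f x) (chart N (f x) (f (param M x z)))"
   unfolding z(2) using z(1) V(5) param_chart[OF N fN] by auto
  then have "f y \<in> U" using z(1) A(4) by auto
  then show "y \<in> {x \<in> W. f x \<in> U}" using z V(3) B(4) by auto
 qed
 ultimately show "\<exists>V. open V \<and> chart M x x \<in> V \<and> V \<subseteq> chart_img M x \<and> param M x ` V \<subseteq> {x \<in> W. f x \<in> U}"
  using V(4) by blast
qed

lemma openin_points: "mfd_atlas M ==> openin (mfd_topology M) (points M)"
 by (metis openin_topspace topspace_mfd_topology)

section \<open>Open submanifolds\<close>

lemma param_open_submfd:
 assumes M: "mfd_atlas M" and p: "p \<in> points M" and y: "y \<in> chart M p ` (chart_dom M p \<inter> U)"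
 shows "param (open_submfd M U) p y = param M p y"
proof -
 obtain x where x: "x \<in> chart_dom M p \<inter> U" "y = chart M p x" using y by blast
 have "inj_on (chart M p) (chart_dom M p \<inter> U)" using atlas_inj[OF M p] by (rule inj_on_subset) simp
 then have "inv_into (chart_dom M p \<inter> U) (chart M p) y = x" unfolding x(2) using x(1) by (rule inv_into_f_f)
 then show ?thesis using param_chart[OF M p] x by (simp add: param_def open_submfd_def)
qed

lemma chart_img_open_submfd: "chart_img (open_submfd M U) p = chart M p ` (chart_dom M p \<inter> U)"
 by (simp add: chart_img_def open_submfd_def)

lemma atlas_open_submfd:
 assumes M: "mfd_atlas M" and U: "openin (mfd_topology M) U"
 shows "mfd_atlas (open_submfd M U)"
proof -
 have o: "open (chart M p ` (chart_dom M p \<inter> A \<inter> U))" if "p \<in> points M" "openin (mfd_topology M) A" for p A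
 proof -
  have "openin (mfd_topology M) (A \<inter> U)" using U that by blast
  then have "open (chart M p ` ((A \<inter> U) \<inter> chart_dom M p))" using that(1) unfolding openin_mfd_topology[OF M] by blast
  then show ?thesis by (simp add: Int_ac)
 qed
 have s: "smooth_on (chart M p ` (chart_dom M p \<inter> chart_dom M q \<inter> U)) (chart M q \<circ> param (open_submfd M U) p)"
  if pq: "p \<in> points M" "q \<in> points M" for p q
 proof (rule smooth_on_cong)
  show "open (chart M p ` (chart_dom M p \<inter> chart_dom M q \<inter> U))"
   by (rule o[OF pq(1) openin_chart_dom[OF M pq(2)]])
  show "smooth_on (chart M p ` (chart_dom M p \<inter> chart_dom M q \<inter> U)) (chart M q \<circ> param M p)"
   by (rule smooth_on_subset[OF atlas_smooth[OF M pq]]) blast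
  show "(chart M q \<circ> param M p) y = (chart M q \<circ> param (open_submfd M U) p) y"
   if "y \<in> chart M p ` (chart_dom M p \<inter> chart_dom M q \<inter> U)" for y
   using param_open_submfd[OF M pq(1), of y U] that by auto
 qed
 have e: "A \<inter> U \<inter> (B \<inter> U) = A \<inter> B \<inter> U" for A B by blast
 have iU: "inj_on (chart M p) (chart_dom M p \<inter> U)" if "p \<in> points M" for p
  using atlas_inj[OF M that] by (rule inj_on_subset) simp
 have oU: "open (chart M p ` (chart_dom M p \<inter> U))" if "p \<in> points M" for p
  using o[OF that openin_chart_dom[OF M that]] by simp
 show ?thesis
  unfolding mfd_atlas_def chart_img_open_submfd
  using o[OF _ openin_chart_dom[OF M]] oU s atlas_dom[OF M] atlas_dom_points[OF M] iU
  by (auto simp: open_submfd_def e)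
qed

lemma smooth_at_open_submfd_dom:
 assumes M: "mfd_atlas M" and U: "openin (mfd_topology M) U" and x: "x \<in> U"
 shows "smooth_at (open_submfd M U) N f x \<longleftrightarrow> smooth_at M N f x"
proof -
 have xM: "x \<in> points M" using U x unfolding openin_mfd_topology[OF M] by blast
 have oU: "open (chart M x ` (chart_dom M x \<inter> U))"
  using U xM unfolding openin_mfd_topology[OF M] by (simp add: Int_commute)
 have c: "chart M x x \<in> chart M x ` (chart_dom M x \<inter> U)" using x atlas_dom[OF M xM] by blast
 have "rep_smooth (open_submfd M U) N f x (f x) (chart M x x) \<longleftrightarrow> rep_smooth M N f x (f x) (chart M x x)"
 proof
  assume "rep_smooth (open_submfd M U) N f x (f x) (chart M x x)"
  then obtain V where V: "open V" "chart M x x \<in> V" "V \<subseteq> chart M x ` (chart_dom M x \<inter> U)"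
   "\<forall>z\<in>V. f (param (open_submfd M U) x z) \<in> chart_dom N (f x)"
   "smooth_on V (%z. chart N (f x) (f (param (open_submfd M U) x z)))"
   unfolding rep_smooth_def chart_img_open_submfd by blast
  have e: "param (open_submfd M U) x z = param M x z" if "z \<in> V" for z
   using V(3) that param_open_submfd[OF M xM] by blast
  show "rep_smooth M N f x (f x) (chart M x x)"
   unfolding rep_smooth_def using V e smooth_on_cong[OF V(1,5), of "%z. chart N (f x) (f (param M x z))"]
   by (intro exI[of _ V]) (auto simp: chart_img_def)
 next
  assume "rep_smooth M N f x (f x) (chart M x x)"
  from rep_smooth_shrink[OF this oU c] obtain V where V: "open V" "chart M x x \<in> V"
   "V \<subseteq> chart M x ` (chart_dom M x \<inter> U)" "\<forall>z\<in>V. f (param M x z) \<in> chart_dom N (f x)"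
   "smooth_on V (%z. chart N (f x) (f (param M x z)))"
   by blast
  have e: "param (open_submfd M U) x z = param M x z" if "z \<in> V" for z
   using V(3) that param_open_submfd[OF M xM] by blast
  show "rep_smooth (open_submfd M U) N f x (f x) (chart M x x)"
   unfolding rep_smooth_def chart_img_open_submfd
   using V e smooth_on_cong[OF V(1,5), of "%z. chart N (f x) (f (param (open_submfd M U) x z))"]
   by (intro exI[of _ V]) auto
 qed
 then show ?thesis using xM x by (simp add: smooth_at_def) (simp add: open_submfd_def)
qed

lemma smooth_at_open_submfd_ran:
 assumes "smooth_at N (open_submfd M U) f x"
 shows "smooth_at N M f x"
 using assms unfolding smooth_at_def rep_smooth_def open_submfd_def by auto

lemma smooth_at_into_open_submfd:
 assumes N: "mfd_atlas N" and M: "mfd_atlas M" and f: "smooth_at N M f x"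
  and U: "openin (mfd_topology M) U" "f x \<in> U"
 shows "smooth_at N (open_submfd M U) f x"
proof -
 have x: "x \<in> points N" and fx: "f x \<in> points M" using f by (simp_all add: smooth_at_def)
 obtain A where A: "open A" "chart M (f x) (f x) \<in> A" "A \<subseteq> chart_img M (f x)" "param M (f x) ` A \<subseteq> U"
  using openin_mfdD[OF M U] by blast
 obtain V where V: "open V" "chart N x x \<in> V" "V \<subseteq> chart_img N x"
   "\<forall>z\<in>V. f (param N x z) \<in> chart_dom M (f x)" "smooth_on V (%z. chart M (f x) (f (param N x z)))"
  using f unfolding smooth_at_def rep_smooth_def by blast
 let ?T = "V \<inter> (%z. chart M (f x) (f (param N x z))) -` A"
 have "open ?T"
  by (rule open_smooth_vimage[OF V(1,5) A(1)])
 moreover have "chart N x x \<in> ?T" using V A param_center[OF N x] by simp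
 moreover have "f (param N x z) \<in> U" if "z \<in> ?T" for z
 proof -
  have "f (param N x z) = param M (f x) (chart M (f x) (f (param N x z)))"
   using that V(4) param_chart[OF M fx] by auto
  then show ?thesis using that A(4) by auto
 qed
 ultimately show ?thesis
  unfolding smooth_at_def rep_smooth_def using V x fx U(2)
  by (intro conjI exI[of _ ?T]) (auto simp: open_submfd_def intro: smooth_on_subset)
qed

section \<open>Products of manifolds\<close>

lemma points_prod_mfd [simp]: "points (prod_mfd M N) = points M \<times> points N"
 by (simp add: prod_mfd_def)

lemma chart_dom_prod_mfd [simp]: "chart_dom (prod_mfd M N) p = chart_dom M (fst p) \<times> chart_dom N (snd p)"
 by (simp add: prod_mfd_def split: prod.split)

lemma chart_prod_mfd [simp]: "chart (prod_mfd M N) p x = (chart M (fst p) (fst x), chart N (snd p) (snd x))"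
 by (simp add: prod_mfd_def split: prod.split)

lemma chart_img_prod_mfd: "chart_img (prod_mfd M N) p = chart_img M (fst p) \<times> chart_img N (snd p)"
 by (auto simp: chart_img_def image_def)

lemma param_prod_mfd:
 assumes "mfd_atlas M" "mfd_atlas N" "p \<in> points M" "q \<in> points N" "y \<in> chart_img M p" "z \<in> chart_img N q"
 shows "param (prod_mfd M N) (p, q) (y, z) = (param M p y, param N q z)"
proof -
 have "inj_on (chart (prod_mfd M N) (p, q)) (chart_dom M p \<times> chart_dom N q)"
  using atlas_inj[OF assms(1,3)] atlas_inj[OF assms(2,4)] by (auto simp: inj_on_def)
 moreover have "chart (prod_mfd M N) (p, q) (param M p y, param N q z) = (y, z)"
  using chart_param[OF assms(1,5)] chart_param[OF assms(2,6)] by simp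
 moreover have "(param M p y, param N q z) \<in> chart_dom M p \<times> chart_dom N q"
  using param_dom[OF assms(1,5)] param_dom[OF assms(2,6)] by simp
 ultimately show ?thesis unfolding param_def[of "prod_mfd M N"]
  using inv_into_f_f[of "chart (prod_mfd M N) (p, q)" "chart_dom M p \<times> chart_dom N q" "(param M p y, param N q z)"]
  by simp
qed

lemma smooth_on_fst_comp: "open S ==> smooth_on S f ==> open T ==> smooth_on (S \<times> T) (%z. f (fst z))"
 by (rule smooth_on_compose[of "S \<times> T" S fst f]) (auto simp: open_Times intro: smooth_on_bounded_linear[OF _ bounded_linear_fst smooth_on_id])

lemma smooth_on_snd_comp: "open S ==> smooth_on T f ==> open T ==> smooth_on (S \<times> T) (%z. f (snd z))"
 by (rule smooth_on_compose[of "S \<times> T" T snd f]) (auto simp: open_Times intro: smooth_on_bounded_linear[OF _ bounded_linear_snd smooth_on_id])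

lemma atlas_prod_mfd:
 assumes M: "mfd_atlas M" and N: "mfd_atlas N"
 shows "mfd_atlas (prod_mfd M N)"
proof -
 have overlap: "chart (prod_mfd M N) z ` (chart_dom (prod_mfd M N) z \<inter> chart_dom (prod_mfd M N) w) =
  chart M (fst z) ` (chart_dom M (fst z) \<inter> chart_dom M (fst w)) \<times> chart N (snd z) ` (chart_dom N (snd z) \<inter> chart_dom N (snd w))"
  for z w
 proof -
  have "(%x. (f (fst x), g (snd x))) ` (A \<times> B) = f ` A \<times> g ` B" for f :: "'a => 'b" and g :: "'c => 'd" and A B
   by force
  then show ?thesis by (simp add: Times_Int_Times)
 qed
 have "smooth_on (chart (prod_mfd M N) z ` (chart_dom (prod_mfd M N) z \<inter> chart_dom (prod_mfd M N) w))
   (chart (prod_mfd M N) w \<circ> param (prod_mfd M N) z)" if z: "z \<in> points (prod_mfd M N)" and w: "w \<in> points (prod_mfd M N)" for z w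
 proof -
  obtain p q p' q' where zw: "z = (p, q)" "w = (p', q')" and pq: "p \<in> points M" "q \<in> points N" "p' \<in> points M" "q' \<in> points N"
   using z w by (cases z; cases w) auto
  let ?A = "chart M p ` (chart_dom M p \<inter> chart_dom M p')" and ?B = "chart N q ` (chart_dom N q \<inter> chart_dom N q')"
  have o: "open ?A" "open ?B" by (rule atlas_open_overlap[OF M pq(1,3)], rule atlas_open_overlap[OF N pq(2,4)])
  have AB: "open (?A \<times> ?B)" using o by (rule open_Times)
  have "smooth_on (?A \<times> ?B) (%u. ((chart M p' \<circ> param M p) (fst u), (chart N q' \<circ> param N q) (snd u)))"
   by (intro smooth_on_Pair AB smooth_on_fst_comp smooth_on_snd_comp o atlas_smooth[OF M pq(1,3)] atlas_smooth[OF N pq(2,4)])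
  then have "smooth_on (?A \<times> ?B) (chart (prod_mfd M N) w \<circ> param (prod_mfd M N) z)"
  proof (rule smooth_on_cong[OF AB])
   fix u assume u: "u \<in> ?A \<times> ?B"
   have "fst u \<in> chart_img M p" "snd u \<in> chart_img N q" using u by (auto simp: chart_img_def)
   from param_prod_mfd[OF M N pq(1,2) this]
   show "((chart M p' \<circ> param M p) (fst u), (chart N q' \<circ> param N q) (snd u)) = (chart (prod_mfd M N) w \<circ> param (prod_mfd M N) z) u"
    by (simp add: zw)
  qed
  then show ?thesis unfolding overlap by (simp add: zw)
 qed
 moreover have "inj_on (chart (prod_mfd M N) z) (chart_dom (prod_mfd M N) z)" if "z \<in> points (prod_mfd M N)" for z
  using that atlas_inj[OF M, of "fst z"] atlas_inj[OF N, of "snd z"] by (auto simp: inj_on_def)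
 moreover have "chart_dom (prod_mfd M N) z \<subseteq> points (prod_mfd M N)" if "z \<in> points (prod_mfd M N)" for z
  using that atlas_dom_points[OF M] atlas_dom_points[OF N] by auto
 ultimately show ?thesis
  unfolding mfd_atlas_def overlap chart_img_prod_mfd
  using atlas_dom[OF M] atlas_dom[OF N]
  by (auto intro!: open_Times atlas_open[OF M] atlas_open[OF N] atlas_open_overlap[OF M] atlas_open_overlap[OF N])
qed

lemma smooth_at_Pair:
 assumes f: "smooth_at K M f x" and g: "smooth_at K N g x"
 shows "smooth_at K (prod_mfd M N) (%z. (f z, g z)) x"
proof -
 obtain V where V: "open V" "chart K x x \<in> V" "V \<subseteq> chart_img K x"
   "\<forall>z\<in>V. f (param K x z) \<in> chart_dom M (f x)" "smooth_on V (%z. chart M (f x) (f (param K x z)))"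
  using f unfolding smooth_at_def rep_smooth_def by blast
 have "rep_smooth K N g x (g x) (chart K x x)" using g by (simp add: smooth_at_def)
 from rep_smooth_shrink[OF this V(1,2)] obtain W where W: "open W" "chart K x x \<in> W" "W \<subseteq> V" "W \<subseteq> chart_img K x"
   "\<forall>z\<in>W. g (param K x z) \<in> chart_dom N (g x)" "smooth_on W (%z. chart N (g x) (g (param K x z)))"
  by blast
 have "smooth_on W (%z. (chart M (f x) (f (param K x z)), chart N (g x) (g (param K x z))))"
  by (rule smooth_on_Pair[OF W(1) smooth_on_subset[OF V(5) W(3)] W(6)])
 then show ?thesis using W V f g unfolding smooth_at_def rep_smooth_def
  by (intro conjI exI[of _ W]) auto
qed

lemma smooth_at_fst:
 assumes M: "mfd_atlas M" and N: "mfd_atlas N" and z: "z \<in> points M \<times> points N"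
 shows "smooth_at (prod_mfd M N) M fst z"
proof -
 obtain p q where pq: "z = (p, q)" "p \<in> points M" "q \<in> points N" using z by auto
 let ?V = "chart_img M p \<times> chart_img N q"
 have V: "open ?V" by (intro open_Times atlas_open M N pq)
 have "smooth_on ?V fst" by (rule smooth_on_bounded_linear[OF V bounded_linear_fst smooth_on_id])
 then have "smooth_on ?V (%u. chart M p (fst (param (prod_mfd M N) (p, q) u)))"
  by (rule smooth_on_cong[OF V]) (auto simp: param_prod_mfd[OF M N pq(2,3)] chart_param[OF M])
 then show ?thesis unfolding smooth_at_def rep_smooth_def pq(1) chart_img_prod_mfd using V pq
  by (intro conjI exI[of _ ?V])
   (auto simp: param_prod_mfd[OF M N pq(2,3)] chart_center_img[OF M] chart_center_img[OF N] param_dom[OF M])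
qed

lemma smooth_at_snd:
 assumes M: "mfd_atlas M" and N: "mfd_atlas N" and z: "z \<in> points M \<times> points N"
 shows "smooth_at (prod_mfd M N) N snd z"
proof -
 obtain p q where pq: "z = (p, q)" "p \<in> points M" "q \<in> points N" using z by auto
 let ?V = "chart_img M p \<times> chart_img N q"
 have V: "open ?V" by (intro open_Times atlas_open M N pq)
 have "smooth_on ?V snd" by (rule smooth_on_bounded_linear[OF V bounded_linear_snd smooth_on_id])
 then have "smooth_on ?V (%u. chart N q (snd (param (prod_mfd M N) (p, q) u)))"
  by (rule smooth_on_cong[OF V]) (auto simp: param_prod_mfd[OF M N pq(2,3)] chart_param[OF N])
 then show ?thesis unfolding smooth_at_def rep_smooth_def pq(1) chart_img_prod_mfd using V pq
  by (intro conjI exI[of _ ?V])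
   (auto simp: param_prod_mfd[OF M N pq(2,3)] chart_center_img[OF M] chart_center_img[OF N] param_dom[OF N])
qed

text \<open>The topology of \<open>E\<close> is induced by the map \<open>(a, c)\<close> into a product of manifolds.\<close>

lemma smooth_manifold_initial:
 assumes E: "mfd_atlas E" and N: "smooth_manifold N" and P: "smooth_manifold P"
  and a: "\<And>z. z \<in> points E ==> smooth_at E N a z" and c: "\<And>z. z \<in> points E ==> smooth_at E P c z"
  and inj: "\<And>y z. y \<in> points E ==> z \<in> points E ==> a y = a z ==> c y = c z ==> y = z"
  and base: "\<And>U z. openin (mfd_topology E) U ==> z \<in> U ==> \<exists>A C. openin (mfd_topology N) A \<and> openin (mfd_topology P) C \<and>
    a z \<in> A \<and> c z \<in> C \<and> (\<forall>y\<in>points E. a y \<in> A \<longrightarrow> c y \<in> C \<longrightarrow> y \<in> U)"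
 shows "smooth_manifold E"
proof -
 have Na: "mfd_atlas N" "Hausdorff_space (mfd_topology N)" "second_countable (mfd_topology N)"
  and Pa: "mfd_atlas P" "Hausdorff_space (mfd_topology P)" "second_countable (mfd_topology P)"
  using N P by (simp_all add: smooth_manifold_iff)
 have prea: "openin (mfd_topology E) {z \<in> points E. a z \<in> A}" if "openin (mfd_topology N) A" for A
  by (rule openin_smooth_preimage[OF E Na(1) openin_points[OF E] a that])
 have prec: "openin (mfd_topology E) {z \<in> points E. c z \<in> A}" if "openin (mfd_topology P) A" for A
  by (rule openin_smooth_preimage[OF E Pa(1) openin_points[OF E] c that])
 have az: "a z \<in> points N" "c z \<in> points P" if "z \<in> points E" for z
  using a[OF that] c[OF that] by (simp_all add: smooth_at_def)
 have "Hausdorff_space (mfd_topology E)"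
  unfolding Hausdorff_space_def topspace_mfd_topology[OF E]
 proof (intro allI impI, elim conjE)
  fix y z assume yz: "y \<in> points E" "z \<in> points E" "y \<noteq> z"
  then consider "a y \<noteq> a z" | "c y \<noteq> c z" using inj by blast
  then show "\<exists>U V. openin (mfd_topology E) U \<and> openin (mfd_topology E) V \<and> y \<in> U \<and> z \<in> V \<and> disjnt U V"
  proof cases
   case 1
   then obtain A B where "openin (mfd_topology N) A" "openin (mfd_topology N) B" "a y \<in> A" "a z \<in> B" "disjnt A B"
    using Na(2)[unfolded Hausdorff_space_def topspace_mfd_topology[OF Na(1)], rule_format, of "a y" "a z"]
     az(1)[OF yz(1)] az(1)[OF yz(2)] by auto
   then show ?thesis using prea yz
    by (intro exI[of _ "{z \<in> points E. a z \<in> A}"] exI[of _ "{z \<in> points E. a z \<in> B}"]) (auto simp: disjnt_iff)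
  next
   case 2
   then obtain A B where "openin (mfd_topology P) A" "openin (mfd_topology P) B" "c y \<in> A" "c z \<in> B" "disjnt A B"
    using Pa(2)[unfolded Hausdorff_space_def topspace_mfd_topology[OF Pa(1)], rule_format, of "c y" "c z"]
     az(2)[OF yz(1)] az(2)[OF yz(2)] by auto
   then show ?thesis using prec yz
    by (intro exI[of _ "{z \<in> points E. c z \<in> A}"] exI[of _ "{z \<in> points E. c z \<in> B}"]) (auto simp: disjnt_iff)
  qed
 qed
 moreover have "second_countable (mfd_topology E)"
 proof -
  obtain BN where BN: "countable BN" "\<forall>V\<in>BN. openin (mfd_topology N) V"
   "\<forall>U x. openin (mfd_topology N) U \<and> x \<in> U \<longrightarrow> (\<exists>V\<in>BN. x \<in> V \<and> V \<subseteq> U)"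
   using Na(3) unfolding second_countable_def by blast
  obtain BP where BP: "countable BP" "\<forall>V\<in>BP. openin (mfd_topology P) V"
   "\<forall>U x. openin (mfd_topology P) U \<and> x \<in> U \<longrightarrow> (\<exists>V\<in>BP. x \<in> V \<and> V \<subseteq> U)"
   using Pa(3) unfolding second_countable_def by blast
  \<comment> \<open>Preimages of pairs of basic open sets are countably many, and the hypothesis
    \<open>base\<close> makes them a basis.\<close>
  let ?h = "%(A, C). {z \<in> points E. a z \<in> A} \<inter> {z \<in> points E. c z \<in> C}"
  show ?thesis unfolding second_countable_def
  proof (intro exI[of _ "?h ` (BN \<times> BP)"] conjI ballI allI impI)
   show "countable (?h ` (BN \<times> BP))" using BN(1) BP(1) by blast
   show "openin (mfd_topology E) V" if "V \<in> ?h ` (BN \<times> BP)" for V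
    using that BN(2) BP(2) by (auto intro!: openin_Int prea prec)
   fix U z assume Uz: "openin (mfd_topology E) U \<and> z \<in> U"
   then have zE: "z \<in> points E" unfolding openin_mfd_topology[OF E] by blast
   obtain A C where AC: "openin (mfd_topology N) A" "openin (mfd_topology P) C" "a z \<in> A" "c z \<in> C"
    "\<forall>y\<in>points E. a y \<in> A \<longrightarrow> c y \<in> C \<longrightarrow> y \<in> U" using base Uz by meson
   obtain A' where A': "A' \<in> BN" "a z \<in> A'" "A' \<subseteq> A" using BN(3) AC by meson
   obtain C' where C': "C' \<in> BP" "c z \<in> C'" "C' \<subseteq> C" using BP(3) AC by meson
   have "z \<in> ?h (A', C')" "?h (A', C') \<subseteq> U" using A' C' AC(5) zE by auto
   then show "\<exists>V\<in>?h ` (BN \<times> BP). z \<in> V \<and> V \<subseteq> U" using A'(1) C'(1) by blast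
  qed
 qed
 ultimately show ?thesis using E by (simp add: smooth_manifold_iff)
qed

lemma openin_param_image:
 assumes M: "mfd_atlas M" and p: "p \<in> points M" and V: "open V" "V \<subseteq> chart_img M p"
 shows "openin (mfd_topology M) (param M p ` V)"
proof (rule openin_mfdI[OF M], intro conjI)
 fix x assume "x \<in> param M p ` V"
 then obtain v where v: "v \<in> V" "x = param M p v" by blast
 have xd: "x \<in> chart_dom M p" using v V(2) param_dom[OF M, of v p] by blast
 then show xM: "x \<in> points M" using atlas_dom_points[OF M p] by blast
 have "rep_smooth M M (%z. z) x p (chart M x x)"
  by (rule rep_smooth_transition[OF M xM p atlas_dom[OF M xM] xd])
 then obtain W where W: "open W" "chart M x x \<in> W" "W \<subseteq> chart_img M x" "\<forall>z\<in>W. param M x z \<in> chart_dom M p"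
   "smooth_on W (%z. chart M p (param M x z))"
  unfolding rep_smooth_def by blast
 let ?T = "W \<inter> (%z. chart M p (param M x z)) -` V"
 have "open ?T"
  by (rule open_smooth_vimage[OF W(1,5) V(1)])
 moreover have "chart M x x \<in> ?T"
 proof -
  have "v \<in> chart_img M p" using v(1) V(2) by blast
  then have "chart M p x \<in> V" using v chart_param[OF M] by simp
  then show ?thesis using W(2) by (simp add: param_center[OF M xM])
 qed
 moreover have "param M x ` ?T \<subseteq> param M p ` V"
 proof
  fix y assume "y \<in> param M x ` ?T"
  then obtain z where z: "z \<in> ?T" "y = param M x z" by blast
  have "y = param M p (chart M p y)" using z W(4) param_chart[OF M p] by auto
  then show "y \<in> param M p ` V" using z by auto
 qed
 ultimately show "\<exists>U. open U \<and> chart M x x \<in> U \<and> U \<subseteq> chart_img M x \<and> param M x ` U \<subseteq> param M p ` V"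
  using W(3) by blast
qed

lemma smooth_manifold_prod:
 assumes M: "smooth_manifold M" and N: "smooth_manifold N"
 shows "smooth_manifold (prod_mfd M N)"
proof -
 note Ma = smooth_manifold_atlas[OF M] and Na = smooth_manifold_atlas[OF N]
 note E = atlas_prod_mfd[OF Ma Na]
 show ?thesis
 proof (rule smooth_manifold_initial[OF E M N, of fst snd])
  show "smooth_at (prod_mfd M N) M fst z" "smooth_at (prod_mfd M N) N snd z" if "z \<in> points (prod_mfd M N)" for z
   using that smooth_at_fst[OF Ma Na] smooth_at_snd[OF Ma Na] by auto
  fix U z assume U: "openin (mfd_topology (prod_mfd M N)) U" "z \<in> U"
  then have "z \<in> points (prod_mfd M N)" unfolding openin_mfd_topology[OF E] by blast
  then obtain p q where z: "z = (p, q)" "p \<in> points M" "q \<in> points N" by auto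
  obtain V where V: "open V" "chart (prod_mfd M N) z z \<in> V" "V \<subseteq> chart_img (prod_mfd M N) z" "param (prod_mfd M N) z ` V \<subseteq> U"
   using openin_mfdD[OF E U] by blast
  obtain V1 V2 where W: "open V1" "open V2" "chart M p p \<in> V1" "chart N q q \<in> V2" "V1 \<times> V2 \<subseteq> V"
  proof (rule open_prod_elim[OF V(1,2)])
   fix A B assume "open A" "open B" "chart (prod_mfd M N) z z \<in> A \<times> B" "A \<times> B \<subseteq> V"
   then show thesis using that[of A B] z(1) by simp
  qed
  have im: "V1 \<times> V2 \<subseteq> chart_img M p \<times> chart_img N q"
   using W(5) V(3) z(1) chart_img_prod_mfd[of M N z] by auto
  then have im': "V1 \<subseteq> chart_img M p" "V2 \<subseteq> chart_img N q" using W(3,4) by auto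
  show "\<exists>A C. openin (mfd_topology M) A \<and> openin (mfd_topology N) C \<and> fst z \<in> A \<and> snd z \<in> C \<and>
    (\<forall>y\<in>points (prod_mfd M N). fst y \<in> A \<longrightarrow> snd y \<in> C \<longrightarrow> y \<in> U)"
  proof (intro exI conjI ballI impI)
   show "openin (mfd_topology M) (param M p ` V1)" by (rule openin_param_image[OF Ma z(2) W(1) im'(1)])
   show "openin (mfd_topology N) (param N q ` V2)" by (rule openin_param_image[OF Na z(3) W(2) im'(2)])
   show "fst z \<in> param M p ` V1" using W(3) z param_center[OF Ma z(2)] by (metis fst_conv imageI)
   show "snd z \<in> param N q ` V2" using W(4) z param_center[OF Na z(3)] by (metis snd_conv imageI)
   fix y assume "fst y \<in> param M p ` V1" "snd y \<in> param N q ` V2"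
   then obtain u v where uv: "u \<in> V1" "v \<in> V2" "y = (param M p u, param N q v)" by (cases y) auto
   then have "y = param (prod_mfd M N) z (u, v)"
    using param_prod_mfd[OF Ma Na z(2,3) subsetD[OF im'(1)] subsetD[OF im'(2)]] z(1) by simp
   then show "y \<in> U" using uv W(5) V(4) by auto
  qed
 qed (auto simp: prod_eq_iff)
qed

section \<open>Trivialisations and fibre products\<close>

text \<open>A manifold \<open>E\<close> whose charts at \<open>z\<close> are obtained from those of \<open>B\<close> through an identification
  \<open>\<Phi> z\<close> of \<open>W z\<close> with an open subset of \<open>B\<close>.\<close>

locale modelled =
 fixes E :: "('m, 'e::findim_normed_vector) mfd" and B :: "('b, 'e) mfd"
  and W :: "'m => 'm set" and \<Phi> :: "'m => 'm => 'b"
 assumes B: "mfd_atlas B"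
  and center: "z \<in> points E ==> z \<in> W z"
  and W: "z \<in> points E ==> W z \<subseteq> points E"
  and dom: "z \<in> points E ==> chart_dom E z = {y \<in> W z. \<Phi> z y \<in> chart_dom B (\<Phi> z z)}"
  and chart: "z \<in> points E ==> y \<in> W z ==> chart E z y = chart B (\<Phi> z z) (\<Phi> z y)"
  and inj: "z \<in> points E ==> inj_on (\<Phi> z) (W z)"
  and opn: "z \<in> points E ==> w \<in> points E ==> openin (mfd_topology B) (\<Phi> z ` (W z \<inter> W w))"
  and trans: "z \<in> points E ==> w \<in> points E ==> y \<in> W z ==> y \<in> W w ==>
   smooth_at B B (%b. \<Phi> w (inv_into (W z) (\<Phi> z) b)) (\<Phi> z y)"

begin

abbreviation "\<Psi> z w \<equiv> %b. \<Phi> w (inv_into (W z) (\<Phi> z) b)"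

lemma Phi_points: "z \<in> points E ==> y \<in> W z ==> \<Phi> z y \<in> points B"
 using trans[of z z y] by (simp add: smooth_at_def)

lemma Psi: "z \<in> points E ==> y \<in> W z ==> \<Psi> z w (\<Phi> z y) = \<Phi> w y"
 using inj[of z] by (simp add: inv_into_f_f)

lemma img: "z \<in> points E ==> chart_img E z = chart B (\<Phi> z z) ` (\<Phi> z ` W z \<inter> chart_dom B (\<Phi> z z))"
 unfolding chart_img_def dom by (force simp: chart)

lemma param_eq:
 assumes z: "z \<in> points E" and u: "u \<in> chart_img E z"
 shows "\<Phi> z (param E z u) = param B (\<Phi> z z) u" "param E z u \<in> W z" "u \<in> chart_img B (\<Phi> z z)"
  "param E z u = inv_into (W z) (\<Phi> z) (param B (\<Phi> z z) u)"
proof -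
 have zB: "\<Phi> z z \<in> points B" by (rule Phi_points[OF z center[OF z]])
 obtain y where y: "y \<in> W z" "\<Phi> z y \<in> chart_dom B (\<Phi> z z)" "u = chart B (\<Phi> z z) (\<Phi> z y)"
  using u unfolding img[OF z] by blast
 have inj': "inj_on (chart E z) (chart_dom E z)"
  using inj[OF z] atlas_inj[OF B zB] unfolding dom[OF z] by (auto simp: inj_on_def chart[OF z])
 have "param E z (chart E z y) = y"
  unfolding param_def by (rule inv_into_f_f[OF inj']) (simp add: dom[OF z] y)
 then have p: "param E z u = y" using y chart[OF z y(1)] by simp
 have b: "param B (\<Phi> z z) u = \<Phi> z y" unfolding y(3) by (rule param_chart[OF B zB y(2)])
 show "\<Phi> z (param E z u) = param B (\<Phi> z z) u" "param E z u \<in> W z" using p b y by simp_all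
 show "u \<in> chart_img B (\<Phi> z z)" unfolding y(3) using y(2) by (simp add: chart_img_def)
 show "param E z u = inv_into (W z) (\<Phi> z) (param B (\<Phi> z z) u)"
  unfolding p b using inj[OF z] y(1) by (simp add: inv_into_f_f)
qed

lemma overlap:
 assumes z: "z \<in> points E" and w: "w \<in> points E"
 shows "chart E z ` (chart_dom E z \<inter> chart_dom E w) =
  chart B (\<Phi> z z) ` ({b \<in> \<Phi> z ` (W z \<inter> W w). \<Psi> z w b \<in> chart_dom B (\<Phi> w w)} \<inter> chart_dom B (\<Phi> z z))"
proof -
 have "y \<in> W z ==> chart B (\<Phi> z z) (\<Phi> z y) = chart E z y" for y by (rule chart[OF z, symmetric])
 then show ?thesis unfolding dom[OF z] dom[OF w] by (force simp: Psi[OF z] image_iff)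
qed

lemma open_overlap:
 assumes z: "z \<in> points E" and w: "w \<in> points E"
 shows "open (chart E z ` (chart_dom E z \<inter> chart_dom E w))"
proof -
 have "openin (mfd_topology B) {b \<in> \<Phi> z ` (W z \<inter> W w). \<Psi> z w b \<in> chart_dom B (\<Phi> w w)}"
  by (rule openin_smooth_preimage[OF B B opn[OF z w] _ openin_chart_dom[OF B Phi_points[OF w center[OF w]]]])
   (use trans[OF z w] in auto)
 then show ?thesis unfolding overlap[OF z w]
  using Phi_points[OF z center[OF z]] unfolding openin_mfd_topology[OF B] by blast
qed

lemma atlas: "mfd_atlas E"
 unfolding mfd_atlas_def
proof (intro conjI ballI)
 fix z assume z: "z \<in> points E"
 have zB: "\<Phi> z z \<in> points B" by (rule Phi_points[OF z center[OF z]])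
 show "z \<in> chart_dom E z" using atlas_dom[OF B zB] center[OF z] by (simp add: dom[OF z])
 show "chart_dom E z \<subseteq> points E" using W[OF z] by (auto simp: dom[OF z])
 show "inj_on (chart E z) (chart_dom E z)"
  using inj[OF z] atlas_inj[OF B zB] unfolding dom[OF z] by (auto simp: inj_on_def chart[OF z])
 show "open (chart_img E z)" using open_overlap[OF z z] by (simp add: chart_img_def)
 fix w assume w: "w \<in> points E"
 have wB: "\<Phi> w w \<in> points B" by (rule Phi_points[OF w center[OF w]])
 show "open (chart E z ` (chart_dom E z \<inter> chart_dom E w))" by (rule open_overlap[OF z w])
 show "smooth_on (chart E z ` (chart_dom E z \<inter> chart_dom E w)) (chart E w \<circ> param E z)"
 proof (rule smooth_on_local)
  fix u assume u: "u \<in> chart E z ` (chart_dom E z \<inter> chart_dom E w)"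
  then obtain y where y: "y \<in> W z" "y \<in> W w" "\<Phi> z y \<in> chart_dom B (\<Phi> z z)" "\<Phi> w y \<in> chart_dom B (\<Phi> w w)"
   "u = chart B (\<Phi> z z) (\<Phi> z y)" unfolding dom[OF z] dom[OF w] by (auto simp: chart[OF z])
  have "rep_smooth B B (\<Psi> z w) (\<Phi> z z) (\<Phi> w w) u"
   unfolding y(5) by (rule smooth_at_rep[OF B B trans[OF z w y(1,2)] zB y(3) wB]) (simp add: Psi[OF z y(1)] y(4))
  from rep_smooth_shrink[OF this open_overlap[OF z w] u] obtain V where
   V: "open V" "u \<in> V" "V \<subseteq> chart E z ` (chart_dom E z \<inter> chart_dom E w)"
    "smooth_on V (%v. chart B (\<Phi> w w) (\<Psi> z w (param B (\<Phi> z z) v)))" by blast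
  have "smooth_on V (chart E w \<circ> param E z)"
  proof (rule smooth_on_cong[OF V(1,4)])
   fix v assume v: "v \<in> V"
   then obtain x where x: "x \<in> chart_dom E z" "x \<in> chart_dom E w" "v = chart E z x" using V(3) by blast
   have vi: "v \<in> chart_img E z" unfolding x(3) chart_img_def using x(1) by blast
   have "\<Phi> z x \<in> chart_dom B (\<Phi> z z)" "x \<in> W z" "x \<in> W w" using x(1,2) by (auto simp: dom[OF z] dom[OF w])
   then have "param B (\<Phi> z z) v = \<Phi> z x" unfolding x(3) by (simp add: chart[OF z] param_chart[OF B zB])
   then have "param E z v = x" using param_eq(4)[OF z vi] inj[OF z] \<open>x \<in> W z\<close> by (simp add: inv_into_f_f)
   then show "chart B (\<Phi> w w) (\<Psi> z w (param B (\<Phi> z z) v)) = (chart E w \<circ> param E z) v"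
    using \<open>param B (\<Phi> z z) v = \<Phi> z x\<close> \<open>x \<in> W z\<close> \<open>x \<in> W w\<close> by (simp add: Psi[OF z] chart[OF w])
  qed
  then show "\<exists>U. open U \<and> u \<in> U \<and> smooth_on U (chart E w \<circ> param E z)" using V by blast
 qed
qed

lemma smooth_at_Phi:
 assumes z: "z \<in> points E" and y: "y \<in> W z"
 shows "smooth_at E B (\<Phi> z) y"
proof -
 have yE: "y \<in> points E" using W[OF z] y by blast
 have yB: "\<Phi> y y \<in> points B" by (rule Phi_points[OF yE center[OF yE]])
 have "smooth_at B B (\<Psi> y z) (\<Phi> y y)" by (rule trans[OF yE z center[OF yE] y])
 then have "rep_smooth B B (\<Psi> y z) (\<Phi> y y) (\<Phi> z y) (chart E y y)"
  by (simp add: smooth_at_def Psi[OF yE center[OF yE]] chart[OF yE center[OF yE]])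
 from rep_smooth_shrink[OF this atlas_open[OF atlas yE] chart_center_img[OF atlas yE]] obtain V where
  V: "open V" "chart E y y \<in> V" "V \<subseteq> chart_img E y" "\<forall>v\<in>V. \<Psi> y z (param B (\<Phi> y y) v) \<in> chart_dom B (\<Phi> z y)"
   "smooth_on V (%v. chart B (\<Phi> z y) (\<Psi> y z (param B (\<Phi> y y) v)))" by blast
 have e: "inv_into (W y) (\<Phi> y) (param B (\<Phi> y y) v) = param E y v" if "v \<in> V" for v
  using param_eq(4)[OF yE, of v] V(3) that by auto
 have "smooth_on V (%v. chart B (\<Phi> z y) (\<Phi> z (param E y v)))"
  by (rule smooth_on_cong[OF V(1,5)]) (simp add: e)
 then show ?thesis unfolding smooth_at_def rep_smooth_def
  using V e Phi_points[OF z y] yE by auto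
qed

text \<open>Maps into \<open>E\<close> are tested on the model \<open>B\<close>, through the
  identification attached to the image point \<open>f x0\<close>; the open set \<open>U\<close>
  keeps nearby values inside its domain.\<close>

lemma smooth_atI:
 assumes X: "mfd_atlas X" and f: "smooth_at X B (%x. \<Phi> (f x0) (f x)) x0"
  and U: "openin (mfd_topology X) U" "x0 \<in> U" "\<And>x. x \<in> U ==> f x \<in> W (f x0)" and f0: "f x0 \<in> points E"
 shows "smooth_at X E f x0"
proof -
 have x0: "x0 \<in> points X" using f by (simp add: smooth_at_def)
 obtain A where A: "open A" "chart X x0 x0 \<in> A" "A \<subseteq> chart_img X x0" "param X x0 ` A \<subseteq> U"
  using openin_mfdD[OF X U(1,2)] by blast
 have "rep_smooth X B (%x. \<Phi> (f x0) (f x)) x0 (\<Phi> (f x0) (f x0)) (chart X x0 x0)" using f by (simp add: smooth_at_def)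
 from rep_smooth_shrink[OF this A(1,2)] obtain V where
  V: "open V" "chart X x0 x0 \<in> V" "V \<subseteq> A" "V \<subseteq> chart_img X x0"
   "\<forall>v\<in>V. \<Phi> (f x0) (f (param X x0 v)) \<in> chart_dom B (\<Phi> (f x0) (f x0))"
   "smooth_on V (%v. chart B (\<Phi> (f x0) (f x0)) (\<Phi> (f x0) (f (param X x0 v))))" by blast
 have W': "f (param X x0 v) \<in> W (f x0)" if "v \<in> V" for v using that U(3) A(4) V(3) by blast
 have "smooth_on V (%v. chart E (f x0) (f (param X x0 v)))"
  by (rule smooth_on_cong[OF V(1,6)]) (simp add: chart[OF f0 W'])
 then show ?thesis unfolding smooth_at_def rep_smooth_def
  using V W' x0 f0 by (auto simp: dom[OF f0])
qed

lemma openin_W: "z \<in> points E ==> openin (mfd_topology E) (W z)"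
proof (rule openin_mfdI[OF atlas], intro conjI)
 fix y assume z: "z \<in> points E" and y: "y \<in> W z"
 then show yE: "y \<in> points E" using W by blast
 have o: "open (chart B (\<Phi> y y) ` (\<Phi> y ` (W y \<inter> W z) \<inter> chart_dom B (\<Phi> y y)))"
  using opn[OF yE z] Phi_points[OF yE center[OF yE]] unfolding openin_mfd_topology[OF B] by blast
 let ?V = "chart B (\<Phi> y y) ` (\<Phi> y ` (W y \<inter> W z) \<inter> chart_dom B (\<Phi> y y))"
 have sub: "?V \<subseteq> chart_img E y" unfolding img[OF yE] by blast
 moreover have "chart E y y \<in> ?V"
  using center[OF yE] y atlas_dom[OF B Phi_points[OF yE center[OF yE]]] by (auto simp: chart[OF yE center[OF yE]])
 moreover have "param E y ` ?V \<subseteq> W z"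
 proof
  fix x assume "x \<in> param E y ` ?V"
  then obtain p where p: "p \<in> W y" "p \<in> W z" "\<Phi> y p \<in> chart_dom B (\<Phi> y y)" "x = param E y (chart B (\<Phi> y y) (\<Phi> y p))" by blast
  have "chart B (\<Phi> y y) (\<Phi> y p) = chart E y p" using chart[OF yE p(1)] by simp
  then have "x = p" using p param_chart[OF atlas yE, of p] by (simp add: dom[OF yE])
  then show "x \<in> W z" using p by simp
 qed
 ultimately show "\<exists>V. open V \<and> chart E y y \<in> V \<and> V \<subseteq> chart_img E y \<and> param E y ` V \<subseteq> W z"
  using o by blast
qed

end

section \<open>Local trivialisations\<close>

definition triv_inv :: "('p, 'pe::findim_normed_vector, 'q, 'qe::findim_normed_vector, 'g, 'ge::findim_normed_vector) pbundle
  => 'q set => ('p => 'g) => 'q \<times> 'g => 'p" where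
 "triv_inv P U h = inv_into {p \<in> points (total P). proj P p \<in> U} (%p. (proj P p, h p))"

lemma points_open_submfd [simp]: "points (open_submfd M U) = points M \<inter> U"
 by (simp add: open_submfd_def)

text \<open>With \<open>U \<times> UNIV\<close> the two records agree at every argument of
  \<open>chart_dom\<close>. With \<open>U \<times> points N\<close> they would agree only at points
  of \<open>N\<close>, where chart domains are known to consist of points.\<close>

lemma prod_open_submfd: "prod_mfd (open_submfd M U) N = open_submfd (prod_mfd M N) (U \<times> UNIV)"
 by (auto simp: prod_mfd_def open_submfd_def fun_eq_iff)

lemma openin_prod_mfd:
 assumes M: "mfd_atlas M" and N: "mfd_atlas N" and U: "openin (mfd_topology M) U"
 shows "openin (mfd_topology (prod_mfd M N)) (U \<times> points N)"
proof -
 have UM: "U \<subseteq> points M" using U unfolding openin_mfd_topology[OF M] by blast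
 have "openin (mfd_topology (prod_mfd M N)) {z \<in> points (prod_mfd M N). fst z \<in> U}"
  by (rule openin_smooth_preimage[OF atlas_prod_mfd[OF M N] M openin_points[OF atlas_prod_mfd[OF M N]] _ U])
   (simp add: smooth_at_fst[OF M N])
 also have "{z \<in> points (prod_mfd M N). fst z \<in> U} = U \<times> points N" using UM by auto
 finally show ?thesis .
qed

lemma smooth_at_prod_open_submfd:
 assumes M: "mfd_atlas M" and N: "mfd_atlas N" and U: "openin (mfd_topology M) U" and z: "z \<in> U \<times> points N"
 shows "smooth_at (prod_mfd (open_submfd M U) N) K f z \<longleftrightarrow> smooth_at (prod_mfd M N) K f z"
proof -
 note MN = atlas_prod_mfd[OF M N] and oU = openin_prod_mfd[OF M N U]
 have UM: "U \<subseteq> points M" using U unfolding openin_mfd_topology[OF M] by blast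
 obtain p q where pq: "z = (p, q)" "p \<in> U" "q \<in> points N" using z by blast
 have pM: "p \<in> points M" using UM pq by blast
 have e: "param (open_submfd (prod_mfd M N) (U \<times> UNIV)) z v = param (open_submfd (prod_mfd M N) (U \<times> points N)) z v"
  and e2: "chart_dom (open_submfd (prod_mfd M N) (U \<times> UNIV)) z = chart_dom (open_submfd (prod_mfd M N) (U \<times> points N)) z" for v
 proof -
  have "chart_dom M p \<times> chart_dom N q \<inter> U \<times> UNIV = chart_dom M p \<times> chart_dom N q \<inter> U \<times> points N"
   using atlas_dom_points[OF N pq(3)] by auto
  then show "param (open_submfd (prod_mfd M N) (U \<times> UNIV)) z v = param (open_submfd (prod_mfd M N) (U \<times> points N)) z v"
   "chart_dom (open_submfd (prod_mfd M N) (U \<times> UNIV)) z = chart_dom (open_submfd (prod_mfd M N) (U \<times> points N)) z"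
   by (simp_all add: param_def open_submfd_def pq(1) del: Times_Int_Times)
 qed
 have "smooth_at (open_submfd (prod_mfd M N) (U \<times> UNIV)) K f z \<longleftrightarrow> smooth_at (open_submfd (prod_mfd M N) (U \<times> points N)) K f z"
  unfolding smooth_at_def rep_smooth_def chart_img_def e e2
  using pq pM by (simp add: open_submfd_def)
 then show ?thesis unfolding prod_open_submfd
  using smooth_at_open_submfd_dom[OF MN oU z] by blast
qed

lemma principal_bundle_atlas:
 assumes "principal_bundle P"
 shows "mfd_atlas (total P)" "mfd_atlas (base P)" "mfd_atlas (lmfd (sgroup P))"
  "points (lmfd (sgroup P)) = carrier (lgroup (sgroup P))" "group (lgroup (sgroup P))"
 using assms by (simp_all add: principal_bundle_def lie_group_def smooth_manifold_atlas)

lemma smooth_at_proj: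
 assumes P: "principal_bundle P" and p: "p \<in> points (total P)"
 shows "smooth_at (total P) (base P) (proj P) p"
proof -
 have "smooth_map (total P) (base P) (proj P)" using P by (simp add: principal_bundle_def)
 then show ?thesis using smooth_map_iff_smooth_at[OF principal_bundle_atlas(1,2)[OF P]] p by blast
qed

lemma proj_points: "principal_bundle P ==> p \<in> points (total P) ==> proj P p \<in> points (base P)"
 by (rule smooth_at_points(2)[OF smooth_at_proj])

lemma openin_proj_preimage:
 assumes P: "principal_bundle P" and U: "openin (mfd_topology (base P)) U"
 shows "openin (mfd_topology (total P)) {p \<in> points (total P). proj P p \<in> U}"
 by (rule openin_smooth_preimage[OF principal_bundle_atlas(1,2)[OF P] openin_points[OF principal_bundle_atlas(1)[OF P]]
    smooth_at_proj[OF P] U])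

text \<open>Unpacks the diffeomorphism into facts about the full manifolds \<open>total P\<close>
  and \<open>base P\<close>, so that open submanifolds and their restricted charts disappear from
  later arguments.\<close>

lemma local_triv_facts:
 assumes P: "principal_bundle P" and L: "local_triv P U h"
 shows "openin (mfd_topology (base P)) U"
  and "\<And>p. p \<in> points (total P) ==> proj P p \<in> U ==> smooth_at (total P) (lmfd (sgroup P)) h p"
  and "\<And>p. p \<in> points (total P) ==> proj P p \<in> U ==> triv_inv P U h (proj P p, h p) = p"
  and "\<And>x g. x \<in> U ==> g \<in> points (lmfd (sgroup P)) ==> triv_inv P U h (x, g) \<in> points (total P)"
  and "\<And>x g. x \<in> U ==> g \<in> points (lmfd (sgroup P)) ==> proj P (triv_inv P U h (x, g)) = x"
  and "\<And>x g. x \<in> U ==> g \<in> points (lmfd (sgroup P)) ==> h (triv_inv P U h (x, g)) = g"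
  and "\<And>x g. x \<in> U ==> g \<in> points (lmfd (sgroup P)) ==>
    smooth_at (prod_mfd (base P) (lmfd (sgroup P))) (total P) (triv_inv P U h) (x, g)"
  and "\<And>p a. p \<in> points (total P) ==> proj P p \<in> U ==> a \<in> carrier (lgroup (sgroup P)) ==>
    h (act P p a) = h p \<otimes>\<^bsub>lgroup (sgroup P)\<^esub> a"
proof -
 let ?T = "total P" and ?Q = "base P" and ?G = "lmfd (sgroup P)"
 let ?TU = "{p \<in> points ?T. proj P p \<in> U}"
 note At = principal_bundle_atlas[OF P]
 show oU: "openin (mfd_topology ?Q) U" using L by (simp add: local_triv_def)
 have UQ: "U \<subseteq> points ?Q" using oU unfolding openin_mfd_topology[OF At(2)] by blast
 note oT = openin_proj_preimage[OF P oU]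
 have AT: "mfd_atlas (open_submfd ?T ?TU)" by (rule atlas_open_submfd[OF At(1) oT])
 have AQ: "mfd_atlas (prod_mfd (open_submfd ?Q U) ?G)"
  by (intro atlas_prod_mfd atlas_open_submfd At oU)
 have pT: "points (open_submfd ?T ?TU) = ?TU" by auto
 have D: "diffeomorphism (open_submfd ?T ?TU) (prod_mfd (open_submfd ?Q U) ?G) (%p. (proj P p, h p))"
  using L by (simp add: local_triv_def)
 have bij: "bij_betw (%p. (proj P p, h p)) ?TU (U \<times> points ?G)"
 proof -
  have "points ?Q \<inter> U = U" using UQ by blast
  then show ?thesis using D unfolding diffeomorphism_def pT by simp
 qed
 have s1: "smooth_at (open_submfd ?T ?TU) (prod_mfd (open_submfd ?Q U) ?G) (%p. (proj P p, h p)) p" if "p \<in> ?TU" for p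
  using D smooth_map_iff_smooth_at[OF AT AQ] that unfolding diffeomorphism_def pT by blast
 have s2: "smooth_at (prod_mfd (open_submfd ?Q U) ?G) (open_submfd ?T ?TU) (triv_inv P U h) z" if "z \<in> U \<times> points ?G" for z
 proof -
  have "z \<in> points (prod_mfd (open_submfd ?Q U) ?G)" using that UQ by auto
  then show ?thesis using D smooth_map_iff_smooth_at[OF AQ AT] unfolding diffeomorphism_def pT triv_inv_def by blast
 qed
 show "smooth_at ?T ?G h p" if p: "p \<in> points ?T" "proj P p \<in> U" for p
 proof -
  have "smooth_at (open_submfd ?T ?TU) ?G (%z. snd (proj P z, h z)) p"
  proof (rule smooth_at_compose[OF AT AQ s1])
   show "p \<in> ?TU" using p by blast
   have "(proj P p, h p) \<in> U \<times> points ?G" using bij p by (auto simp: bij_betw_def)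
   then have "(proj P p, h p) \<in> points (open_submfd ?Q U) \<times> points ?G" using UQ by auto
   then show "smooth_at (prod_mfd (open_submfd ?Q U) ?G) ?G snd (proj P p, h p)"
    by (rule smooth_at_snd[OF atlas_open_submfd[OF At(2) oU] At(3)])
  qed
  then have "smooth_at (open_submfd ?T ?TU) ?G h p" by simp
  then show ?thesis using smooth_at_open_submfd_dom[OF At(1) oT, of p ?G h] p by blast
 qed
 show "triv_inv P U h (proj P p, h p) = p" if "p \<in> points ?T" "proj P p \<in> U" for p
  unfolding triv_inv_def using bij that by (intro inv_into_f_f) (auto simp: bij_betw_def)
 have inv: "triv_inv P U h (x, g) \<in> ?TU" "(proj P (triv_inv P U h (x, g)), h (triv_inv P U h (x, g))) = (x, g)"
  if "x \<in> U" "g \<in> points ?G" for x g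
 proof -
  have "(x, g) \<in> (%p. (proj P p, h p)) ` ?TU" using bij that by (auto simp: bij_betw_def)
  then show "triv_inv P U h (x, g) \<in> ?TU" "(proj P (triv_inv P U h (x, g)), h (triv_inv P U h (x, g))) = (x, g)"
   unfolding triv_inv_def by (rule inv_into_into, rule f_inv_into_f)
 qed
 show "triv_inv P U h (x, g) \<in> points ?T" "proj P (triv_inv P U h (x, g)) = x" "h (triv_inv P U h (x, g)) = g"
  if "x \<in> U" "g \<in> points ?G" for x g
  using inv[OF that] by auto
 show "smooth_at (prod_mfd ?Q ?G) ?T (triv_inv P U h) (x, g)" if "x \<in> U" "g \<in> points ?G" for x g
  using smooth_at_open_submfd_ran[OF s2[of "(x, g)"]] smooth_at_prod_open_submfd[OF At(2,3) oU, of "(x, g)"] that by auto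
 show "h (act P p a) = h p \<otimes>\<^bsub>lgroup (sgroup P)\<^esub> a"
  if "p \<in> points ?T" "proj P p \<in> U" "a \<in> carrier (lgroup (sgroup P))" for p a
  using L that by (simp add: local_triv_def)
qed

text \<open>The converse direction: an explicit inverse \<tau> certifies the trivialisation, and
  bijectivity together with the passage to open submanifolds is dealt with once.\<close>

lemma local_trivI:
 fixes P :: "('p, 'pe::findim_normed_vector, 'q, 'qe::findim_normed_vector, 'g, 'ge::findim_normed_vector) pbundle"
 assumes T: "mfd_atlas (total P)" and Q: "mfd_atlas (base P)" and G: "mfd_atlas (lmfd (sgroup P))"
  and oU: "openin (mfd_topology (base P)) U"
  and pr: "\<And>p. p \<in> points (total P) ==> smooth_at (total P) (base P) (proj P) p"
  and h: "\<And>p. p \<in> points (total P) ==> proj P p \<in> U ==> smooth_at (total P) (lmfd (sgroup P)) h p"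
  and t1: "\<And>p. p \<in> points (total P) ==> proj P p \<in> U ==> \<tau> (proj P p, h p) = p"
  and t2: "\<And>x g. x \<in> U ==> g \<in> points (lmfd (sgroup P)) ==> proj P (\<tau> (x, g)) = x \<and> h (\<tau> (x, g)) = g"
  and t3: "\<And>x g. x \<in> U ==> g \<in> points (lmfd (sgroup P)) ==>
    smooth_at (prod_mfd (base P) (lmfd (sgroup P))) (total P) \<tau> (x, g)"
  and eqv: "\<And>p a. p \<in> points (total P) ==> proj P p \<in> U ==> a \<in> carrier (lgroup (sgroup P)) ==>
    h (act P p a) = h p \<otimes>\<^bsub>lgroup (sgroup P)\<^esub> a"
 shows "local_triv P U h"
proof -
 let ?T = "total P" and ?Q = "base P" and ?G = "lmfd (sgroup P)"
 let ?TU = "{p \<in> points ?T. proj P p \<in> U}"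
 let ?f = "%p. (proj P p, h p)"
 have UQ: "U \<subseteq> points ?Q" using oU unfolding openin_mfd_topology[OF Q] by blast
 have oT: "openin (mfd_topology ?T) ?TU"
  by (rule openin_smooth_preimage[OF T Q openin_points[OF T] pr oU])
 have AT: "mfd_atlas (open_submfd ?T ?TU)" by (rule atlas_open_submfd[OF T oT])
 have AU: "mfd_atlas (open_submfd ?Q U)" by (rule atlas_open_submfd[OF Q oU])
 have AQ: "mfd_atlas (prod_mfd (open_submfd ?Q U) ?G)" by (rule atlas_prod_mfd[OF AU G])
 have pT: "points (open_submfd ?T ?TU) = ?TU" by auto
 have pQ: "points (prod_mfd (open_submfd ?Q U) ?G) = U \<times> points ?G" using UQ by auto
 have tT: "\<tau> (x, g) \<in> ?TU" if "x \<in> U" "g \<in> points ?G" for x g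
  using t3[OF that] t2[OF that] that by (simp add: smooth_at_def)
 have hG: "h p \<in> points ?G" if "p \<in> ?TU" for p using h that by (auto simp: smooth_at_def)
 have img: "?f ` ?TU = U \<times> points ?G"
 proof
  show "?f ` ?TU \<subseteq> U \<times> points ?G" using hG by auto
  show "U \<times> points ?G \<subseteq> ?f ` ?TU"
  proof
   fix z assume "z \<in> U \<times> points ?G"
   then obtain x g where z: "z = (x, g)" "x \<in> U" "g \<in> points ?G" by blast
   then have "z = ?f (\<tau> (x, g))" using t2 by simp
   then show "z \<in> ?f ` ?TU" using tT[OF z(2,3)] by blast
  qed
 qed
 have inj: "inj_on ?f ?TU" by (rule inj_on_inverseI[of _ \<tau>]) (simp add: t1)
 have s1: "smooth_map (open_submfd ?T ?TU) (prod_mfd (open_submfd ?Q U) ?G) ?f"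
  unfolding smooth_map_iff_smooth_at[OF AT AQ] pT
 proof
  fix p assume p: "p \<in> ?TU"
  have "smooth_at ?T (open_submfd ?Q U) (proj P) p"
   by (rule smooth_at_into_open_submfd[OF T Q pr oU]) (use p in auto)
  from smooth_at_Pair[OF this h[of p]] p
  have "smooth_at ?T (prod_mfd (open_submfd ?Q U) ?G) ?f p" by simp
  then show "smooth_at (open_submfd ?T ?TU) (prod_mfd (open_submfd ?Q U) ?G) ?f p"
   using smooth_at_open_submfd_dom[OF T oT p] by blast
 qed
 have inv: "inv_into ?TU ?f z = \<tau> z" if zU: "z \<in> U \<times> points ?G" for z
 proof -
  obtain x g where z: "z = (x, g)" "x \<in> U" "g \<in> points ?G" using zU by blast
  have "inv_into ?TU ?f (?f (\<tau> z)) = \<tau> z" unfolding z(1) by (rule inv_into_f_f[OF inj tT[OF z(2,3)]])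
  then show ?thesis using t2[OF z(2,3)] z(1) by simp
 qed
 have s2: "smooth_map (prod_mfd (open_submfd ?Q U) ?G) (open_submfd ?T ?TU) (inv_into ?TU ?f)"
  unfolding smooth_map_iff_smooth_at[OF AQ AT]
 proof
  fix z assume "z \<in> points (prod_mfd (open_submfd ?Q U) ?G)"
  then have z: "z \<in> U \<times> points ?G" unfolding pQ .
  have "smooth_at (prod_mfd ?Q ?G) ?T \<tau> z" using t3 z by auto
  then have "smooth_at (prod_mfd (open_submfd ?Q U) ?G) ?T \<tau> z"
   using smooth_at_prod_open_submfd[OF Q G oU z] by blast
  then have *: "smooth_at (prod_mfd (open_submfd ?Q U) ?G) (open_submfd ?T ?TU) \<tau> z"
   by (rule smooth_at_into_open_submfd[OF AQ T _ oT]) (use tT z in auto)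
  show "smooth_at (prod_mfd (open_submfd ?Q U) ?G) (open_submfd ?T ?TU) (inv_into ?TU ?f) z"
  proof (rule smooth_at_cong[OF AQ openin_points[OF AQ] _ *])
   show "z \<in> points (prod_mfd (open_submfd ?Q U) ?G)" unfolding pQ by (rule z)
   show "\<tau> y = inv_into ?TU ?f y" if "y \<in> points (prod_mfd (open_submfd ?Q U) ?G)" for y
    using that unfolding pQ by (rule inv[symmetric])
  qed
 qed
 show ?thesis unfolding local_triv_def diffeomorphism_def pT pQ
  using oU s1 s2 inj img eqv by (auto simp: bij_betw_def)
qed

text \<open>\<open>\<Phi> z\<close> keeps the point of \<open>N\<close> and records the point of
  \<open>P\<close> by its group coordinate in the trivialisation that \<open>triv_at\<close> chooses
  at \<open>f (fst z)\<close>. The choice varies with \<open>z\<close>, so changes of trivialisation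
  enter the transition maps.\<close>

locale fibre_product_setup =
 fixes N :: "('n, 'ne::findim_normed_vector) mfd" and f :: "'n => 'q"
  and P :: "('p, 'pe::findim_normed_vector, 'q, 'qe::findim_normed_vector, 'g, 'ge::findim_normed_vector) pbundle"
 assumes N: "mfd_atlas N" and P: "principal_bundle P"
  and f: "\<And>n. n \<in> points N ==> smooth_at N (base P) f n"

begin

abbreviation "E \<equiv> fibre_product N f P"

abbreviation "G \<equiv> lmfd (sgroup P)"

abbreviation "domU z \<equiv> fst (triv_at P (f (fst z)))"

abbreviation "trivh z \<equiv> snd (triv_at P (f (fst z)))"

abbreviation "W z \<equiv> {y \<in> points E. f (fst y) \<in> domU z}"

abbreviation "\<Phi> z y \<equiv> (fst y, trivh z (snd y))"

abbreviation "\<tau> z \<equiv> triv_inv P (domU z) (trivh z)"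

lemmas At = principal_bundle_atlas[OF P]

lemma points_E: "points E = {(n, p). n \<in> points N \<and> p \<in> points (total P) \<and> f n = proj P p}"
 by (simp add: fibre_product_def Let_def)

lemma E_iff: "z \<in> points E \<longleftrightarrow> fst z \<in> points N \<and> snd z \<in> points (total P) \<and> f (fst z) = proj P (snd z)"
 by (cases z) (simp add: points_E)

lemma f_points: "n \<in> points N ==> f n \<in> points (base P)"
 using smooth_at_points(2)[OF f] .

lemma triv:
 assumes "n \<in> points N"
 shows "f n \<in> fst (triv_at P (f n)) \<and> local_triv P (fst (triv_at P (f n))) (snd (triv_at P (f n)))"
proof -
 have "\<exists>U h. f n \<in> U \<and> local_triv P U h" using P f_points[OF assms] by (simp add: principal_bundle_def)
 then have "\<exists>x. case x of (U, h) => f n \<in> U \<and> local_triv P U h" by auto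
 then have "case triv_at P (f n) of (U, h) => f n \<in> U \<and> local_triv P U h"
  unfolding triv_at_def by (rule someI_ex)
 then show ?thesis by (simp add: case_prod_unfold)
qed

lemma triv_z: "z \<in> points E ==> f (fst z) \<in> domU z" "z \<in> points E ==> local_triv P (domU z) (trivh z)"
 using triv[of "fst z"] unfolding E_iff by blast+

lemmas tf = local_triv_facts[OF P triv_z(2)]

lemma W_proj: "y \<in> W z ==> snd y \<in> points (total P) \<and> proj P (snd y) \<in> domU z"
 by (auto simp: E_iff)

lemma oW: "z \<in> points E ==> openin (mfd_topology N) {n \<in> points N. f n \<in> domU z}"
 by (rule openin_smooth_preimage[OF N At(2) openin_points[OF N] f tf(1)])

lemma trivh_points: "z \<in> points E ==> y \<in> W z ==> trivh z (snd y) \<in> points G"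
 using smooth_at_points(2)[OF tf(2)[of z "snd y"]] W_proj[of y z] by blast

lemma tau_Phi: "z \<in> points E ==> y \<in> W z ==> \<tau> z (f (fst y), trivh z (snd y)) = snd y"
 using tf(3)[of z "snd y"] W_proj[of y z] by (auto simp: E_iff)

lemma inj_Phi: "z \<in> points E ==> inj_on (\<Phi> z) (W z)"
proof (rule inj_on_inverseI)
 fix y assume z: "z \<in> points E" and y: "y \<in> W z"
 show "(fst (\<Phi> z y), \<tau> z (f (fst (\<Phi> z y)), snd (\<Phi> z y))) = y"
  using tau_Phi[OF z y] by (simp add: prod_eq_iff)
qed

lemma tau_W:
 assumes z: "z \<in> points E" and n: "n \<in> points N" "f n \<in> domU z" and g: "g \<in> points G"
 shows "(n, \<tau> z (f n, g)) \<in> W z" "\<Phi> z (n, \<tau> z (f n, g)) = (n, g)"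
 using tf(4-6)[OF z n(2) g] n by (auto simp: E_iff)

lemma inv_Phi:
 assumes z: "z \<in> points E" and n: "n \<in> points N" "f n \<in> domU z" and g: "g \<in> points G"
 shows "inv_into (W z) (\<Phi> z) (n, g) = (n, \<tau> z (f n, g))"
proof -
 have "inv_into (W z) (\<Phi> z) (\<Phi> z (n, \<tau> z (f n, g))) = (n, \<tau> z (f n, g))"
  by (rule inv_into_f_f[OF inj_Phi[OF z] tau_W(1)[OF assms]])
 then show ?thesis using tau_W(2)[OF assms] by simp
qed

lemma Phi_image:
 assumes z: "z \<in> points E" and w: "w \<in> points E"
 shows "\<Phi> z ` (W z \<inter> W w) = {n \<in> points N. f n \<in> domU z \<inter> domU w} \<times> points G" (is "?L = ?R")
proof
 show "?L \<subseteq> ?R" using trivh_points[OF z] by (auto simp: E_iff)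
 show "?R \<subseteq> ?L"
 proof
  fix b assume "b \<in> ?R"
  then obtain n g where b: "b = (n, g)" "n \<in> points N" "f n \<in> domU z" "f n \<in> domU w" "g \<in> points G" by blast
  have "(n, \<tau> z (f n, g)) \<in> W z \<inter> W w" using tau_W(1)[OF z b(2,3,5)] b(4) by auto
  moreover have "b = \<Phi> z (n, \<tau> z (f n, g))" using tau_W(2)[OF z b(2,3,5)] b(1) by simp
  ultimately show "b \<in> ?L" by blast
 qed
qed

lemma smooth_tau:
 assumes X: "mfd_atlas X" and z: "z \<in> points E" and n: "smooth_at X N n x" "f (n x) \<in> domU z"
  and g: "smooth_at X G g x"
 shows "smooth_at X (total P) (%y. \<tau> z (f (n y), g y)) x"
proof -
 have fn: "smooth_at X (base P) (%y. f (n y)) x"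
  by (rule smooth_at_compose[OF X N n(1) f]) (rule smooth_at_points(2)[OF n(1)])
 show ?thesis
  by (rule smooth_at_compose[OF X atlas_prod_mfd[OF At(2,3)] smooth_at_Pair[OF fn g] tf(7)[OF z n(2) smooth_at_points(2)[OF g]]])
qed

text \<open>A transition map sends \<open>(n, g)\<close> to \<open>n\<close> together with the group
  coordinate, in the trivialisation of \<open>w\<close>, of the point of \<open>P\<close> with
  coordinate \<open>g\<close> in the trivialisation of \<open>z\<close>. It is smooth because a
  trivialisation and the inverse of another one are.\<close>

sublocale m: modelled E "prod_mfd N G" "%z. W z" "%z. \<Phi> z"
proof
 note NG = atlas_prod_mfd[OF N At(3)]
 show "mfd_atlas (prod_mfd N G)" by (rule NG)
 fix z assume z: "z \<in> points E"
 show "z \<in> W z" using z triv_z(1) by blast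
 show "W z \<subseteq> points E" by blast
 show "inj_on (\<Phi> z) (W z)" by (rule inj_Phi[OF z])
 show "chart_dom E z = {y \<in> W z. \<Phi> z y \<in> chart_dom (prod_mfd N G) (\<Phi> z z)}"
  by (cases z) (auto simp: fibre_product_def Let_def case_prod_unfold)
 show "chart E z y = chart (prod_mfd N G) (\<Phi> z z) (\<Phi> z y)" if "y \<in> W z" for y
  by (cases z; cases y) (simp add: fibre_product_def Let_def case_prod_unfold)
 fix w assume w: "w \<in> points E"
 show "openin (mfd_topology (prod_mfd N G)) (\<Phi> z ` (W z \<inter> W w))"
 proof -
  have "openin (mfd_topology N) ({n \<in> points N. f n \<in> domU z} \<inter> {n \<in> points N. f n \<in> domU w})"
   by (rule openin_Int[OF oW[OF z] oW[OF w]])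
  also have "{n \<in> points N. f n \<in> domU z} \<inter> {n \<in> points N. f n \<in> domU w} = {n \<in> points N. f n \<in> domU z \<inter> domU w}" by blast
  finally show ?thesis unfolding Phi_image[OF z w] by (rule openin_prod_mfd[OF N At(3)])
 qed
 fix y assume y: "y \<in> W z" "y \<in> W w"
 have yb: "\<Phi> z y \<in> points (prod_mfd N G)" using trivh_points[OF z y(1)] y by (auto simp: E_iff)
 have 1: "smooth_at (prod_mfd N G) N fst (\<Phi> z y)" "smooth_at (prod_mfd N G) G snd (\<Phi> z y)"
  using smooth_at_fst[OF N At(3)] smooth_at_snd[OF N At(3)] yb by simp_all
 have 2: "smooth_at (prod_mfd N G) (total P) (%b. \<tau> z (f (fst b), snd b)) (\<Phi> z y)"
  by (rule smooth_tau[OF NG z 1(1) _ 1(2)]) (use y in simp)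
 have 3: "smooth_at (prod_mfd N G) G (%b. trivh w (\<tau> z (f (fst b), snd b))) (\<Phi> z y)"
 proof (rule smooth_at_compose[OF NG At(1) 2])
  have "\<tau> z (f (fst (\<Phi> z y)), snd (\<Phi> z y)) = snd y" using tau_Phi[OF z y(1)] by simp
  then show "smooth_at (total P) G (trivh w) (\<tau> z (f (fst (\<Phi> z y)), snd (\<Phi> z y)))"
   using tf(2)[OF w, of "snd y"] W_proj[OF y(2)] by simp
 qed
 have 4: "smooth_at (prod_mfd N G) (prod_mfd N G) (%b. (fst b, trivh w (\<tau> z (f (fst b), snd b)))) (\<Phi> z y)"
  by (rule smooth_at_Pair[OF 1(1) 3])
 show "smooth_at (prod_mfd N G) (prod_mfd N G) (%b. \<Phi> w (inv_into (W z) (\<Phi> z) b)) (\<Phi> z y)"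
 proof (rule smooth_at_cong[OF NG openin_prod_mfd[OF N At(3) oW[OF z]] _ 4])
  show "\<Phi> z y \<in> {n \<in> points N. f n \<in> domU z} \<times> points G"
   using yb y by simp
  fix b assume "b \<in> {n \<in> points N. f n \<in> domU z} \<times> points G"
  then obtain n g where b: "b = (n, g)" "n \<in> points N" "f n \<in> domU z" "g \<in> points G" by blast
  show "(fst b, trivh w (\<tau> z (f (fst b), snd b))) = \<Phi> w (inv_into (W z) (\<Phi> z) b)"
   unfolding b(1) inv_Phi[OF z b(2-4)] by simp
 qed
qed

lemma smooth_at_E_fst:
 assumes z: "z \<in> points E" shows "smooth_at E N fst z"
proof -
 have "\<Phi> z z \<in> points N \<times> points G" using m.Phi_points[OF z m.center[OF z]] by simp
 from smooth_at_compose[OF m.atlas m.B m.smooth_at_Phi[OF z m.center[OF z]] smooth_at_fst[OF N At(3) this]]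
 show ?thesis by simp
qed

text \<open>The component in \<open>P\<close> is not a coordinate of the charts; it is recovered
  from base point and group coordinate by the inverse trivialisation \<tau>.\<close>

lemma smooth_at_E_snd:
 assumes z: "z \<in> points E" shows "smooth_at E (total P) snd z"
proof -
 have "\<Phi> z z \<in> points N \<times> points G" using m.Phi_points[OF z m.center[OF z]] by simp
 from smooth_at_compose[OF m.atlas m.B m.smooth_at_Phi[OF z m.center[OF z]] smooth_at_snd[OF N At(3) this]]
 have 1: "smooth_at E G (%y. trivh z (snd y)) z" by simp
 have 2: "smooth_at E (total P) (%y. \<tau> z (f (fst y), trivh z (snd y))) z"
  by (rule smooth_tau[OF m.atlas z smooth_at_E_fst[OF z] triv_z(1)[OF z] 1])
 show ?thesis
  by (rule smooth_at_cong[OF m.atlas m.openin_W[OF z] m.center[OF z] 2]) (rule tau_Phi[OF z])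
qed

text \<open>The universal property of the fibre product. After \<open>\<Phi>\<close> only
  \<open>a\<close> and the group coordinate of \<open>c\<close> remain, and both are smooth; the
  equation over the base is needed on a neighbourhood, so that the values stay in the fibre
  product.\<close>

lemma smooth_at_into_E:
 assumes X: "mfd_atlas X" and a: "\<And>y. y \<in> V ==> smooth_at X N a y" and c: "\<And>y. y \<in> V ==> smooth_at X (total P) c y"
  and V: "openin (mfd_topology X) V" "x \<in> V" and eq: "\<And>y. y \<in> V ==> f (a y) = proj P (c y)"
 shows "smooth_at X E (%y. (a y, c y)) x"
proof (rule m.smooth_atI[OF X])
 have inE: "(a y, c y) \<in> points E" if "y \<in> V" for y
  using smooth_at_points(2)[OF a[OF that]] smooth_at_points(2)[OF c[OF that]] eq[OF that] by (simp add: E_iff)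
 show xE: "(a x, c x) \<in> points E" by (rule inE[OF V(2)])
 have "f (a x) \<in> domU (a x, c x)" using triv_z(1)[OF xE] by simp
 then have "smooth_at X G (%y. trivh (a x, c x) (c y)) x"
  using smooth_at_compose[OF X At(1) c[OF V(2)] tf(2)[OF xE]] smooth_at_points(2)[OF c[OF V(2)]] eq[OF V(2)] by simp
 from smooth_at_Pair[OF a[OF V(2)] this]
 show "smooth_at X (prod_mfd N G) (%y. \<Phi> (a x, c x) (a y, c y)) x" by simp
 show "openin (mfd_topology X) {y \<in> V. a y \<in> {n \<in> points N. f n \<in> domU (a x, c x)}}"
  by (rule openin_smooth_preimage[OF X N V(1) a oW[OF xE]])
 show "x \<in> {y \<in> V. a y \<in> {n \<in> points N. f n \<in> domU (a x, c x)}}"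
  using V(2) triv_z(1)[OF xE] smooth_at_points(2)[OF a[OF V(2)]] by simp
 show "(a y, c y) \<in> W (a x, c x)" if "y \<in> {y \<in> V. a y \<in> {n \<in> points N. f n \<in> domU (a x, c x)}}" for y
  using that inE by simp
qed

lemma smooth_manifold_E:
 assumes SN: "smooth_manifold N" and ST: "smooth_manifold (total P)"
 shows "smooth_manifold E"
proof (rule smooth_manifold_initial[OF m.atlas SN ST, of fst snd])
 show "smooth_at E N fst z" "smooth_at E (total P) snd z" if "z \<in> points E" for z
  using that by (rule smooth_at_E_fst, rule smooth_at_E_snd)
 fix U z assume U: "openin (mfd_topology E) U" "z \<in> U"
 then have z: "z \<in> points E" unfolding openin_mfd_topology[OF m.atlas] by blast
 have zN: "fst z \<in> points N" and zG: "trivh z (snd z) \<in> points G" and zP: "snd z \<in> points (total P)"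
  using z trivh_points[OF z m.center[OF z]] by (simp_all add: E_iff)
 obtain V where V: "open V" "chart E z z \<in> V" "V \<subseteq> chart_img E z" "param E z ` V \<subseteq> U"
  using openin_mfdD[OF m.atlas U] by blast
 have "(chart N (fst z) (fst z), chart G (trivh z (snd z)) (trivh z (snd z))) \<in> V"
  using V(2) m.chart[OF z m.center[OF z]] by simp
 from open_prod_elim[OF V(1) this] obtain A B where AB: "open A" "open B"
   "(chart N (fst z) (fst z), chart G (trivh z (snd z)) (trivh z (snd z))) \<in> A \<times> B" "A \<times> B \<subseteq> V"
  by blast
 have im: "V \<subseteq> chart_img N (fst z) \<times> chart_img G (trivh z (snd z))"
  using V(3) m.param_eq(3)[OF z] by (auto simp: chart_img_prod_mfd)
 have imA: "A \<subseteq> chart_img N (fst z)" "B \<subseteq> chart_img G (trivh z (snd z))" using im AB(3,4) by auto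
 \<comment> \<open>A chart box \<open>A \<times> B\<close> is cut out of the fibre product by a
   condition on the point of \<open>N\<close> and by this open set of points of \<open>P\<close>,
   whose group coordinates lie over \<open>B\<close>. Hence the topology is induced by the two
   projections.\<close>
 define C where "C = {p \<in> {p \<in> points (total P). proj P p \<in> domU z}. trivh z p \<in> param G (trivh z (snd z)) ` B}"
 show "\<exists>A C. openin (mfd_topology N) A \<and> openin (mfd_topology (total P)) C \<and> fst z \<in> A \<and> snd z \<in> C \<and>
   (\<forall>y\<in>points E. fst y \<in> A \<longrightarrow> snd y \<in> C \<longrightarrow> y \<in> U)"
 proof (intro exI conjI ballI impI)
  show "openin (mfd_topology N) (param N (fst z) ` A)" by (rule openin_param_image[OF N zN AB(1) imA(1)])
  show "openin (mfd_topology (total P)) C" unfolding C_def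
   by (rule openin_smooth_preimage[OF At(1) At(3) openin_proj_preimage[OF P tf(1)[OF z]] _ openin_param_image[OF At(3) zG AB(2) imA(2)]])
    (use tf(2)[OF z] in auto)
  have "fst z = param N (fst z) (chart N (fst z) (fst z))" using param_center[OF N zN] by simp
  then show "fst z \<in> param N (fst z) ` A" using AB(3) by auto
  have "trivh z (snd z) = param G (trivh z (snd z)) (chart G (trivh z (snd z)) (trivh z (snd z)))"
   using param_center[OF At(3) zG] by simp
  then show "snd z \<in> C" unfolding C_def using AB(3) zP W_proj[OF m.center[OF z]] by auto
  fix y assume y: "y \<in> points E" "fst y \<in> param N (fst z) ` A" "snd y \<in> C"
  obtain u where u: "u \<in> A" "fst y = param N (fst z) u" using y by blast
  obtain v where v: "v \<in> B" "trivh z (snd y) = param G (trivh z (snd z)) v" using y unfolding C_def by blast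
  have ud: "u \<in> chart_img N (fst z)" and vd: "v \<in> chart_img G (trivh z (snd z))" using imA u v by auto
  have yW: "y \<in> W z" using y(1,3) unfolding C_def E_iff by auto
  have "y \<in> chart_dom E z"
   unfolding m.dom[OF z] using yW u v param_dom[OF N ud] param_dom[OF At(3) vd] by simp
  moreover have "chart E z y = (u, v)"
   using m.chart[OF z yW] u v chart_param[OF N ud] chart_param[OF At(3) vd] by simp
  ultimately have "y = param E z (u, v)" using param_chart[OF m.atlas z, of y] by simp
  then show "y \<in> U" using V(4) AB(4) u v by auto
 qed
qed (auto simp: prod_eq_iff)

end

section \<open>Pulled back bundles and fibre products of bundles\<close>

lemma principal_bundle_act:
 assumes P: "principal_bundle P" and p: "p \<in> points (total P)" and a: "a \<in> carrier (lgroup (sgroup P))"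
 shows "act P p a \<in> points (total P)" "proj P (act P p a) = proj P p"
  "smooth_at (prod_mfd (total P) (lmfd (sgroup P))) (total P) (%z. act P (fst z) (snd z)) (p, a)"
proof -
 note At = principal_bundle_atlas[OF P]
 have "smooth_map (prod_mfd (total P) (lmfd (sgroup P))) (total P) (%(p, a). act P p a)"
  using P by (simp add: principal_bundle_def)
 then show s: "smooth_at (prod_mfd (total P) (lmfd (sgroup P))) (total P) (%z. act P (fst z) (snd z)) (p, a)"
  using smooth_map_iff_smooth_at[OF atlas_prod_mfd[OF At(1,3)] At(1)] p a At(4) by (simp add: case_prod_unfold)
 show "act P p a \<in> points (total P)" using smooth_at_points(2)[OF s] by simp
 show "proj P (act P p a) = proj P p" using P p a by (simp add: principal_bundle_def)
qed

lemma smooth_at_act: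
 assumes P: "principal_bundle P" and X: "mfd_atlas X"
  and f: "smooth_at X (total P) f x" and g: "smooth_at X (lmfd (sgroup P)) g x"
 shows "smooth_at X (total P) (%y. act P (f y) (g y)) x"
proof -
 note At = principal_bundle_atlas[OF P]
 have "smooth_at (prod_mfd (total P) (lmfd (sgroup P))) (total P) (%z. act P (fst z) (snd z)) (f x, g x)"
  by (rule principal_bundle_act(3)[OF P smooth_at_points(2)[OF f]]) (use smooth_at_points(2)[OF g] At(4) in simp)
 from smooth_at_compose[OF X atlas_prod_mfd[OF At(1,3)] smooth_at_Pair[OF f g] this]
 show ?thesis by simp
qed

lemma principal_bundleI:
 fixes P :: "('p, 'pe::findim_normed_vector, 'q, 'qe::findim_normed_vector, 'g, 'ge::findim_normed_vector) pbundle"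
 assumes "smooth_manifold (total P)" "smooth_manifold (base P)" "lie_group (sgroup P)"
  and "\<And>p. p \<in> points (total P) ==> smooth_at (total P) (base P) (proj P) p"
  and "\<And>p a. p \<in> points (total P) ==> a \<in> carrier (lgroup (sgroup P)) ==>
   smooth_at (prod_mfd (total P) (lmfd (sgroup P))) (total P) (%(p, a). act P p a) (p, a)"
  and "\<And>p. p \<in> points (total P) ==> act P p \<one>\<^bsub>lgroup (sgroup P)\<^esub> = p"
  and "\<And>p a b. p \<in> points (total P) ==> a \<in> carrier (lgroup (sgroup P)) ==> b \<in> carrier (lgroup (sgroup P)) ==>
   act P (act P p a) b = act P p (a \<otimes>\<^bsub>lgroup (sgroup P)\<^esub> b)"
  and "\<And>p a. p \<in> points (total P) ==> a \<in> carrier (lgroup (sgroup P)) ==> proj P (act P p a) = proj P p"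
  and "\<And>x. x \<in> points (base P) ==> \<exists>U h. x \<in> U \<and> local_triv P U h"
 shows "principal_bundle P"
proof -
 have At: "mfd_atlas (total P)" "mfd_atlas (base P)" "mfd_atlas (lmfd (sgroup P))"
  and c: "points (lmfd (sgroup P)) = carrier (lgroup (sgroup P))"
  using assms(1-3) by (simp_all add: lie_group_def smooth_manifold_atlas)
 have "smooth_map (total P) (base P) (proj P)" using smooth_map_iff_smooth_at[OF At(1,2)] assms(4) by blast
 moreover have "smooth_map (prod_mfd (total P) (lmfd (sgroup P))) (total P) (%(p, a). act P p a)"
  unfolding smooth_map_iff_smooth_at[OF atlas_prod_mfd[OF At(1,3)] At(1)] using assms(5) c by auto
 ultimately show ?thesis unfolding principal_bundle_def using assms by simp
qed

section \<open>The product of two Lie groups as a Lie group\<close>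

lemma prod_lie_simps [simp]:
 "lgroup (prod_lie G H) = lgroup G \<times>\<times> lgroup H" "lmfd (prod_lie G H) = prod_mfd (lmfd G) (lmfd H)"
 by (simp_all add: prod_lie_def)

lemma lie_groupD:
 assumes G: "lie_group G"
 shows "group (lgroup G)" "mfd_atlas (lmfd G)" "points (lmfd G) = carrier (lgroup G)"
  and "\<And>x y. x \<in> carrier (lgroup G) ==> y \<in> carrier (lgroup G) ==>
   smooth_at (prod_mfd (lmfd G) (lmfd G)) (lmfd G) (%z. fst z \<otimes>\<^bsub>lgroup G\<^esub> snd z) (x, y)"
  and "\<And>x. x \<in> carrier (lgroup G) ==> smooth_at (lmfd G) (lmfd G) (%x. inv\<^bsub>lgroup G\<^esub> x) x"
proof -
 show a: "mfd_atlas (lmfd G)" and p: "points (lmfd G) = carrier (lgroup G)" and "group (lgroup G)"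
  using G by (simp_all add: lie_group_def smooth_manifold_atlas)
 show "smooth_at (prod_mfd (lmfd G) (lmfd G)) (lmfd G) (%z. fst z \<otimes>\<^bsub>lgroup G\<^esub> snd z) (x, y)"
  if "x \<in> carrier (lgroup G)" "y \<in> carrier (lgroup G)" for x y
  using G that p unfolding lie_group_def smooth_map_iff_smooth_at[OF atlas_prod_mfd[OF a a] a]
  by (simp add: case_prod_unfold)
 show "smooth_at (lmfd G) (lmfd G) (%x. inv\<^bsub>lgroup G\<^esub> x) x" if "x \<in> carrier (lgroup G)" for x
  using G that p unfolding lie_group_def smooth_map_iff_smooth_at[OF a a] by simp
qed

lemma smooth_at_mult:
 assumes G: "lie_group G" and X: "mfd_atlas X" and f: "smooth_at X (lmfd G) f x" and g: "smooth_at X (lmfd G) g x"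
 shows "smooth_at X (lmfd G) (%y. f y \<otimes>\<^bsub>lgroup G\<^esub> g y) x"
proof -
 note L = lie_groupD[OF G]
 have "smooth_at (prod_mfd (lmfd G) (lmfd G)) (lmfd G) (%z. fst z \<otimes>\<^bsub>lgroup G\<^esub> snd z) (f x, g x)"
  by (rule L(4)) (use smooth_at_points(2)[OF f] smooth_at_points(2)[OF g] L(3) in simp_all)
 from smooth_at_compose[OF X atlas_prod_mfd[OF L(2) L(2)] smooth_at_Pair[OF f g] this]
 show ?thesis by simp
qed

lemma lie_group_prod:
 assumes G: "lie_group G" and H: "lie_group H"
 shows "lie_group (prod_lie G H)"
proof -
 note g = lie_groupD[OF G] and h = lie_groupD[OF H]
 note gh = atlas_prod_mfd[OF g(2) h(2)]
 note ghgh = atlas_prod_mfd[OF gh gh]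
 have grp: "group (lgroup G \<times>\<times> lgroup H)" using g(1) h(1) by (rule DirProd_group)
 have man: "smooth_manifold (prod_mfd (lmfd G) (lmfd H))"
  by (rule smooth_manifold_prod) (use G H in \<open>simp_all add: lie_group_def\<close>)
 have "smooth_map (prod_mfd (prod_mfd (lmfd G) (lmfd H)) (prod_mfd (lmfd G) (lmfd H))) (prod_mfd (lmfd G) (lmfd H))
   (%(x, y). x \<otimes>\<^bsub>lgroup G \<times>\<times> lgroup H\<^esub> y)"
  unfolding smooth_map_iff_smooth_at[OF ghgh gh]
 proof
  fix z assume "z \<in> points (prod_mfd (prod_mfd (lmfd G) (lmfd H)) (prod_mfd (lmfd G) (lmfd H)))"
  then have z: "z \<in> (points (lmfd G) \<times> points (lmfd H)) \<times> (points (lmfd G) \<times> points (lmfd H))" by simp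
  then have zz: "fst z \<in> points (lmfd G) \<times> points (lmfd H)" "snd z \<in> points (lmfd G) \<times> points (lmfd H)"
   "z \<in> points (prod_mfd (lmfd G) (lmfd H)) \<times> points (prod_mfd (lmfd G) (lmfd H))" by auto
  note f1 = smooth_at_fst[OF gh gh zz(3)] and s1 = smooth_at_snd[OF gh gh zz(3)]
  note ff = smooth_at_compose[OF ghgh gh f1 smooth_at_fst[OF g(2) h(2) zz(1)]]
   and fs = smooth_at_compose[OF ghgh gh f1 smooth_at_snd[OF g(2) h(2) zz(1)]]
   and sf = smooth_at_compose[OF ghgh gh s1 smooth_at_fst[OF g(2) h(2) zz(2)]]
   and ss = smooth_at_compose[OF ghgh gh s1 smooth_at_snd[OF g(2) h(2) zz(2)]]
  from smooth_at_Pair[OF smooth_at_mult[OF G ghgh ff sf] smooth_at_mult[OF H ghgh fs ss]]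
  show "smooth_at (prod_mfd (prod_mfd (lmfd G) (lmfd H)) (prod_mfd (lmfd G) (lmfd H))) (prod_mfd (lmfd G) (lmfd H))
   (%(x, y). x \<otimes>\<^bsub>lgroup G \<times>\<times> lgroup H\<^esub> y) z"
   by (simp add: case_prod_unfold mult_DirProd')
 qed
 moreover have "smooth_map (prod_mfd (lmfd G) (lmfd H)) (prod_mfd (lmfd G) (lmfd H)) (%x. inv\<^bsub>lgroup G \<times>\<times> lgroup H\<^esub> x)"
  unfolding smooth_map_iff_smooth_at[OF gh gh]
 proof
  fix z assume "z \<in> points (prod_mfd (lmfd G) (lmfd H))"
  then have z: "z \<in> points (lmfd G) \<times> points (lmfd H)" by simp
  have zc: "fst z \<in> carrier (lgroup G)" "snd z \<in> carrier (lgroup H)" using z g(3) h(3) by (simp_all add: mem_Times_iff)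
  have *: "smooth_at (prod_mfd (lmfd G) (lmfd H)) (prod_mfd (lmfd G) (lmfd H)) (%x. (inv\<^bsub>lgroup G\<^esub> fst x, inv\<^bsub>lgroup H\<^esub> snd x)) z"
  proof (rule smooth_at_Pair)
   show "smooth_at (prod_mfd (lmfd G) (lmfd H)) (lmfd G) (%x. inv\<^bsub>lgroup G\<^esub> fst x) z"
    by (rule smooth_at_compose[OF gh g(2) smooth_at_fst[OF g(2) h(2) z] g(5)[OF zc(1)]])
   show "smooth_at (prod_mfd (lmfd G) (lmfd H)) (lmfd H) (%x. inv\<^bsub>lgroup H\<^esub> snd x) z"
    by (rule smooth_at_compose[OF gh h(2) smooth_at_snd[OF g(2) h(2) z] h(5)[OF zc(2)]])
  qed
  show "smooth_at (prod_mfd (lmfd G) (lmfd H)) (prod_mfd (lmfd G) (lmfd H)) (%x. inv\<^bsub>lgroup G \<times>\<times> lgroup H\<^esub> x) z"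
  proof (rule smooth_at_cong[OF gh openin_points[OF gh] _ *])
   show "z \<in> points (prod_mfd (lmfd G) (lmfd H))" using z by simp
   fix y assume "y \<in> points (prod_mfd (lmfd G) (lmfd H))"
   then have "fst y \<in> carrier (lgroup G)" "snd y \<in> carrier (lgroup H)" using g(3) h(3) by auto
   from inv_DirProd[OF g(1) h(1) this]
   show "(inv\<^bsub>lgroup G\<^esub> fst y, inv\<^bsub>lgroup H\<^esub> snd y) = inv\<^bsub>lgroup G \<times>\<times> lgroup H\<^esub> y" by simp
  qed
 qed
 ultimately show ?thesis unfolding lie_group_def using grp man g(3) h(3) by simp
qed

section \<open>Pullback bundle and fibre product of bundles\<close>

lemma pullback_bundle_simps [simp]:
 "total (pullback_bundle N f P) = fibre_product N f P" "base (pullback_bundle N f P) = N"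
 "sgroup (pullback_bundle N f P) = sgroup P" "proj (pullback_bundle N f P) = fst"
 "act (pullback_bundle N f P) z a = (fst z, act P (snd z) a)"
 by (simp_all add: pullback_bundle_def case_prod_unfold)

lemma product_bundle_simps [simp]:
 "total (product_bundle S P) = fibre_product (total S) (proj S) P" "base (product_bundle S P) = base S"
 "sgroup (product_bundle S P) = prod_lie (sgroup S) (sgroup P)" "proj (product_bundle S P) z = proj S (fst z)"
 "act (product_bundle S P) z a = (act S (fst z) (fst a), act P (snd z) (snd a))"
 by (simp_all add: product_bundle_def case_prod_unfold)

lemma principal_bundle_group_acts:
 assumes P: "principal_bundle P"
 shows "lie_group (sgroup P)"
  "\<And>p. p \<in> points (total P) ==> act P p \<one>\<^bsub>lgroup (sgroup P)\<^esub> = p"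
  "\<And>p a b. p \<in> points (total P) ==> a \<in> carrier (lgroup (sgroup P)) ==> b \<in> carrier (lgroup (sgroup P)) ==>
   act P (act P p a) b = act P p (a \<otimes>\<^bsub>lgroup (sgroup P)\<^esub> b)"
  "\<And>x. x \<in> points (base P) ==> \<exists>U h. x \<in> U \<and> local_triv P U h"
  "smooth_manifold (total P)" "smooth_manifold (base P)"
 using P by (simp_all add: principal_bundle_def)

text \<open>A trivialisation of \<open>P\<close> over \<open>U\<close> induces one over the preimage
  of \<open>U\<close>: the group coordinate is that of the component in \<open>P\<close>, and the
  inverse applies \<open>triv_inv\<close> over \<open>f n\<close>.\<close>

lemma principal_bundle_pullback:
 fixes P :: "('p, 'pe::findim_normed_vector, 'q, 'qe::findim_normed_vector, 'g, 'ge::findim_normed_vector) pbundle"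
  and N :: "('n, 'ne::findim_normed_vector) mfd"
 assumes sN: "smooth_manifold N" and P: "principal_bundle P"
  and f: "\<And>n. n \<in> points N ==> smooth_at N (base P) f n"
 shows "principal_bundle (pullback_bundle N f P)"
proof -
 interpret fibre_product_setup N f P
  by unfold_locales (use smooth_manifold_atlas[OF sN] P f in auto)
 note pb = principal_bundle_group_acts[OF P]
 note EG = atlas_prod_mfd[OF m.atlas At(3)]
 show ?thesis
 proof (rule principal_bundleI, unfold pullback_bundle_simps)
  show "smooth_manifold E" by (rule smooth_manifold_E[OF sN pb(5)])
  show "smooth_manifold N" "lie_group (sgroup P)" by (rule sN, rule pb(1))
  show "smooth_at E N fst p" if "p \<in> points E" for p by (rule smooth_at_E_fst[OF that])
  show "(fst p, act P (snd p) \<one>\<^bsub>lgroup (sgroup P)\<^esub>) = p" if "p \<in> points E" for p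
   using that pb(2)[of "snd p"] by (simp add: E_iff)
  show "(fst (fst p, act P (snd p) a), act P (snd (fst p, act P (snd p) a)) b) = (fst p, act P (snd p) (a \<otimes>\<^bsub>lgroup (sgroup P)\<^esub> b))"
   if "p \<in> points E" "a \<in> carrier (lgroup (sgroup P))" "b \<in> carrier (lgroup (sgroup P))" for p a b
   using that pb(3)[of "snd p" a b] by (simp add: E_iff)
  show "fst (fst p, act P (snd p) a) = fst p" for p :: "'n \<times> 'p" and a by simp
  show "smooth_at (prod_mfd E G) E (%(p, a). (fst p, act P (snd p) a)) (p, a)"
   if "p \<in> points E" "a \<in> carrier (lgroup (sgroup P))" for p a
  proof -
   have pa: "(p, a) \<in> points (prod_mfd E G)" using that At(4) by simp
   have F: "smooth_at (prod_mfd E G) E fst z" "smooth_at (prod_mfd E G) G snd z" "fst z \<in> points E" "snd z \<in> points G"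
    if "z \<in> points (prod_mfd E G)" for z
    using that smooth_at_fst[OF m.atlas At(3)] smooth_at_snd[OF m.atlas At(3)] by auto
   have "smooth_at (prod_mfd E G) E (%z. (fst (fst z), act P (snd (fst z)) (snd z))) (p, a)"
   proof (rule smooth_at_into_E[OF EG _ _ openin_points[OF EG] pa])
    fix z assume z: "z \<in> points (prod_mfd E G)"
    show "smooth_at (prod_mfd E G) N (%z. fst (fst z)) z"
     by (rule smooth_at_compose[OF EG m.atlas F(1)[OF z] smooth_at_E_fst[OF F(3)[OF z]]])
    show "smooth_at (prod_mfd E G) (total P) (%z. act P (snd (fst z)) (snd z)) z"
     by (rule smooth_at_act[OF P EG smooth_at_compose[OF EG m.atlas F(1)[OF z] smooth_at_E_snd[OF F(3)[OF z]]] F(2)[OF z]])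
    show "f (fst (fst z)) = proj P (act P (snd (fst z)) (snd z))"
     using F(3,4)[OF z] principal_bundle_act(2)[OF P, of "snd (fst z)" "snd z"] At(4) by (simp add: E_iff)
   qed
   then show ?thesis by (simp add: case_prod_unfold)
  qed
  show "\<exists>U h. x \<in> U \<and> local_triv (pullback_bundle N f P) U h" if x: "x \<in> points N" for x
  proof -
   obtain U h where U: "f x \<in> U" "local_triv P U h" using pb(4)[OF f_points[OF x]] by blast
   note t = local_triv_facts[OF P U(2)]
   let ?V = "{n \<in> points N. f n \<in> U}"
   have oV: "openin (mfd_topology N) ?V"
    by (rule openin_smooth_preimage[OF N At(2) openin_points[OF smooth_manifold_atlas[OF sN]] f t(1)])
   have NA: "mfd_atlas N" by (rule smooth_manifold_atlas[OF sN])
   note NG = atlas_prod_mfd[OF NA At(3)]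
   have "local_triv (pullback_bundle N f P) ?V (%z. h (snd z))"
   proof (rule local_trivI[where \<tau> = "%b. (fst b, triv_inv P U h (f (fst b), snd b))"], unfold pullback_bundle_simps)
    show "mfd_atlas E" "mfd_atlas N" "mfd_atlas G" by (rule m.atlas, rule NA, rule At(3))
    show "openin (mfd_topology N) ?V" by (rule oV)
    show "smooth_at E N fst p" if "p \<in> points E" for p by (rule smooth_at_E_fst[OF that])
    show "smooth_at E G (%z. h (snd z)) p" if "p \<in> points E" "fst p \<in> ?V" for p
     by (rule smooth_at_compose[OF m.atlas At(1) smooth_at_E_snd[OF that(1)] t(2)]) (use that in \<open>auto simp: E_iff\<close>)
    show "(fst (fst p, h (snd p)), triv_inv P U h (f (fst (fst p, h (snd p))), snd (fst p, h (snd p)))) = p"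
     if "p \<in> points E" "fst p \<in> ?V" for p
     using t(3)[of "snd p"] that by (simp add: E_iff prod_eq_iff)
    show "fst (fst (x, g), triv_inv P U h (f (fst (x, g)), snd (x, g))) = x \<and>
     h (snd (fst (x, g), triv_inv P U h (f (fst (x, g)), snd (x, g)))) = g" if "x \<in> ?V" "g \<in> points G" for x g
     using t(6)[of "f x" g] that by simp
    show "h (snd (fst p, act P (snd p) a)) = h (snd p) \<otimes>\<^bsub>lgroup (sgroup P)\<^esub> a"
     if "p \<in> points E" "fst p \<in> ?V" "a \<in> carrier (lgroup (sgroup P))" for p a
     using t(8)[of "snd p" a] that by (simp add: E_iff)
    show "smooth_at (prod_mfd N G) E (%b. (fst b, triv_inv P U h (f (fst b), snd b))) (x, g)"
     if xg: "x \<in> ?V" "g \<in> points G" for x g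
    proof (rule smooth_at_into_E[OF NG _ _ openin_prod_mfd[OF NA At(3) oV]])
     show "(x, g) \<in> ?V \<times> points G" using xg by blast
     fix z assume z: "z \<in> ?V \<times> points G"
     then have zz: "z \<in> points N \<times> points G" by auto
     show s1: "smooth_at (prod_mfd N G) N fst z" by (rule smooth_at_fst[OF NA At(3) zz])
     have fn: "smooth_at (prod_mfd N G) (base P) (%y. f (fst y)) z"
      by (rule smooth_at_compose[OF NG NA s1 f]) (use zz in auto)
     have "smooth_at (prod_mfd (base P) G) (total P) (triv_inv P U h) (f (fst z), snd z)"
      by (rule t(7)) (use z in auto)
     from smooth_at_compose[OF NG atlas_prod_mfd[OF At(2,3)] smooth_at_Pair[OF fn smooth_at_snd[OF NA At(3) zz]] this]
     show "smooth_at (prod_mfd N G) (total P) (%b. triv_inv P U h (f (fst b), snd b)) z" .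
     show "f (fst z) = proj P (triv_inv P U h (f (fst z), snd z))" using t(5)[of "f (fst z)" "snd z"] z by auto
    qed
   qed
   moreover have "x \<in> ?V" using x U(1) by simp
   ultimately show ?thesis by (intro exI[of _ ?V] exI[of _ "%z. h (snd z)"] conjI)
  qed
 qed
qed

text \<open>The underlying manifold is the pullback of \<open>P\<close> to \<open>total S\<close>,
  so \<open>S\<close> enters through its charts and \<open>P\<close> through its trivialisations.
  The two bundles become symmetric again in the local trivialisations, which pair both group
  coordinates over the intersection of two trivialising sets.\<close>

lemma principal_bundle_product:
 fixes P :: "('p, 'pe::findim_normed_vector, 'q, 'qe::findim_normed_vector, 'g, 'ge::findim_normed_vector) pbundle"
  and S :: "('s, 'se::findim_normed_vector, 'q, 'qe, 'h, 'he::findim_normed_vector) pbundle"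
 assumes S: "principal_bundle S" and P: "principal_bundle P" and base: "base P = base S"
 shows "principal_bundle (product_bundle S P)"
proof -
 note At' = principal_bundle_atlas[OF S]
 interpret fibre_product_setup "total S" "proj S" P
  by unfold_locales (use At'(1) P smooth_at_proj[OF S] base in auto)
 note pb = principal_bundle_group_acts[OF P] and sb = principal_bundle_group_acts[OF S]
 let ?H = "lmfd (sgroup S)"
 let ?HG = "prod_mfd ?H G"
 note HG = atlas_prod_mfd[OF At'(3) At(3)]
 note EG = atlas_prod_mfd[OF m.atlas HG]
 have Q: "smooth_at E (base S) (%z. proj S (fst z)) p" if "p \<in> points E" for p
  by (rule smooth_at_compose[OF m.atlas At'(1) smooth_at_E_fst[OF that] smooth_at_proj[OF S]]) (use that in \<open>simp add: E_iff\<close>)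
 show ?thesis
 proof (rule principal_bundleI, unfold product_bundle_simps)
  show "smooth_manifold E" by (rule smooth_manifold_E[OF sb(5) pb(5)])
  show "smooth_manifold (base S)" "lie_group (prod_lie (sgroup S) (sgroup P))"
   by (rule sb(6), rule lie_group_prod[OF sb(1) pb(1)])
  show "smooth_at E (base S) (%z. proj S (fst z)) p" if "p \<in> points E" for p
   by (rule Q[OF that])
  show "(act S (fst p) (fst \<one>\<^bsub>lgroup (prod_lie (sgroup S) (sgroup P))\<^esub>), act P (snd p) (snd \<one>\<^bsub>lgroup (prod_lie (sgroup S) (sgroup P))\<^esub>)) = p"
   if "p \<in> points E" for p
   using that pb(2)[of "snd p"] sb(2)[of "fst p"] by (simp add: E_iff)
  show "(act S (fst (act S (fst p) (fst a), act P (snd p) (snd a))) (fst b), act P (snd (act S (fst p) (fst a), act P (snd p) (snd a))) (snd b)) =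
   (act S (fst p) (fst (a \<otimes>\<^bsub>lgroup (prod_lie (sgroup S) (sgroup P))\<^esub> b)), act P (snd p) (snd (a \<otimes>\<^bsub>lgroup (prod_lie (sgroup S) (sgroup P))\<^esub> b)))"
   if "p \<in> points E" "a \<in> carrier (lgroup (prod_lie (sgroup S) (sgroup P)))" "b \<in> carrier (lgroup (prod_lie (sgroup S) (sgroup P)))" for p a b
   using that pb(3)[of "snd p" "snd a" "snd b"] sb(3)[of "fst p" "fst a" "fst b"] by (auto simp: E_iff mult_DirProd')
  show "proj S (fst (act S (fst p) (fst a), act P (snd p) (snd a))) = proj S (fst p)"
   if "p \<in> points E" "a \<in> carrier (lgroup (prod_lie (sgroup S) (sgroup P)))" for p a
   using that principal_bundle_act(2)[OF S, of "fst p" "fst a"] by (auto simp: E_iff)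
  show "smooth_at (prod_mfd E (lmfd (prod_lie (sgroup S) (sgroup P)))) E (%(p, a). (act S (fst p) (fst a), act P (snd p) (snd a))) (p, a)"
   if "p \<in> points E" "a \<in> carrier (lgroup (prod_lie (sgroup S) (sgroup P)))" for p a
  proof -
   have pa: "(p, a) \<in> points (prod_mfd E ?HG)" using that At(4) At'(4) by auto
   have F: "smooth_at (prod_mfd E ?HG) E fst z" "smooth_at (prod_mfd E ?HG) ?HG snd z" "fst z \<in> points E"
     "snd z \<in> points ?H \<times> points G"
    if "z \<in> points (prod_mfd E ?HG)" for z
    using that smooth_at_fst[OF m.atlas HG] smooth_at_snd[OF m.atlas HG] by auto
   have "smooth_at (prod_mfd E ?HG) E (%z. (act S (fst (fst z)) (fst (snd z)), act P (snd (fst z)) (snd (snd z)))) (p, a)"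
   proof (rule smooth_at_into_E[OF EG _ _ openin_points[OF EG] pa])
    fix z assume z: "z \<in> points (prod_mfd E ?HG)"
    show "smooth_at (prod_mfd E ?HG) (total S) (%z. act S (fst (fst z)) (fst (snd z))) z"
     by (rule smooth_at_act[OF S EG smooth_at_compose[OF EG m.atlas F(1)[OF z] smooth_at_E_fst[OF F(3)[OF z]]]
        smooth_at_compose[OF EG HG F(2)[OF z] smooth_at_fst[OF At'(3) At(3) F(4)[OF z]]]])
    show "smooth_at (prod_mfd E ?HG) (total P) (%z. act P (snd (fst z)) (snd (snd z))) z"
     by (rule smooth_at_act[OF P EG smooth_at_compose[OF EG m.atlas F(1)[OF z] smooth_at_E_snd[OF F(3)[OF z]]]
        smooth_at_compose[OF EG HG F(2)[OF z] smooth_at_snd[OF At'(3) At(3) F(4)[OF z]]]])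
    show "proj S (act S (fst (fst z)) (fst (snd z))) = proj P (act P (snd (fst z)) (snd (snd z)))"
     using F(3,4)[OF z] principal_bundle_act(2)[OF P, of "snd (fst z)" "snd (snd z)"]
      principal_bundle_act(2)[OF S, of "fst (fst z)" "fst (snd z)"] At(4) At'(4) by (auto simp: E_iff)
   qed
   then show ?thesis by (simp add: case_prod_unfold)
  qed
  show "\<exists>U h. x \<in> U \<and> local_triv (product_bundle S P) U h" if x: "x \<in> points (base S)" for x
  proof -
   obtain U h where U: "x \<in> U" "local_triv P U h" using pb(4) x base by metis
   obtain U' h' where U': "x \<in> U'" "local_triv S U' h'" using sb(4)[OF x] by metis
   note t = local_triv_facts[OF P U(2)] and t' = local_triv_facts[OF S U'(2)]
   let ?V = "U' \<inter> U"
   let ?X = "prod_mfd (base S) ?HG"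
   note QA = At'(2)
   note XA = atlas_prod_mfd[OF QA HG]
   have oV: "openin (mfd_topology (base S)) ?V" using t(1) t'(1) base by (simp add: openin_Int)
   have VQ: "?V \<subseteq> points (base S)" using oV unfolding openin_mfd_topology[OF QA] by blast
   have "local_triv (product_bundle S P) ?V (%z. (h' (fst z), h (snd z)))"
   proof (rule local_trivI[where \<tau> = "%b. (triv_inv S U' h' (fst b, fst (snd b)), triv_inv P U h (fst b, snd (snd b)))"],
     unfold product_bundle_simps prod_lie_simps)
    show "mfd_atlas E" "mfd_atlas (base S)" "mfd_atlas ?HG" by (rule m.atlas, rule QA, rule HG)
    show "openin (mfd_topology (base S)) ?V" by (rule oV)
    show "smooth_at E (base S) (%z. proj S (fst z)) p" if "p \<in> points E" for p
     by (rule Q[OF that])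
    show "smooth_at E ?HG (%z. (h' (fst z), h (snd z))) p" if "p \<in> points E" "proj S (fst p) \<in> ?V" for p
    proof (rule smooth_at_Pair)
     show "smooth_at E ?H (%z. h' (fst z)) p"
      by (rule smooth_at_compose[OF m.atlas At'(1) smooth_at_E_fst[OF that(1)] t'(2)]) (use that in \<open>auto simp: E_iff\<close>)
     show "smooth_at E G (%z. h (snd z)) p"
      by (rule smooth_at_compose[OF m.atlas At(1) smooth_at_E_snd[OF that(1)] t(2)]) (use that in \<open>auto simp: E_iff\<close>)
    qed
    show "(triv_inv S U' h' (fst (proj S (fst p), h' (fst p), h (snd p)), fst (snd (proj S (fst p), h' (fst p), h (snd p)))),
      triv_inv P U h (fst (proj S (fst p), h' (fst p), h (snd p)), snd (snd (proj S (fst p), h' (fst p), h (snd p))))) = p"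
     if "p \<in> points E" "proj S (fst p) \<in> ?V" for p
     using t(3)[of "snd p"] t'(3)[of "fst p"] that by (simp add: E_iff prod_eq_iff)
    show "proj S (fst (triv_inv S U' h' (fst (x, g), fst (snd (x, g))), triv_inv P U h (fst (x, g), snd (snd (x, g))))) = x \<and>
     (h' (fst (triv_inv S U' h' (fst (x, g), fst (snd (x, g))), triv_inv P U h (fst (x, g), snd (snd (x, g))))),
      h (snd (triv_inv S U' h' (fst (x, g), fst (snd (x, g))), triv_inv P U h (fst (x, g), snd (snd (x, g)))))) = g"
     if "x \<in> ?V" "g \<in> points ?HG" for x g
     using t(6)[of x "snd g"] t'(5,6)[of x "fst g"] that by auto
    show "(h' (fst (act S (fst p) (fst a), act P (snd p) (snd a))), h (snd (act S (fst p) (fst a), act P (snd p) (snd a)))) =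
     (h' (fst p), h (snd p)) \<otimes>\<^bsub>lgroup (sgroup S) \<times>\<times> lgroup (sgroup P)\<^esub> a"
     if "p \<in> points E" "proj S (fst p) \<in> ?V" "a \<in> carrier (lgroup (sgroup S) \<times>\<times> lgroup (sgroup P))" for p a
     using t(8)[of "snd p" "snd a"] t'(8)[of "fst p" "fst a"] that by (auto simp: E_iff mult_DirProd')
    show "smooth_at ?X E (%b. (triv_inv S U' h' (fst b, fst (snd b)), triv_inv P U h (fst b, snd (snd b)))) (x, g)"
     if xg: "x \<in> ?V" "g \<in> points ?HG" for x g
    proof (rule smooth_at_into_E[OF XA _ _ openin_prod_mfd[OF QA HG oV]])
     show "(x, g) \<in> ?V \<times> points ?HG" using xg by blast
     fix z assume z: "z \<in> ?V \<times> points ?HG"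
     then have zz: "z \<in> points (base S) \<times> points ?HG" "snd z \<in> points ?H \<times> points G" using VQ by auto
     note s1 = smooth_at_fst[OF QA HG zz(1)] and s2 = smooth_at_snd[OF QA HG zz(1)]
     note s21 = smooth_at_compose[OF XA HG s2 smooth_at_fst[OF At'(3) At(3) zz(2)]]
      and s22 = smooth_at_compose[OF XA HG s2 smooth_at_snd[OF At'(3) At(3) zz(2)]]
     have "smooth_at (prod_mfd (base S) ?H) (total S) (triv_inv S U' h') (fst z, fst (snd z))"
      by (rule t'(7)) (use z in auto)
     from smooth_at_compose[OF XA atlas_prod_mfd[OF QA At'(3)] smooth_at_Pair[OF s1 s21] this]
     show "smooth_at ?X (total S) (%b. triv_inv S U' h' (fst b, fst (snd b))) z" .
     have "smooth_at (prod_mfd (base S) G) (total P) (triv_inv P U h) (fst z, snd (snd z))"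
      unfolding base[symmetric] by (rule t(7)) (use z in auto)
     from smooth_at_compose[OF XA atlas_prod_mfd[OF QA At(3)] smooth_at_Pair[OF s1 s22] this]
     show "smooth_at ?X (total P) (%b. triv_inv P U h (fst b, snd (snd b))) z" .
     show "proj S (triv_inv S U' h' (fst z, fst (snd z))) = proj P (triv_inv P U h (fst z, snd (snd z)))"
      using t(5)[of "fst z" "snd (snd z)"] t'(5)[of "fst z" "fst (snd z)"] z by auto
    qed
   qed
   moreover have "x \<in> ?V" using U U' by simp
   ultimately show ?thesis by (intro exI[of _ ?V] exI[of _ "%z. (h' (fst z), h (snd z))"] conjI)
  qed
 qed
qed

section \<open>Differential forms on manifolds\<close>

text \<open>A form at \<open>y\<close> expects vectors in the preferred chart of \<open>y\<close>.
  This is the conversion from coordinate vectors of the chart at \<open>p\<close> to those of the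
  preferred chart at the point with coordinate \<open>x\<close>.\<close>

definition dchart :: "('m, 'e::real_normed_vector) mfd => 'm => 'e => 'e => 'e" where
 "dchart M p x = frechet_derivative (chart M (param M p x) \<circ> param M p) (at x)"

lemma in_chart_dchart: "in_chart M p \<alpha> x ws = \<alpha> (param M p x) (map (dchart M p x) ws)"
 by (simp add: in_chart_def Let_def dchart_def)

lemma frechet_derivative_ident: "frechet_derivative (%x. x) (at y) = (%v. v)"
 by (rule frechet_derivative_eqI) (rule has_derivative_ident)

lemma chart_param_deriv:
 assumes M: "mfd_atlas M" and p: "p \<in> points M" and q: "q \<in> points M" and x: "x \<in> chart_img M p" "param M p x \<in> chart_dom M q"
 shows "(%z. chart M q (param M p z)) differentiable (at x)"
proof -
 have "x \<in> chart M p ` (chart_dom M p \<inter> chart_dom M q)"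
  using x chart_param[OF M x(1)] param_dom[OF M x(1)] by (metis IntI imageI)
 from smooth_on_differentiable[OF atlas_smooth[OF M p q] this] show ?thesis by (simp add: o_def)
qed

lemma linear_dchart:
 assumes M: "mfd_atlas M" and p: "p \<in> points M" and x: "x \<in> chart_img M p"
 shows "linear (dchart M p x)"
proof -
 have y: "param M p x \<in> points M" by (rule param_points[OF M p x])
 show ?thesis unfolding dchart_def o_def
  by (rule linear_frechet_derivative) (rule chart_param_deriv[OF M p y x atlas_dom[OF M y]])
qed

lemma dchart_center:
 assumes M: "mfd_atlas M" and p: "p \<in> points M"
 shows "dchart M p (chart M p p) = (%v. v)"
proof -
 have "frechet_derivative (%z. chart M p (param M p z)) (at (chart M p p)) = frechet_derivative (%z. z) (at (chart M p p))"
  by (rule frechet_derivative_cong_open[OF atlas_open[OF M p] chart_center_img[OF M p]]) (rule chart_param[OF M])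
 then show ?thesis unfolding dchart_def o_def param_center[OF M p] frechet_derivative_ident .
qed

lemma in_chart_center:
 assumes "mfd_atlas M" "p \<in> points M"
 shows "in_chart M p \<alpha> (chart M p p) = \<alpha> p"
 by (rule ext) (simp add: in_chart_dchart dchart_center[OF assms] param_center[OF assms])

lemma rep_smooth_differentiable: "rep_smooth M N f p q x ==> (%z. chart N q (f (param M p z))) differentiable (at x)"
 unfolding rep_smooth_def using smooth_on_differentiable by blast

lemma rep_compose_derivative:
 assumes N: "inj_on (chart N q) (chart_dom N q)"
  and f: "rep_smooth M N f p q x" and g: "(%z. h (param N q z)) differentiable (at (chart N q (f (param M p x))))"
 shows "frechet_derivative (%z. h (f (param M p z))) (at x) v =
  frechet_derivative (%z. h (param N q z)) (at (chart N q (f (param M p x))))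
   (frechet_derivative (%z. chart N q (f (param M p z))) (at x) v)"
proof -
 obtain V where V: "open V" "x \<in> V" "\<forall>z\<in>V. f (param M p z) \<in> chart_dom N q"
  using f unfolding rep_smooth_def by blast
 have "frechet_derivative (%z. h (f (param M p z))) (at x) =
  frechet_derivative (%z. h (param N q (chart N q (f (param M p z))))) (at x)"
 proof (rule frechet_derivative_cong_open[OF V(1,2)])
  fix z assume "z \<in> V"
  then have "param N q (chart N q (f (param M p z))) = f (param M p z)"
   unfolding param_def[of N] using V(3) N by (simp add: inv_into_f_f)
  then show "h (f (param M p z)) = h (param N q (chart N q (f (param M p z))))" by simp
 qed
 also have "\<dots> = (%v. frechet_derivative (%z. h (param N q z)) (at (chart N q (f (param M p x))))
   (frechet_derivative (%z. chart N q (f (param M p z))) (at x) v))"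
  by (rule frechet_derivative_chain[where g = "%z. h (param N q z)", OF rep_smooth_differentiable[OF f] g])
 finally show ?thesis by simp
qed

text \<open>Both sides are the derivative of \<open>f\<close> read from the chart at
  \<open>p\<close> into the preferred chart of the image point; the chain rule is applied once in
  the source and once in the target.\<close>

lemma tangent_map_dchart:
 assumes M: "mfd_atlas M" and N: "mfd_atlas N" and p: "p \<in> points M" and q: "q \<in> points N"
  and x: "x \<in> chart_img M p" and f: "smooth_at M N f (param M p x)" and fq: "f (param M p x) \<in> chart_dom N q"
 shows "tangent_map M N f (param M p x) (dchart M p x v) =
  dchart N q (chart N q (f (param M p x))) (frechet_derivative (%z. chart N q (f (param M p z))) (at x) v)"
proof -
 let ?y = "param M p x"
 have y: "?y \<in> points M" "?y \<in> chart_dom M p" by (rule param_points[OF M p x], rule param_dom[OF M x])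
 have fy: "f ?y \<in> points N" by (rule smooth_at_points(2)[OF f])
 have F: "rep_smooth M N f p q x" using smooth_at_rep[OF M N f p y(2) q fq] chart_param[OF M x] by simp
 have I: "rep_smooth M M (%z. z) p ?y x"
  using rep_smooth_transition[OF M p y(1) y(2) atlas_dom[OF M y(1)]] chart_param[OF M x] by simp
 have f': "rep_smooth M N f ?y (f ?y) (chart M ?y ?y)" using f by (simp add: smooth_at_def)
 have "tangent_map M N f ?y (dchart M p x v) = frechet_derivative (%z. chart N (f ?y) (f (param M p z))) (at x) v"
  unfolding tangent_map_def dchart_def o_def
  using rep_compose_derivative[OF atlas_inj[OF M y(1)] I, of "%z. chart N (f ?y) (f z)"] rep_smooth_differentiable[OF f']
  by simp
 also have "\<dots> = frechet_derivative (%z. chart N (f ?y) (param N q z)) (at (chart N q (f ?y)))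
   (frechet_derivative (%z. chart N q (f (param M p z))) (at x) v)"
 proof (rule rep_compose_derivative[OF atlas_inj[OF N q] F])
  have "chart N q (f ?y) \<in> chart_img N q" using fq by (rule chart_in_img[OF N])
  then show "(%z. chart N (f ?y) (param N q z)) differentiable at (chart N q (f ?y))"
   by (rule chart_param_deriv[OF N q fy]) (simp add: param_chart[OF N q fq] atlas_dom[OF N fy])
 qed
 finally show ?thesis by (simp add: dchart_def o_def param_chart[OF N q fq])
qed

lemma in_chart_pullback:
 assumes M: "mfd_atlas M" and N: "mfd_atlas N" and p: "p \<in> points M" and q: "q \<in> points N"
  and x: "x \<in> chart_img M p" and f: "smooth_at M N f (param M p x)" and fq: "f (param M p x) \<in> chart_dom N q"
 shows "in_chart M p (pullback M N f \<alpha>) x ws =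
  in_chart N q \<alpha> (chart N q (f (param M p x))) (map (frechet_derivative (%z. chart N q (f (param M p z))) (at x)) ws)"
 by (simp add: in_chart_dchart pullback_def param_chart[OF N q fq] o_def tangent_map_dchart[OF M N p q x f fq])

lemma tangent_map_id:
 assumes M: "mfd_atlas M" and p: "p \<in> points M"
 shows "tangent_map M M (%x. x) p = (%v. v)"
 using dchart_center[OF M p] by (simp add: tangent_map_def dchart_def o_def param_center[OF M p])

lemma tangent_map_compose:
 assumes M: "mfd_atlas M" and N: "mfd_atlas N" and f: "smooth_at M N f x" and g: "smooth_at N K g (f x)"
 shows "tangent_map M K (%y. g (f y)) x v = tangent_map N K g (f x) (tangent_map M N f x v)"
proof -
 have x: "x \<in> points M" "f x \<in> points N" using smooth_at_points[OF f] by auto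
 have "rep_smooth M N f x (f x) (chart M x x)" "rep_smooth N K g (f x) (g (f x)) (chart N (f x) (f x))"
  using f g by (simp_all add: smooth_at_def)
 from rep_compose_derivative[OF atlas_inj[OF N x(2)] this(1), of "%z. chart K (g (f x)) (g z)"] rep_smooth_differentiable[OF this(2)]
 show ?thesis by (simp add: tangent_map_def o_def param_center[OF M x(1)])
qed

lemma tangent_map_linear: "smooth_at M N f x ==> linear (tangent_map M N f x)"
 unfolding tangent_map_def o_def
 by (rule linear_frechet_derivative) (simp add: smooth_at_def rep_smooth_differentiable)

lemma tangent_map_cong:
 assumes M: "mfd_atlas M" and U: "openin (mfd_topology M) U" "x \<in> U" and eq: "\<And>y. y \<in> U ==> f y = g y"
 shows "tangent_map M N f x = tangent_map M N g x"
proof -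
 obtain V where V: "open V" "chart M x x \<in> V" "V \<subseteq> chart_img M x" "param M x ` V \<subseteq> U"
  using openin_mfdD[OF M U] by blast
 show ?thesis unfolding tangent_map_def o_def eq[OF U(2)]
 proof (rule frechet_derivative_cong_open[OF V(1,2)])
  fix z assume "z \<in> V"
  then have "param M x z \<in> U" using V(4) by blast
  then show "chart N (g x) (f (param M x z)) = chart N (g x) (g (param M x z))" by (simp add: eq)
 qed
qed

section \<open>Smooth forms, pullback and exterior derivative on a manifold\<close>

lemma smooth_form_iff:
 fixes M :: "('m, 'e::findim_normed_vector) mfd"
 assumes M: "mfd_atlas M"
 shows "smooth_form M k \<alpha> \<longleftrightarrow> (\<forall>p\<in>points M. smooth_flat_form (chart_img M p) k (in_chart M p \<alpha>))"
proof
 assume s: "smooth_form M k \<alpha>"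
 show "\<forall>p\<in>points M. smooth_flat_form (chart_img M p) k (in_chart M p \<alpha>)"
 proof
  fix p assume p: "p \<in> points M"
  have "alt_form k (in_chart M p \<alpha> x)" if x: "x \<in> chart_img M p" for x
  proof -
   have "alt_form k (\<alpha> (param M p x))" using s param_points[OF M p x] by (simp add: smooth_form_def)
   from alt_form_map[OF this linear_dchart[OF M p x]]
   show ?thesis by (simp add: in_chart_dchart[abs_def])
  qed
  then show "smooth_flat_form (chart_img M p) k (in_chart M p \<alpha>)"
   using s p by (simp add: smooth_flat_form_def smooth_form_def)
 qed
next
 assume s: "\<forall>p\<in>points M. smooth_flat_form (chart_img M p) k (in_chart M p \<alpha>)"
 show "smooth_form M k \<alpha>" unfolding smooth_form_def
 proof (intro ballI conjI allI)
  fix p assume p: "p \<in> points M"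
  have "alt_form k (in_chart M p \<alpha> (chart M p p))"
   using s p chart_center_img[OF M p] by (simp add: smooth_flat_form_def)
  then show "alt_form k (\<alpha> p)" by (simp add: in_chart_center[OF M p])
  show "smooth_on (chart_img M p) (%x. in_chart M p \<alpha> x ws)" for ws
   using s p by (simp add: smooth_flat_form_def)
 qed
qed

lemma smooth_form_flat: "mfd_atlas M ==> smooth_form M k \<alpha> ==> p \<in> points M ==> smooth_flat_form (chart_img M p) k (in_chart M p \<alpha>)"
 by (simp add: smooth_form_iff)

lemma smooth_form_alt: "smooth_form M k \<alpha> ==> p \<in> points M ==> alt_form k (\<alpha> p)"
 by (simp add: smooth_form_def)

lemma smooth_form_differentiable:
 assumes M: "mfd_atlas M" and a: "smooth_form M k \<alpha>" and p: "p \<in> points M" and x: "x \<in> chart_img M p"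
 shows "(%y. in_chart M p \<alpha> y ws) differentiable (at x)"
 by (rule smooth_on_differentiable[OF _ x]) (use a p in \<open>simp add: smooth_form_def\<close>)

lemma pullback_alt:
 assumes "alt_form k (\<alpha> (f x))" "smooth_at M N f x"
 shows "alt_form k (pullback M N f \<alpha> x)"
 using alt_form_map[OF assms(1) tangent_map_linear[OF assms(2)]] by (simp add: pullback_def[abs_def])

lemma smooth_form_pullback:
 assumes M: "mfd_atlas M" and N: "mfd_atlas N" and f: "\<And>x. x \<in> points M ==> smooth_at M N f x" and a: "smooth_form N k \<alpha>"
 shows "smooth_form M k (pullback M N f \<alpha>)"
 unfolding smooth_form_def
proof (intro ballI conjI allI)
 fix p assume p: "p \<in> points M"
 show "alt_form k (pullback M N f \<alpha> p)"
  using pullback_alt[of k \<alpha> f p M N] smooth_form_alt[OF a smooth_at_points(2)[OF f[OF p]]] f[OF p] by blast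
 fix ws
 show "smooth_on (chart_img M p) (%x. in_chart M p (pullback M N f \<alpha>) x ws)"
 proof (rule smooth_on_local)
  fix x assume x: "x \<in> chart_img M p"
  let ?y = "param M p x"
  have y: "?y \<in> points M" "?y \<in> chart_dom M p" by (rule param_points[OF M p x], rule param_dom[OF M x])
  have fy: "f ?y \<in> points N" by (rule smooth_at_points(2)[OF f[OF y(1)]])
  have "rep_smooth M N f p (f ?y) x"
   using smooth_at_rep[OF M N f[OF y(1)] p y(2) fy atlas_dom[OF N fy]] chart_param[OF M x] by simp
  then obtain V where V: "open V" "x \<in> V" "V \<subseteq> chart_img M p" "\<forall>z\<in>V. f (param M p z) \<in> chart_dom N (f ?y)"
   "smooth_on V (%z. chart N (f ?y) (f (param M p z)))" unfolding rep_smooth_def by blast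
  let ?F = "%z. chart N (f ?y) (f (param M p z))"
  have im: "?F ` V \<subseteq> chart_img N (f ?y)" using V(4) chart_in_img[OF N] by blast
  have "smooth_on V (%z. in_chart N (f ?y) \<alpha> (?F z) ([] @ map (%w. w z) (map (%u z. frechet_derivative ?F (at z) u) ws)))"
   by (rule smooth_on_form_apply[OF V(1) atlas_open[OF N fy] im smooth_form_flat[OF N a fy] V(5)])
    (use smooth_on_frechet_derivative[OF V(5)] in auto)
  then have s: "smooth_on V (%z. in_chart N (f ?y) \<alpha> (?F z) (map (frechet_derivative ?F (at z)) ws))"
   by (simp add: o_def)
  have "smooth_on V (%x. in_chart M p (pullback M N f \<alpha>) x ws)"
  proof (rule smooth_on_cong[OF V(1) s])
   fix z assume z: "z \<in> V"
   then have zi: "z \<in> chart_img M p" using V(3) by blast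
   show "in_chart N (f ?y) \<alpha> (?F z) (map (frechet_derivative ?F (at z)) ws) = in_chart M p (pullback M N f \<alpha>) z ws"
    by (rule in_chart_pullback[OF M N p fy zi f[OF param_points[OF M p zi]], symmetric]) (use V(4) z in blast)
  qed
  then show "\<exists>U. open U \<and> x \<in> U \<and> smooth_on U (%x. in_chart M p (pullback M N f \<alpha>) x ws)" using V by blast
 qed
qed

lemma flat_d_in_chart_pullback:
 assumes M: "mfd_atlas M" and N: "mfd_atlas N" and p: "p \<in> points M" and q: "q \<in> points N"
  and x: "x \<in> chart_img M p" and f: "\<And>y. y \<in> points M ==> smooth_at M N f y" and fq: "f (param M p x) \<in> chart_dom N q"
  and a: "smooth_form N k \<alpha>"
 shows "flat_d (in_chart M p (pullback M N f \<alpha>)) x vs =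
  flat_d (in_chart N q \<alpha>) (chart N q (f (param M p x))) (map (frechet_derivative (%z. chart N q (f (param M p z))) (at x)) vs)"
proof -
 let ?y = "param M p x" and ?F = "%z. chart N q (f (param M p z))"
 have y: "?y \<in> points M" "?y \<in> chart_dom M p" by (rule param_points[OF M p x], rule param_dom[OF M x])
 have "rep_smooth M N f p q x" using smooth_at_rep[OF M N f[OF y(1)] p y(2) q fq] chart_param[OF M x] by simp
 then obtain V where V: "open V" "x \<in> V" "V \<subseteq> chart_img M p" "\<forall>z\<in>V. f (param M p z) \<in> chart_dom N q"
   "smooth_on V ?F" unfolding rep_smooth_def by blast
 have im: "?F ` V \<subseteq> chart_img N q" using V(4) chart_in_img[OF N] by blast
 have "flat_d (in_chart M p (pullback M N f \<alpha>)) x vs = flat_d (%z ws. in_chart N q \<alpha> (?F z) (map (frechet_derivative ?F (at z)) ws)) x vs"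
 proof (rule flat_d_cong_open[OF V(1,2)])
  fix z ws assume z: "z \<in> V"
  then have zi: "z \<in> chart_img M p" using V(3) by blast
  show "in_chart M p (pullback M N f \<alpha>) z ws = in_chart N q \<alpha> (?F z) (map (frechet_derivative ?F (at z)) ws)"
   by (rule in_chart_pullback[OF M N p q zi f[OF param_points[OF M p zi]]]) (use V(4) z in blast)
 qed
 also have "\<dots> = flat_d (in_chart N q \<alpha>) (?F x) (map (frechet_derivative ?F (at x)) vs)"
  by (rule flat_d_pullback[OF V(1) atlas_open[OF N q] im smooth_form_flat[OF N a q] V(2,5)])
 finally show ?thesis .
qed

lemma ext_d_pullback:
 assumes M: "mfd_atlas M" and N: "mfd_atlas N" and f: "\<And>y. y \<in> points M ==> smooth_at M N f y"
  and a: "smooth_form N k \<alpha>" and x: "x \<in> points M"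
 shows "ext_d M (pullback M N f \<alpha>) x vs = pullback M N f (ext_d N \<alpha>) x vs"
proof -
 have fx: "f x \<in> points N" by (rule smooth_at_points(2)[OF f[OF x]])
 have "flat_d (in_chart M x (pullback M N f \<alpha>)) (chart M x x) vs =
  flat_d (in_chart N (f x) \<alpha>) (chart N (f x) (f (param M x (chart M x x))))
   (map (frechet_derivative (%z. chart N (f x) (f (param M x z))) (at (chart M x x))) vs)"
  by (rule flat_d_in_chart_pullback[OF M N x fx chart_center_img[OF M x] f _ a])
   (simp_all add: param_center[OF M x] atlas_dom[OF N fx])
 then show ?thesis by (simp add: ext_d_def pullback_def tangent_map_def o_def param_center[OF M x])
qed

lemma in_chart_cong:
 assumes "mfd_atlas M" "p \<in> points M" "x \<in> chart_img M p" "\<And>y vs. y \<in> points M ==> \<alpha> y vs = \<beta> y vs"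
 shows "in_chart M p \<alpha> x ws = in_chart M p \<beta> x ws"
 using assms(4)[OF param_points[OF assms(1-3)]] by (simp add: in_chart_dchart)

lemma ext_d_cong:
 assumes M: "mfd_atlas M" and x: "x \<in> points M" and eq: "\<And>y vs. y \<in> points M ==> \<alpha> y vs = \<beta> y vs"
 shows "ext_d M \<alpha> x vs = ext_d M \<beta> x vs"
 unfolding ext_d_def
 by (rule flat_d_cong_open[OF atlas_open[OF M x] chart_center_img[OF M x]]) (rule in_chart_cong[OF M x _ eq])

lemma smooth_form_cong:
 assumes M: "mfd_atlas M" and a: "smooth_form M k \<alpha>" and eq: "\<And>y vs. y \<in> points M ==> \<alpha> y vs = \<beta> y vs"
 shows "smooth_form M k \<beta>"
 unfolding smooth_form_def
proof (intro ballI conjI allI)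
 fix p assume p: "p \<in> points M"
 have "\<alpha> p = \<beta> p" using eq[OF p] by blast
 then show "alt_form k (\<beta> p)" using smooth_form_alt[OF a p] by simp
 show "smooth_on (chart_img M p) (%x. in_chart M p \<beta> x ws)" for ws
  by (rule smooth_on_cong[OF atlas_open[OF M p], of "%x. in_chart M p \<alpha> x ws"])
   (use a p in_chart_cong[OF M p _ eq] in \<open>auto simp: smooth_form_def\<close>)
qed

text \<open>\<open>ext_d\<close> uses a different chart at every point. That its expression in one
  fixed chart is the flat derivative is the case of the identity map in
  \<open>flat_d_in_chart_pullback\<close>.\<close>

lemma in_chart_ext_d:
 assumes M: "mfd_atlas M" and a: "smooth_form M k \<alpha>" and p: "p \<in> points M" and x: "x \<in> chart_img M p"
 shows "in_chart M p (ext_d M \<alpha>) x vs = flat_d (in_chart M p \<alpha>) x vs"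
proof -
 let ?y = "param M p x"
 have y: "?y \<in> points M" "?y \<in> chart_dom M p" by (rule param_points[OF M p x], rule param_dom[OF M x])
 have pid: "pullback M M (%z. z) \<alpha> z ws = \<alpha> z ws" if "z \<in> points M" for z ws
  by (simp add: pullback_def tangent_map_id[OF M that])
 have "flat_d (in_chart M p \<alpha>) x vs = flat_d (in_chart M p (pullback M M (%z. z) \<alpha>)) x vs"
  by (rule flat_d_cong_open[OF atlas_open[OF M p] x], rule in_chart_cong[OF M p]) (simp_all add: pid)
 also have "\<dots> = flat_d (in_chart M ?y \<alpha>) (chart M ?y ?y) (map (frechet_derivative (%z. chart M ?y (param M p z)) (at x)) vs)"
  by (rule flat_d_in_chart_pullback[OF M M p y(1) x smooth_at_id[OF M] atlas_dom[OF M y(1)] a])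
 finally show ?thesis by (simp add: in_chart_dchart[of M p "ext_d M \<alpha>"] ext_d_def dchart_def o_def)
qed

lemma ext_d_ext_d_1form:
 fixes \<alpha> :: "'m => 'e::findim_normed_vector list => 'v::findim_normed_vector"
 assumes M: "mfd_atlas M" and a: "smooth_form M 1 \<alpha>" and p: "p \<in> points M"
 shows "ext_d M (ext_d M \<alpha>) p vs = 0"
proof -
 have "ext_d M (ext_d M \<alpha>) p vs = flat_d (flat_d (in_chart M p \<alpha>)) (chart M p p) vs"
  unfolding ext_d_def[of M "ext_d M \<alpha>"]
  by (rule flat_d_cong_open[OF atlas_open[OF M p] chart_center_img[OF M p]]) (rule in_chart_ext_d[OF M a p])
 also have "\<dots> = 0"
  by (rule flat_d_flat_d_1form[OF atlas_open[OF M p] smooth_form_flat[OF M a p] chart_center_img[OF M p]])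
 finally show ?thesis .
qed

section \<open>Algebraic operations on smooth forms\<close>

lemma in_chart_wedge: "in_chart M p (%q. wedge_with b (\<alpha> q) (\<beta> q)) x = wedge_with b (in_chart M p \<alpha> x) (in_chart M p \<beta> x)"
 unfolding in_chart_dchart[abs_def] by (rule ext) (simp add: wedge_with_map)

lemma ext_d_wedge_with:
 fixes \<alpha> :: "'m => 'e::findim_normed_vector list => 'u::real_normed_vector"
  and \<beta> :: "'m => 'e list => 'v::real_normed_vector" and b :: "'u => 'v => 'w::real_normed_vector"
 assumes M: "mfd_atlas M" and b: "bounded_bilinear b" and a: "smooth_form M k \<alpha>" and c: "smooth_form M l \<beta>" and p: "p \<in> points M"
 shows "ext_d M (%q. wedge_with b (\<alpha> q) (\<beta> q)) p vs =
  wedge_with b (ext_d M \<alpha> p) (\<beta> p) vs + wedge_with b (grade_sgn (\<alpha> p)) (ext_d M \<beta> p) vs"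
proof -
 have "flat_d (%y. wedge_with b (in_chart M p \<alpha> y) (in_chart M p \<beta> y)) (chart M p p) vs =
  wedge_with b (flat_d (in_chart M p \<alpha>) (chart M p p)) (in_chart M p \<beta> (chart M p p)) vs +
  wedge_with b (grade_sgn (in_chart M p \<alpha> (chart M p p))) (flat_d (in_chart M p \<beta>) (chart M p p)) vs"
  by (rule flat_d_wedge_with[OF b]) (rule smooth_form_differentiable[OF M a p chart_center_img[OF M p]],
    rule smooth_form_differentiable[OF M c p chart_center_img[OF M p]])
 then show ?thesis by (simp add: ext_d_def in_chart_wedge[abs_def] in_chart_center[OF M p])
qed

lemma smooth_form_wedge_with:
 fixes \<alpha> :: "'m => 'e::findim_normed_vector list => 'u::real_normed_vector"
  and \<beta> :: "'m => 'e list => 'v::real_normed_vector" and b :: "'u => 'v => 'w::real_normed_vector"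
 assumes M: "mfd_atlas M" and b: "bounded_bilinear b" and a: "smooth_form M k \<alpha>" and c: "smooth_form M l \<beta>"
 shows "smooth_form M (k + l) (%q. wedge_with b (\<alpha> q) (\<beta> q))"
 unfolding smooth_form_def
proof (intro ballI conjI allI)
 fix p assume p: "p \<in> points M"
 show "alt_form (k + l) (wedge_with b (\<alpha> p) (\<beta> p))"
  by (rule alt_form_wedge_with[OF bounded_bilinear_imp_bilinear[OF b] smooth_form_alt[OF a p] smooth_form_alt[OF c p]])
 have s: "smooth_on (chart_img M p) (%x. in_chart M p \<alpha> x us)" "smooth_on (chart_img M p) (%x. in_chart M p \<beta> x us)" for us
  using a c p by (simp_all add: smooth_form_def)
 show "smooth_on (chart_img M p) (%x. in_chart M p (%q. wedge_with b (\<alpha> q) (\<beta> q)) x ws)" for ws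
  unfolding in_chart_wedge wedge_with_def
  by (rule smooth_on_sum[OF atlas_open[OF M p]], rule smooth_on_scaleR[OF atlas_open[OF M p] smooth_on_const],
    rule smooth_on_bilinear[OF atlas_open[OF M p] b s])
qed

lemma smooth_form_add:
 assumes M: "mfd_atlas M" and a: "smooth_form M k \<alpha>" and c: "smooth_form M k \<beta>"
 shows "smooth_form M k (%q vs. \<alpha> q vs + \<beta> q vs)"
 unfolding smooth_form_def
proof (intro ballI conjI allI)
 fix p assume p: "p \<in> points M"
 show "alt_form k (%vs. \<alpha> p vs + \<beta> p vs)"
  by (rule alt_form_add[OF smooth_form_alt[OF a p] smooth_form_alt[OF c p]])
 show "smooth_on (chart_img M p) (%x. in_chart M p (%q vs. \<alpha> q vs + \<beta> q vs) x ws)" for ws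
  using smooth_on_add[OF atlas_open[OF M p], of "%x. in_chart M p \<alpha> x ws" "%x. in_chart M p \<beta> x ws"] a c p
  by (simp add: smooth_form_def in_chart_dchart)
qed

lemma smooth_form_bounded_linear:
 assumes M: "mfd_atlas M" and L: "bounded_linear L" and a: "smooth_form M k \<alpha>"
 shows "smooth_form M k (%q vs. L (\<alpha> q vs))"
 unfolding smooth_form_def
proof (intro ballI conjI allI)
 fix p assume p: "p \<in> points M"
 show "alt_form k (%vs. L (\<alpha> p vs))"
  by (rule alt_form_linear[OF smooth_form_alt[OF a p] bounded_linear.linear[OF L]])
 show "smooth_on (chart_img M p) (%x. in_chart M p (%q vs. L (\<alpha> q vs)) x ws)" for ws
  using smooth_on_bounded_linear[OF atlas_open[OF M p] L, of "%x. in_chart M p \<alpha> x ws"] a p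
  by (simp add: smooth_form_def in_chart_dchart)
qed

lemma smooth_form_scale_fun:
 assumes M: "mfd_atlas M" and f: "smooth_fun M f" and a: "smooth_form M k \<alpha>"
 shows "smooth_form M k (%q vs. f q *\<^sub>R \<alpha> q vs)"
 unfolding smooth_form_def
proof (intro ballI conjI allI)
 fix p assume p: "p \<in> points M"
 show "alt_form k (%vs. f p *\<^sub>R \<alpha> p vs)" by (rule alt_form_scale[OF smooth_form_alt[OF a p]])
 show "smooth_on (chart_img M p) (%x. in_chart M p (%q vs. f q *\<^sub>R \<alpha> q vs) x ws)" for ws
  using smooth_on_scaleR[OF atlas_open[OF M p], of "%x. f (param M p x)" "%x. in_chart M p \<alpha> x ws"] a p f
  by (simp add: smooth_form_def in_chart_dchart smooth_fun_def o_def)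
qed

lemma smooth_form_Pair:
 assumes M: "mfd_atlas M" and a: "smooth_form M k \<alpha>" and c: "smooth_form M k \<beta>"
 shows "smooth_form M k (%q vs. (\<alpha> q vs, \<beta> q vs))"
proof -
 have l: "bounded_linear (%y. (y, 0))" "bounded_linear (%z. (0, z))"
  by (intro bounded_linear_Pair bounded_linear_ident bounded_linear_zero)+
 from smooth_form_add[OF M smooth_form_bounded_linear[OF M l(1) a] smooth_form_bounded_linear[OF M l(2) c]]
 show ?thesis by simp
qed

lemma ext_d_add:
 assumes M: "mfd_atlas M" and a: "smooth_form M k \<alpha>" and c: "smooth_form M l \<beta>" and p: "p \<in> points M"
 shows "ext_d M (%q vs. \<alpha> q vs + \<beta> q vs) p vs = ext_d M \<alpha> p vs + ext_d M \<beta> p vs"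
 using flat_d_add[OF smooth_form_differentiable[OF M a p chart_center_img[OF M p]]
   smooth_form_differentiable[OF M c p chart_center_img[OF M p]]]
 by (simp add: ext_d_def in_chart_dchart[abs_def])

lemma ext_d_bounded_linear:
 assumes M: "mfd_atlas M" and L: "bounded_linear L" and a: "smooth_form M k \<alpha>" and p: "p \<in> points M"
 shows "ext_d M (%q vs. L (\<alpha> q vs)) p vs = L (ext_d M \<alpha> p vs)"
proof -
 interpret L: bounded_linear L by (rule L)
 have "flat_d (%x ws. L (in_chart M p \<alpha> x ws)) (chart M p p) vs = L (flat_d (in_chart M p \<alpha>) (chart M p p) vs)"
  unfolding flat_d_def
  by (simp add: frechet_derivative_bounded_linear[OF L smooth_form_differentiable[OF M a p chart_center_img[OF M p]]]
    L.sum L.scaleR)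
 then show ?thesis by (simp add: ext_d_def in_chart_dchart[abs_def])
qed

lemma ext_d_Pair:
 assumes M: "mfd_atlas M" and a: "smooth_form M k \<alpha>" and c: "smooth_form M l \<beta>" and p: "p \<in> points M"
 shows "ext_d M (%q vs. (\<alpha> q vs, \<beta> q vs)) p vs = (ext_d M \<alpha> p vs, ext_d M \<beta> p vs)"
proof -
 have l: "bounded_linear (%y. (y, 0))" "bounded_linear (%z. (0, z))"
  by (intro bounded_linear_Pair bounded_linear_ident bounded_linear_zero)+
 have "ext_d M (%q vs. (\<alpha> q vs, 0) + (0, \<beta> q vs)) p vs = (ext_d M \<alpha> p vs, 0) + (0, ext_d M \<beta> p vs)"
  unfolding ext_d_add[OF M smooth_form_bounded_linear[OF M l(1) a] smooth_form_bounded_linear[OF M l(2) c] p]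
   ext_d_bounded_linear[OF M l(1) a p] ext_d_bounded_linear[OF M l(2) c p] ..
 then show ?thesis by simp
qed

lemma pullback_wedge:
 "pullback M N f (%q. wedge_with b (\<alpha> q) (\<beta> q)) p vs = wedge_with b (pullback M N f \<alpha> p) (pullback M N f \<beta> p) vs"
 unfolding pullback_def[abs_def] by (simp add: wedge_with_map)

lemma pullback_compose:
 assumes "mfd_atlas M" "mfd_atlas N" "smooth_at M N f x" "smooth_at N K g (f x)"
 shows "pullback M N f (pullback N K g \<alpha>) x vs = pullback M K (%y. g (f y)) \<alpha> x vs"
proof -
 have "map (tangent_map M K (%y. g (f y)) x) vs = map (tangent_map N K g (f x) \<circ> tangent_map M N f x) vs"
  by (rule map_cong[OF refl]) (simp add: tangent_map_compose[OF assms])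
 then show ?thesis unfolding pullback_def map_map by (simp only:)
qed

section \<open>The Hodge star in an orthonormal frame\<close>

text \<open>For an orthonormal list this is the inner product of forms: each frame vector is either
  left out or inserted into both forms. It differs from \<open>hodge\<close> only in that the second
  form is later taken to be the volume form with its last arguments fixed.\<close>

fun pairing :: "'e list => ('e list => real) => ('e list => real) => real" where
 "pairing [] a c = a [] * c []"
| "pairing (e # es) a c = pairing es a c + pairing es (e \<lrcorner> a) (e \<lrcorner> c)"

lemma pairing_sum: "pairing es a c = (\<Sum>A\<in>Pow {..<length es}. a (nths es A) * c (nths es A))"
proof (induction es arbitrary: a c)
 case (Cons e es)
 show ?case unfolding length_Cons sum_Pow_Suc nths_Cons_insert nths_Cons_Suc
  by (simp add: Cons contraction_def add.commute)
qed simp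

lemma pairing_zero_left: "pairing es (%_. 0) c = 0"
 by (simp add: pairing_sum)

lemma contraction_zero: "e \<lrcorner> (%_. 0) = (%_. 0)"
 by (simp add: contraction_def)

lemma pairing_minus: "pairing es (%vs. - a vs) (%vs. - c vs) = pairing es a c"
 by (simp add: pairing_sum)

lemma adj_alt_contraction_swap:
 assumes "multilin a" "adj_alt a"
 shows "v \<lrcorner> w \<lrcorner> a = (%vs. - (w \<lrcorner> v \<lrcorner> a) vs)"
 unfolding contraction_def using adj_alt_swap[OF assms, of "[]" w v] by (simp only: append_Nil)

text \<open>A set of \<open>k\<close> frame vectors is obtained once for each of its members as that
  member plus the rest. The sign from moving the member to the front occurs in both forms and
  cancels.\<close>

lemma pairing_contraction_sum:
 assumes "homog k a" "multilin a" "adj_alt a" "multilin c" "adj_alt c"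
 shows "(\<Sum>e\<leftarrow>es. pairing es (e \<lrcorner> a) (e \<lrcorner> c)) = real k * pairing es a c"
 using assms
proof (induction es arbitrary: a c k)
 case Nil
 then show ?case by (cases "k = 0") (auto simp: homog_def)
next
 case (Cons e0 es)
 have IH1: "(\<Sum>e\<leftarrow>es. pairing es (e \<lrcorner> a) (e \<lrcorner> c)) = real k * pairing es a c"
  by (rule Cons.IH) (use Cons.prems in auto)
 have IH2: "(\<Sum>e\<leftarrow>es. pairing es (e \<lrcorner> e0 \<lrcorner> a) (e \<lrcorner> e0 \<lrcorner> c)) = (real k - 1) * pairing es (e0 \<lrcorner> a) (e0 \<lrcorner> c)"
 proof (cases k)
  case 0
  have e0: "e0 \<lrcorner> a = (%_. 0)" by (rule homog_0_contraction) (use Cons.prems(1) 0 in simp)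
  show ?thesis unfolding e0 contraction_zero pairing_zero_left by simp
 next
  case (Suc k')
  then have "homog k' (e0 \<lrcorner> a)" using Cons.prems(1) by (simp add: homog_contraction)
  from Cons.IH[OF this] Cons.prems show ?thesis
   by (simp add: Suc multilin_contraction adj_alt_contraction)
 qed
 have sw: "pairing es (e0 \<lrcorner> e \<lrcorner> a) (e0 \<lrcorner> e \<lrcorner> c) = pairing es (e \<lrcorner> e0 \<lrcorner> a) (e \<lrcorner> e0 \<lrcorner> c)" for e
  unfolding adj_alt_contraction_swap[OF Cons.prems(2,3), of e0 e] adj_alt_contraction_swap[OF Cons.prems(4,5), of e0 e]
  by (rule pairing_minus)
 have "(\<Sum>e\<leftarrow>e0 # es. pairing (e0 # es) (e \<lrcorner> a) (e \<lrcorner> c)) =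
  pairing es (e0 \<lrcorner> a) (e0 \<lrcorner> c) + (\<Sum>e\<leftarrow>es. pairing es (e \<lrcorner> a) (e \<lrcorner> c)) + (\<Sum>e\<leftarrow>es. pairing es (e \<lrcorner> e0 \<lrcorner> a) (e \<lrcorner> e0 \<lrcorner> c))"
  by (simp add: sw sum_list_addf adj_alt_contraction_twice[OF Cons.prems(3)] pairing_zero_left)
 then show ?case unfolding IH1 IH2 by (simp add: algebra_simps)
qed

text \<open>A sum over all \<open>k\<close>-tuples instead of subsets. It exceeds
  \<open>pairing\<close> by the factor \<open>fact k\<close>, but it is an iterated trace, and the
  trace of a bilinear form does not depend on the orthonormal frame.\<close>

fun full_pairing :: "nat => 'e list => ('e list => real) => ('e list => real) => real" where
 "full_pairing 0 es a c = a [] * c []"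
| "full_pairing (Suc k) es a c = (\<Sum>e\<leftarrow>es. full_pairing k es (e \<lrcorner> a) (e \<lrcorner> c))"

lemma pairing_homog_0: "homog 0 a ==> pairing es a c = a [] * c []"
 by (induction es arbitrary: c) (simp_all add: homog_0_contraction pairing_zero_left)

lemma full_pairing_eq:
 assumes "homog k a" "multilin a" "adj_alt a" "multilin c" "adj_alt c"
 shows "full_pairing k es a c = fact k * pairing es a c"
 using assms
proof (induction k arbitrary: a c)
 case 0
 then show ?case by (simp add: pairing_homog_0)
next
 case (Suc k)
 have "full_pairing (Suc k) es a c = (\<Sum>e\<leftarrow>es. fact k * pairing es (e \<lrcorner> a) (e \<lrcorner> c))"
  using Suc by (simp add: homog_contraction multilin_contraction adj_alt_contraction)
 also have "\<dots> = fact k * (\<Sum>e\<leftarrow>es. pairing es (e \<lrcorner> a) (e \<lrcorner> c))" by (rule sum_list_const_mult)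
 also have "\<dots> = fact (Suc k) * pairing es a c"
  unfolding pairing_contraction_sum[OF Suc.prems] by simp
 finally show ?case .
qed

lemma sum_list_nth: "(\<Sum>e\<leftarrow>es. F e) = (\<Sum>i<length es. F (es ! i))"
 by (simp add: sum_list_sum_nth atLeast0LessThan)

text \<open>Orthonormality gives linear independence, and \<open>DIM\<close> many independent
  vectors span the space; the coefficients are then read off with \<open>g\<close>.\<close>

lemma orthonormal_frame_expand:
 fixes es :: "'e::euclidean_space list"
 assumes b: "bilinear g" and es: "orthonormal_frame g es"
 shows "v = (\<Sum>i<DIM('e). g v (es ! i) *\<^sub>R es ! i)"
proof -
 have len: "length es = DIM('e)" using es by (simp add: orthonormal_frame_def)
 have o: "g (es ! i) (es ! j) = of_bool (i = j)" if "i < DIM('e)" "j < DIM('e)" for i j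
  using es that by (simp add: orthonormal_frame_def)
 have lin: "linear (%x. g x y)" for y using b by (simp add: bilinear_def)
 have coeff: "g (\<Sum>i<DIM('e). c i *\<^sub>R es ! i) (es ! j) = c j" if "j < DIM('e)" for c j
 proof -
  have "g (\<Sum>i<DIM('e). c i *\<^sub>R es ! i) (es ! j) = (\<Sum>i<DIM('e). c i * g (es ! i) (es ! j))"
   by (simp add: linear_sum[OF lin] linear_scale[OF lin])
  also have "\<dots> = (\<Sum>i<DIM('e). if i = j then c i else 0)" by (intro sum.cong) (auto simp: o that)
  finally show ?thesis using that by simp
 qed
 have dist: "inj_on ((!) es) {..<DIM('e)}"
 proof (rule inj_onI)
  fix i j assume ij: "i \<in> {..<DIM('e)}" "j \<in> {..<DIM('e)}" "es ! i = es ! j"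
  then have "g (es ! i) (es ! j) = 1" using o[of j j] by simp
  then show "i = j" using o[of i j] ij by (auto split: if_splits simp: of_bool_def)
 qed
 have set: "set es = (!) es ` {..<DIM('e)}" using len by (auto simp: in_set_conv_nth)
 have card: "card (set es) = DIM('e)" unfolding set using dist by (simp add: card_image)
 have "independent (set es)"
  unfolding independent_explicit
 proof (intro conjI allI impI ballI)
  fix u v assume u: "(\<Sum>v\<in>set es. u v *\<^sub>R v) = 0" and "v \<in> set es"
  then obtain j where j: "j < DIM('e)" "v = es ! j" unfolding set by blast
  have "(\<Sum>i<DIM('e). u (es ! i) *\<^sub>R es ! i) = 0" using u unfolding set by (simp add: sum.reindex[OF dist])
  then show "u v = 0" using coeff[OF j(1), of "%i. u (es ! i)"] linear_0[OF lin] j(2) by simp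
 qed simp
 then have "UNIV \<subseteq> span (set es)" by (intro card_ge_dim_independent) (auto simp: card)
 then obtain u where "v = (\<Sum>w\<in>set es. u w *\<^sub>R w)" using span_finite[of "set es"] by auto
 then have v: "v = (\<Sum>i<DIM('e). u (es ! i) *\<^sub>R es ! i)" unfolding set by (simp add: sum.reindex[OF dist])
 have "g v (es ! j) = u (es ! j)" if "j < DIM('e)" for j
  unfolding v by (rule coeff[OF that])
 then show ?thesis by (subst v) simp
qed

text \<open>The coefficients of \<open>fs\<close> with respect to \<open>es\<close> form an
  orthogonal matrix, which is the content of \<open>ge\<close>.\<close>

lemma trace_frame_independent:
 fixes es fs :: "'e::euclidean_space list"
 assumes g: "inner_product g" and es: "orthonormal_frame g es" and fs: "orthonormal_frame g fs" and Q: "bilinear Q"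
 shows "(\<Sum>i<DIM('e). Q (fs ! i) (fs ! i)) = (\<Sum>i<DIM('e). Q (es ! i) (es ! i) :: real)"
proof -
 let ?n = "DIM('e)"
 have lg: "linear (%x. g x y)" for y using g by (simp add: inner_product_def bilinear_def)
 have sym: "g x y = g y x" for x y using g by (simp add: inner_product_def)
 have l1: "linear (%x. Q x y)" and l2: "linear (Q x)" for x y using Q by (simp_all add: bilinear_def)
 have Qe: "Q x y = (\<Sum>j<?n. \<Sum>k<?n. g x (es ! j) * g y (es ! k) * Q (es ! j) (es ! k))" for x y
 proof -
  have "Q x y = Q (\<Sum>j<?n. g x (es ! j) *\<^sub>R es ! j) (\<Sum>k<?n. g y (es ! k) *\<^sub>R es ! k)"
   using orthonormal_frame_expand[OF conjunct1[OF g[unfolded inner_product_def]] es] by metis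
  also have "\<dots> = (\<Sum>j<?n. g x (es ! j) * Q (es ! j) (\<Sum>k<?n. g y (es ! k) *\<^sub>R es ! k))"
   by (simp only: linear_sum[OF l1] linear_scale[OF l1] real_scaleR_def)
  also have "\<dots> = (\<Sum>j<?n. g x (es ! j) * (\<Sum>k<?n. g y (es ! k) * Q (es ! j) (es ! k)))"
   by (simp only: linear_sum[OF l2] linear_scale[OF l2] real_scaleR_def)
  finally show ?thesis by (simp add: sum_distrib_left mult.assoc)
 qed
 have ge: "(\<Sum>i<?n. g (fs ! i) (es ! j) * g (fs ! i) (es ! k)) = of_bool (j = k)" if "j < ?n" "k < ?n" for j k
 proof -
  have "g (es ! j) (es ! k) = g (\<Sum>i<?n. g (es ! j) (fs ! i) *\<^sub>R fs ! i) (es ! k)"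
   using orthonormal_frame_expand[OF conjunct1[OF g[unfolded inner_product_def]] fs] by metis
  also have "\<dots> = (\<Sum>i<?n. g (es ! j) (fs ! i) * g (fs ! i) (es ! k))"
   by (simp add: linear_sum[OF lg] linear_scale[OF lg])
  also have "\<dots> = (\<Sum>i<?n. g (fs ! i) (es ! j) * g (fs ! i) (es ! k))"
   by (intro sum.cong refl) (simp only: sym[of "es ! j"])
  also have "g (es ! j) (es ! k) = of_bool (j = k)" using es that by (simp add: orthonormal_frame_def)
  finally show ?thesis by (rule HOL.sym)
 qed
 have "(\<Sum>i<?n. Q (fs ! i) (fs ! i)) =
  (\<Sum>i<?n. \<Sum>j<?n. \<Sum>k<?n. g (fs ! i) (es ! j) * g (fs ! i) (es ! k) * Q (es ! j) (es ! k))"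
  by (intro sum.cong refl Qe)
 also have "\<dots> = (\<Sum>j<?n. \<Sum>i<?n. \<Sum>k<?n. g (fs ! i) (es ! j) * g (fs ! i) (es ! k) * Q (es ! j) (es ! k))"
  by (rule sum.swap)
 also have "\<dots> = (\<Sum>j<?n. \<Sum>k<?n. \<Sum>i<?n. g (fs ! i) (es ! j) * g (fs ! i) (es ! k) * Q (es ! j) (es ! k))"
  by (rule sum.cong[OF refl], rule sum.swap)
 also have "\<dots> = (\<Sum>j<?n. \<Sum>k<?n. of_bool (j = k) * Q (es ! j) (es ! k))"
  by (intro sum.cong refl) (simp add: sum_distrib_right[symmetric] ge)
 also have "\<dots> = (\<Sum>j<?n. \<Sum>k<?n. if j = k then Q (es ! j) (es ! j) else 0)"
  by (intro sum.cong refl) auto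
 also have "\<dots> = (\<Sum>j<?n. Q (es ! j) (es ! j))" by (intro sum.cong refl) simp
 finally show ?thesis .
qed

lemma full_pairing_linear:
 assumes "multilin a" "multilin c"
 shows "linear (%u. full_pairing k es (u \<lrcorner> a) c)" "linear (%u. full_pairing k es a (u \<lrcorner> c))"
proof -
 have gen: "linear (%u. full_pairing k es (a u) c)"
  if "\<And>vs. linear (%u. a u vs)" for a :: "'b::real_vector => 'a list => real" and c
  using that
 proof (induction k arbitrary: a c)
  case 0
  from linear_compose_scale_right[OF 0[of "[]"], of "c []"] show ?case by (simp add: mult.commute)
 next
  case (Suc k)
  have l: "linear (%u. full_pairing k es (e \<lrcorner> a u) (e \<lrcorner> c))" for e
   by (rule Suc.IH) (use Suc.prems in \<open>simp add: contraction_def\<close>)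
  show ?case unfolding full_pairing.simps sum_list_nth by (rule linear_compose_sum) (simp add: l)
 qed
 have sym: "full_pairing k es a c = full_pairing k es c a" for a c :: "'a list => real"
  by (induction k arbitrary: a c) (simp_all add: mult.commute)
 show "linear (%u. full_pairing k es (u \<lrcorner> a) c)"
  by (rule gen) (simp add: contraction_def linear_head[OF assms(1)])
 show "linear (%u. full_pairing k es a (u \<lrcorner> c))"
  unfolding sym[of a] by (rule gen) (simp add: contraction_def linear_head[OF assms(2)])
qed

lemma full_pairing_frame_independent:
 fixes es fs :: "'e::euclidean_space list"
 assumes g: "inner_product g" and es: "orthonormal_frame g es" and fs: "orthonormal_frame g fs"
  and "multilin a" "multilin c"
 shows "full_pairing k fs a c = full_pairing k es a c"
 using assms(4,5)
proof (induction k arbitrary: a c)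
 case (Suc k)
 have len: "length es = DIM('e)" "length fs = DIM('e)" using es fs by (simp_all add: orthonormal_frame_def)
 have "full_pairing (Suc k) fs a c = (\<Sum>i<DIM('e). full_pairing k es (fs ! i \<lrcorner> a) (fs ! i \<lrcorner> c))"
  using Suc by (simp add: sum_list_nth len multilin_contraction)
 also have "\<dots> = (\<Sum>i<DIM('e). full_pairing k es (es ! i \<lrcorner> a) (es ! i \<lrcorner> c))"
 proof (rule trace_frame_independent[OF g es fs, where Q = "%u v. full_pairing k es (u \<lrcorner> a) (v \<lrcorner> c)"])
  show "bilinear (%u v. full_pairing k es (u \<lrcorner> a) (v \<lrcorner> c))"
   unfolding bilinear_def using Suc.prems by (auto intro!: full_pairing_linear multilin_contraction)
 qed
 finally show ?case by (simp add: sum_list_nth len)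
qed simp

lemma pairing_frame_independent:
 fixes es fs :: "'e::euclidean_space list"
 assumes g: "inner_product g" and es: "orthonormal_frame g es" and fs: "orthonormal_frame g fs"
  and a: "alt_form k a" and c: "multilin c" "adj_alt c"
 shows "pairing fs a c = pairing es a c"
proof -
 have a': "homog k a" "multilin a" "adj_alt a" using a by (simp_all add: alt_form_iff)
 have "fact k * pairing fs a c = fact k * pairing es a c"
  using full_pairing_frame_independent[OF g es fs a'(2) c(1), of k]
  unfolding full_pairing_eq[OF a' c] .
 then show ?thesis by simp
qed

section \<open>The Hodge star evaluated on a frame\<close>

lemma multilin_append: "multilin v ==> multilin (%vs. v (vs @ ws))"
 by (simp add: multilin_def)

lemma adj_alt_append: "adj_alt v ==> adj_alt (%vs. v (vs @ ws))"
 by (simp add: adj_alt_def)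

lemma hodge_frame:
 fixes es :: "'e::euclidean_space list"
 assumes g: "inner_product g" and es: "orthonormal_frame g es" and a: "alt_form k a" and v: "alt_form n v"
 shows "hodge g v a ws = pairing es a (%vs. v (vs @ ws))"
proof -
 have s: "orthonormal_frame g (SOME es. orthonormal_frame g es)" using es by (rule someI)
 have "hodge g v a ws = pairing (SOME es. orthonormal_frame g es) a (%vs. v (vs @ ws))"
  by (simp add: hodge_def Let_def pairing_sum)
 also have "\<dots> = pairing es a (%vs. v (vs @ ws))"
  by (rule pairing_frame_independent[OF g es s a]) (use v in \<open>simp_all add: alt_form_iff multilin_append adj_alt_append\<close>)
 finally show ?thesis .
qed

lemma alt_form_hodge:
 assumes a: "alt_form k a" and v: "alt_form n v" and kn: "k \<le> n"
 shows "alt_form (n - k) (hodge g v a)"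
proof -
 define es where "es = (SOME es. orthonormal_frame g es)"
 have h: "hodge g v a ws = (\<Sum>A\<in>Pow {..<length es}. a (nths es A) * v (nths es A @ ws))" for ws
  by (simp add: hodge_def Let_def es_def)
 have "homog (n - k) (hodge g v a)" unfolding homog_def
 proof (intro allI impI)
  fix ws :: "'a list" assume l: "length ws \<noteq> n - k"
  have "a (nths es A) * v (nths es A @ ws) = 0" for A
  proof (cases "length (nths es A) = k")
   case True
   then have "length (nths es A @ ws) \<noteq> n" using l kn by simp
   then show ?thesis using v by (simp add: alt_form_def)
  qed (use a in \<open>simp add: alt_form_def\<close>)
  then show "hodge g v a ws = 0" unfolding h by (intro sum.neutral ballI)
 qed
 moreover have "multilin (hodge g v a)" unfolding multilin_def h
 proof (intro allI linear_compose_sum ballI)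
  fix us ws :: "'a list" and A
  have "linear (%x. v ((nths es A @ us) @ x # ws))" using v unfolding alt_form_iff multilin_def by blast
  from linear_compose_scale_right[OF this, of "a (nths es A)"]
  show "linear (%x. a (nths es A) * v (nths es A @ us @ x # ws))" by simp
 qed
 moreover have "adj_alt (hodge g v a)" unfolding adj_alt_def h
 proof (intro allI sum.neutral ballI)
  fix us ws :: "'a list" and x A
  have "v ((nths es A @ us) @ x # x # ws) = 0" using v unfolding alt_form_iff adj_alt_def by blast
  then show "a (nths es A) * v (nths es A @ us @ x # x # ws) = 0" by simp
 qed
 ultimately show ?thesis by (simp add: alt_form_iff)
qed

text \<open>Masks replace sets of positions: on a frame of known length the finitely many components
  of a form are then reached by case distinctions and simplification.\<close>

fun sel :: "bool list => 'e list => 'e list" where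
 "sel (True # bs) (e # es) = e # sel bs es"
| "sel (False # bs) (e # es) = sel bs es"
| "sel _ _ = []"

text \<open>The sign of the shuffle that moves selected entries to the front: an unselected entry
  crosses every selected one behind it.\<close>

fun shuffle_sign :: "bool list => real" where
 "shuffle_sign [] = 1"
| "shuffle_sign (True # bs) = shuffle_sign bs"
| "shuffle_sign (False # bs) = (if even (length (filter id bs)) then 1 else - 1) * shuffle_sign bs"

lemma length_sel: "length bs = length es ==> length (sel bs es) = length (filter id bs)"
 by (induction bs es rule: sel.induct) auto

lemma sel_shuffle:
 assumes v: "multilin v" "adj_alt v" and "length bs = length es"
 shows "v (us @ sel bs es @ sel (map Not bs) es) = shuffle_sign bs * (v (us @ es) :: real)"
 using assms(3)
proof (induction bs es arbitrary: us rule: sel.induct)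
 case (1 bs e es)
 then show ?case using "1.IH"[of "us @ [e]"] by simp
next
 case (2 bs e es)
 have "v (us @ sel (False # bs) (e # es) @ sel (map Not (False # bs)) (e # es)) = v (us @ sel bs es @ e # sel (map Not bs) es)" by simp
 also have "\<dots> = (-1) ^ length (sel bs es) * v (us @ e # sel bs es @ sel (map Not bs) es)"
  unfolding adj_alt_move[OF v, of us e "sel bs es"] by (simp add: minus_one_mult_self flip: mult.assoc)
 also have "\<dots> = (-1) ^ length (sel bs es) * (shuffle_sign bs * v ((us @ [e]) @ es))"
  using "2.IH"[of "us @ [e]"] "2.prems" by simp
 finally show ?case using "2.prems" by (simp add: length_sel minus_one_power_iff)
qed auto

lemma sel_nths: "length bs = length es ==> sel bs es = nths es {i. i < length bs \<and> bs ! i}"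
proof (induction bs es rule: sel.induct)
 case (1 bs e es)
 have "{j. Suc j < length (True # bs) \<and> (True # bs) ! Suc j} = {i. i < length bs \<and> bs ! i}" by simp
 then show ?case using 1 by (simp add: nths_Cons)
next
 case (2 bs e es)
 have "{j. Suc j < length (False # bs) \<and> (False # bs) ! Suc j} = {i. i < length bs \<and> bs ! i}" by simp
 then show ?case using 2 by (simp add: nths_Cons)
qed auto

text \<open>Only the set complementary to the given arguments contributes. A proper subset of it
  makes the argument list of \<open>v\<close> too short, and any other set repeats one of the given
  vectors.\<close>

lemma hodge_sel:
 fixes es :: "'e::euclidean_space list"
 assumes g: "inner_product g" and es: "orthonormal_frame g es" and a: "alt_form k a"
  and v: "alt_form (DIM('e)) v" "v es = 1" and bs: "length bs = DIM('e)"
 shows "hodge g v a (sel (map Not bs) es) = shuffle_sign bs * a (sel bs es)"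
proof -
 have len: "length es = DIM('e)" using es by (simp add: orthonormal_frame_def)
 let ?ws = "sel (map Not bs) es"
 define S where "S = {i. i < length bs \<and> bs ! i}"
 have S: "S \<subseteq> {..<length es}" using bs len by (auto simp: S_def)
 have ws: "?ws = nths es ({..<length es} - S)"
  using sel_nths[of "map Not bs" es] bs len by (simp add: S_def) (rule arg_cong[where f = "nths es"], auto)
 have z: "v (nths es A @ ?ws) = 0" if A: "A \<subseteq> {..<length es}" "A \<noteq> S" for A
 proof (cases "A \<subseteq> S")
  case True
  then have "card A < card S" using A S by (intro psubset_card_mono) (auto intro: finite_subset)
  moreover have "card S + card ({..<length es} - S) = length es"
   using S by (metis card_Diff_subset card_lessThan card_mono finite_lessThan finite_subset le_add_diff_inverse)
  ultimately have "length (nths es A @ ?ws) \<noteq> DIM('e)"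
   unfolding ws using A S len by (simp add: length_nths_subset)
  then show ?thesis using v(1) by (simp add: alt_form_def)
 next
  case False
  then obtain i where i: "i \<in> A" "i \<notin> S" "i < length es" using A by blast
  then have "es ! i \<in> set (nths es A)" "es ! i \<in> set ?ws" unfolding ws by (auto simp: set_nths)
  then have "\<not> distinct (nths es A @ ?ws)" by auto
  then show ?thesis using v(1) unfolding alt_form_def by blast
 qed
 have "hodge g v a ?ws = (\<Sum>A\<in>Pow {..<length es}. a (nths es A) * v (nths es A @ ?ws))"
  using hodge_frame[OF g es a v(1)] by (simp add: pairing_sum)
 also have "\<dots> = (\<Sum>A\<in>Pow {..<length es}. if A = S then a (nths es S) * v (nths es S @ ?ws) else 0)"
  by (intro sum.cong refl) (auto simp: z)
 also have "\<dots> = a (nths es S) * v (nths es S @ ?ws)" using S by simp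
 also have "nths es S = sel bs es" using sel_nths[of bs es] bs len by (simp add: S_def)
 also have "v (sel bs es @ ?ws) = shuffle_sign bs"
  using sel_shuffle[of v bs es "[]"] v bs len by (simp add: alt_form_iff)
 finally show ?thesis by (simp add: mult.commute)
qed

text \<open>Each entry of \<open>ws\<close> splits into a multiple of \<open>e\<close> and a vector
  of \<open>S\<close>. Once one \<open>e\<close> has been moved to the front, contraction with it
  leaves a form that a second \<open>e\<close> annihilates.\<close>

lemma alt_vanish_extend:
 fixes b :: "'e::real_vector list => 'v::real_vector"
 assumes "multilin b" "adj_alt b"
  and "\<And>vs. set vs \<subseteq> S ==> b vs = 0" "\<And>vs. set vs \<subseteq> S ==> (e \<lrcorner> b) vs = 0"
  and "set us \<subseteq> S" and "\<And>w. w \<in> set ws ==> \<exists>c s. s \<in> S \<and> w = c *\<^sub>R e + s"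
 shows "b (us @ ws) = 0"
 using assms
proof (induction ws arbitrary: b us)
 case Nil
 then show ?case by simp
next
 case (Cons w ws)
 obtain c s where w: "s \<in> S" "w = c *\<^sub>R e + s" using Cons.prems(6)[of w] by auto
 have lin: "linear (%x. b (us @ x # ws))" using Cons.prems(1) by (simp add: multilin_def)
 have "b (us @ w # ws) = c *\<^sub>R b (us @ e # ws) + b ((us @ [s]) @ ws)"
  unfolding w(2) by (simp add: linear_add[OF lin] linear_scale[OF lin])
 moreover have "b ((us @ [s]) @ ws) = 0"
  by (rule Cons.IH[OF Cons.prems(1-4)]) (use Cons.prems(5,6) w in auto)
 moreover have "b (us @ e # ws) = 0"
 proof -
  have "(e \<lrcorner> b) (us @ ws) = 0"
  proof (rule Cons.IH)
   show "(e \<lrcorner> e \<lrcorner> b) vs = 0" for vs by (simp add: adj_alt_contraction_twice[OF Cons.prems(2)])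
   show "\<exists>c s. s \<in> S \<and> w = c *\<^sub>R e + s" if "w \<in> set ws" for w using Cons.prems(6)[of w] that by simp
  qed (use Cons.prems in \<open>simp_all add: multilin_contraction adj_alt_contraction\<close>)
  then have "b ([] @ e # us @ ws) = 0" by (simp add: contraction_apply)
  then show ?thesis unfolding adj_alt_move[OF Cons.prems(1,2)] by simp
 qed
 ultimately show ?case by simp
qed

text \<open>Induction over the frame: its first vector is removed by restricting the arguments to
  the span of the others, once for the form and once for its contraction.\<close>

lemma alt_vanish_on_frame:
 assumes "multilin a" "adj_alt a" "\<And>bs. length bs = length es ==> a (sel bs es) = 0" "set vs \<subseteq> span (set es)"
 shows "a vs = 0"
 using assms
proof (induction es arbitrary: a vs)
 case Nil
 then show ?case
 proof (cases vs)
  case (Cons v ws)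
  then have "v = 0" using Nil.prems(4) by simp
  then show ?thesis using linear_0[OF linear_head[OF Nil.prems(1), of ws]] Cons by simp
 qed (use Nil.prems(3)[of "[]"] in simp)
next
 case (Cons e es)
 have 1: "a ws = 0" if "set ws \<subseteq> span (set es)" for ws
  by (rule Cons.IH[OF Cons.prems(1,2) _ that]) (use Cons.prems(3)[of "False # _"] in simp)
 have 2: "(e \<lrcorner> a) ws = 0" if "set ws \<subseteq> span (set es)" for ws
  by (rule Cons.IH[OF multilin_contraction[OF Cons.prems(1)] adj_alt_contraction[OF Cons.prems(2)] _ that])
   (use Cons.prems(3)[of "True # _"] in \<open>simp add: contraction_apply\<close>)
 have "a ([] @ vs) = 0"
 proof (rule alt_vanish_extend[OF Cons.prems(1,2) 1 2, of "span (set es)"])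
  fix w assume "w \<in> set vs"
  then have "w \<in> span (insert e (set es))" using Cons.prems(4) by auto
  then obtain c where "w - c *\<^sub>R e \<in> span (set es)" unfolding span_insert by blast
  then show "\<exists>c s. s \<in> span (set es) \<and> w = c *\<^sub>R e + s"
   by (intro exI[of _ c] exI[of _ "w - c *\<^sub>R e"]) simp
 qed auto
 then show ?case by simp
qed

lemma alt_form_eq_on_frame:
 fixes a c :: "'e::real_vector list => 'v::real_vector"
 assumes a: "alt_form k a" and c: "alt_form k c" and es: "span (set es) = UNIV"
  and eq: "\<And>bs. length bs = length es ==> length (filter id bs) = k ==> a (sel bs es) = c (sel bs es)"
 shows "a vs = c vs"
proof -
 have d: "alt_form k (%vs. a vs - c vs)"
  using alt_form_add[OF a alt_form_scale[OF c, of "-1"]] by simp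
 have "a (sel bs es) - c (sel bs es) = 0" if l: "length bs = length es" for bs
 proof (cases "length (filter id bs) = k")
  case False
  then have "length (sel bs es) \<noteq> k" using l by (simp add: length_sel)
  then show ?thesis using a c by (simp add: alt_form_def)
 qed (simp add: eq l)
 then have "a vs - c vs = 0"
  using alt_vanish_on_frame[of "%vs. a vs - c vs" es vs] d es by (simp add: alt_form_iff)
 then show ?thesis by simp
qed

section \<open>A \<open>G\<^sub>2\<close>-form in an adapted frame\<close>

text \<open>The wedge product unfolded for the simplifier. \<open>p\<close> and \<open>q\<close>
  collect the arguments of the two factors, and the first still expects \<open>k\<close> of them; a
  vector handed to the second factor passes these, which gives its sign.\<close>

fun shuffle_sum :: "('u => 'v => 'w::real_vector) => nat => ('e list => 'u) => ('e list => 'v) =>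
  'e list => 'e list => 'e list => 'w" where
 "shuffle_sum b 0 a c p q vs = b (a p) (c (q @ vs))"
| "shuffle_sum b (Suc k) a c p q [] = 0"
| "shuffle_sum b (Suc k) a c p q (v # vs) =
   shuffle_sum b k a c (p @ [v]) q vs + (-1) ^ Suc k *\<^sub>R shuffle_sum b (Suc k) a c p (q @ [v]) vs"

lemma wedge_with_homog_0:
 assumes b: "bilinear b" and "homog 0 a"
 shows "wedge_with b a c vs = b (a []) (c vs)"
 using assms(2)
proof (induction vs arbitrary: c)
 case (Cons v vs)
 then show ?case
  unfolding wedge_with_Cons[OF b] homog_0_contraction[OF Cons.prems] homog_grade_sgn[OF Cons.prems]
  by (simp add: wedge_with_zero_left[OF b] contraction_apply)
qed simp

lemma wedge_with_shuffle_sum_gen: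
 assumes b: "bilinear b" and "homog k (%ws. a (p @ ws))"
 shows "wedge_with b (%ws. a (p @ ws)) (%ws. c (q @ ws)) vs = shuffle_sum b k a c p q vs"
 using assms(2)
proof (induction vs arbitrary: k p q)
 case Nil
 then show ?case by (cases k) (auto simp: homog_def bilinear_lzero[OF b] dest: spec[of _ "[]"])
next
 case (Cons v vs)
 show ?case
 proof (cases k)
  case 0
  then show ?thesis using wedge_with_homog_0[OF b] Cons.prems by force
 next
  case (Suc k')
  have c1: "v \<lrcorner> (%ws. a (p @ ws)) = (%ws. a ((p @ [v]) @ ws))" "v \<lrcorner> (%ws. c (q @ ws)) = (%ws. c ((q @ [v]) @ ws))"
   by (simp_all add: contraction_def)
  have "homog k' (%ws. a ((p @ [v]) @ ws))"
   unfolding c1(1)[symmetric] by (rule homog_contraction) (use Cons.prems Suc in simp)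
  note IH1 = Cons.IH[OF this, of q] and IH2 = Cons.IH[OF Cons.prems, of "q @ [v]"]
  show ?thesis
   unfolding wedge_with_Cons[OF b] homog_grade_sgn[OF Cons.prems] wedge_with_scale_left[OF b] c1 IH1 IH2 Suc shuffle_sum.simps ..
 qed
qed

lemma wedge_with_shuffle_sum:
 assumes "bilinear b" "homog k a" shows "wedge_with b a c vs = shuffle_sum b k a c [] [] vs"
 using wedge_with_shuffle_sum_gen[of b k a "[]" c "[]" vs] assms by simp

lemmas wedge_shuffle_sum = wedge_with_shuffle_sum[OF bilinear_mult_real]

lemma length_7_conv: "length bs = 7 \<longleftrightarrow> (\<exists>b0 b1 b2 b3 b4 b5 b6. bs = [b0, b1, b2, b3, b4, b5, b6])"
 by (auto simp: numeral_eq_Suc length_Suc_conv)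

text \<open>Only components with increasing indices are tabulated. They suffice for wedge products
  of these forms on the frame, since a shuffle of an increasing list keeps both parts increasing;
  for the same reason horizontality is stated with \<open>f0\<close> in first place.\<close>

locale g2_frame =
 fixes g7 :: "real^7 => real^7 => real" and f0 f1 f2 f3 f4 f5 f6 :: "real^7"
  and eta W P M :: "(real^7) list => real"
 assumes inner: "inner_product g7" and frame: "orthonormal_frame g7 [f0, f1, f2, f3, f4, f5, f6]"
  and alt: "alt_form 1 eta" "alt_form 2 W" "alt_form 3 P" "alt_form 3 M"
  and eta_f: "eta [f0] = 1" "eta [f1] = 0" "eta [f2] = 0" "eta [f3] = 0" "eta [f4] = 0" "eta [f5] = 0" "eta [f6] = 0"
  and f0: "\<And>vs. W (f0 # vs) = 0" "\<And>vs. P (f0 # vs) = 0" "\<And>vs. M (f0 # vs) = 0"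
  and W_f: "W [f1, f2] = 1"
   "W [f1, f3] = 0"
   "W [f1, f4] = 0"
   "W [f1, f5] = 0"
   "W [f1, f6] = 0"
   "W [f2, f3] = 0"
   "W [f2, f4] = 0"
   "W [f2, f5] = 0"
   "W [f2, f6] = 0"
   "W [f3, f4] = 1"
   "W [f3, f5] = 0"
   "W [f3, f6] = 0"
   "W [f4, f5] = 0"
   "W [f4, f6] = 0"
   "W [f5, f6] = 1"
  and P_f: "P [f1, f2, f3] = 0"
   "P [f1, f2, f4] = 0"
   "P [f1, f2, f5] = 0"
   "P [f1, f2, f6] = 0"
   "P [f1, f3, f4] = 0"
   "P [f1, f3, f5] = 1"
   "P [f1, f3, f6] = 0"
   "P [f1, f4, f5] = 0"
   "P [f1, f4, f6] = - 1"
   "P [f1, f5, f6] = 0"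
   "P [f2, f3, f4] = 0"
   "P [f2, f3, f5] = 0"
   "P [f2, f3, f6] = - 1"
   "P [f2, f4, f5] = - 1"
   "P [f2, f4, f6] = 0"
   "P [f2, f5, f6] = 0"
   "P [f3, f4, f5] = 0"
   "P [f3, f4, f6] = 0"
   "P [f3, f5, f6] = 0"
   "P [f4, f5, f6] = 0"
  and M_f: "M [f1, f2, f3] = 0"
   "M [f1, f2, f4] = 0"
   "M [f1, f2, f5] = 0"
   "M [f1, f2, f6] = 0"
   "M [f1, f3, f4] = 0"
   "M [f1, f3, f5] = 0"
   "M [f1, f3, f6] = 1"
   "M [f1, f4, f5] = 1"
   "M [f1, f4, f6] = 0"
   "M [f1, f5, f6] = 0"
   "M [f2, f3, f4] = 0"
   "M [f2, f3, f5] = 1"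
   "M [f2, f3, f6] = 0"
   "M [f2, f4, f5] = 0"
   "M [f2, f4, f6] = - 1"
   "M [f2, f5, f6] = 0"
   "M [f3, f4, f5] = 0"
   "M [f3, f4, f6] = 0"
   "M [f3, f5, f6] = 0"
   "M [f4, f5, f6] = 0"

begin

abbreviation "fs \<equiv> [f0, f1, f2, f3, f4, f5, f6]"

definition "phi = (%vs. (eta \<^bold>\<and> W) vs + P vs)"

definition "vol = (%vs. (1/6) *\<^sub>R (eta \<^bold>\<and> W \<^bold>\<and> W \<^bold>\<and> W) vs)"

lemmas tables = eta_f f0 W_f P_f M_f

lemma alt_phi: "alt_form 3 phi"
 unfolding phi_def by (rule alt_form_add[OF _ alt(3)]) (use alt_form_wedge[OF alt(1,2)] in \<open>simp add: numeral_3_eq_3\<close>)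

lemma alt_vol: "alt_form 7 vol"
proof -
 have "alt_form (1 + (2 + (2 + 2))) (eta \<^bold>\<and> W \<^bold>\<and> W \<^bold>\<and> W)" by (intro alt_form_wedge alt)
 then have "alt_form 7 (eta \<^bold>\<and> W \<^bold>\<and> W \<^bold>\<and> W)" by simp
 then show ?thesis unfolding vol_def by (rule alt_form_scale)
qed

lemmas hom = alt(1)[THEN alt_form_homog] alt(2)[THEN alt_form_homog, unfolded numeral_2_eq_2]
 alt(3)[THEN alt_form_homog, unfolded numeral_3_eq_3] alt(4)[THEN alt_form_homog, unfolded numeral_3_eq_3]

lemmas ws = wedge_shuffle_sum[OF hom(1)[unfolded One_nat_def]] wedge_shuffle_sum[OF hom(2)]
 wedge_shuffle_sum[OF hom(3)] wedge_shuffle_sum[OF hom(4)]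

lemma vol_fs: "vol fs = 1"
 unfolding vol_def by (simp add: ws tables)

lemma span_fs: "span (set fs) = UNIV"
proof -
 have "v \<in> span (set fs)" for v
 proof -
  have "fs ! i \<in> span (set fs)" if "i < 7" for i
   by (rule span_base, rule nth_mem) (use that in simp)
  then have "(\<Sum>i<DIM(real^7). g7 v (fs ! i) *\<^sub>R fs ! i) \<in> span (set fs)"
   by (intro span_sum span_scale) simp
  then show ?thesis using orthonormal_frame_expand[OF conjunct1[OF inner[unfolded inner_product_def]] frame, of v] by simp
 qed
 then show ?thesis by blast
qed

lemma phi_value: "phi [x, y, z] = eta [x] * W [y, z] - eta [y] * W [x, z] + eta [z] * W [x, y] + P [x, y, z]"
 unfolding phi_def by (simp add: ws)

lemma phi_table:
   "phi [f0, f1, f2] = 1"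
   "phi [f0, f1, f3] = 0"
   "phi [f0, f1, f4] = 0"
   "phi [f0, f1, f5] = 0"
   "phi [f0, f1, f6] = 0"
   "phi [f0, f2, f3] = 0"
   "phi [f0, f2, f4] = 0"
   "phi [f0, f2, f5] = 0"
   "phi [f0, f2, f6] = 0"
   "phi [f0, f3, f4] = 1"
   "phi [f0, f3, f5] = 0"
   "phi [f0, f3, f6] = 0"
   "phi [f0, f4, f5] = 0"
   "phi [f0, f4, f6] = 0"
   "phi [f0, f5, f6] = 1"
   "phi [f1, f2, f3] = 0"
   "phi [f1, f2, f4] = 0"
   "phi [f1, f2, f5] = 0"
   "phi [f1, f2, f6] = 0"
   "phi [f1, f3, f4] = 0"
   "phi [f1, f3, f5] = 1"
   "phi [f1, f3, f6] = 0"
   "phi [f1, f4, f5] = 0"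
   "phi [f1, f4, f6] = - 1"
   "phi [f1, f5, f6] = 0"
   "phi [f2, f3, f4] = 0"
   "phi [f2, f3, f5] = 0"
   "phi [f2, f3, f6] = - 1"
   "phi [f2, f4, f5] = - 1"
   "phi [f2, f4, f6] = 0"
   "phi [f2, f5, f6] = 0"
   "phi [f3, f4, f5] = 0"
   "phi [f3, f4, f6] = 0"
   "phi [f3, f5, f6] = 0"
   "phi [f4, f5, f6] = 0"
 by (simp_all add: phi_value tables)

lemma g7_fs: "i < 7 ==> j < 7 ==> g7 (fs ! i) (fs ! j) = of_bool (i = j)"
 using frame by (simp add: orthonormal_frame_def)

lemma distinct_fs: "distinct fs"
 unfolding distinct_conv_nth
proof (intro allI impI)
 fix i j assume ij: "i < length fs" "j < length fs" "i \<noteq> j"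
 then have "g7 (fs ! i) (fs ! j) = 0" "g7 (fs ! j) (fs ! j) = 1" using g7_fs[of i j] g7_fs[of j j] by simp_all
 then show "fs ! i \<noteq> fs ! j" by auto
qed

lemma is_g2_phi: "is_g2_form phi"
 unfolding is_g2_form_def
proof (intro conjI alt_phi exI[of _ fs])
 note dist = distinct_fs
 show "distinct fs" by (rule dist)
 show "length fs = 7" by simp
 show "span (set fs) = UNIV" by (rule span_fs)
 show "independent (set fs)"
  using card_eq_dim[of "set fs" UNIV] span_fs distinct_card[OF dist] by simp
 have "\<forall>k<7. \<forall>j<k. \<forall>i<j. phi [fs ! i, fs ! j, fs ! k] =
     (if (i, j, k) \<in> {(0,1,2), (0,3,4), (0,5,6), (1,3,5)} then 1
      else if (i, j, k) \<in> {(1,4,6), (2,3,6), (2,4,5)} then -1 else 0)"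
  by (simp add: All_less_Suc numeral_eq_Suc phi_table)
 then show "\<forall>i j k. i < j \<and> j < k \<and> k < 7 \<longrightarrow> phi [fs ! i, fs ! j, fs ! k] =
     (if (i, j, k) \<in> {(0,1,2), (0,3,4), (0,5,6), (1,3,5)} then 1
      else if (i, j, k) \<in> {(1,4,6), (2,3,6), (2,4,5)} then -1 else 0)"
  by blast
qed

lemma frame_sel_eq:
 assumes "alt_form k a" "alt_form k c"
  and "\<And>b0 b1 b2 b3 b4 b5 b6. length (filter id [b0, b1, b2, b3, b4, b5, b6]) = k ==>
   a (sel [b0, b1, b2, b3, b4, b5, b6] fs) = c (sel [b0, b1, b2, b3, b4, b5, b6] fs)"
 shows "a vs = (c vs :: real)"
proof (rule alt_form_eq_on_frame[OF assms(1,2) span_fs])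
 fix bs :: "bool list" assume "length bs = length fs" and k: "length (filter id bs) = k"
 then have "length bs = 7" by simp
 then obtain b0 b1 b2 b3 b4 b5 b6 where "bs = [b0, b1, b2, b3, b4, b5, b6]" unfolding length_7_conv by blast
 then show "a (sel bs fs) = c (sel bs fs)" using assms(3) k by blast
qed

text \<open>For a top-degree form the pairing with itself has a single term, the square of its value
  on the frame, and the pairing does not depend on the frame.\<close>

lemma vol_orthonormal: "orthonormal_frame g7 es ==> \<bar>vol es\<bar> = 1"
proof -
 assume es: "orthonormal_frame g7 es"
 have m: "multilin vol" "adj_alt vol" using alt_vol by (simp_all add: alt_form_iff)
 have p: "pairing us vol vol = vol us * vol us" if "length us = 7" for us
 proof -
  have "pairing us vol vol = (\<Sum>A\<in>Pow {..<length us}. if A = {..<length us} then vol us * vol us else 0)"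
   unfolding pairing_sum
  proof (rule sum.cong[OF refl])
   fix A assume A: "A \<in> Pow {..<length us}"
   show "vol (nths us A) * vol (nths us A) = (if A = {..<length us} then vol us * vol us else 0)"
   proof (cases "A = {..<length us}")
    case False
    then have "card A < card {..<length us}" using A by (intro psubset_card_mono) auto
    then have "length (nths us A) \<noteq> 7" using A that by (simp add: length_nths_subset)
    then show ?thesis using False alt_vol by (simp add: alt_form_def)
   qed (simp add: nths_all)
  qed
  then show ?thesis by simp
 qed
 have "pairing es vol vol = pairing fs vol vol" by (rule pairing_frame_independent[OF inner frame es alt_vol m])
 moreover have "length es = 7" using es by (simp add: orthonormal_frame_def)
 ultimately have "vol es * vol es = 1" using p[of es] p[of fs] by (simp only: vol_fs) simp
 then show ?thesis by (metis abs_1 abs_mult_self_eq abs_square_eq_1 power2_eq_square)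
qed

section \<open>Metric and volume form determined by \<open>phi\<close>\<close>

lemma phi_zero: "phi [x, x, y] = 0" "phi [x, y, y] = 0"
 using alt_phi[unfolded alt_form_iff adj_alt_def, THEN conjunct2, THEN conjunct2, rule_format, of "[]" x "[y]"]
  alt_phi[unfolded alt_form_iff adj_alt_def, THEN conjunct2, THEN conjunct2, rule_format, of "[x]" y "[]"] by simp_all

lemma phi_swap: "phi [y, x, w] = - phi [x, y, w]" "phi [w, y, x] = - phi [w, x, y]"
 using adj_alt_swap[of phi "[]" y x "[w]"] adj_alt_swap[of phi "[w]" y x "[]"] alt_phi by (simp_all add: alt_form_iff)

lemmas sw1 = phi_swap(1) and sw2 = phi_swap(2)

text \<open>Contraction puts an arbitrary frame vector in front, so the arguments of
  \<open>phi\<close> are no longer increasing in the metric computation and have to be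
  sorted.\<close>

lemmas phi_sort = sw1[of f1 f0] sw1[of f2 f0] sw1[of f3 f0] sw1[of f4 f0] sw1[of f5 f0] sw1[of f6 f0] sw1[of f2 f1] sw1[of f3 f1] sw1[of f4 f1] sw1[of f5 f1] sw1[of f6 f1] sw1[of f3 f2] sw1[of f4 f2] sw1[of f5 f2] sw1[of f6 f2] sw1[of f4 f3] sw1[of f5 f3] sw1[of f6 f3] sw1[of f5 f4] sw1[of f6 f4] sw1[of f6 f5]
   sw2[of _ f1 f0] sw2[of _ f2 f0] sw2[of _ f3 f0] sw2[of _ f4 f0] sw2[of _ f5 f0] sw2[of _ f6 f0] sw2[of _ f2 f1] sw2[of _ f3 f1] sw2[of _ f4 f1] sw2[of _ f5 f1] sw2[of _ f6 f1] sw2[of _ f3 f2] sw2[of _ f4 f2] sw2[of _ f5 f2] sw2[of _ f6 f2] sw2[of _ f4 f3] sw2[of _ f5 f3] sw2[of _ f6 f3] sw2[of _ f5 f4] sw2[of _ f6 f4] sw2[of _ f6 f5]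

lemma homog_contr_phi: "homog (Suc (Suc 0)) (X \<lrcorner> phi)"
 by (rule homog_contraction) (use alt_phi[THEN alt_form_homog] in \<open>simp add: numeral_3_eq_3\<close>)

lemma metric_row_0:
 "((f0 \<lrcorner> phi) \<^bold>\<and> (f0 \<lrcorner> phi) \<^bold>\<and> phi) fs = 6"
 "((f0 \<lrcorner> phi) \<^bold>\<and> (f1 \<lrcorner> phi) \<^bold>\<and> phi) fs = 0"
 "((f0 \<lrcorner> phi) \<^bold>\<and> (f2 \<lrcorner> phi) \<^bold>\<and> phi) fs = 0"
 "((f0 \<lrcorner> phi) \<^bold>\<and> (f3 \<lrcorner> phi) \<^bold>\<and> phi) fs = 0"
 "((f0 \<lrcorner> phi) \<^bold>\<and> (f4 \<lrcorner> phi) \<^bold>\<and> phi) fs = 0"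
 "((f0 \<lrcorner> phi) \<^bold>\<and> (f5 \<lrcorner> phi) \<^bold>\<and> phi) fs = 0"
 "((f0 \<lrcorner> phi) \<^bold>\<and> (f6 \<lrcorner> phi) \<^bold>\<and> phi) fs = 0"
 by (simp_all only: wedge_shuffle_sum[OF homog_contr_phi] shuffle_sum.simps append.simps contraction_apply phi_zero phi_sort phi_table) simp_all

lemma metric_row_1:
 "((f1 \<lrcorner> phi) \<^bold>\<and> (f0 \<lrcorner> phi) \<^bold>\<and> phi) fs = 0"
 "((f1 \<lrcorner> phi) \<^bold>\<and> (f1 \<lrcorner> phi) \<^bold>\<and> phi) fs = 6"
 "((f1 \<lrcorner> phi) \<^bold>\<and> (f2 \<lrcorner> phi) \<^bold>\<and> phi) fs = 0"
 "((f1 \<lrcorner> phi) \<^bold>\<and> (f3 \<lrcorner> phi) \<^bold>\<and> phi) fs = 0"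
 "((f1 \<lrcorner> phi) \<^bold>\<and> (f4 \<lrcorner> phi) \<^bold>\<and> phi) fs = 0"
 "((f1 \<lrcorner> phi) \<^bold>\<and> (f5 \<lrcorner> phi) \<^bold>\<and> phi) fs = 0"
 "((f1 \<lrcorner> phi) \<^bold>\<and> (f6 \<lrcorner> phi) \<^bold>\<and> phi) fs = 0"
 by (simp_all only: wedge_shuffle_sum[OF homog_contr_phi] shuffle_sum.simps append.simps contraction_apply phi_zero phi_sort phi_table) simp_all

lemma metric_row_2:
 "((f2 \<lrcorner> phi) \<^bold>\<and> (f0 \<lrcorner> phi) \<^bold>\<and> phi) fs = 0"
 "((f2 \<lrcorner> phi) \<^bold>\<and> (f1 \<lrcorner> phi) \<^bold>\<and> phi) fs = 0"
 "((f2 \<lrcorner> phi) \<^bold>\<and> (f2 \<lrcorner> phi) \<^bold>\<and> phi) fs = 6"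
 "((f2 \<lrcorner> phi) \<^bold>\<and> (f3 \<lrcorner> phi) \<^bold>\<and> phi) fs = 0"
 "((f2 \<lrcorner> phi) \<^bold>\<and> (f4 \<lrcorner> phi) \<^bold>\<and> phi) fs = 0"
 "((f2 \<lrcorner> phi) \<^bold>\<and> (f5 \<lrcorner> phi) \<^bold>\<and> phi) fs = 0"
 "((f2 \<lrcorner> phi) \<^bold>\<and> (f6 \<lrcorner> phi) \<^bold>\<and> phi) fs = 0"
 by (simp_all only: wedge_shuffle_sum[OF homog_contr_phi] shuffle_sum.simps append.simps contraction_apply phi_zero phi_sort phi_table) simp_all

lemma metric_row_3:
 "((f3 \<lrcorner> phi) \<^bold>\<and> (f0 \<lrcorner> phi) \<^bold>\<and> phi) fs = 0"
 "((f3 \<lrcorner> phi) \<^bold>\<and> (f1 \<lrcorner> phi) \<^bold>\<and> phi) fs = 0"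
 "((f3 \<lrcorner> phi) \<^bold>\<and> (f2 \<lrcorner> phi) \<^bold>\<and> phi) fs = 0"
 "((f3 \<lrcorner> phi) \<^bold>\<and> (f3 \<lrcorner> phi) \<^bold>\<and> phi) fs = 6"
 "((f3 \<lrcorner> phi) \<^bold>\<and> (f4 \<lrcorner> phi) \<^bold>\<and> phi) fs = 0"
 "((f3 \<lrcorner> phi) \<^bold>\<and> (f5 \<lrcorner> phi) \<^bold>\<and> phi) fs = 0"
 "((f3 \<lrcorner> phi) \<^bold>\<and> (f6 \<lrcorner> phi) \<^bold>\<and> phi) fs = 0"
 by (simp_all only: wedge_shuffle_sum[OF homog_contr_phi] shuffle_sum.simps append.simps contraction_apply phi_zero phi_sort phi_table) simp_all

lemma metric_row_4:
 "((f4 \<lrcorner> phi) \<^bold>\<and> (f0 \<lrcorner> phi) \<^bold>\<and> phi) fs = 0"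
 "((f4 \<lrcorner> phi) \<^bold>\<and> (f1 \<lrcorner> phi) \<^bold>\<and> phi) fs = 0"
 "((f4 \<lrcorner> phi) \<^bold>\<and> (f2 \<lrcorner> phi) \<^bold>\<and> phi) fs = 0"
 "((f4 \<lrcorner> phi) \<^bold>\<and> (f3 \<lrcorner> phi) \<^bold>\<and> phi) fs = 0"
 "((f4 \<lrcorner> phi) \<^bold>\<and> (f4 \<lrcorner> phi) \<^bold>\<and> phi) fs = 6"
 "((f4 \<lrcorner> phi) \<^bold>\<and> (f5 \<lrcorner> phi) \<^bold>\<and> phi) fs = 0"
 "((f4 \<lrcorner> phi) \<^bold>\<and> (f6 \<lrcorner> phi) \<^bold>\<and> phi) fs = 0"
 by (simp_all only: wedge_shuffle_sum[OF homog_contr_phi] shuffle_sum.simps append.simps contraction_apply phi_zero phi_sort phi_table) simp_all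

lemma metric_row_5:
 "((f5 \<lrcorner> phi) \<^bold>\<and> (f0 \<lrcorner> phi) \<^bold>\<and> phi) fs = 0"
 "((f5 \<lrcorner> phi) \<^bold>\<and> (f1 \<lrcorner> phi) \<^bold>\<and> phi) fs = 0"
 "((f5 \<lrcorner> phi) \<^bold>\<and> (f2 \<lrcorner> phi) \<^bold>\<and> phi) fs = 0"
 "((f5 \<lrcorner> phi) \<^bold>\<and> (f3 \<lrcorner> phi) \<^bold>\<and> phi) fs = 0"
 "((f5 \<lrcorner> phi) \<^bold>\<and> (f4 \<lrcorner> phi) \<^bold>\<and> phi) fs = 0"
 "((f5 \<lrcorner> phi) \<^bold>\<and> (f5 \<lrcorner> phi) \<^bold>\<and> phi) fs = 6"
 "((f5 \<lrcorner> phi) \<^bold>\<and> (f6 \<lrcorner> phi) \<^bold>\<and> phi) fs = 0"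
 by (simp_all only: wedge_shuffle_sum[OF homog_contr_phi] shuffle_sum.simps append.simps contraction_apply phi_zero phi_sort phi_table) simp_all

lemma metric_row_6:
 "((f6 \<lrcorner> phi) \<^bold>\<and> (f0 \<lrcorner> phi) \<^bold>\<and> phi) fs = 0"
 "((f6 \<lrcorner> phi) \<^bold>\<and> (f1 \<lrcorner> phi) \<^bold>\<and> phi) fs = 0"
 "((f6 \<lrcorner> phi) \<^bold>\<and> (f2 \<lrcorner> phi) \<^bold>\<and> phi) fs = 0"
 "((f6 \<lrcorner> phi) \<^bold>\<and> (f3 \<lrcorner> phi) \<^bold>\<and> phi) fs = 0"
 "((f6 \<lrcorner> phi) \<^bold>\<and> (f4 \<lrcorner> phi) \<^bold>\<and> phi) fs = 0"
 "((f6 \<lrcorner> phi) \<^bold>\<and> (f5 \<lrcorner> phi) \<^bold>\<and> phi) fs = 0"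
 "((f6 \<lrcorner> phi) \<^bold>\<and> (f6 \<lrcorner> phi) \<^bold>\<and> phi) fs = 6"
 by (simp_all only: wedge_shuffle_sum[OF homog_contr_phi] shuffle_sum.simps append.simps contraction_apply phi_zero phi_sort phi_table) simp_all

lemmas metric_rows = metric_row_0 metric_row_1 metric_row_2 metric_row_3 metric_row_4 metric_row_5 metric_row_6

text \<open>Both sides are bilinear in \<open>X\<close> and \<open>Y\<close> and of top degree in
  \<open>vs\<close>, so the 49 values on pairs of frame vectors decide.\<close>

lemma metric_identity: "6 * g7 X Y * vol vs = ((X \<lrcorner> phi) \<^bold>\<and> (Y \<lrcorner> phi) \<^bold>\<and> phi) vs"
proof -
 note lb = wedge_with_add_left[OF bilinear_mult_real] wedge_with_scale_left[OF bilinear_mult_real]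
  wedge_with_add_right[OF bilinear_mult_real] wedge_with_scale_right[OF bilinear_mult_real]
 have lin: "linear (%X. phi (X # us))" for us using alt_phi linear_head by (auto simp: alt_form_iff)
 have ca: "(X + X') \<lrcorner> phi = (%us. (X \<lrcorner> phi) us + (X' \<lrcorner> phi) us)" "(r *\<^sub>R X) \<lrcorner> phi = (%us. r *\<^sub>R (X \<lrcorner> phi) us)" for X X' r
  by (simp_all add: contraction_def linear_add[OF lin] linear_scale[OF lin])
 have lbf: "(%us. a us + a' us) \<^bold>\<and> c = (%us. (a \<^bold>\<and> c) us + (a' \<^bold>\<and> c) us)" "(%us. r *\<^sub>R a us) \<^bold>\<and> c = (%us. r *\<^sub>R (a \<^bold>\<and> c) us)"
  for a a' c :: "(real^7) list => real" and r
  by (rule ext, rule lb)+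
 have bilB: "bilinear (%X Y. ((X \<lrcorner> phi) \<^bold>\<and> (Y \<lrcorner> phi) \<^bold>\<and> phi) vs)" for vs
  unfolding bilinear_def by (intro conjI allI linearI) (simp_all only: ca lb lbf)
 have gs: "g7 X Y = of_bool (X = Y)" if XY: "X \<in> set fs" "Y \<in> set fs" for X Y
 proof -
  obtain i j where ij: "i < length fs" "j < length fs" "X = fs ! i" "Y = fs ! j" using XY unfolding in_set_conv_nth by blast
  then show ?thesis using g7_fs[of i j] nth_eq_iff_index_eq[OF distinct_fs ij(1,2)] by simp
 qed
 have B: "((X \<lrcorner> phi) \<^bold>\<and> (Y \<lrcorner> phi) \<^bold>\<and> phi) fs = 6 * of_bool (X = Y)" if XY: "X \<in> set fs" "Y \<in> set fs" for X Y
 proof -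
  note ne = distinct_fs[simplified]
  have ne': "f1 \<noteq> f0 \<and> f2 \<noteq> f0 \<and> f3 \<noteq> f0 \<and> f4 \<noteq> f0 \<and> f5 \<noteq> f0 \<and> f6 \<noteq> f0 \<and> f2 \<noteq> f1 \<and> f3 \<noteq> f1 \<and> f4 \<noteq> f1 \<and> f5 \<noteq> f1 \<and> f6 \<noteq> f1 \<and> f3 \<noteq> f2 \<and> f4 \<noteq> f2 \<and> f5 \<noteq> f2 \<and> f6 \<noteq> f2 \<and> f4 \<noteq> f3 \<and> f5 \<noteq> f3 \<and> f6 \<noteq> f3 \<and> f5 \<noteq> f4 \<and> f6 \<noteq> f4 \<and> f6 \<noteq> f5"
   using ne by metis
  have "X = f0 \<or> X = f1 \<or> X = f2 \<or> X = f3 \<or> X = f4 \<or> X = f5 \<or> X = f6"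
   "Y = f0 \<or> Y = f1 \<or> Y = f2 \<or> Y = f3 \<or> Y = f4 \<or> Y = f5 \<or> Y = f6" using XY by auto
  then show ?thesis
   by (elim disjE; simp only: metric_rows; simp add: ne ne')
 qed
 have bg: "bilinear (%X Y. 6 * g7 X Y * vol vs)" for vs
 proof -
  have "bilinear g7" using inner by (simp add: inner_product_def)
  then show ?thesis unfolding bilinear_def by (auto simp: linear_iff algebra_simps)
 qed
 have S: "6 * g7 X Y * vol vs = ((X \<lrcorner> phi) \<^bold>\<and> (Y \<lrcorner> phi) \<^bold>\<and> phi) vs" if XY: "X \<in> set fs" "Y \<in> set fs" for X Y
 proof (rule frame_sel_eq[of 7])
  show "alt_form 7 (%vs. 6 * g7 X Y * vol vs)" using alt_form_scale[OF alt_vol, of "6 * g7 X Y"] by simp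
  have "alt_form 2 (Z \<lrcorner> phi)" for Z by (rule alt_form_contraction) (use alt_phi in \<open>simp add: numeral_3_eq_3 numeral_2_eq_2\<close>)
  then have "alt_form (2 + (2 + 3)) ((X \<lrcorner> phi) \<^bold>\<and> (Y \<lrcorner> phi) \<^bold>\<and> phi)" by (intro alt_form_wedge alt_phi)
  then show "alt_form 7 ((X \<lrcorner> phi) \<^bold>\<and> (Y \<lrcorner> phi) \<^bold>\<and> phi)" by simp
  fix b0 b1 b2 b3 b4 b5 b6 assume "length (filter id [b0, b1, b2, b3, b4, b5, b6]) = 7"
  then have "b0 \<and> b1 \<and> b2 \<and> b3 \<and> b4 \<and> b5 \<and> b6" by (auto split: if_splits)
  then show "6 * g7 X Y * vol (sel [b0, b1, b2, b3, b4, b5, b6] fs) = ((X \<lrcorner> phi) \<^bold>\<and> (Y \<lrcorner> phi) \<^bold>\<and> phi) (sel [b0, b1, b2, b3, b4, b5, b6] fs)"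
   using B[OF XY] gs[OF XY] vol_fs by simp
 qed
 show ?thesis
  by (rule bilinear_eq[OF bg bilB, of UNIV "set fs" UNIV "set fs"]) (simp_all only: span_fs S subset_UNIV UNIV_I)
qed

text \<open>The defining identity fixes the pair only up to a scale \<open>c\<close>: the metric is
  divided by \<open>c\<close> and the volume form multiplied by it. Positivity of the metric gives
  \<open>c > 0\<close>, and the condition that the volume form has absolute value 1 on orthonormal
  frames then forces \<open>c = 1\<close>.\<close>

lemma g2_metric_vol_phi: "g2_metric_vol phi = (g7, vol)"
 unfolding g2_metric_vol_def
proof (rule the_equality)
 show "case (g7, vol) of (g, v) => inner_product g \<and> alt_form 7 v \<and>
   (\<forall>es. orthonormal_frame g es \<longrightarrow> \<bar>v es\<bar> = 1) \<and>
   (\<forall>X Y vs. 6 * g X Y * v vs = ((X \<lrcorner> phi) \<^bold>\<and> (Y \<lrcorner> phi) \<^bold>\<and> phi) vs)"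
  using inner alt_vol vol_orthonormal metric_identity by simp
 fix gv assume A: "case gv of (g, v) => inner_product g \<and> alt_form 7 v \<and>
   (\<forall>es. orthonormal_frame g es \<longrightarrow> \<bar>v es\<bar> = 1) \<and>
   (\<forall>X Y vs. 6 * g X Y * v vs = ((X \<lrcorner> phi) \<^bold>\<and> (Y \<lrcorner> phi) \<^bold>\<and> phi) vs)"
 obtain g v where gv: "gv = (g, v)" by (cases gv)
 have g: "inner_product g" "alt_form 7 v" and o: "\<And>es. orthonormal_frame g es ==> \<bar>v es\<bar> = 1"
  and m: "\<And>X Y vs. 6 * g X Y * v vs = 6 * g7 X Y * vol vs" using A metric_identity unfolding gv by auto
 have e: "g X Y * v fs = g7 X Y" for X Y using m[of X Y fs] vol_fs by simp
 have f00: "g7 f0 f0 = 1" using g7_fs[of 0 0] by simp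
 then have f0n: "f0 \<noteq> 0" using inner bilinear_lzero[of g7 f0] by (auto simp: inner_product_def)
 have gp: "g f0 f0 > 0" using g(1) f0n by (simp add: inner_product_def)
 define c where "c = v fs"
 have "g f0 f0 * c = 1" using e[of f0 f0] f00 by (simp add: c_def)
 then have c: "c > 0" using gp by (metis zero_less_mult_pos zero_less_one)
 have gc: "g X Y = g7 X Y / c" for X Y using e[of X Y] c by (simp add: c_def field_simps)
 define r where "r = sqrt c"
 have r: "r > 0" "r * r = c" using c by (simp_all add: r_def)
 have bg: "bilinear g" using g(1) by (simp add: inner_product_def)
 have "orthonormal_frame g (map (%x. r *\<^sub>R x) fs)"
  unfolding orthonormal_frame_def
 proof (intro conjI allI impI)
  show "length (map (%x. r *\<^sub>R x) fs) = DIM(real^7)" by simp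
  fix i j assume "i < length (map (%x. r *\<^sub>R x) fs)" "j < length (map (%x. r *\<^sub>R x) fs)"
  then have ij: "i < 7" "j < 7" by simp_all
  have "g (r *\<^sub>R (fs ! i)) (r *\<^sub>R (fs ! j)) = r * r * g (fs ! i) (fs ! j)"
   by (simp only: bilinear_lmul[OF bg] bilinear_rmul[OF bg]) simp
  also have "\<dots> = of_bool (i = j)" unfolding r(2) gc g7_fs[OF ij] using c by simp
  finally show "g (map (%x. r *\<^sub>R x) fs ! i) (map (%x. r *\<^sub>R x) fs ! j) = of_bool (i = j)"
   using ij by (simp only: nth_map length_Cons list.size)
 qed
 from o[OF this] have "\<bar>v (map (%x. r *\<^sub>R x) fs)\<bar> = 1" .
 moreover have "v (us @ map (%x. s *\<^sub>R x) ws) = s ^ length ws * v (us @ ws)" for s us ws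
 proof (induction ws arbitrary: us)
  case (Cons w ws)
  have "linear (%x. v (us @ x # ys))" for ys using g(2) by (simp add: alt_form_iff multilin_def)
  from linear_scale[OF this] Cons[of "us @ [w]"] show ?case by simp
 qed simp
 from this[of "[]" r fs] have "v (map (%x. r *\<^sub>R x) fs) = r ^ length fs * c" by (simp only: append_Nil c_def)
 moreover have "length fs = 7" by simp
 ultimately have "\<bar>r ^ 7 * c\<bar> = 1" by (simp only:)
 moreover have "r ^ 7 * c > 0" using r(1) c by simp
 ultimately have "r ^ 7 * c = 1" by (simp only: abs_of_pos)
 \<comment> \<open>Seven factors come from the rescaled frame vectors and two from \<open>c\<close>,
   the square of \<open>r\<close>.\<close>
 then have "r ^ 9 = 1 ^ 9" unfolding r(2)[symmetric] by (simp add: eval_nat_numeral)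
 then have "r = 1" using r(1) power_eq_iff_eq_base[of 9 r 1] by simp
 then have c1: "c = 1" using r(2) by simp
 have gg: "g = g7" using gc c1 by (intro ext) simp
 have "v vs = vol vs" for vs using m[of f0 f0 vs] f00 unfolding gg by simp
 then show "gv = (g7, vol)" unfolding gv gg by auto
qed

lemma g2_star_phi: "g2_star phi = hodge g7 vol"
 unfolding g2_star_def g2_metric_vol_phi by simp

lemma star_sel:
 assumes "alt_form k a" "length bs = 7"
 shows "g2_star phi a (sel bs fs) = shuffle_sign (map Not bs) * a (sel (map Not bs) fs)"
proof -
 have n: "map Not (map Not bs) = bs" by (simp add: o_def)
 have v: "alt_form DIM(real^7) vol" using alt_vol by simp
 show ?thesis unfolding g2_star_phi
  using hodge_sel[OF inner frame assms(1) v vol_fs, of "map Not bs"] assms(2) unfolding n by simp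
qed

lemma alt_star: "alt_form k a ==> k \<le> 7 ==> alt_form (7 - k) (g2_star phi a)"
 unfolding g2_star_phi by (rule alt_form_hodge[OF _ alt_vol])

end

section \<open>Torsion in an adapted frame\<close>

text \<open>The relations are oriented as rewrite rules. Seven of them leave 8 of the 15 components
  of \<open>K\<close>, eight leave 12 of the 20 components of \<open>N3\<close>, in agreement with
  the dimensions of the two representations. The tables for \<open>J1\<close> and \<open>J3\<close>
  express that the complex structure sends \<open>f1\<close>, \<open>f3\<close>, \<open>f5\<close>
  to \<open>f2\<close>, \<open>f4\<close>, \<open>f6\<close>.\<close>

locale g2_torsion = g2_frame +
 fixes K N1 N3 J1 J3 :: "(real^7) list => real" and p s :: real
 assumes alt': "alt_form 2 K" "alt_form 1 N1" "alt_form 3 N3" "alt_form 1 J1" "alt_form 3 J3"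
  and f0': "\<And>vs. K (f0 # vs) = 0" "\<And>vs. N1 (f0 # vs) = 0" "\<And>vs. N3 (f0 # vs) = 0"
   "\<And>vs. J1 (f0 # vs) = 0" "\<And>vs. J3 (f0 # vs) = 0"
  and K_f: "K [f2, f4] = K [f1, f3]"
   "K [f2, f3] = - K [f1, f4]"
   "K [f2, f6] = K [f1, f5]"
   "K [f2, f5] = - K [f1, f6]"
   "K [f4, f6] = K [f3, f5]"
   "K [f4, f5] = - K [f3, f6]"
   "K [f5, f6] = - K [f1, f2] - K [f3, f4]"
  and N3_f: "N3 [f3, f4, f5] = - N3 [f1, f2, f5]"
   "N3 [f3, f4, f6] = - N3 [f1, f2, f6]"
   "N3 [f3, f5, f6] = - N3 [f1, f2, f3]"
   "N3 [f4, f5, f6] = - N3 [f1, f2, f4]"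
   "N3 [f1, f5, f6] = - N3 [f1, f3, f4]"
   "N3 [f2, f5, f6] = - N3 [f2, f3, f4]"
   "N3 [f2, f4, f6] = N3 [f1, f3, f6] + N3 [f1, f4, f5] + N3 [f2, f3, f5]"
   "N3 [f2, f4, f5] = N3 [f1, f3, f5] - N3 [f1, f4, f6] - N3 [f2, f3, f6]"
  and J1_f: "J1 [f1] = N1 [f2]"
   "J1 [f2] = - N1 [f1]"
   "J1 [f3] = N1 [f4]"
   "J1 [f4] = - N1 [f3]"
   "J1 [f5] = N1 [f6]"
   "J1 [f6] = - N1 [f5]"
  and J3_f: "J3 [f1, f2, f3] = N3 [f1, f2, f4]"
   "J3 [f1, f2, f4] = - N3 [f1, f2, f3]"
   "J3 [f1, f2, f5] = N3 [f1, f2, f6]"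
   "J3 [f1, f2, f6] = - N3 [f1, f2, f5]"
   "J3 [f1, f3, f4] = N3 [f2, f3, f4]"
   "J3 [f1, f3, f5] = N3 [f2, f4, f6]"
   "J3 [f1, f3, f6] = - N3 [f2, f4, f5]"
   "J3 [f1, f4, f5] = - N3 [f2, f3, f6]"
   "J3 [f1, f4, f6] = N3 [f2, f3, f5]"
   "J3 [f1, f5, f6] = N3 [f2, f5, f6]"
   "J3 [f2, f3, f4] = - N3 [f1, f3, f4]"
   "J3 [f2, f3, f5] = - N3 [f1, f4, f6]"
   "J3 [f2, f3, f6] = N3 [f1, f4, f5]"
   "J3 [f2, f4, f5] = N3 [f1, f3, f6]"
   "J3 [f2, f4, f6] = - N3 [f1, f3, f5]"
   "J3 [f2, f5, f6] = - N3 [f1, f5, f6]"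
   "J3 [f3, f4, f5] = N3 [f3, f4, f6]"
   "J3 [f3, f4, f6] = - N3 [f3, f4, f5]"
   "J3 [f3, f5, f6] = N3 [f4, f5, f6]"
   "J3 [f4, f5, f6] = - N3 [f3, f5, f6]"

begin

text \<open>From here to \<open>T\<close> stand d\<omega>, the derivatives of the two parts of the
  rotated \<Upsilon>, d\<phi>, \<psi>, \<open>\<tau>\<^sub>1\<close> and \<open>T_\<phi>\<close>,
  written algebraically in one tangent space. That they are the actual forms and derivatives is
  shown only on the manifold.\<close>

definition "dW = (%vs. - (3/2) * s * P vs + (3/2) * p * M vs + (N1 \<^bold>\<and> W) vs + N3 vs)"

definition "dP = (%vs. p * (W \<^bold>\<and> W) vs + 2 * (N1 \<^bold>\<and> P) vs)"

definition "dM = (%vs. s * (W \<^bold>\<and> W) vs + 2 * (N1 \<^bold>\<and> M) vs)"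

definition "D = (%vs. (K \<^bold>\<and> W) vs - (eta \<^bold>\<and> dW) vs + dP vs)"

definition "psi = (%vs. (1/2) * (W \<^bold>\<and> W) vs - (eta \<^bold>\<and> M) vs)"

definition "tau = (%vs. (1/2) * N1 vs + (1/2) * s * eta vs)"

definition "T = (%vs. (eta \<^bold>\<and> K) vs + (p / 2 * P vs + s / 2 * M vs + (J1 \<^bold>\<and> W) vs + J3 vs))"

lemmas tables' = K_f N3_f J1_f J3_f f0'

lemmas hom' = alt'(1)[THEN alt_form_homog, unfolded numeral_2_eq_2] alt'(2)[THEN alt_form_homog, unfolded One_nat_def]

lemma alt_sum: "alt_form k a ==> alt_form k c ==> alt_form k (%vs. a vs - (c vs :: real))"
 "alt_form k a ==> alt_form k (%vs. r * (a vs :: real))"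
 using alt_form_add[of k a "%vs. -1 *\<^sub>R c vs"] alt_form_scale[of k c "-1"] alt_form_scale[of k a r] by simp_all

lemma alt_wedge: "alt_form k a ==> alt_form l c ==> m = k + l ==> alt_form m (a \<^bold>\<and> c)"
 using alt_form_wedge by blast

lemma alt_dW: "alt_form 3 dW" unfolding dW_def
 by (intro alt_form_add alt_sum(2) alt alt' alt_wedge[OF alt'(2) alt(2)]) simp

lemma alt_dP: "alt_form 4 dP" and alt_dM: "alt_form 4 dM" unfolding dP_def dM_def
 by (intro alt_form_add alt_sum(2) alt_wedge[OF alt(2,2)] alt_wedge[OF alt'(2) alt(3)] alt_wedge[OF alt'(2) alt(4)]; simp)+

lemma alt_D: "alt_form 4 D" unfolding D_def
 by (intro alt_form_add alt_sum(1) alt_wedge[OF alt'(1) alt(2)] alt_wedge[OF alt(1) alt_dW] alt_dP; simp)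

lemma alt_psi: "alt_form 4 psi" unfolding psi_def
 by (intro alt_sum alt_wedge[OF alt(2,2)] alt_wedge[OF alt(1,4)]; simp)

lemma alt_tau: "alt_form 1 tau" unfolding tau_def by (intro alt_form_add alt_sum(2) alt alt')

lemma alt_T: "alt_form 3 T" unfolding T_def
 by (intro alt_form_add alt_sum(2) alt alt' alt_wedge[OF alt(1) alt'(1)] alt_wedge[OF alt'(4) alt(2)]; simp)

lemmas wsh = ws wedge_shuffle_sum[OF hom'(1)] wedge_shuffle_sum[OF hom'(2)]
 wedge_shuffle_sum[OF alt'(4)[THEN alt_form_homog, unfolded One_nat_def]]
 wedge_shuffle_sum[OF alt_dW[THEN alt_form_homog, unfolded numeral_3_eq_3]]
 wedge_shuffle_sum[OF alt_phi[THEN alt_form_homog, unfolded numeral_3_eq_3]]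

lemma dW_apply: "dW vs = - (3/2) * s * P vs + (3/2) * p * M vs + (N1 \<^bold>\<and> W) vs + N3 vs" by (simp add: dW_def)

lemma dP_apply: "dP vs = p * (W \<^bold>\<and> W) vs + 2 * (N1 \<^bold>\<and> P) vs" by (simp add: dP_def)

lemma dM_apply: "dM vs = s * (W \<^bold>\<and> W) vs + 2 * (N1 \<^bold>\<and> M) vs" by (simp add: dM_def)

lemma D_apply: "D vs = (K \<^bold>\<and> W) vs - (eta \<^bold>\<and> dW) vs + dP vs" by (simp add: D_def)

lemma psi_apply: "psi vs = (1/2) * (W \<^bold>\<and> W) vs - (eta \<^bold>\<and> M) vs" by (simp add: psi_def)

lemma T_apply: "T vs = (eta \<^bold>\<and> K) vs + (p / 2 * P vs + s / 2 * M vs + (J1 \<^bold>\<and> W) vs + J3 vs)" by (simp add: T_def)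

lemma tau_apply: "tau vs = (1/2) * N1 vs + (1/2) * s * eta vs" by (simp add: tau_def)

lemmas applies = dW_apply dP_apply dM_apply D_apply psi_apply T_apply tau_apply

lemma psi_eq: "g2_star phi phi vs = psi vs"
proof (rule frame_sel_eq[of 4])
 show "alt_form 4 (g2_star phi phi)" using alt_star[OF alt_phi] by simp
 show "alt_form 4 psi" by (rule alt_psi)
 fix b0 b1 b2 b3 b4 b5 b6 assume l: "length (filter id [b0, b1, b2, b3, b4, b5, b6]) = 4"
 let ?bs = "[b0, b1, b2, b3, b4, b5, b6]"
 have "g2_star phi phi (sel ?bs fs) = shuffle_sign (map Not ?bs) * phi (sel (map Not ?bs) fs)"
  by (rule star_sel[OF alt_phi]) simp
 then show "g2_star phi phi (sel ?bs fs) = psi (sel ?bs fs)"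
  using l by (cases b0; cases b1; cases b2; cases b3; cases b4; cases b5; cases b6;
   simp add: phi_table psi_apply wsh tables)
qed

text \<open>All 35 components of this 3-form, prepared with explicit masks: they occur inside a
  wedge product in \<open>tau_eq\<close>, where rewriting meets lists of frame vectors and no
  masks.\<close>

lemmas star_D = star_sel[OF alt_D, of "[True, True, True, False, False, False, False]"]
  star_sel[OF alt_D, of "[True, True, False, True, False, False, False]"]
  star_sel[OF alt_D, of "[True, True, False, False, True, False, False]"]
  star_sel[OF alt_D, of "[True, True, False, False, False, True, False]"]
  star_sel[OF alt_D, of "[True, True, False, False, False, False, True]"]
  star_sel[OF alt_D, of "[True, False, True, True, False, False, False]"]
  star_sel[OF alt_D, of "[True, False, True, False, True, False, False]"]
  star_sel[OF alt_D, of "[True, False, True, False, False, True, False]"]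
  star_sel[OF alt_D, of "[True, False, True, False, False, False, True]"]
  star_sel[OF alt_D, of "[True, False, False, True, True, False, False]"]
  star_sel[OF alt_D, of "[True, False, False, True, False, True, False]"]
  star_sel[OF alt_D, of "[True, False, False, True, False, False, True]"]
  star_sel[OF alt_D, of "[True, False, False, False, True, True, False]"]
  star_sel[OF alt_D, of "[True, False, False, False, True, False, True]"]
  star_sel[OF alt_D, of "[True, False, False, False, False, True, True]"]
  star_sel[OF alt_D, of "[False, True, True, True, False, False, False]"]
  star_sel[OF alt_D, of "[False, True, True, False, True, False, False]"]
  star_sel[OF alt_D, of "[False, True, True, False, False, True, False]"]
  star_sel[OF alt_D, of "[False, True, True, False, False, False, True]"]
  star_sel[OF alt_D, of "[False, True, False, True, True, False, False]"]
  star_sel[OF alt_D, of "[False, True, False, True, False, True, False]"]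
  star_sel[OF alt_D, of "[False, True, False, True, False, False, True]"]
  star_sel[OF alt_D, of "[False, True, False, False, True, True, False]"]
  star_sel[OF alt_D, of "[False, True, False, False, True, False, True]"]
  star_sel[OF alt_D, of "[False, True, False, False, False, True, True]"]
  star_sel[OF alt_D, of "[False, False, True, True, True, False, False]"]
  star_sel[OF alt_D, of "[False, False, True, True, False, True, False]"]
  star_sel[OF alt_D, of "[False, False, True, True, False, False, True]"]
  star_sel[OF alt_D, of "[False, False, True, False, True, True, False]"]
  star_sel[OF alt_D, of "[False, False, True, False, True, False, True]"]
  star_sel[OF alt_D, of "[False, False, True, False, False, True, True]"]
  star_sel[OF alt_D, of "[False, False, False, True, True, True, False]"]
  star_sel[OF alt_D, of "[False, False, False, True, True, False, True]"]
  star_sel[OF alt_D, of "[False, False, False, True, False, True, True]"]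
  star_sel[OF alt_D, of "[False, False, False, False, True, True, True]"]

lemmas star_D' = star_D[simplified list.map sel.simps simp_thms]

lemma homog_D: "homog (Suc (Suc (Suc (Suc 0)))) D"
 using alt_D[THEN alt_form_homog] by (simp add: eval_nat_numeral)

lemmas wsh' = wsh wedge_shuffle_sum[OF alt_tau[THEN alt_form_homog, unfolded One_nat_def]] wedge_shuffle_sum[OF homog_D]

lemma alt_star_D: "alt_form 3 (g2_star phi D)" using alt_star[OF alt_D] by simp

lemma tau_eq: "(1/12) * g2_star phi (phi \<^bold>\<and> g2_star phi D) vs = tau vs"
proof (rule frame_sel_eq[of 1])
 have a: "alt_form 6 (phi \<^bold>\<and> g2_star phi D)" by (rule alt_wedge[OF alt_phi alt_star_D]) simp
 show "alt_form 1 (%vs. (1/12) * g2_star phi (phi \<^bold>\<and> g2_star phi D) vs)"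
  by (rule alt_sum(2)) (use alt_star[OF a] in simp)
 show "alt_form 1 tau" by (rule alt_tau)
 fix b0 b1 b2 b3 b4 b5 b6 assume l: "length (filter id [b0, b1, b2, b3, b4, b5, b6]) = 1"
 let ?bs = "[b0, b1, b2, b3, b4, b5, b6]"
 have "g2_star phi (phi \<^bold>\<and> g2_star phi D) (sel ?bs fs) = shuffle_sign (map Not ?bs) * (phi \<^bold>\<and> g2_star phi D) (sel (map Not ?bs) fs)"
  by (rule star_sel[OF a]) simp
 then show "(1/12) * g2_star phi (phi \<^bold>\<and> g2_star phi D) (sel ?bs fs) = tau (sel ?bs fs)"
  using l by (cases b0; cases b1; cases b2; cases b3; cases b4; cases b5; cases b6;
   simp add: phi_table applies wsh' tables tables' star_D'; simp add: algebra_simps)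
qed

text \<open>Fixes the scalar torsion: the first term of \<open>T_\<phi>\<close> becomes
  \<open>2 * p\<close> times \<open>phi\<close>.\<close>

lemma star_D_phi: "g2_star phi (D \<^bold>\<and> phi) [] = 12 * p"
proof -
 have a: "alt_form 7 (D \<^bold>\<and> phi)" by (rule alt_wedge[OF alt_D alt_phi]) simp
 show ?thesis using star_sel[OF a, of "[False, False, False, False, False, False, False]"]
  by (simp add: phi_table applies wsh' tables tables')
qed

text \<open>The scalar coefficients balance as follows. The \<open>p\<close>-part of the star of
  d\<phi> is \<open>2 p\<close> times \<eta> \<and> \<omega> plus \<open>3/2 p\<close> times
  \<open>P\<close>, which leaves \<open>p / 2\<close> on \<open>P\<close> when subtracted from
  \<open>2 p phi\<close>. On \<open>M\<close> the star of d\<phi> contributes \<open>- 3/2 s\<close>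
  and the term with \<open>tau\<close> contributes \<open>2 s\<close>, which leaves
  \<open>s / 2\<close>.\<close>

lemma T_eq: "(1/6) * g2_star phi (D \<^bold>\<and> phi) [] * phi vs - g2_star phi D vs
  + g2_star phi ((%ws. 4 * tau ws) \<^bold>\<and> phi) vs = T vs"
proof (rule frame_sel_eq[of 3])
 have at: "alt_form 1 (%ws. 4 * tau ws)" by (rule alt_sum(2)[OF alt_tau])
 have a: "alt_form 4 ((%ws. 4 * tau ws) \<^bold>\<and> phi)" by (rule alt_wedge[OF at alt_phi]) simp
 have a': "alt_form 3 (g2_star phi ((%ws. 4 * tau ws) \<^bold>\<and> phi))" using alt_star[OF a] by simp
 show "alt_form 3 (%vs. (1/6) * g2_star phi (D \<^bold>\<and> phi) [] * phi vs - g2_star phi D vs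
  + g2_star phi ((%ws. 4 * tau ws) \<^bold>\<and> phi) vs)"
  by (intro alt_form_add alt_sum alt_phi alt_star_D a')
 show "alt_form 3 T" by (rule alt_T)
 fix b0 b1 b2 b3 b4 b5 b6 assume l: "length (filter id [b0, b1, b2, b3, b4, b5, b6]) = 3"
 let ?bs = "[b0, b1, b2, b3, b4, b5, b6]"
 have 1: "g2_star phi ((%ws. 4 * tau ws) \<^bold>\<and> phi) (sel ?bs fs) =
   shuffle_sign (map Not ?bs) * (4 * (tau \<^bold>\<and> phi) (sel (map Not ?bs) fs))"
  using star_sel[OF a, of ?bs] wedge_with_scale_left[OF bilinear_mult_real, of 4 tau phi] by simp
 have 2: "g2_star phi D (sel ?bs fs) = shuffle_sign (map Not ?bs) * D (sel (map Not ?bs) fs)"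
  by (rule star_sel[OF alt_D]) simp
 show "(1/6) * g2_star phi (D \<^bold>\<and> phi) [] * phi (sel ?bs fs) - g2_star phi D (sel ?bs fs)
  + g2_star phi ((%ws. 4 * tau ws) \<^bold>\<and> phi) (sel ?bs fs) = T (sel ?bs fs)"
  unfolding 1 2 star_D_phi
  using l by (cases b0; cases b1; cases b2; cases b3; cases b4; cases b5; cases b6;
   simp add: phi_table applies wsh' tables tables'; simp add: algebra_simps)
qed

text \<open>The products of \<open>W\<close> with \<open>P\<close>, \<open>M\<close> and
  \<open>N3\<close> vanish, and so does \<open>K \<and> M\<close> by type. What remains on both
  sides is \<open>N1 \<and> W \<and> W\<close> plus \<open>s\<close> times
  \<open>eta \<and> W \<and> W\<close> plus twice \<open>eta \<and> N1 \<and> M\<close>; the last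
  coefficient matches because of the factor 2 in \<open>dM\<close>, that is \<pi>1 = 2
  \<nu>1.\<close>

lemma dpsi_eq: "(1/2) * ((dW \<^bold>\<and> W) vs + (W \<^bold>\<and> dW) vs) - ((K \<^bold>\<and> M) vs - (eta \<^bold>\<and> dM) vs) =
  ((%ws. 4 * tau ws) \<^bold>\<and> psi) vs"
proof -
 have "(1/2) * ((dW \<^bold>\<and> W) vs + (W \<^bold>\<and> dW) vs) - ((K \<^bold>\<and> M) vs - (eta \<^bold>\<and> dM) vs) = 4 * (tau \<^bold>\<and> psi) vs"
 proof (rule frame_sel_eq[of 5])
  show "alt_form 5 (%vs. (1/2) * ((dW \<^bold>\<and> W) vs + (W \<^bold>\<and> dW) vs) - ((K \<^bold>\<and> M) vs - (eta \<^bold>\<and> dM) vs))"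
   by (intro alt_form_add alt_sum alt_wedge[OF alt_dW alt(2)] alt_wedge[OF alt(2) alt_dW] alt_wedge[OF alt'(1) alt(4)]
     alt_wedge[OF alt(1) alt_dM]; simp)
  show "alt_form 5 (%vs. 4 * (tau \<^bold>\<and> psi) vs)" by (intro alt_sum alt_wedge[OF alt_tau alt_psi]; simp)
  fix b0 b1 b2 b3 b4 b5 b6 assume l: "length (filter id [b0, b1, b2, b3, b4, b5, b6]) = 5"
  let ?bs = "[b0, b1, b2, b3, b4, b5, b6]"
  show "(1/2) * ((dW \<^bold>\<and> W) (sel ?bs fs) + (W \<^bold>\<and> dW) (sel ?bs fs)) - ((K \<^bold>\<and> M) (sel ?bs fs) - (eta \<^bold>\<and> dM) (sel ?bs fs)) =
   4 * (tau \<^bold>\<and> psi) (sel ?bs fs)"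
   using l by (cases b0; cases b1; cases b2; cases b3; cases b4; cases b5; cases b6;
    simp add: applies wsh' tables tables'; simp add: algebra_simps)
 qed
 then show ?thesis using wedge_with_scale_left[OF bilinear_mult_real, of 4 tau psi] by simp
qed

text \<open>\<open>K\<close> is primitive, so its product with \<open>W \<and> W\<close> vanishes,
  and it has type (1,1), so its product with \<open>M\<close> does.\<close>

lemma K_psi: "(K \<^bold>\<and> psi) vs = 0"
proof (rule frame_sel_eq[of 6])
 show "alt_form 6 (K \<^bold>\<and> psi)" by (intro alt_wedge[OF alt'(1) alt_psi]; simp)
 show "alt_form 6 (%vs. 0)" by (simp add: alt_form_def linear_iff)
 fix b0 b1 b2 b3 b4 b5 b6 assume l: "length (filter id [b0, b1, b2, b3, b4, b5, b6]) = 6"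
 let ?bs = "[b0, b1, b2, b3, b4, b5, b6]"
 show "(K \<^bold>\<and> psi) (sel ?bs fs) = 0"
  using l by (cases b0; cases b1; cases b2; cases b3; cases b4; cases b5; cases b6;
   simp add: applies wsh' tables tables'; simp add: algebra_simps)
qed

end

section \<open>Unitary frames\<close>

lemma exists_unit_orthogonal:
 fixes B :: "'e::euclidean_space set"
 assumes g: "inner_product g" and B: "finite B" "card B < DIM('e)" and o: "\<And>b c. b \<in> B ==> c \<in> B ==> g b c = of_bool (b = c)"
 shows "\<exists>v. g v v = 1 \<and> (\<forall>b\<in>B. g v b = 0 \<and> g b v = 0)"
proof -
 have bl: "bilinear g" and sym: "\<And>x y. g x y = g y x" and pos: "\<And>x. x \<noteq> 0 ==> g x x > 0"
  using g by (auto simp: inner_product_def)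
 have "dim (span B) < DIM('e)" using B dim_le_card'[OF B(1)] by simp
 then obtain v0 where v0: "v0 \<notin> span B"
  by (metis dim_UNIV nat_neq_iff UNIV_eq_I)
 define v1 where "v1 = v0 - (\<Sum>b\<in>B. g v0 b *\<^sub>R b)"
 have v1: "v1 \<noteq> 0"
 proof
  assume "v1 = 0"
  then have "v0 = (\<Sum>b\<in>B. g v0 b *\<^sub>R b)" by (simp add: v1_def)
  also have "\<dots> \<in> span B" by (intro span_sum span_scale span_base)
  finally show False using v0 by simp
 qed
 have lin: "linear (%x. g x c)" for c using bl by (simp add: bilinear_def)
 have orth: "g v1 c = 0" if c: "c \<in> B" for c
 proof -
  have "g (\<Sum>b\<in>B. g v0 b *\<^sub>R b) c = (\<Sum>b\<in>B. g v0 b * g b c)"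
   by (simp add: linear_sum[OF lin] linear_scale[OF lin])
  also have "\<dots> = (\<Sum>b\<in>B. if b = c then g v0 b else 0)" by (intro sum.cong) (auto simp: o c)
  finally show ?thesis using c B by (simp add: v1_def linear_diff[OF lin])
 qed
 define v where "v = (1 / sqrt (g v1 v1)) *\<^sub>R v1"
 have "g v v = 1" unfolding v_def using pos[OF v1]
  by (simp add: bilinear_lmul[OF bl] bilinear_rmul[OF bl])
 moreover have "g v b = 0" if "b \<in> B" for b unfolding v_def using orth[OF that] by (simp add: bilinear_lmul[OF bl])
 ultimately show ?thesis using sym by metis
qed

text \<open>A point of an \<open>SU(3)\<close>-structure, with the phase \<open>u\<close> applied to the complex volume form.\<close>

locale su3_point =
 fixes g :: "real^6 => real^6 => real" and J :: "real^6 => real^6" and w :: "(real^6) list => real"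
  and U :: "(real^6) list => complex" and u :: complex
 assumes inner6: "inner_product g" and linJ: "linear J" and JJ: "\<And>X. J (J X) = - X"
  and gJ: "\<And>X Y. g (J X) (J Y) = g X Y" and w: "\<And>X Y. w [X, Y] = g (J X) Y"
  and altw: "alt_form 2 w" and altU: "alt_form 3 U" and UJ: "\<And>X vs. U (J X # vs) = \<i> * U (X # vs)"
  and norm: "\<And>vs. (\<i> / 2) * wedge_with (*) U (%ws. cnj (U ws)) vs = complex_of_real ((2/3) * (w \<^bold>\<and> w \<^bold>\<and> w) vs)"
  and u: "cmod u = 1"

begin

lemma bg: "bilinear g" and gsym: "g x y = g y x" and gpos: "x \<noteq> 0 ==> g x x > 0"
 using inner6 by (auto simp: inner_product_def)

lemma gneg: "g (- x) y = - g x y" "g x (- y) = - g x y"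
 by (rule bilinear_lneg[OF bg], rule bilinear_rneg[OF bg])

lemma gJ_left: "g (J x) y = - g x (J y)"
 using gJ[of "J x" y] by (simp add: JJ gneg)

lemma gJ_self: "g x (J x) = 0" "g (J x) x = 0"
 using gJ_left[of x x] gsym[of x "J x"] by simp_all

lemma mU: "multilin U" "adj_alt U" using altU by (simp_all add: alt_form_iff)

lemma U_rules: "U [J x, y, z] = \<i> * U [x, y, z]" "U [x, J y, z] = \<i> * U [x, y, z]" "U [x, y, J z] = \<i> * U [x, y, z]"
 "U [x, x, y] = 0" "U [x, y, y] = 0"
proof -
 have s1: "U [a, b, c] = - U [b, a, c]" for a b c using adj_alt_swap[OF mU, of "[]" a b "[c]"] by simp
 have s2: "U [a, b, c] = - U [a, c, b]" for a b c using adj_alt_swap[OF mU, of "[a]" b c "[]"] by simp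
 show 1: "U [J x, y, z] = \<i> * U [x, y, z]" for x y z by (rule UJ)
 have 2: "U [x, J y, z] = \<i> * U [x, y, z]" for x y z
  unfolding s1[of x "J y" z] 1 by (subst s1[of y x z]) simp
 show "U [x, J y, z] = \<i> * U [x, y, z]" by (rule 2)
 show "U [x, y, J z] = \<i> * U [x, y, z]" unfolding s2[of x y "J z"] 2 by (subst s2[of x z y]) simp
 show "U [x, x, y] = 0" "U [x, y, y] = 0"
  using mU(2)[unfolded adj_alt_def, rule_format, of "[]" x "[y]"] mU(2)[unfolded adj_alt_def, rule_format, of "[x]" y "[]"] by simp_all
qed

text \<open>Two unit vectors and a third one, each orthogonal to the complex lines before it, are
  complex orthonormal. The normalisation of \<open>U\<close> makes its value on them a number of
  modulus 1, and the remaining phase, together with \<open>u\<close>, is absorbed by turning the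
  third vector in its complex line.\<close>

lemma unitary_frame:
 obtains e1 e3 e5 where "orthonormal_frame g [e1, J e1, e3, J e3, e5, J e5]" "u * U [e1, e3, e5] = 1"
proof -
 obtain e1 where e1: "g e1 e1 = 1" using exists_unit_orthogonal[OF inner6, of "{}"] by auto
 have n1: "J e1 \<noteq> e1" using gJ_self[of e1] e1 by auto
 have g1: "g (J e1) (J e1) = 1" using gJ e1 by simp
 have "\<exists>v. g v v = 1 \<and> (\<forall>b\<in>{e1, J e1}. g v b = 0 \<and> g b v = 0)"
 proof (rule exists_unit_orthogonal[OF inner6])
  show "g b c = of_bool (b = c)" if "b \<in> {e1, J e1}" "c \<in> {e1, J e1}" for b c
   using that e1 g1 gJ_self n1 by auto
  show "card {e1, J e1} < DIM(real^6)" using card_length[of "[e1, J e1]"] by simp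
 qed simp
 then obtain e3 where e3: "g e3 e3 = 1" "g e3 e1 = 0" "g e3 (J e1) = 0" "g e1 e3 = 0" "g (J e1) e3 = 0" by blast
 have g3: "g (J e3) (J e3) = 1" "g (J e3) e1 = 0" "g (J e3) (J e1) = 0" "g e1 (J e3) = 0" "g (J e1) (J e3) = 0"
  using e3 gJ_left[of e3 e1] gJ_left[of e1 e3] gJ by simp_all
 have "\<exists>v. g v v = 1 \<and> (\<forall>b\<in>{e1, J e1, e3, J e3}. g v b = 0 \<and> g b v = 0)"
 proof (rule exists_unit_orthogonal[OF inner6])
  have ne: "a \<noteq> b" if "g a b = 0" "g b b = 1" for a b using that by auto
  have "e1 \<noteq> e3" "J e1 \<noteq> e3" "e1 \<noteq> J e3" "J e1 \<noteq> J e3" "e3 \<noteq> J e3"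
   using ne e3 g3 gJ_self by blast+
  then show "g b c = of_bool (b = c)" if "b \<in> {e1, J e1, e3, J e3}" "c \<in> {e1, J e1, e3, J e3}" for b c
   using that e1 g1 e3 g3 gJ_self n1 by (elim insertE emptyE) simp_all
  show "card {e1, J e1, e3, J e3} < DIM(real^6)" using card_length[of "[e1, J e1, e3, J e3]"] by simp
 qed simp
 then obtain e where e: "g e e = 1" "g e e1 = 0" "g e (J e1) = 0" "g e1 e = 0" "g (J e1) e = 0"
  "g e e3 = 0" "g e (J e3) = 0" "g e3 e = 0" "g (J e3) e = 0" by blast
 have ge: "g (J e) (J e) = 1" "g (J e) e1 = 0" "g (J e) (J e1) = 0" "g e1 (J e) = 0" "g (J e1) (J e) = 0"
  "g (J e) e3 = 0" "g (J e) (J e3) = 0" "g e3 (J e) = 0" "g (J e3) (J e) = 0"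
  using e gJ_left[of e e1] gJ_left[of e1 e] gJ_left[of e e3] gJ_left[of e3 e] gJ by simp_all
 define z where "z = U [e1, e3, e]"
 note gt = e1 g1 e3 g3 e ge gJ_self
 have hU: "homog (Suc (Suc (Suc 0))) U" using alt_form_homog[OF altU] by (simp add: numeral_3_eq_3)
 have hw: "homog (Suc (Suc 0)) w" using alt_form_homog[OF altw] by (simp add: numeral_2_eq_2)
 have bc: "bilinear ((*) :: complex => complex => complex)"
  by (simp add: bilinear_def linear_iff algebra_simps)
 \<comment> \<open>Of the 20 shuffles only the 8 that take one vector from each complex line
   contribute. With the factor \<open>\<i> / 2\<close> this is four times the squared modulus of
   \<open>z\<close>, while the right-hand side of \<open>norm\<close> is
   \<open>(2/3) * 6 = 4\<close>.\<close>
 have "wedge_with (*) U (%ws. cnj (U ws)) [e1, J e1, e3, J e3, e, J e] = - 8 * \<i> * (z * cnj z)"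
  by (simp add: wedge_with_shuffle_sum[OF bc hU] U_rules z_def[symmetric])
 moreover have "(w \<^bold>\<and> w \<^bold>\<and> w) [e1, J e1, e3, J e3, e, J e] = 6"
  by (simp add: wedge_shuffle_sum[OF hw] w gt JJ gneg)
 ultimately have "complex_of_real 4 = (\<i> / 2) * (- 8 * \<i> * (z * cnj z))"
  using norm[of "[e1, J e1, e3, J e3, e, J e]"] by simp
 then have zz: "z * cnj z = 1" by (simp add: field_simps)
 \<comment> \<open>The conjugate of a number of modulus 1 is its inverse, so this factor makes the
   rotated value equal to 1.\<close>
 define c where "c = cnj (u * z)"
 have uu: "u * cnj u = 1" using u by (simp add: complex_norm_square[symmetric])
 have cc: "u * (c * z) = 1"
 proof -
  have "u * (c * z) = (u * cnj u) * (z * cnj z)" by (simp add: c_def)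
  then show ?thesis using uu zz by simp
 qed
 have c1: "Re c * Re c + Im c * Im c = 1"
 proof -
  have "c * cnj c = (u * cnj u) * (z * cnj z)" by (simp add: c_def)
  then have "c * cnj c = 1" using uu zz by simp
  then show ?thesis using complex_mult_cnj[of c] by (simp add: power2_eq_square complex_eq_iff)
 qed
 define e5 where "e5 = Re c *\<^sub>R e + Im c *\<^sub>R J e"
 have Je5: "J e5 = Re c *\<^sub>R J e - Im c *\<^sub>R e"
  unfolding e5_def by (simp add: linear_add[OF linJ] linear_scale[OF linJ] JJ)
 note bgs = bilinear_ladd[OF bg] bilinear_radd[OF bg] bilinear_lsub[OF bg] bilinear_rsub[OF bg] bilinear_lmul[OF bg] bilinear_rmul[OF bg]
 have g5: "g e5 e5 = 1" "g (J e5) (J e5) = 1" "g e5 (J e5) = 0" "g (J e5) e5 = 0"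
  "g e5 e1 = 0" "g e1 e5 = 0" "g e5 (J e1) = 0" "g (J e1) e5 = 0" "g e5 e3 = 0" "g e3 e5 = 0" "g e5 (J e3) = 0" "g (J e3) e5 = 0"
  "g (J e5) e1 = 0" "g e1 (J e5) = 0" "g (J e5) (J e1) = 0" "g (J e1) (J e5) = 0" "g (J e5) e3 = 0" "g e3 (J e5) = 0" "g (J e5) (J e3) = 0" "g (J e3) (J e5) = 0"
  unfolding Je5 unfolding e5_def using c1 by (simp_all add: bgs gt)
 have "orthonormal_frame g [e1, J e1, e3, J e3, e5, J e5]"
  unfolding orthonormal_frame_def by (simp add: All_less_Suc numeral_eq_Suc gt g5)
 moreover have "U [e1, e3, e5] = c * z"
 proof -
  have l: "linear (%x. U [e1, e3, x])" using mU(1)[unfolded multilin_def, rule_format, of "[e1, e3]" "[]"] by simp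
  have "U [e1, e3, e5] = Re c *\<^sub>R z + Im c *\<^sub>R (\<i> * z)"
   unfolding e5_def by (simp add: linear_add[OF l] linear_scale[OF l] U_rules z_def)
  also have "\<dots> = c * z" by (subst (3) complex_eq[of c]) (simp add: scaleR_conv_of_real algebra_simps)
  finally show ?thesis .
 qed
 ultimately show thesis using that cc by simp
qed

lemma frame_w:
 assumes "orthonormal_frame g [e1, J e1, e3, J e3, e5, J e5]"
 shows "w [e1, J e1] = 1"
  "w [e1, e3] = 0"
  "w [e1, J e3] = 0"
  "w [e1, e5] = 0"
  "w [e1, J e5] = 0"
  "w [J e1, e3] = 0"
  "w [J e1, J e3] = 0"
  "w [J e1, e5] = 0"
  "w [J e1, J e5] = 0"
  "w [e3, J e3] = 1"
  "w [e3, e5] = 0"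
  "w [e3, J e5] = 0"
  "w [J e3, e5] = 0"
  "w [J e3, J e5] = 0"
  "w [e5, J e5] = 1"
proof -
 show "w [e1, J e1] = 1"
  "w [e1, e3] = 0"
  "w [e1, J e3] = 0"
  "w [e1, e5] = 0"
  "w [e1, J e5] = 0"
  "w [J e1, e3] = 0"
  "w [J e1, J e3] = 0"
  "w [J e1, e5] = 0"
  "w [J e1, J e5] = 0"
  "w [e3, J e3] = 1"
  "w [e3, e5] = 0"
  "w [e3, J e5] = 0"
  "w [J e3, e5] = 0"
  "w [J e3, J e5] = 0"
  "w [e5, J e5] = 1"
  using assms by (simp_all add: orthonormal_frame_def All_less_Suc numeral_eq_Suc w JJ gneg)
qed

lemma rotated_U_frame:
 assumes "u * U [e1, e3, e5] = 1"
 shows "u * U [e1, J e1, e3] = 0"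
  "u * U [e1, J e1, J e3] = 0"
  "u * U [e1, J e1, e5] = 0"
  "u * U [e1, J e1, J e5] = 0"
  "u * U [e1, e3, J e3] = 0"
  "u * U [e1, e3, e5] = 1"
  "u * U [e1, e3, J e5] = \<i>"
  "u * U [e1, J e3, e5] = \<i>"
  "u * U [e1, J e3, J e5] = - 1"
  "u * U [e1, e5, J e5] = 0"
  "u * U [J e1, e3, J e3] = 0"
  "u * U [J e1, e3, e5] = \<i>"
  "u * U [J e1, e3, J e5] = - 1"
  "u * U [J e1, J e3, e5] = - 1"
  "u * U [J e1, J e3, J e5] = - \<i>"
  "u * U [J e1, e5, J e5] = 0"
  "u * U [e3, J e3, e5] = 0"
  "u * U [e3, J e3, J e5] = 0"
  "u * U [e3, e5, J e5] = 0"
  "u * U [J e3, e5, J e5] = 0"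
proof -
 have i: "u * (\<i> * x) = \<i> * (u * x)" for x by simp
 show "u * U [e1, J e1, e3] = 0"
  "u * U [e1, J e1, J e3] = 0"
  "u * U [e1, J e1, e5] = 0"
  "u * U [e1, J e1, J e5] = 0"
  "u * U [e1, e3, J e3] = 0"
  "u * U [e1, e3, e5] = 1"
  "u * U [e1, e3, J e5] = \<i>"
  "u * U [e1, J e3, e5] = \<i>"
  "u * U [e1, J e3, J e5] = - 1"
  "u * U [e1, e5, J e5] = 0"
  "u * U [J e1, e3, J e3] = 0"
  "u * U [J e1, e3, e5] = \<i>"
  "u * U [J e1, e3, J e5] = - 1"
  "u * U [J e1, J e3, e5] = - 1"
  "u * U [J e1, J e3, J e5] = - \<i>"
  "u * U [J e1, e5, J e5] = 0"
  "u * U [e3, J e3, e5] = 0"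
  "u * U [e3, J e3, J e5] = 0"
  "u * U [e3, e5, J e5] = 0"
  "u * U [J e3, e5, J e5] = 0"
  by (simp_all only: U_rules i assms mult_zero_right) simp_all
qed

text \<open>Invariance under \<open>J\<close> accounts for the first six relations. The last one is
  the value of \<open>K \<and> w \<and> w\<close> on the whole frame, which is twice the sum of
  \<open>K\<close> over the three complex lines.\<close>

lemma Lambda2_8_on_frame:
 assumes fr: "orthonormal_frame g [e1, J e1, e3, J e3, e5, J e5]" and K: "in_Lambda2_8 J w K"
 shows "K [J e1, J e3] = K [e1, e3]" "K [J e1, e3] = - K [e1, J e3]" "K [J e1, J e5] = K [e1, e5]"
  "K [J e1, e5] = - K [e1, J e5]" "K [J e3, J e5] = K [e3, e5]" "K [J e3, e5] = - K [e3, J e5]"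
  "K [e5, J e5] = - K [e1, J e1] - K [e3, J e3]"
proof -
 have a: "alt_form 2 K" and JK: "\<And>vs. K (map J vs) = K vs" and z: "\<And>vs. (K \<^bold>\<and> w \<^bold>\<and> w) vs = 0"
  using K by (auto simp: in_Lambda2_8_def J_form_def fun_eq_iff)
 have m: "multilin K" "adj_alt K" using a by (simp_all add: alt_form_iff)
 show 1: "K [J x, J y] = K [x, y]" for x y using JK[of "[x, y]"] by simp
 have neg: "K [- x, y] = - K [x, y]" for x y
  using linear_neg[OF linear_head[OF m(1), of "[y]"]] by simp
 show "K [J x, y] = - K [x, J y]" for x y using JK[of "[J x, y]"] by (simp add: JJ neg)
 show "K [J x, y] = - K [x, J y]" for x y using JK[of "[J x, y]"] by (simp add: JJ neg)
 show "K [J x, y] = - K [x, J y]" for x y using JK[of "[J x, y]"] by (simp add: JJ neg)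
 show "K [J x, J y] = K [x, y]" "K [J x, J y] = K [x, y]" for x y by (rule 1)+
 have hK: "homog (Suc (Suc 0)) K" and hw: "homog (Suc (Suc 0)) w"
  using alt_form_homog[OF a] alt_form_homog[OF altw] by (simp_all add: numeral_2_eq_2)
 have "(K \<^bold>\<and> w \<^bold>\<and> w) [e1, J e1, e3, J e3, e5, J e5] = 2 * (K [e1, J e1] + K [e3, J e3] + K [e5, J e5])"
  by (simp add: wedge_shuffle_sum[OF hK] wedge_shuffle_sum[OF hw] frame_w[OF fr])
 then show "K [e5, J e5] = - K [e1, J e1] - K [e3, J e3]" using z by simp
qed

text \<open>Six relations come from \<open>N \<and> w\<close> on the 5-element parts of the frame,
  two from the products with the real and imaginary parts on the whole frame. As both parts of
  \<open>U\<close> are annihilated, so are those of \<open>U\<close> with any phase.\<close>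

lemma Lambda3_12_on_frame:
 assumes fr: "orthonormal_frame g [e1, J e1, e3, J e3, e5, J e5]" and U1: "u * U [e1, e3, e5] = 1" and N: "in_Lambda3_12 w U N"
 shows "N [e3, J e3, e5] = - N [e1, J e1, e5]"
  "N [e3, J e3, J e5] = - N [e1, J e1, J e5]"
  "N [e3, e5, J e5] = - N [e1, J e1, e3]"
  "N [J e3, e5, J e5] = - N [e1, J e1, J e3]"
  "N [e1, e5, J e5] = - N [e1, e3, J e3]"
  "N [J e1, e5, J e5] = - N [J e1, e3, J e3]"
  "N [J e1, J e3, J e5] = N [e1, e3, J e5] + N [e1, J e3, e5] + N [J e1, e3, e5]"
  "N [J e1, J e3, e5] = N [e1, e3, e5] - N [e1, J e3, J e5] - N [J e1, e3, J e5]"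
proof -
 have a: "alt_form 3 N" and z: "\<And>vs. (N \<^bold>\<and> w) vs = 0" and zr: "\<And>vs. (N \<^bold>\<and> (%vs. Re (U vs))) vs = 0"
  and zi: "\<And>vs. (N \<^bold>\<and> (%vs. Im (U vs))) vs = 0" using N by (auto simp: in_Lambda3_12_def)
 note wl = wedge_with_add_right[OF bilinear_mult_real] wedge_with_diff_right[OF bilinear_mult_real]
  wedge_with_scale_right[OF bilinear_mult_real, unfolded real_scaleR_def]
 have zP: "(N \<^bold>\<and> (%vs. Re (u * U vs))) vs = 0" and zM: "(N \<^bold>\<and> (%vs. Im (u * U vs))) vs = 0" for vs
  by (simp_all add: wl zr zi)
 have hN: "homog (Suc (Suc (Suc 0))) N" using alt_form_homog[OF a] by (simp add: numeral_3_eq_3)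
 note t = wedge_shuffle_sum[OF hN] frame_w[OF fr] rotated_U_frame[OF U1]
 show "N [e3, J e3, e5] = - N [e1, J e1, e5]" using z[of "[e1, J e1, e3, J e3, e5]"] by (simp add: t)
 show "N [e3, J e3, J e5] = - N [e1, J e1, J e5]" using z[of "[e1, J e1, e3, J e3, J e5]"] by (simp add: t)
 show "N [e3, e5, J e5] = - N [e1, J e1, e3]" using z[of "[e1, J e1, e3, e5, J e5]"] by (simp add: t)
 show "N [J e3, e5, J e5] = - N [e1, J e1, J e3]" using z[of "[e1, J e1, J e3, e5, J e5]"] by (simp add: t)
 show "N [e1, e5, J e5] = - N [e1, e3, J e3]" using z[of "[e1, e3, J e3, e5, J e5]"] by (simp add: t)
 show "N [J e1, e5, J e5] = - N [J e1, e3, J e3]" using z[of "[J e1, e3, J e3, e5, J e5]"] by (simp add: t)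
 show "N [J e1, J e3, J e5] = N [e1, e3, J e5] + N [e1, J e3, e5] + N [J e1, e3, e5]" using zP[of "[e1, J e1, e3, J e3, e5, J e5]"] by (simp add: t del: times_complex.sel)
 show "N [J e1, J e3, e5] = N [e1, e3, e5] - N [e1, J e3, J e5] - N [J e1, e3, J e5]" using zM[of "[e1, J e1, e3, J e3, e5, J e5]"] by (simp add: t del: times_complex.sel)
qed

lemma g2_torsion_lift:
 fixes L :: "real^7 => real^6"
 assumes L: "linear L" "surj L" and eta: "alt_form 1 eta" and xi: "L xi = 0" "eta [xi] = 1"
  and K: "in_Lambda2_8 J w K" and N1: "alt_form 1 N1" and N3: "in_Lambda3_12 w U N3"
 obtains g7 f1 f2 f3 f4 f5 f6 where "g2_torsion g7 xi f1 f2 f3 f4 f5 f6 eta (%vs. w (map L vs))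
  (%vs. Re (u * U (map L vs))) (%vs. Im (u * U (map L vs))) (%vs. K (map L vs)) (%vs. N1 (map L vs))
  (%vs. N3 (map L vs)) (%vs. J_form J N1 (map L vs)) (%vs. J_form J N3 (map L vs))"
proof -
 obtain e1 e3 e5 where fr: "orthonormal_frame g [e1, J e1, e3, J e3, e5, J e5]" and U1: "u * U [e1, e3, e5] = 1"
  by (rule unitary_frame)
 have leta: "linear (%x. eta [x])" using linear_head[of eta "[]"] eta by (simp add: alt_form_iff)
 \<comment> \<open>Any preimage of \<open>e\<close> becomes horizontal when its \<eta>-component
   along \<open>xi\<close> is subtracted, and \<open>L\<close> does not notice this.\<close>
 define f where "f e = (let x = (SOME x. L x = e) in x - eta [x] *\<^sub>R xi)" for e
 have Lf: "L (f e) = e" for e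
 proof -
  have "\<exists>x. L x = e" using surjD[OF L(2), of e] by metis
  from someI_ex[OF this] have "L (SOME x. L x = e) = e" .
  then show ?thesis by (simp add: f_def Let_def linear_diff[OF L(1)] linear_scale[OF L(1)] xi)
 qed
 have ef: "eta [f e] = 0" for e by (simp add: f_def Let_def linear_diff[OF leta] linear_scale[OF leta] xi)
 define g7 where "g7 x y = eta [x] * eta [y] + g (L x) (L y)" for x y
 have b7: "bilinear g7"
  unfolding bilinear_def g7_def
  by (simp add: linear_iff linear_add[OF leta] linear_scale[OF leta] linear_add[OF L(1)] linear_scale[OF L(1)]
   bilinear_ladd[OF bg] bilinear_radd[OF bg] bilinear_lmul[OF bg] bilinear_rmul[OF bg] algebra_simps)
 let ?fs = "[xi, f e1, f (J e1), f e3, f (J e3), f e5, f (J e5)]"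
 have frame7: "orthonormal_frame g7 ?fs"
  using fr unfolding orthonormal_frame_def
  by (simp add: All_less_Suc numeral_eq_Suc g7_def ef Lf xi bilinear_lzero[OF bg] bilinear_rzero[OF bg])
 have inner7: "inner_product g7"
  unfolding inner_product_def
 proof (intro conjI allI impI b7)
  show "g7 x y = g7 y x" for x y by (simp add: g7_def gsym[of "L x"])
  show "0 < g7 x x" if "x \<noteq> 0" for x
  proof -
   have nn: "g y y \<ge> 0" for y using gpos[of y] by (cases "y = 0") (auto simp: bilinear_lzero[OF bg])
   have "g7 x x \<noteq> 0"
   proof
    assume "g7 x x = 0"
    then have "eta [x] * eta [x] = 0 \<and> g (L x) (L x) = 0"
     using nn[of "L x"] zero_le_square[of "eta [x]"] unfolding g7_def by linarith
    then have z: "eta [x] = 0" "L x = 0" using gpos[of "L x"] by auto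
    \<comment> \<open>A vector annihilated by \<eta> and by \<open>L\<close> is orthogonal to
      everything, and its frame expansion is then zero; this replaces a count of dimensions.\<close>
    have "g7 x y = 0" for y by (simp add: g7_def z bilinear_lzero[OF bg])
    then show False using orthonormal_frame_expand[OF b7 frame7, of x] that by simp
   qed
   then show ?thesis using nn[of "L x"] zero_le_square[of "eta [x]"] unfolding g7_def by linarith
  qed
 qed
 have aK: "alt_form 2 K" and aN3: "alt_form 3 N3" using K N3 by (simp_all add: in_Lambda2_8_def in_Lambda3_12_def)
 have mJ: "alt_form k (%vs. J_form J a vs)" if "alt_form k a" for k a
  unfolding J_form_def by (rule alt_form_map[OF that linJ])
 have aP: "alt_form 3 (%vs. Re (u * U vs))" and aM: "alt_form 3 (%vs. Im (u * U vs))"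
  by (rule alt_form_linear[OF altU], simp add: linear_iff algebra_simps)+
 have kill: "a (map L (xi # vs)) = 0" if "alt_form k a" for a :: "(real^6) list => real" and k vs
  using linear_0[OF linear_head[of a "map L vs"]] that by (simp add: alt_form_iff xi)
 have n1: "N1 [- x] = - N1 [x]" for x
  using N1 linear_neg[OF linear_head[of N1 "[]"]] by (simp add: alt_form_iff)
 have m3: "multilin N3" using aN3 by (simp add: alt_form_iff)
 have n3: "N3 [- x, y, z] = - N3 [x, y, z]" "N3 [x, - y, z] = - N3 [x, y, z]" "N3 [x, y, - z] = - N3 [x, y, z]" for x y z
  using linear_neg[OF linear_head[OF m3, of "[y, z]"]]
   linear_neg[OF m3[unfolded multilin_def, rule_format, of "[x]" "[z]"]]
   linear_neg[OF m3[unfolded multilin_def, rule_format, of "[x, y]" "[]"]] by simp_all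
 have s3: "N3 [a, b, c] = - N3 [b, a, c]" "N3 [a, b, c] = - N3 [a, c, b]" for a b c
  using adj_alt_swap[OF m3, of "[]" a b "[c]"] adj_alt_swap[OF m3, of "[a]" b c "[]"] aN3 by (simp_all add: alt_form_iff)
 note sw = s3(1)[of "J e1" e1] s3(1)[of "J e3" e3] s3(2)[of _ "J e3" e3] s3(2)[of _ "J e5" e5]
 note lists = list.map Lf ef xi
 have g2: "g2_frame g7 xi (f e1) (f (J e1)) (f e3) (f (J e3)) (f e5) (f (J e5)) eta (%vs. w (map L vs))
  (%vs. Re (u * U (map L vs))) (%vs. Im (u * U (map L vs)))"
 proof (rule g2_frame.intro, goal_cases)
  case 1 show ?case by (rule inner7)
 next case 2 show ?case by (rule frame7)
 next case 3 show ?case by (rule eta)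
 next case 4 show ?case by (rule alt_form_map[OF altw L(1)])
 next case 5 show ?case by (rule alt_form_map[OF aP L(1)])
 next case 6 show ?case by (rule alt_form_map[OF aM L(1)])
 next case 14 show ?case by (rule kill[OF altw])
 next case 15 show ?case by (rule kill[OF aP])
 next case 16 show ?case by (rule kill[OF aM])
 qed (simp_all only: lists frame_w[OF fr] rotated_U_frame[OF U1], simp_all)
 have J1: "J_form J N1 [x] = N1 [J x]" for x by (simp add: J_form_def)
 have J3: "J_form J N3 [x, y, z] = N3 [J x, J y, J z]" for x y z by (simp add: J_form_def)
 have "g2_torsion_axioms xi (f e1) (f (J e1)) (f e3) (f (J e3)) (f e5) (f (J e5))
  (%vs. K (map L vs)) (%vs. N1 (map L vs))
  (%vs. N3 (map L vs)) (%vs. J_form J N1 (map L vs)) (%vs. J_form J N3 (map L vs))"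
 proof (rule g2_torsion_axioms.intro, goal_cases)
  case 1 show ?case by (rule alt_form_map[OF aK L(1)])
 next case 2 show ?case by (rule alt_form_map[OF N1 L(1)])
 next case 3 show ?case by (rule alt_form_map[OF aN3 L(1)])
 next case 4 show ?case by (rule alt_form_map[OF mJ[OF N1] L(1)])
 next case 5 show ?case by (rule alt_form_map[OF mJ[OF aN3] L(1)])
 next case 6 show ?case by (rule kill[OF aK])
 next case 7 show ?case by (rule kill[OF N1])
 next case 8 show ?case by (rule kill[OF aN3])
 next case 9 show ?case by (rule kill[OF mJ[OF N1]])
 next case 10 show ?case by (rule kill[OF mJ[OF aN3]])
 qed (simp_all only: lists Lambda2_8_on_frame[OF fr K] Lambda3_12_on_frame[OF fr U1 N3] J1 J3 JJ n1 n3 sw minus_minus)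
 with g2 show thesis by (intro that g2_torsion.intro)
qed

end

section \<open>Products of Lie groups\<close>

lemma frechet_derivative_map_prod:
 assumes "f differentiable (at x)" "h differentiable (at y)"
 shows "frechet_derivative (%z. (f (fst z), h (snd z))) (at (x, y)) =
  (%v. (frechet_derivative f (at x) (fst v), frechet_derivative h (at y) (snd v)))"
proof (rule frechet_derivative_eqI)
 have f: "(f has_derivative frechet_derivative f (at x)) (at (fst (x, y)))" and h: "(h has_derivative frechet_derivative h (at y)) (at (snd (x, y)))"
  using assms by (simp_all add: frechet_derivative_works)
 have 1: "((%z. f (fst z)) has_derivative (%v. frechet_derivative f (at x) (fst v))) (at (x, y))"
  by (rule has_derivative_compose[OF has_derivative_fst[OF has_derivative_ident] f])
 have 2: "((%z. h (snd z)) has_derivative (%v. frechet_derivative h (at y) (snd v))) (at (x, y))"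
  by (rule has_derivative_compose[OF has_derivative_snd[OF has_derivative_ident] h])
 show "((%z. (f (fst z), h (snd z))) has_derivative
   (%v. (frechet_derivative f (at x) (fst v), frechet_derivative h (at y) (snd v)))) (at (x, y))"
  by (rule has_derivative_Pair[OF 1 2])
qed

lemma tangent_map_map_prod:
 assumes M: "mfd_atlas M" and N: "mfd_atlas N" and f: "smooth_at M M' f x" and h: "smooth_at N N' h y"
 shows "tangent_map (prod_mfd M N) (prod_mfd M' N') (%z. (f (fst z), h (snd z))) (x, y) v =
  (tangent_map M M' f x (fst v), tangent_map N N' h y (snd v))"
proof -
 have xy: "x \<in> points M" "y \<in> points N" using smooth_at_points(1)[OF f] smooth_at_points(1)[OF h] .
 let ?S = "chart_img M x \<times> chart_img N y" and ?c = "(chart M x x, chart N y y)"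
 have o: "open ?S" "?c \<in> ?S"
  using atlas_open[OF M xy(1)] atlas_open[OF N xy(2)] chart_center_img[OF M xy(1)] chart_center_img[OF N xy(2)]
  by (auto intro: open_Times)
 have d: "(%z. chart M' (f x) (f (param M x z))) differentiable (at (chart M x x))"
  "(%z. chart N' (h y) (h (param N y z))) differentiable (at (chart N y y))"
  by (rule rep_smooth_differentiable, use f h in \<open>simp add: smooth_at_def\<close>)+
 have "frechet_derivative (chart (prod_mfd M' N') (f x, h y) \<circ> (%z. (f (fst z), h (snd z))) \<circ> param (prod_mfd M N) (x, y)) (at ?c) =
   frechet_derivative (%z. ((%z. chart M' (f x) (f (param M x z))) (fst z), (%z. chart N' (h y) (h (param N y z))) (snd z))) (at ?c)"
  by (rule frechet_derivative_cong_open[OF o]) (auto simp: param_prod_mfd[OF M N xy])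
 then show ?thesis unfolding tangent_map_def frechet_derivative_map_prod[OF d] by (simp add: o_def)
qed

lemma tangent_map_prod_fst_snd:
 assumes M: "mfd_atlas M" and N: "mfd_atlas N" and z: "z \<in> points (prod_mfd M N)"
 shows "tangent_map (prod_mfd M N) M fst z v = fst v" "tangent_map (prod_mfd M N) N snd z v = snd v"
proof -
 obtain x y where xy: "z = (x, y)" "x \<in> points M" "y \<in> points N" using z by (cases z) auto
 let ?S = "chart_img M x \<times> chart_img N y" and ?c = "(chart M x x, chart N y y)"
 have o: "open ?S" "?c \<in> ?S"
  using atlas_open[OF M xy(2)] atlas_open[OF N xy(3)] chart_center_img[OF M xy(2)] chart_center_img[OF N xy(3)]
  by (auto intro: open_Times)
 have "frechet_derivative (chart M x \<circ> fst \<circ> param (prod_mfd M N) (x, y)) (at ?c) = frechet_derivative fst (at ?c)"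
  "frechet_derivative (chart N y \<circ> snd \<circ> param (prod_mfd M N) (x, y)) (at ?c) = frechet_derivative snd (at ?c)"
  by (rule frechet_derivative_cong_open[OF o]; auto simp: param_prod_mfd[OF M N xy(2,3)] chart_param[OF M] chart_param[OF N])+
 moreover have "frechet_derivative fst (at ?c) = fst" "frechet_derivative snd (at ?c) = snd"
  by (rule frechet_derivative_eqI, rule bounded_linear_imp_has_derivative, simp add: bounded_linear_fst bounded_linear_snd)+
 ultimately show "tangent_map (prod_mfd M N) M fst z v = fst v" "tangent_map (prod_mfd M N) N snd z v = snd v"
  by (simp_all add: tangent_map_def xy(1))
qed

text \<open>In coordinates the field is the derivative of the multiplication at
  \<open>(x, x0)\<close> in the direction \<open>(0, X)\<close>, with \<open>x0\<close> the
  coordinate of the identity, and so it is smooth in \<open>x\<close>. A box inside the open set on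
  which the coordinate multiplication is smooth supplies the neighbourhood \<open>U\<close>.\<close>

lemma left_inv_field_smooth:
 fixes G :: "('g, 'e::findim_normed_vector) lie"
 assumes G: "lie_group G"
 shows "\<exists>U. open U \<and> chart (lmfd G) \<one>\<^bsub>lgroup G\<^esub> \<one>\<^bsub>lgroup G\<^esub> \<in> U \<and> U \<subseteq> chart_img (lmfd G) \<one>\<^bsub>lgroup G\<^esub> \<and>
  (\<forall>X. smooth_on U (left_inv_field G X)) \<and> (\<forall>x\<in>U. (%z. chart (lmfd G) \<one>\<^bsub>lgroup G\<^esub>
   (param (lmfd G) \<one>\<^bsub>lgroup G\<^esub> x \<otimes>\<^bsub>lgroup G\<^esub> param (lmfd G) \<one>\<^bsub>lgroup G\<^esub> z)) differentiable (at (chart (lmfd G) \<one>\<^bsub>lgroup G\<^esub> \<one>\<^bsub>lgroup G\<^esub>)))"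
proof -
 note L = lie_groupD[OF G]
 interpret group "lgroup G" by (rule L(1))
 let ?M = "lmfd G" and ?e = "\<one>\<^bsub>lgroup G\<^esub>"
 let ?x0 = "chart ?M ?e ?e"
 let ?m = "%w. chart ?M ?e (param ?M ?e (fst w) \<otimes>\<^bsub>lgroup G\<^esub> param ?M ?e (snd w))"
 have e: "?e \<in> points ?M" using L(3) by simp
 have "rep_smooth (prod_mfd ?M ?M) ?M (%z. fst z \<otimes>\<^bsub>lgroup G\<^esub> snd z) (?e, ?e) ?e (?x0, ?x0)"
  using L(4)[of ?e ?e] by (simp add: smooth_at_def)
 then obtain V where V: "open V" "(?x0, ?x0) \<in> V" "V \<subseteq> chart_img ?M ?e \<times> chart_img ?M ?e"
  and s: "smooth_on V (%z. chart ?M ?e (fst (param (prod_mfd ?M ?M) (?e, ?e) z) \<otimes>\<^bsub>lgroup G\<^esub> snd (param (prod_mfd ?M ?M) (?e, ?e) z)))"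
  unfolding rep_smooth_def chart_img_prod_mfd by auto
 have m: "smooth_on V ?m"
  by (rule smooth_on_cong[OF V(1) s]) (use V(3) in \<open>auto simp: param_prod_mfd[OF L(2) L(2) e e]\<close>)
 obtain U W where UW: "open U" "open W" "(?x0, ?x0) \<in> U \<times> W" "U \<times> W \<subseteq> V" using open_prod_elim[OF V(1,2)] by metis
 have d: "?m differentiable (at (x, ?x0))" if "x \<in> U" for x using smooth_on_differentiable[OF m] UW that by blast
 have d2: "(%z. (x, z)) differentiable (at ?x0)" for x :: 'e
  by (rule differentiableI[OF has_derivative_Pair[OF has_derivative_const has_derivative_ident]])
 have fd2: "frechet_derivative (%z. (x, z)) (at ?x0) = (%v. (0, v))" for x :: 'e
  by (rule frechet_derivative_eqI[OF has_derivative_Pair[OF has_derivative_const has_derivative_ident]])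
 have dx: "(%z. ?m (x, z)) differentiable (at ?x0)" if "x \<in> U" for x
  using differentiable_chain_at[OF d2, of ?m x] d[OF that] by (simp add: o_def)
 have lif: "left_inv_field G X x = frechet_derivative ?m (at (x, ?x0)) (0, X)" if "x \<in> U" for X x
  using fun_cong[OF frechet_derivative_chain[OF d2, of ?m x], of X] d[OF that]
  by (simp add: left_inv_field_def Let_def fd2)
 have "smooth_on U (%x. frechet_derivative ?m (at (x, ?x0)) (0, X))" for X
 proof (rule smooth_on_compose[OF UW(1) V(1) _ smooth_on_frechet_derivative[OF m]])
  show "(%x. (x, ?x0)) ` U \<subseteq> V" using UW by auto
  show "smooth_on U (%x. (x, ?x0))" by (rule smooth_on_Pair[OF UW(1) smooth_on_id smooth_on_const])
 qed
 then have "smooth_on U (left_inv_field G X)" for X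
  by (rule smooth_on_cong[OF UW(1)]) (simp add: lif)
 moreover have "U \<subseteq> chart_img ?M ?e" using UW V(3) by auto
 ultimately show ?thesis using UW dx by (intro exI[of _ U]) auto
qed

lemma left_inv_field_linear:
 assumes "(%z. chart (lmfd G) \<one>\<^bsub>lgroup G\<^esub>
   (param (lmfd G) \<one>\<^bsub>lgroup G\<^esub> x \<otimes>\<^bsub>lgroup G\<^esub> param (lmfd G) \<one>\<^bsub>lgroup G\<^esub> z)) differentiable (at (chart (lmfd G) \<one>\<^bsub>lgroup G\<^esub> \<one>\<^bsub>lgroup G\<^esub>))"
 shows "linear (%X. left_inv_field G X x)"
 using linear_frechet_derivative[OF assms] by (simp add: left_inv_field_def Let_def)

text \<open>Linearity of \<open>left_inv_field\<close> in \<open>X\<close> is available near the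
  identity, where the multiplication is differentiable in the chart. A neighbourhood is enough, as
  the bracket differentiates the fields at the identity.\<close>

lemma bilinear_lie_bracket:
 fixes G :: "('g, 'e::findim_normed_vector) lie"
 assumes G: "lie_group G"
 shows "bilinear (lie_bracket G)"
proof -
 let ?x0 = "chart (lmfd G) \<one>\<^bsub>lgroup G\<^esub> \<one>\<^bsub>lgroup G\<^esub>"
 obtain U where U: "open U" "?x0 \<in> U" and s: "\<And>X. smooth_on U (left_inv_field G X)"
  and l: "\<And>x. x \<in> U ==> linear (%X. left_inv_field G X x)"
 proof -
  obtain U where U: "open U \<and> ?x0 \<in> U \<and> U \<subseteq> chart_img (lmfd G) \<one>\<^bsub>lgroup G\<^esub> \<and> (\<forall>X. smooth_on U (left_inv_field G X)) \<and>
   (\<forall>x\<in>U. (%z. chart (lmfd G) \<one>\<^bsub>lgroup G\<^esub>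
    (param (lmfd G) \<one>\<^bsub>lgroup G\<^esub> x \<otimes>\<^bsub>lgroup G\<^esub> param (lmfd G) \<one>\<^bsub>lgroup G\<^esub> z)) differentiable (at ?x0))"
   using left_inv_field_smooth[OF G] ..
  show ?thesis by (rule that[of U]) (use U in \<open>auto intro: left_inv_field_linear\<close>)
 qed
 note d = smooth_on_has_derivative[OF s U(2)]
 let ?D = "%X. frechet_derivative (left_inv_field G X) (at ?x0)"
 have add: "?D (X + Y) v = ?D X v + ?D Y v" for X Y v
 proof -
  have "?D (X + Y) = frechet_derivative (%x. left_inv_field G X x + left_inv_field G Y x) (at ?x0)"
   by (rule frechet_derivative_cong_open[OF U]) (rule linear_add[OF l])
  also have "\<dots> = (%v. ?D X v + ?D Y v)" by (rule frechet_derivative_eqI[OF has_derivative_add[OF d d]])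
  finally show ?thesis by simp
 qed
 have scale: "?D (c *\<^sub>R X) v = c *\<^sub>R ?D X v" for c X v
 proof -
  have "?D (c *\<^sub>R X) = frechet_derivative (%x. c *\<^sub>R left_inv_field G X x) (at ?x0)"
   by (rule frechet_derivative_cong_open[OF U]) (rule linear_scale[OF l])
  also have "\<dots> = (%v. c *\<^sub>R ?D X v)" by (rule frechet_derivative_eqI[OF has_derivative_scaleR_right[OF d]])
  finally show ?thesis by simp
 qed
 have lD: "linear (?D X)" for X using d by (rule has_derivative_linear)
 note l0 = l[OF U(2)]
 show ?thesis unfolding bilinear_def lie_bracket_def Let_def
  by (simp add: linear_iff add scale linear_add[OF lD] linear_scale[OF lD] linear_add[OF l0] linear_scale[OF l0] algebra_simps)
qed

text \<open>A bilinear bracket on a line is determined by its value on \<open>(1, 1)\<close>, which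
  is zero. This covers the circle without a computation in its angle charts.\<close>

lemma lie_bracket_1_dimensional:
 fixes G :: "('g, real) lie"
 assumes G: "lie_group G"
 shows "lie_bracket G X Y = 0"
proof -
 have b: "bilinear (lie_bracket G)" by (rule bilinear_lie_bracket[OF G])
 have "lie_bracket G (X * 1) (Y * 1) = X * Y * lie_bracket G 1 1"
  using bilinear_lmul[OF b, of X 1 "Y *\<^sub>R 1"] bilinear_rmul[OF b, of 1 Y 1] by simp
 moreover have "lie_bracket G 1 1 = 0" by (simp add: lie_bracket_def Let_def)
 ultimately show ?thesis by simp
qed

lemma lie_bracket_prod:
 fixes G :: "('g, 'e::findim_normed_vector) lie" and H :: "('h, 'f::findim_normed_vector) lie"
 assumes G: "lie_group G" and H: "lie_group H"
 shows "lie_bracket (prod_lie G H) X Y = (lie_bracket G (fst X) (fst Y), lie_bracket H (snd X) (snd Y))"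
proof -
 note LG = lie_groupD[OF G] and LH = lie_groupD[OF H]
 let ?e = "\<one>\<^bsub>lgroup G\<^esub>" and ?u = "\<one>\<^bsub>lgroup H\<^esub>"
 let ?x0 = "chart (lmfd G) ?e ?e" and ?y0 = "chart (lmfd H) ?u ?u"
 have eu: "?e \<in> points (lmfd G)" "?u \<in> points (lmfd H)"
  using LG(1,3) LH(1,3) by (simp_all add: group.is_monoid monoid.one_closed)
 obtain U where U: "open U" "?x0 \<in> U" "U \<subseteq> chart_img (lmfd G) ?e" and sU: "\<And>X. smooth_on U (left_inv_field G X)"
  and dU: "\<And>x. x \<in> U ==> (%z. chart (lmfd G) ?e (param (lmfd G) ?e x \<otimes>\<^bsub>lgroup G\<^esub> param (lmfd G) ?e z)) differentiable (at ?x0)"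
  using left_inv_field_smooth[OF G] by blast
 obtain V where V: "open V" "?y0 \<in> V" "V \<subseteq> chart_img (lmfd H) ?u" and sV: "\<And>X. smooth_on V (left_inv_field H X)"
  and dV: "\<And>x. x \<in> V ==> (%z. chart (lmfd H) ?u (param (lmfd H) ?u x \<otimes>\<^bsub>lgroup H\<^esub> param (lmfd H) ?u z)) differentiable (at ?y0)"
  using left_inv_field_smooth[OF H] by blast
 let ?S = "chart_img (lmfd G) ?e \<times> chart_img (lmfd H) ?u"
 have S: "open ?S" "(?x0, ?y0) \<in> ?S"
  using atlas_open[OF LG(2) eu(1)] atlas_open[OF LH(2) eu(2)] U V by (auto intro: open_Times)
 have lif: "left_inv_field (prod_lie G H) Z w = (left_inv_field G (fst Z) (fst w), left_inv_field H (snd Z) (snd w))"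
  if w: "w \<in> U \<times> V" for Z w
 proof -
  have wi: "fst w \<in> chart_img (lmfd G) ?e" "snd w \<in> chart_img (lmfd H) ?u" using w U V by auto
  have w': "fst w \<in> U" "snd w \<in> V" using w by auto
  let ?P = "prod_mfd (lmfd G) (lmfd H)"
  have "frechet_derivative (%z. chart ?P (?e, ?u) (param ?P (?e, ?u) w \<otimes>\<^bsub>lgroup G \<times>\<times> lgroup H\<^esub> param ?P (?e, ?u) z)) (at (?x0, ?y0)) =
   frechet_derivative (%z. ((%z. chart (lmfd G) ?e (param (lmfd G) ?e (fst w) \<otimes>\<^bsub>lgroup G\<^esub> param (lmfd G) ?e z)) (fst z),
    (%z. chart (lmfd H) ?u (param (lmfd H) ?u (snd w) \<otimes>\<^bsub>lgroup H\<^esub> param (lmfd H) ?u z)) (snd z))) (at (?x0, ?y0))"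
   by (rule frechet_derivative_cong_open[OF S])
    (use wi param_prod_mfd[OF LG(2) LH(2) eu wi] in \<open>auto simp: param_prod_mfd[OF LG(2) LH(2) eu] DirProd_def case_prod_unfold prod_eq_iff\<close>)
  also have "\<dots> = (%v. (left_inv_field G (fst v) (fst w), left_inv_field H (snd v) (snd w)))"
   unfolding frechet_derivative_map_prod[OF dU[OF w'(1)] dV[OF w'(2)]] by (simp add: left_inv_field_def Let_def)
  finally show ?thesis by (simp add: left_inv_field_def Let_def)
 qed
 have UV: "open (U \<times> V)" "(?x0, ?y0) \<in> U \<times> V" using U V by (auto intro: open_Times)
 have "frechet_derivative (left_inv_field (prod_lie G H) Z) (at (?x0, ?y0)) =
   (%v. (frechet_derivative (left_inv_field G (fst Z)) (at ?x0) (fst v), frechet_derivative (left_inv_field H (snd Z)) (at ?y0) (snd v)))" for Z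
  by (rule trans[OF frechet_derivative_cong_open[OF UV lif[of _ Z]]
   frechet_derivative_map_prod[OF smooth_on_differentiable[OF sU U(2)] smooth_on_differentiable[OF sV V(2)]]])
 then show ?thesis using lif[OF UV(2)] by (simp add: lie_bracket_def Let_def)
qed

lemma Ad_prod:
 fixes G :: "('g, 'e::findim_normed_vector) lie" and H :: "('h, 'f::findim_normed_vector) lie"
 assumes G: "lie_group G" and H: "lie_group H" and a: "a \<in> carrier (lgroup G)" and c: "c \<in> carrier (lgroup H)"
 shows "Ad (prod_lie G H) (a, c) X = (Ad G a (fst X), Ad H c (snd X))"
proof -
 note LG = lie_groupD[OF G] and LH = lie_groupD[OF H]
 have conj: "smooth_at (lmfd G) (lmfd G) (%x. a \<otimes>\<^bsub>lgroup G\<^esub> x \<otimes>\<^bsub>lgroup G\<^esub> inv\<^bsub>lgroup G\<^esub> a) \<one>\<^bsub>lgroup G\<^esub>"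
  if G: "lie_group G" and a: "a \<in> carrier (lgroup G)" for G :: "('x, 'y::findim_normed_vector) lie" and a
 proof -
  note L = lie_groupD[OF G]
  interpret group "lgroup G" by (rule L(1))
  show ?thesis using a
   by (intro smooth_at_mult[OF G L(2)] smooth_at_const[OF L(2)] smooth_at_id[OF L(2)]) (simp_all add: L)
 qed
 have inv: "inv\<^bsub>lgroup G \<times>\<times> lgroup H\<^esub> (a, c) = (inv\<^bsub>lgroup G\<^esub> a, inv\<^bsub>lgroup H\<^esub> c)"
  by (rule inv_DirProd[OF LG(1) LH(1) a c])
 have "Ad (prod_lie G H) (a, c) X = tangent_map (prod_mfd (lmfd G) (lmfd H)) (prod_mfd (lmfd G) (lmfd H))
   (%z. ((%x. a \<otimes>\<^bsub>lgroup G\<^esub> x \<otimes>\<^bsub>lgroup G\<^esub> inv\<^bsub>lgroup G\<^esub> a) (fst z), (%x. c \<otimes>\<^bsub>lgroup H\<^esub> x \<otimes>\<^bsub>lgroup H\<^esub> inv\<^bsub>lgroup H\<^esub> c) (snd z)))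
   (\<one>\<^bsub>lgroup G\<^esub>, \<one>\<^bsub>lgroup H\<^esub>) X"
  unfolding Ad_def prod_lie_simps inv by (simp add: DirProd_def case_prod_unfold)
 also have "\<dots> = (Ad G a (fst X), Ad H c (snd X))"
  unfolding tangent_map_map_prod[OF LG(2) LH(2) conj[OF G a] conj[OF H c]] by (simp add: Ad_def)
 finally show ?thesis .
qed

section \<open>The product connection\<close>

lemma smooth_at_act_orbit:
 assumes P: "principal_bundle P" and p: "p \<in> points (total P)" and a: "a \<in> carrier (lgroup (sgroup P))"
 shows "smooth_at (lmfd (sgroup P)) (total P) (act P p) a"
 using smooth_at_act[OF P principal_bundle_atlas(3)[OF P], of "%_. p" a "%x. x"]
  smooth_at_const[OF principal_bundle_atlas(3,1)[OF P], of a p] smooth_at_id[OF principal_bundle_atlas(3)[OF P], of a]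
  p a principal_bundle_atlas(4)[OF P] by simp

lemma smooth_at_act_right:
 assumes P: "principal_bundle P" and p: "p \<in> points (total P)" and a: "a \<in> carrier (lgroup (sgroup P))"
 shows "smooth_at (total P) (total P) (%p. act P p a) p"
 using smooth_at_act[OF P principal_bundle_atlas(1)[OF P], of "%x. x" p "%_. a"]
  smooth_at_const[OF principal_bundle_atlas(1,3)[OF P], of p a] smooth_at_id[OF principal_bundle_atlas(1)[OF P], of p]
  p a principal_bundle_atlas(4)[OF P] by simp

text \<open>\<open>F\<close> intertwines the two actions along \<open>k\<close>, so by the chain
  rule it sends generators to generators and turns right translation by \<open>a\<close> into right
  translation by \<open>k a\<close>. Applied to the two projections of the product bundle, it gives
  both components of the connection axioms.\<close>

lemma principal_connection_pullback_hom:
 fixes P :: "('p, 'pe::findim_normed_vector, 'q, 'qe::findim_normed_vector, 'g, 'ge::findim_normed_vector) pbundle"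
  and R :: "('r, 're::findim_normed_vector, 'n, 'ne::findim_normed_vector, 'h, 'he::findim_normed_vector) pbundle"
 assumes R: "principal_bundle R" and P: "principal_bundle P" and \<theta>: "principal_connection P \<theta>"
  and F: "\<And>z. z \<in> points (total R) ==> smooth_at (total R) (total P) F z"
  and k: "\<And>a. a \<in> carrier (lgroup (sgroup R)) ==> smooth_at (lmfd (sgroup R)) (lmfd (sgroup P)) k a"
  and k1: "k \<one>\<^bsub>lgroup (sgroup R)\<^esub> = \<one>\<^bsub>lgroup (sgroup P)\<^esub>"
  and eq: "\<And>z a. z \<in> points (total R) ==> a \<in> carrier (lgroup (sgroup R)) ==> F (act R z a) = act P (F z) (k a)"
 shows "smooth_form (total R) 1 (pullback (total R) (total P) F \<theta>)"
  "z \<in> points (total R) ==> pullback (total R) (total P) F \<theta> z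
   [tangent_map (lmfd (sgroup R)) (total R) (act R z) \<one>\<^bsub>lgroup (sgroup R)\<^esub> X] =
   tangent_map (lmfd (sgroup R)) (lmfd (sgroup P)) k \<one>\<^bsub>lgroup (sgroup R)\<^esub> X"
  "z \<in> points (total R) ==> a \<in> carrier (lgroup (sgroup R)) ==>
   pullback (total R) (total R) (%z. act R z a) (pullback (total R) (total P) F \<theta>) z [v] =
   Ad (sgroup P) (inv\<^bsub>lgroup (sgroup P)\<^esub> (k a)) (pullback (total R) (total P) F \<theta> z [v])"
proof -
 note AR = principal_bundle_atlas[OF R] and AP = principal_bundle_atlas[OF P]
 let ?T = "total R" and ?TP = "total P" and ?H = "lmfd (sgroup R)" and ?G = "lmfd (sgroup P)"
 let ?e = "\<one>\<^bsub>lgroup (sgroup R)\<^esub>"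
 have sm: "smooth_form ?TP 1 \<theta>" and vert: "\<And>p X. p \<in> points ?TP ==> \<theta> p [tangent_map ?G ?TP (act P p) \<one>\<^bsub>lgroup (sgroup P)\<^esub> X] = X"
  and equi: "\<And>p a v. p \<in> points ?TP ==> a \<in> carrier (lgroup (sgroup P)) ==>
   pullback ?TP ?TP (%p. act P p a) \<theta> p [v] = Ad (sgroup P) (inv\<^bsub>lgroup (sgroup P)\<^esub> a) (\<theta> p [v])"
  using \<theta> by (simp_all add: principal_connection_def)
 show "smooth_form ?T 1 (pullback ?T ?TP F \<theta>)" by (rule smooth_form_pullback[OF AR(1) AP(1) F sm])
 have e: "?e \<in> carrier (lgroup (sgroup R))" using AR(5) by (simp add: group.is_monoid monoid.one_closed)
 show "pullback ?T ?TP F \<theta> z [tangent_map ?H ?T (act R z) ?e X] = tangent_map ?H ?G k ?e X" if z: "z \<in> points ?T"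
 proof -
  have r: "act R z ?e = z" by (rule principal_bundle_group_acts(2)[OF R z])
  have Fz: "F z \<in> points ?TP" by (rule smooth_at_points(2)[OF F[OF z]])
  have "tangent_map ?T ?TP F z (tangent_map ?H ?T (act R z) ?e X) = tangent_map ?H ?TP (%a. F (act R z a)) ?e X"
   using tangent_map_compose[OF AR(3,1) smooth_at_act_orbit[OF R z e], of ?TP F X] F[OF z] by (simp add: r)
  also have "tangent_map ?H ?TP (%a. F (act R z a)) ?e = tangent_map ?H ?TP (%a. act P (F z) (k a)) ?e"
   by (rule tangent_map_cong[OF AR(3) openin_points[OF AR(3)]]) (use eq[OF z] e AR(4) in simp_all)
  also have "tangent_map ?H ?TP (%a. act P (F z) (k a)) ?e X =
    tangent_map ?G ?TP (act P (F z)) \<one>\<^bsub>lgroup (sgroup P)\<^esub> (tangent_map ?H ?G k ?e X)"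
   using tangent_map_compose[OF AR(3) AP(3) k[OF e], of ?TP "act P (F z)" X] smooth_at_act_orbit[OF P Fz, of "k ?e"]
    smooth_at_points(2)[OF k[OF e]] AP(4) by (simp add: k1)
  finally show ?thesis unfolding pullback_def using vert[OF Fz] by simp
 qed
 show "pullback ?T ?T (%z. act R z a) (pullback ?T ?TP F \<theta>) z [v] =
   Ad (sgroup P) (inv\<^bsub>lgroup (sgroup P)\<^esub> (k a)) (pullback ?T ?TP F \<theta> z [v])" if z: "z \<in> points ?T" and a: "a \<in> carrier (lgroup (sgroup R))"
 proof -
  have Fz: "F z \<in> points ?TP" by (rule smooth_at_points(2)[OF F[OF z]])
  have ka: "k a \<in> carrier (lgroup (sgroup P))" using smooth_at_points(2)[OF k[OF a]] AP(4) by simp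
  have za: "act R z a \<in> points ?T" by (rule principal_bundle_act(1)[OF R z a])
  have "pullback ?T ?T (%z. act R z a) (pullback ?T ?TP F \<theta>) z [v] = pullback ?T ?TP (%z. F (act R z a)) \<theta> z [v]"
   by (rule pullback_compose[OF AR(1) AR(1) smooth_at_act_right[OF R z a] F[OF za]])
  also have "\<dots> = pullback ?T ?TP (%z. act P (F z) (k a)) \<theta> z [v]"
   unfolding pullback_def eq[OF z a]
   by (subst tangent_map_cong[OF AR(1) openin_points[OF AR(1)] z, of "%z. F (act R z a)" "%z. act P (F z) (k a)"])
    (simp_all add: eq a)
  also have "\<dots> = pullback ?T ?TP F (pullback ?TP ?TP (%p. act P p (k a)) \<theta>) z [v]"
   by (rule pullback_compose[OF AR(1) AP(1) F[OF z] smooth_at_act_right[OF P Fz ka], symmetric])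
  also have "\<dots> = Ad (sgroup P) (inv\<^bsub>lgroup (sgroup P)\<^esub> (k a)) (pullback ?T ?TP F \<theta> z [v])"
   unfolding pullback_def[of ?T ?TP F] using equi[OF Fz ka] by simp
  finally show ?thesis .
 qed
qed

text \<open>The pullback \<open>R\<close> to \<open>total S\<close> of the fibre product of \<open>S\<close> and \<open>P\<close>; its points are triples
  \<open>(m, (s, p))\<close> over one point of the base, and only \<open>s\<close> and \<open>p\<close> enter the connection.\<close>

locale product_pullback =
 fixes S :: "('s, 'se::findim_normed_vector, 'q, 'qe::findim_normed_vector, 'h, 'he::findim_normed_vector) pbundle"
  and P :: "('p, 'pe::findim_normed_vector, 'q, 'qe, 'g, 'ge::findim_normed_vector) pbundle"
  and \<eta> :: "'s => 'se list => 'he" and A :: "'p => 'pe list => 'ge"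
 assumes S: "principal_bundle S" and P: "principal_bundle P" and base: "base P = base S"
  and \<eta>: "principal_connection S \<eta>" and A: "principal_connection P A"

begin

abbreviation "SP \<equiv> product_bundle S P"

abbreviation "R \<equiv> pullback_bundle (total S) (proj S) SP"

abbreviation "B \<equiv> pullback_connection (total S) (proj S) SP (product_connection S P \<eta> A)"

abbreviation "TS \<equiv> total S"

abbreviation "TP \<equiv> total P"

abbreviation "TR \<equiv> total R"

abbreviation "F1 z \<equiv> fst (snd z)"

abbreviation "F2 z \<equiv> snd (snd z)"

lemmas AS = principal_bundle_atlas[OF S] and AP = principal_bundle_atlas[OF P]

lemma principal_SP: "principal_bundle SP" by (rule principal_bundle_product[OF S P base])

lemmas ASP = principal_bundle_atlas[OF principal_SP]

sublocale sp: fibre_product_setup TS "proj S" P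
 by unfold_locales (use AS P smooth_at_proj[OF S] in \<open>simp_all add: base\<close>)

sublocale r: fibre_product_setup TS "proj S" SP
 by unfold_locales (use AS principal_SP smooth_at_proj[OF S] in simp_all)

lemma principal_R: "principal_bundle R"
 by (rule principal_bundle_pullback[OF principal_bundle_group_acts(5)[OF S] principal_SP]) (simp add: smooth_at_proj[OF S])

lemmas AR = principal_bundle_atlas[OF principal_R]

lemma TR_iff: "z \<in> points TR \<longleftrightarrow> fst z \<in> points TS \<and> F1 z \<in> points TS \<and> F2 z \<in> points TP \<and>
  proj S (fst z) = proj S (F1 z) \<and> proj S (F1 z) = proj P (F2 z)"
 using r.E_iff[of z] sp.E_iff[of "snd z"] by auto

lemma smooth_m: "z \<in> points TR ==> smooth_at TR TS fst z"
 using r.smooth_at_E_fst[of z] by simp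

lemma smooth_snd: "z \<in> points TR ==> smooth_at TR (total SP) snd z"
 using r.smooth_at_E_snd[of z] by simp

lemma smooth_F1: assumes z: "z \<in> points TR" shows "smooth_at TR TS F1 z"
proof -
 have "smooth_at (total SP) TS fst (snd z)" using sp.smooth_at_E_fst[of "snd z"] smooth_at_points(2)[OF smooth_snd[OF z]] by simp
 from smooth_at_compose[OF AR(1) ASP(1) smooth_snd[OF z] this] show ?thesis by simp
qed

lemma smooth_F2: assumes z: "z \<in> points TR" shows "smooth_at TR TP F2 z"
proof -
 have "smooth_at (total SP) TP snd (snd z)" using sp.smooth_at_E_snd[of "snd z"] smooth_at_points(2)[OF smooth_snd[OF z]] by simp
 from smooth_at_compose[OF AR(1) ASP(1) smooth_snd[OF z] this] show ?thesis by simp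
qed

lemma B_eq:
 assumes z: "z \<in> points TR"
 shows "B z vs = (pullback TR TS F1 \<eta> z vs, pullback TR TP F2 A z vs)"
proof -
 have s: "snd z \<in> points (total SP)" using smooth_at_points(2)[OF smooth_snd[OF z]] .
 have "pullback TR (total SP) snd (pullback (total SP) TS fst \<eta>) z vs = pullback TR TS F1 \<eta> z vs"
  by (rule pullback_compose[OF AR(1) ASP(1) smooth_snd[OF z]]) (use sp.smooth_at_E_fst[of "snd z"] s in simp)
 moreover have "pullback TR (total SP) snd (pullback (total SP) TP snd A) z vs = pullback TR TP F2 A z vs"
  by (rule pullback_compose[OF AR(1) ASP(1) smooth_snd[OF z]]) (use sp.smooth_at_E_snd[of "snd z"] s in simp)
 ultimately show ?thesis
  by (simp add: pullback_connection_def product_connection_def pullback_def Let_def)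
qed

lemma group_R: "sgroup R = prod_lie (sgroup S) (sgroup P)" by simp

lemma pull1: "smooth_form TR 1 (pullback TR TS F1 \<eta>)"
  "z \<in> points TR ==> pullback TR TS F1 \<eta> z [tangent_map (lmfd (sgroup R)) TR (act R z) \<one>\<^bsub>lgroup (sgroup R)\<^esub> X] = fst X"
  "z \<in> points TR ==> a \<in> carrier (lgroup (sgroup R)) ==>
   pullback TR TR (%z. act R z a) (pullback TR TS F1 \<eta>) z [v] =
   Ad (sgroup S) (inv\<^bsub>lgroup (sgroup S)\<^esub> (fst a)) (pullback TR TS F1 \<eta> z [v])"
proof -
 have k: "smooth_at (lmfd (sgroup R)) (lmfd (sgroup S)) fst a" if "a \<in> carrier (lgroup (sgroup R))" for a
  using smooth_at_fst[OF AS(3) AP(3), of a] that AR(4) by simp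
 have k1: "fst \<one>\<^bsub>lgroup (sgroup R)\<^esub> = \<one>\<^bsub>lgroup (sgroup S)\<^esub>" by simp
 have eq: "F1 (act R z a) = act S (F1 z) (fst a)" for z a by simp
 show "smooth_form TR 1 (pullback TR TS F1 \<eta>)" by (rule principal_connection_pullback_hom(1)[OF principal_R S \<eta> smooth_F1 k k1 eq])
 have o: "\<one>\<^bsub>lgroup (sgroup R)\<^esub> \<in> points (prod_mfd (lmfd (sgroup S)) (lmfd (sgroup P)))"
  using AS(4,5) AP(4,5) by (simp add: group.is_monoid monoid.one_closed)
 show "pullback TR TS F1 \<eta> z [tangent_map (lmfd (sgroup R)) TR (act R z) \<one>\<^bsub>lgroup (sgroup R)\<^esub> X] = fst X" if "z \<in> points TR"
 proof -
  have "pullback TR TS F1 \<eta> z [tangent_map (lmfd (sgroup R)) TR (act R z) \<one>\<^bsub>lgroup (sgroup R)\<^esub> X] =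
    tangent_map (lmfd (sgroup R)) (lmfd (sgroup S)) fst \<one>\<^bsub>lgroup (sgroup R)\<^esub> X"
   by (rule principal_connection_pullback_hom(2)[OF principal_R S \<eta> smooth_F1 k k1 eq that])
  then show ?thesis using tangent_map_prod_fst_snd(1)[OF AS(3) AP(3) o] by (simp only: group_R prod_lie_simps)
 qed
 show "z \<in> points TR ==> a \<in> carrier (lgroup (sgroup R)) ==>
   pullback TR TR (%z. act R z a) (pullback TR TS F1 \<eta>) z [v] =
   Ad (sgroup S) (inv\<^bsub>lgroup (sgroup S)\<^esub> (fst a)) (pullback TR TS F1 \<eta> z [v])" by (rule principal_connection_pullback_hom(3)[OF principal_R S \<eta> smooth_F1 k k1 eq])
qed

lemma pull2: "smooth_form TR 1 (pullback TR TP F2 A)"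
  "z \<in> points TR ==> pullback TR TP F2 A z [tangent_map (lmfd (sgroup R)) TR (act R z) \<one>\<^bsub>lgroup (sgroup R)\<^esub> X] = snd X"
  "z \<in> points TR ==> a \<in> carrier (lgroup (sgroup R)) ==>
   pullback TR TR (%z. act R z a) (pullback TR TP F2 A) z [v] =
   Ad (sgroup P) (inv\<^bsub>lgroup (sgroup P)\<^esub> (snd a)) (pullback TR TP F2 A z [v])"
proof -
 have k: "smooth_at (lmfd (sgroup R)) (lmfd (sgroup P)) snd a" if "a \<in> carrier (lgroup (sgroup R))" for a
  using smooth_at_snd[OF AS(3) AP(3), of a] that AR(4) by simp
 have k1: "snd \<one>\<^bsub>lgroup (sgroup R)\<^esub> = \<one>\<^bsub>lgroup (sgroup P)\<^esub>" by simp
 have eq: "F2 (act R z a) = act P (F2 z) (snd a)" for z a by simp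
 show "smooth_form TR 1 (pullback TR TP F2 A)" by (rule principal_connection_pullback_hom(1)[OF principal_R P A smooth_F2 k k1 eq])
 have o: "\<one>\<^bsub>lgroup (sgroup R)\<^esub> \<in> points (prod_mfd (lmfd (sgroup S)) (lmfd (sgroup P)))"
  using AS(4,5) AP(4,5) by (simp add: group.is_monoid monoid.one_closed)
 show "pullback TR TP F2 A z [tangent_map (lmfd (sgroup R)) TR (act R z) \<one>\<^bsub>lgroup (sgroup R)\<^esub> X] = snd X" if "z \<in> points TR"
 proof -
  have "pullback TR TP F2 A z [tangent_map (lmfd (sgroup R)) TR (act R z) \<one>\<^bsub>lgroup (sgroup R)\<^esub> X] =
    tangent_map (lmfd (sgroup R)) (lmfd (sgroup P)) snd \<one>\<^bsub>lgroup (sgroup R)\<^esub> X"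
   by (rule principal_connection_pullback_hom(2)[OF principal_R P A smooth_F2 k k1 eq that])
  then show ?thesis using tangent_map_prod_fst_snd(2)[OF AS(3) AP(3) o] by (simp only: group_R prod_lie_simps)
 qed
 show "z \<in> points TR ==> a \<in> carrier (lgroup (sgroup R)) ==>
   pullback TR TR (%z. act R z a) (pullback TR TP F2 A) z [v] =
   Ad (sgroup P) (inv\<^bsub>lgroup (sgroup P)\<^esub> (snd a)) (pullback TR TP F2 A z [v])" by (rule principal_connection_pullback_hom(3)[OF principal_R P A smooth_F2 k k1 eq])
qed

lemma principal_connection_B: "principal_connection R B"
 unfolding principal_connection_def
proof (intro conjI ballI allI)
 show "smooth_form TR 1 B"
  by (rule smooth_form_cong[OF AR(1) smooth_form_Pair[OF AR(1) pull1(1) pull2(1)]]) (rule B_eq[symmetric])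
 show "B z [tangent_map (lmfd (sgroup R)) TR (act R z) \<one>\<^bsub>lgroup (sgroup R)\<^esub> X] = X" if "z \<in> points TR" for z X
  unfolding B_eq[OF that] pull1(2)[OF that] pull2(2)[OF that] by simp
 show "pullback TR TR (%z. act R z a) B z [v] = Ad (sgroup R) (inv\<^bsub>lgroup (sgroup R)\<^esub> a) (B z [v])"
  if z: "z \<in> points TR" and a: "a \<in> carrier (lgroup (sgroup R))" for z a v
 proof -
  have za: "act R z a \<in> points TR" by (rule principal_bundle_act(1)[OF principal_R z a])
  obtain x y where xy: "a = (x, y)" "x \<in> carrier (lgroup (sgroup S))" "y \<in> carrier (lgroup (sgroup P))"
   using a by (cases a) auto
  have inv: "inv\<^bsub>lgroup (sgroup R)\<^esub> a = (inv\<^bsub>lgroup (sgroup S)\<^esub> x, inv\<^bsub>lgroup (sgroup P)\<^esub> y)"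
   using inv_DirProd[OF AS(5) AP(5) xy(2,3)] by (simp add: xy(1))
  have ic: "inv\<^bsub>lgroup (sgroup S)\<^esub> x \<in> carrier (lgroup (sgroup S))" "inv\<^bsub>lgroup (sgroup P)\<^esub> y \<in> carrier (lgroup (sgroup P))"
   using AS(5) AP(5) xy by (simp_all add: group.inv_closed)
  have "pullback TR TR (%z. act R z a) B z [v] =
    (pullback TR TR (%z. act R z a) (pullback TR TS F1 \<eta>) z [v], pullback TR TR (%z. act R z a) (pullback TR TP F2 A) z [v])"
   unfolding pullback_def[of TR TR] by (rule B_eq[OF za])
  also have "\<dots> = Ad (sgroup R) (inv\<^bsub>lgroup (sgroup R)\<^esub> a) (B z [v])"
   unfolding inv unfolding pull1(3)[OF z a] pull2(3)[OF z a] B_eq[OF z] group_R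
    Ad_prod[OF principal_bundle_group_acts(1)[OF S] principal_bundle_group_acts(1)[OF P] ic] by (simp add: xy(1))
  finally show ?thesis .
 qed
qed

lemma wedge_with_pair:
 "wedge_with (%x y. (b1 (fst x) (fst y), b2 (snd x) (snd y))) (%vs. (a1 vs, a2 vs)) (%vs. (c1 vs, c2 vs)) vs =
  (wedge_with b1 a1 c1 vs, wedge_with b2 a2 c2 vs)"
 by (simp add: wedge_with_def prod_eq_iff fst_sum snd_sum)

text \<open>The exterior derivative commutes with pullback along the two projections and the bracket
  of a product group is componentwise, so no mixed term arises.\<close>

lemma curvature_B:
 assumes z: "z \<in> points TR"
 shows "curvature R B z vs = (pullback TR TS F1 (curvature S \<eta>) z vs, pullback TR TP F2 (curvature P A) z vs)"
proof -
 have s\<eta>: "smooth_form TS 1 \<eta>" and sA: "smooth_form TP 1 A" using \<eta> A by (simp_all add: principal_connection_def)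
 have "ext_d TR B z vs = ext_d TR (%z vs. (pullback TR TS F1 \<eta> z vs, pullback TR TP F2 A z vs)) z vs"
  by (rule ext_d_cong[OF AR(1) z]) (rule B_eq)
 also have "\<dots> = (ext_d TR (pullback TR TS F1 \<eta>) z vs, ext_d TR (pullback TR TP F2 A) z vs)"
  by (rule ext_d_Pair[OF AR(1) pull1(1) pull2(1) z])
 also have "\<dots> = (pullback TR TS F1 (ext_d TS \<eta>) z vs, pullback TR TP F2 (ext_d TP A) z vs)"
  using ext_d_pullback[OF AR(1) AS(1) smooth_F1 s\<eta> z] ext_d_pullback[OF AR(1) AP(1) smooth_F2 sA z] by simp
 finally have d: "ext_d TR B z vs = (pullback TR TS F1 (ext_d TS \<eta>) z vs, pullback TR TP F2 (ext_d TP A) z vs)" .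
 have Bz: "B z = (%vs. (pullback TR TS F1 \<eta> z vs, pullback TR TP F2 A z vs))" by (rule ext) (rule B_eq[OF z])
 have lb: "lie_bracket (sgroup R) = (%x y. (lie_bracket (sgroup S) (fst x) (fst y), lie_bracket (sgroup P) (snd x) (snd y)))"
  by (intro ext) (simp add: lie_bracket_prod[OF principal_bundle_group_acts(1)[OF S] principal_bundle_group_acts(1)[OF P]])
 have "wedge_with (lie_bracket (sgroup R)) (B z) (B z) vs =
   (wedge_with (lie_bracket (sgroup S)) (pullback TR TS F1 \<eta> z) (pullback TR TS F1 \<eta> z) vs,
    wedge_with (lie_bracket (sgroup P)) (pullback TR TP F2 A z) (pullback TR TP F2 A z) vs)"
  unfolding lb Bz wedge_with_pair ..
 also have "\<dots> = (wedge_with (lie_bracket (sgroup S)) (\<eta> (F1 z)) (\<eta> (F1 z)) (map (tangent_map TR TS F1 z) vs),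
    wedge_with (lie_bracket (sgroup P)) (A (F2 z)) (A (F2 z)) (map (tangent_map TR TP F2 z) vs))"
  unfolding wedge_with_map[symmetric] pullback_def[abs_def] ..
 finally have w: "wedge_with (lie_bracket (sgroup R)) (B z) (B z) vs =
   (wedge_with (lie_bracket (sgroup S)) (\<eta> (F1 z)) (\<eta> (F1 z)) (map (tangent_map TR TS F1 z) vs),
    wedge_with (lie_bracket (sgroup P)) (A (F2 z)) (A (F2 z)) (map (tangent_map TR TP F2 z) vs))" .
 show ?thesis unfolding curvature_def[of R B] w d unfolding pullback_def curvature_def by simp
qed

text \<open>The three components of a point of \<open>R\<close> lie over the same base point, so the
  three maps to the base agree on \<open>TR\<close> and have equal differentials. This is how
  equations for forms from the base travel between \<open>S\<close> and \<open>P\<close>.\<close>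

lemma pullback_via_base:
 assumes z: "z \<in> points TR"
 shows "pullback TR TS F1 (lift_form S \<alpha>) z vs = pullback TR TS fst (lift_form S \<alpha>) z vs"
  "pullback TR TP F2 (lift_form P \<alpha>) z vs = pullback TR TS fst (lift_form S \<alpha>) z vs"
proof -
 have zz: "fst z \<in> points TS" "F1 z \<in> points TS" "F2 z \<in> points TP" "proj S (F1 z) = proj S (fst z)" "proj P (F2 z) = proj S (fst z)"
  using z[unfolded TR_iff] by simp_all
 have t: "tangent_map TR (base S) (%z. proj S (F1 z)) z = tangent_map TR (base S) (%z. proj S (fst z)) z"
  "tangent_map TR (base S) (%z. proj P (F2 z)) z = tangent_map TR (base S) (%z. proj S (fst z)) z"
  by (rule tangent_map_cong[OF AR(1) openin_points[OF AR(1)] z], drule TR_iff[THEN iffD1], simp)+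
 have c: "pullback TR TS fst (lift_form S \<alpha>) z vs = pullback TR (base S) (%z. proj S (fst z)) \<alpha> z vs"
  unfolding lift_form_def by (rule pullback_compose[OF AR(1) AS(1) smooth_m[OF z] smooth_at_proj[OF S zz(1)]])
 have c1: "pullback TR TS F1 (lift_form S \<alpha>) z vs = pullback TR (base S) (%z. proj S (F1 z)) \<alpha> z vs"
  unfolding lift_form_def by (rule pullback_compose[OF AR(1) AS(1) smooth_F1[OF z] smooth_at_proj[OF S zz(2)]])
 have c2: "pullback TR TP F2 (lift_form P \<alpha>) z vs = pullback TR (base S) (%z. proj P (F2 z)) \<alpha> z vs"
  unfolding lift_form_def base using pullback_compose[OF AR(1) AP(1) smooth_F2[OF z] smooth_at_proj[OF P zz(3)]] by (simp add: base)
 show "pullback TR TS F1 (lift_form S \<alpha>) z vs = pullback TR TS fst (lift_form S \<alpha>) z vs"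
  unfolding c c1 unfolding pullback_def t zz ..
 show "pullback TR TP F2 (lift_form P \<alpha>) z vs = pullback TR TS fst (lift_form S \<alpha>) z vs"
  unfolding c c2 unfolding pullback_def t zz ..
qed

end

section \<open>Curvature and the instanton condition\<close>

lemma tangent_map_proj_surj:
 assumes P: "principal_bundle P" and p: "p \<in> points (total P)"
 shows "surj (tangent_map (total P) (base P) (proj P) p)"
proof -
 note A = principal_bundle_atlas[OF P]
 have q: "proj P p \<in> points (base P)" by (rule proj_points[OF P p])
 obtain U h where U: "proj P p \<in> U" and L: "local_triv P U h" using principal_bundle_group_acts(4)[OF P q] by blast
 note f = local_triv_facts[OF P L]
 have hp: "h p \<in> points (lmfd (sgroup P))" by (rule smooth_at_points(2)[OF f(2)[OF p U]])
 \<comment> \<open>The local section through \<open>p\<close> with constant group coordinate; its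
   differential is a right inverse of that of the projection.\<close>
 let ?\<tau> = "%x. triv_inv P U h (x, h p)"
 have \<tau>p: "?\<tau> (proj P p) = p" by (rule f(3)[OF p U])
 have s: "smooth_at (base P) (total P) ?\<tau> (proj P p)"
  by (rule smooth_at_compose[OF A(2) atlas_prod_mfd[OF A(2,3)] smooth_at_Pair[OF smooth_at_id[OF A(2) q] smooth_at_const[OF A(2,3) q hp]] f(7)[OF U hp]])
 have "tangent_map (total P) (base P) (proj P) p (tangent_map (base P) (total P) ?\<tau> (proj P p) v) = v" for v
 proof -
  have "tangent_map (total P) (base P) (proj P) (?\<tau> (proj P p)) (tangent_map (base P) (total P) ?\<tau> (proj P p) v) =
    tangent_map (base P) (base P) (%x. proj P (?\<tau> x)) (proj P p) v"
   by (rule tangent_map_compose[OF A(2,1) s, symmetric]) (simp add: \<tau>p smooth_at_proj[OF P p])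
  also have "tangent_map (base P) (base P) (%x. proj P (?\<tau> x)) (proj P p) = tangent_map (base P) (base P) (%x. x) (proj P p)"
   by (rule tangent_map_cong[OF A(2) f(1) U]) (rule f(5)[OF _ hp])
  finally show ?thesis by (simp add: \<tau>p tangent_map_id[OF A(2) q])
 qed
 then show ?thesis by (metis surjI)
qed

text \<open>The projection is constant along orbits of the structure group.\<close>

lemma tangent_map_proj_vertical:
 assumes P: "principal_bundle P" and p: "p \<in> points (total P)"
 shows "tangent_map (total P) (base P) (proj P) p (tangent_map (lmfd (sgroup P)) (total P) (act P p) \<one>\<^bsub>lgroup (sgroup P)\<^esub> X) = 0"
proof -
 note A = principal_bundle_atlas[OF P]
 let ?G = "lmfd (sgroup P)" and ?e = "\<one>\<^bsub>lgroup (sgroup P)\<^esub>"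
 have e: "?e \<in> carrier (lgroup (sgroup P))" using A(5) by (simp add: group.is_monoid monoid.one_closed)
 have r: "act P p ?e = p" by (rule principal_bundle_group_acts(2)[OF P p])
 have s: "smooth_at ?G (total P) (act P p) ?e"
  using smooth_at_act[OF P A(3), of "%_. p" ?e "%x. x"] smooth_at_const[OF A(3,1), of ?e p] smooth_at_id[OF A(3), of ?e] p e A(4) by simp
 have "tangent_map (total P) (base P) (proj P) (act P p ?e) (tangent_map ?G (total P) (act P p) ?e X) =
   tangent_map ?G (base P) (%a. proj P (act P p a)) ?e X"
  by (rule tangent_map_compose[OF A(3,1) s, symmetric]) (simp add: r smooth_at_proj[OF P p])
 also have "tangent_map ?G (base P) (%a. proj P (act P p a)) ?e = tangent_map ?G (base P) (%a. proj P p) ?e"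
  by (rule tangent_map_cong[OF A(3) openin_points[OF A(3)]]) (use e A(4) principal_bundle_act(2)[OF P p] in simp_all)
 also have "tangent_map ?G (base P) (%a. proj P p) ?e X = 0" by (simp add: tangent_map_def o_def)
 finally show ?thesis by (simp add: r)
qed

text \<open>In degree 1 the derivative is the antisymmetrisation of \<open>G\<close>. Its linearity
  in the inserted vector comes from linearity of the form at all points of \<open>S\<close>, since a
  pointwise identity can be differentiated only on a neighbourhood.\<close>

lemma alt_form_flat_d_1form:
 fixes a :: "'e::findim_normed_vector => 'e list => 'v::real_normed_vector"
 assumes S: "open S" "x \<in> S" and a: "smooth_flat_form S 1 a"
 shows "alt_form 2 (flat_d a x)"
proof -
 have a1: "alt_form 1 (a y)" if "y \<in> S" for y using a that by (simp add: smooth_flat_form_def)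
 have l: "linear (%v. a y [v])" if "y \<in> S" for y
  using linear_head[of "a y" "[]"] a1[OF that] by (simp add: alt_form_iff)
 have d: "((%y. a y ws) has_derivative frechet_derivative (%y. a y ws) (at x)) (at x)" for ws
  by (rule smooth_on_has_derivative[OF _ S(2)]) (use a in \<open>simp add: smooth_flat_form_def\<close>)
 let ?G = "%v w. frechet_derivative (%y. a y [w]) (at x) v"
 have F: "flat_d a x [v, w] = ?G v w - ?G w v" for v w by (simp add: flat_d_def numeral_2_eq_2)
 have z: "flat_d a x vs = 0" if n: "length vs \<noteq> 2" for vs
  unfolding flat_d_def
 proof (rule sum.neutral, rule ballI)
  fix i assume i: "i \<in> {..<length vs}"
  have "frechet_derivative (%y. a y (take i vs @ drop (Suc i) vs)) (at x) = frechet_derivative (%y. 0) (at x)"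
   by (rule frechet_derivative_cong_open[OF S]) (use i n a1 in \<open>simp add: alt_form_def\<close>)
  then show "(- 1) ^ i *\<^sub>R frechet_derivative (%y. a y (take i vs @ drop (Suc i) vs)) (at x) (vs ! i) = 0" by simp
 qed
 have l1: "linear (%v. ?G v w)" for w using d by (rule has_derivative_linear)
 have l2: "linear (%w. ?G v w)" for v
 proof (rule linearI)
  fix w w' and c :: real
  have "frechet_derivative (%y. a y [w + w']) (at x) = frechet_derivative (%y. a y [w] + a y [w']) (at x)"
   by (rule frechet_derivative_cong_open[OF S]) (rule linear_add[OF l])
  also have "\<dots> = (%v. ?G v w + ?G v w')" by (rule frechet_derivative_eqI[OF has_derivative_add[OF d d]])
  finally show "?G v (w + w') = ?G v w + ?G v w'" by simp
  have "frechet_derivative (%y. a y [c *\<^sub>R w]) (at x) = frechet_derivative (%y. c *\<^sub>R a y [w]) (at x)"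
   by (rule frechet_derivative_cong_open[OF S]) (rule linear_scale[OF l])
  also have "\<dots> = (%v. c *\<^sub>R ?G v w)" by (rule frechet_derivative_eqI[OF has_derivative_scaleR_right[OF d]])
  finally show "?G v (c *\<^sub>R w) = c *\<^sub>R ?G v w" by simp
 qed
 show ?thesis
  unfolding alt_form_def
 proof (intro conjI allI impI)
  show "flat_d a x vs = 0" if "length vs \<noteq> 2" for vs by (rule z[OF that])
  fix us ws :: "'e list"
  assume "length us + length ws + 1 = 2"
  then consider w where "us = []" "ws = [w]" | u where "us = [u]" "ws = []"
   by (cases us; cases ws) auto
  then show "linear (%v. flat_d a x (us @ v # ws))"
   by cases (simp_all add: F linear_compose_sub[OF l1 l2] linear_compose_sub[OF l2 l1])
 next
  fix vs :: "'e list" assume "length vs = 2 \<and> \<not> distinct vs"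
  then obtain v where "vs = [v, v]" by (auto simp: length_Suc_conv numeral_2_eq_2)
  then show "flat_d a x vs = 0" by (simp add: F)
 qed
qed

lemma alt_form_ext_d_1form:
 assumes M: "mfd_atlas M" and a: "smooth_form M 1 \<alpha>" and p: "p \<in> points M"
 shows "alt_form 2 (ext_d M \<alpha> p)"
 unfolding ext_d_def
 by (rule alt_form_flat_d_1form[OF atlas_open[OF M p] chart_center_img[OF M p] smooth_form_flat[OF M a p]])

lemma alt_form_curvature:
 fixes P :: "('p, 'pe::findim_normed_vector, 'q, 'qe::findim_normed_vector, 'g, 'ge::findim_normed_vector) pbundle"
 assumes P: "principal_bundle P" and A: "principal_connection P A" and p: "p \<in> points (total P)"
 shows "alt_form 2 (curvature P A p)"
proof -
 have s: "smooth_form (total P) 1 A" using A by (simp add: principal_connection_def)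
 have "alt_form (1 + 1) (wedge_with (lie_bracket (sgroup P)) (A p) (A p))"
  by (rule alt_form_wedge_with[OF bilinear_lie_bracket[OF principal_bundle_group_acts(1)[OF P]]
   smooth_form_alt[OF s p] smooth_form_alt[OF s p]])
 then have w: "alt_form 2 (wedge_with (lie_bracket (sgroup P)) (A p) (A p))" by (simp add: numeral_2_eq_2)
 have "curvature P A p = (%vs. ext_d (total P) A p vs + (1/2) *\<^sub>R wedge_with (lie_bracket (sgroup P)) (A p) (A p) vs)"
  by (rule ext) (simp add: curvature_def)
 then show ?thesis
  using alt_form_add[OF alt_form_ext_d_1form[OF principal_bundle_atlas(1)[OF P] s p] alt_form_scale[OF w, of "1/2"]] by simp
qed

lemma bilinear_scaleR_flip: "bilinear (%(X::'v::real_vector) (r::real). r *\<^sub>R X)"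
 by (simp add: bilinear_def linear_iff scaleR_add_left scaleR_add_right)

context su3_point

begin

text \<open>Contracting with vectors in the kernel of \<open>L\<close> shows first that \<open>F\<close> is pulled back by \<open>L\<close>; then
  \<open>F \<and> Re \<Upsilon> = 0\<close> says that \<open>F\<close> has no \<open>(0,2)\<close>-part, and so does \<open>F \<and> Im \<Upsilon> = 0\<close>.\<close>

lemma wedge_Re_imp_Im:
 fixes F :: "'v::real_vector list => 'w::real_vector" and L :: "'v => real^6"
 assumes L: "linear L" "surj L" and F: "alt_form 2 F"
  and zero: "\<And>vs. wedge_with (%X r. r *\<^sub>R X) F (%vs. Re (u * U (map L vs))) vs = 0"
 shows "wedge_with (%X r. r *\<^sub>R X) F (%vs. Im (u * U (map L vs))) vs = 0"
proof -
 let ?b = "%(X::'w) (r::real). r *\<^sub>R X"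
 let ?P = "%vs. Re (u * U vs)" and ?M = "%vs. Im (u * U vs)"
 note bb = bilinear_scaleR_flip[where 'v = 'w]
 obtain R where R: "linear R" "L \<circ> R = id" using linear_surjective_right_inverse[OF L] by blast
 have LR: "L (R x) = x" for x using R(2) by (metis comp_apply id_apply)
 obtain e1 e3 e5 where fr: "orthonormal_frame g [e1, J e1, e3, J e3, e5, J e5]" and U1: "u * U [e1, e3, e5] = 1"
  by (rule unitary_frame)
 let ?E = "[e1, J e1, e3, J e3, e5, J e5]"
 note tab = rotated_U_frame[OF U1]
 have mF: "multilin F" "adj_alt F" "homog (Suc (Suc 0)) F" using F by (simp_all add: alt_form_iff numeral_2_eq_2)
 have lin0: "U (map L (X # vs)) = 0" if "L X = 0" for X vs
  using linear_0[OF linear_head[OF mU(1), of "map L vs"]] that by simp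
 have first: "F [X, Y] = 0" if X: "L X = 0" for X Y
 proof -
  let ?a = "X \<lrcorner> F"
  have ha: "homog (Suc 0) ?a" by (rule homog_contraction[OF mF(3)])
  have "(X \<lrcorner> wedge_with ?b F (%vs. ?P (map L vs))) vs = 0" for vs using zero[of "X # vs"] by (simp only: contraction_def)
  moreover have "X \<lrcorner> (%vs. ?P (map L vs)) = (%vs. 0)" by (rule ext) (simp only: contraction_def lin0[OF X] mult_zero_right zero_complex.sel)
  ultimately have za: "wedge_with ?b ?a (%vs. ?P (map L vs)) vs = 0" for vs
   unfolding contraction_wedge_with[OF bb] by (simp add: wedge_with_zero_right[OF bb])
  have U0: "U (0 # ws) = 0" for ws using linear_0[OF linear_head[OF mU(1), of ws]] .
  \<comment> \<open>On \<open>Z\<close> and a horizontal triple whose real part is 1, every other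
    term of the product has the vertical vector \<open>Z\<close> inside \<open>U\<close>.\<close>
  have vert: "?a [Z] = 0" if Z: "L Z = 0" for Z
   using za[of "[Z, R e1, R e3, R e5]"]
   by (simp add: wedge_with_shuffle_sum[OF bb ha] LR tab Z U0 del: times_complex.sel)
  \<comment> \<open>In this quadruple and the five that follow, only one of the triples left after
    removing a vector has a non-zero real part, namely the one that misses the vector under
    consideration.\<close>
  have h1: "?a [R (e1)] = 0"
   using za[of "[R (e1), R (J e1), R (e3), R (J e5)]"]
   by (simp add: wedge_with_shuffle_sum[OF bb ha] LR tab del: times_complex.sel)
  have h2: "?a [R (J e1)] = 0"
   using za[of "[R (e1), R (J e1), R (e3), R (e5)]"]
   by (simp add: wedge_with_shuffle_sum[OF bb ha] LR tab del: times_complex.sel)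
  have h3: "?a [R (e3)] = 0"
   using za[of "[R (e1), R (e3), R (J e3), R (J e5)]"]
   by (simp add: wedge_with_shuffle_sum[OF bb ha] LR tab del: times_complex.sel)
  have h4: "?a [R (J e3)] = 0"
   using za[of "[R (e1), R (e3), R (J e3), R (e5)]"]
   by (simp add: wedge_with_shuffle_sum[OF bb ha] LR tab del: times_complex.sel)
  have h5: "?a [R (e5)] = 0"
   using za[of "[R (e1), R (J e3), R (e5), R (J e5)]"]
   by (simp add: wedge_with_shuffle_sum[OF bb ha] LR tab del: times_complex.sel)
  have h6: "?a [R (J e5)] = 0"
   using za[of "[R (e1), R (e3), R (e5), R (J e5)]"]
   by (simp add: wedge_with_shuffle_sum[OF bb ha] LR tab del: times_complex.sel)
  have la: "linear (%v. ?a [v])"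
   using mF(1)[unfolded multilin_def, rule_format, of "[X]" "[]"] by (simp add: contraction_def)
  have lR: "linear (%w. ?a [R w])" using linear_compose[OF R(1) la] by (simp add: o_def)
  have base: "?a [R w] = 0" for w
  proof -
   have s: "?a [R (\<Sum>i<DIM(real^6). g w (?E ! i) *\<^sub>R ?E ! i)] = 0"
    unfolding linear_sum[OF lR] linear_scale[OF lR]
   proof (rule sum.neutral, rule ballI)
    fix i assume i: "i \<in> {..<DIM(real^6)}"
    have "\<forall>i<6. ?a [R (?E ! i)] = 0"
     by (simp add: All_less_Suc numeral_eq_Suc h1 h2 h3 h4 h5 h6)
    then show "g w (?E ! i) *\<^sub>R ?a [R (?E ! i)] = 0" using i by simp
   qed
   show ?thesis by (subst orthonormal_frame_expand[OF bg fr, of w]) (rule s)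
  qed
  have v0: "?a [Y - R (L Y)] = 0" by (rule vert) (simp add: linear_diff[OF L(1)] LR)
  have "?a [Y] = ?a [Y - R (L Y)] + ?a [R (L Y)]" using linear_diff[OF la, of Y "R (L Y)"] by simp
  then have "?a [Y] = 0" using v0 base by simp
  then show ?thesis by (simp add: contraction_def)
 qed
 have anti: "F [X, Y] = - F [Y, X]" for X Y using adj_alt_swap[OF mF(1,2), of "[]" X Y "[]"] by simp
 have F2: "F [v, w] = F [R (L v), R (L w)]" for v w
 proof -
  have d: "L (v - R (L v)) = 0" for v by (simp add: linear_diff[OF L(1)] LR)
  have "F [v - R (L v), w] = F [v, w] - F [R (L v), w]" using linear_diff[OF linear_head[OF mF(1), of "[w]"]] by simp
  moreover have "F [w - R (L w), R (L v)] = F [w, R (L v)] - F [R (L w), R (L v)]"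
   using linear_diff[OF linear_head[OF mF(1), of "[R (L v)]"]] by simp
  ultimately have "F [v, w] = F [R (L v), w]" "F [w, R (L v)] = F [R (L w), R (L v)]" using first[OF d] by simp_all
  then show ?thesis using anti by metis
 qed
 have Fmap: "F vs = F (map R (map L vs))" for vs
 proof (cases "length vs = 2")
  case True
  then obtain v w where "vs = [v, w]" by (auto simp: length_Suc_conv numeral_2_eq_2)
  then show ?thesis using F2 by simp
 qed (use F in \<open>simp add: alt_form_def\<close>)
 let ?F = "%vs. F (map R vs)"
 have aF: "alt_form 2 ?F" by (rule alt_form_map[OF F R(1)])
 have hF: "homog (Suc (Suc 0)) ?F" using aF by (simp add: alt_form_iff numeral_2_eq_2)
 have "wedge_with ?b ?F (%vs. ?P (map L (map R vs))) vs = 0" for vs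
  unfolding wedge_with_map[of ?b F R "%vs. ?P (map L vs)"] by (rule zero)
 then have zP: "wedge_with ?b ?F ?P vs = 0" for vs by (simp add: LR o_def)
 have aM: "alt_form 3 ?M" by (rule alt_form_linear[OF altU]) (simp add: linear_iff algebra_simps)
 have aFM: "alt_form 5 (wedge_with ?b ?F ?M)" using alt_form_wedge_with[OF bb aF aM] by simp
 note t = wedge_with_shuffle_sum[OF bb hF] tab
 \<comment> \<open>The six 5-element parts of the frame give six relations, which say that
   \<open>?F\<close> is invariant under \<open>J\<close>. With them each component of the product
   with the imaginary part cancels.\<close>
 have r6: "?F [J e1, J e3] = ?F [e1, e3]"
  using zP[of "[e1, J e1, e3, J e3, e5]"] by (simp add: t del: times_complex.sel)
 have r5: "?F [J e1, e3] = - ?F [e1, J e3]"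
  using zP[of "[e1, J e1, e3, J e3, J e5]"] by (simp add: t eq_neg_iff_add_eq_0 add.commute del: times_complex.sel)
 have r4: "?F [J e1, J e5] = ?F [e1, e5]"
  using zP[of "[e1, J e1, e3, e5, J e5]"] by (simp add: t del: times_complex.sel)
 have r3: "?F [J e1, e5] = - ?F [e1, J e5]"
  using zP[of "[e1, J e1, J e3, e5, J e5]"] by (simp add: t eq_neg_iff_add_eq_0 add.commute del: times_complex.sel)
 have r2: "?F [J e3, J e5] = ?F [e3, e5]"
  using zP[of "[e1, e3, J e3, e5, J e5]"] by (simp add: t del: times_complex.sel)
 have r1: "?F [J e3, e5] = - ?F [e3, J e5]"
  using zP[of "[J e1, e3, J e3, e5, J e5]"] by (simp add: t eq_neg_iff_add_eq_0 add.commute del: times_complex.sel)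
 have "wedge_with ?b ?F ?M vs = 0" for vs
 proof (rule alt_form_eq_on_frame[OF aFM, of "%_. 0" "?E"])
  show "alt_form 5 (%_::(real^6) list. 0 :: 'w)" by (simp add: alt_form_def linear_iff)
  have "v \<in> span (set ?E)" for v
  proof -
   have "(\<Sum>i<DIM(real^6). g v (?E ! i) *\<^sub>R ?E ! i)
     \<in> span (set ?E)"
    by (intro span_sum span_scale span_base nth_mem) simp
   then show ?thesis by (subst orthonormal_frame_expand[OF bg fr, of v])
  qed
  then show "span (set ?E) = UNIV" by blast
  fix bs :: "bool list" assume l: "length bs = length ?E" and k: "length (filter id bs) = 5"
  have "length bs = Suc (Suc (Suc (Suc (Suc (Suc 0)))))" using l by simp
  then obtain b1 b2 b3 b4 b5 b6 where bs: "bs = [b1, b2, b3, b4, b5, b6]" unfolding length_Suc_conv by blast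
  show "wedge_with ?b ?F ?M (sel bs ?E) = 0"
   using k unfolding bs
   by (cases b1; cases b2; cases b3; cases b4; cases b5; cases b6;
    simp add: t r1[simplified] r2[simplified] r3[simplified] r4[simplified] r5[simplified] r6[simplified] del: times_complex.sel)
 qed
 note zM = this
 have "wedge_with ?b F (%vs. ?M (map L vs)) vs = wedge_with ?b (%vs. ?F (map L vs)) (%vs. ?M (map L vs)) vs"
  by (rule arg_cong[where f = "%f. wedge_with ?b f _ vs"]) (rule ext, rule Fmap)
 also have "\<dots> = 0" by (rule trans[OF wedge_with_map[of ?b ?F L ?M vs] zM])
 finally show ?thesis .
qed

end

section \<open>The total space of the circle bundle\<close>

text \<open>The chain rule for two mutually inverse chart changes. Smoothness of \<open>J\<close> is
  stated after conversion to a fixed chart, whereas forms are evaluated in the preferred chart of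
  the point, so the conversion has to be undone.\<close>

lemma dchart_inverse:
 assumes M: "mfd_atlas M" and p: "p \<in> points M" and x: "x \<in> chart_img M p"
 shows "dchart M p x (frechet_derivative (chart M p \<circ> param M (param M p x)) (at (chart M (param M p x) (param M p x))) v) = v"
proof -
 let ?y = "param M p x"
 let ?c = "chart M ?y ?y"
 have y: "?y \<in> points M" "?y \<in> chart_dom M p" "?y \<in> chart_dom M ?y"
  using param_points[OF M p x] param_dom[OF M x] atlas_dom[OF M] by auto
 have py: "param M ?y ?c = ?y" by (rule param_center[OF M y(1)])
 have d1: "(%z. chart M p (param M ?y z)) differentiable (at ?c)"
  by (rule chart_param_deriv[OF M y(1) p chart_center_img[OF M y(1)]]) (simp add: py y(2))
 have hx: "chart M p (param M ?y ?c) = x" by (simp add: py chart_param[OF M x])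
 have d2: "(%z. chart M ?y (param M p z)) differentiable (at (chart M p (param M ?y ?c)))"
  unfolding hx by (rule chart_param_deriv[OF M p y(1) x y(3)])
 have o: "open (chart M ?y ` (chart_dom M ?y \<inter> chart_dom M p))" by (rule atlas_open_overlap[OF M y(1) p])
 have "frechet_derivative (%z. chart M ?y (param M p (chart M p (param M ?y z)))) (at ?c) = frechet_derivative (%z. z) (at ?c)"
 proof (rule frechet_derivative_cong_open[OF o])
  show "?c \<in> chart M ?y ` (chart_dom M ?y \<inter> chart_dom M p)" using y by blast
  fix w assume "w \<in> chart M ?y ` (chart_dom M ?y \<inter> chart_dom M p)"
  then obtain r where r: "r \<in> chart_dom M ?y" "r \<in> chart_dom M p" "w = chart M ?y r" by blast
  then show "chart M ?y (param M p (chart M p (param M ?y w))) = w"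
   by (simp add: param_chart[OF M y(1)] param_chart[OF M p])
 qed
 moreover have "frechet_derivative (%z. chart M ?y (param M p (chart M p (param M ?y z)))) (at ?c) =
   (%v. dchart M p x (frechet_derivative (chart M p \<circ> param M ?y) (at ?c) v))"
  using frechet_derivative_chain[OF d1 d2] unfolding hx by (simp add: dchart_def o_def)
 ultimately show ?thesis by (metis frechet_derivative_ident)
qed

lemma smooth_form_J_form:
 assumes M: "mfd_atlas M" and J: "almost_complex_structure M J" and a: "smooth_form M k \<alpha>"
 shows "smooth_form M k (%q. J_form (J q) (\<alpha> q))"
 unfolding smooth_form_def
proof (intro ballI conjI allI)
 fix p assume p: "p \<in> points M"
 show "alt_form k (J_form (J p) (\<alpha> p))" unfolding J_form_def[abs_def]
  using J p by (intro alt_form_map smooth_form_alt[OF a]) (auto simp: almost_complex_structure_def)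
 fix ws
 \<comment> \<open>The image under \<open>J\<close> of the coordinate vector \<open>u\<close>,
   converted back to the chart at \<open>p\<close>. By the definition of an almost complex structure
   it is a smooth vector-valued function, so \<open>smooth_on_form_apply\<close> applies with these
   as moving arguments.\<close>
 define jc where "jc u x = frechet_derivative (chart M p \<circ> param M (param M p x)) (at (chart M (param M p x) (param M p x)))
   (J (param M p x) (dchart M p x u))" for u x
 have s: "smooth_on (chart_img M p) (jc u)" for u
  using J p unfolding almost_complex_structure_def Let_def jc_def[abs_def] dchart_def by simp
 note o = atlas_open[OF M p]
 have "smooth_on (chart_img M p) (%x. in_chart M p \<alpha> x ([] @ map (%w. w x) (map jc ws)))"
  by (rule smooth_on_form_apply[OF o o _ smooth_form_flat[OF M a p] smooth_on_id]) (auto simp: s)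
 then show "smooth_on (chart_img M p) (%x. in_chart M p (%q. J_form (J q) (\<alpha> q)) x ws)"
  by (rule smooth_on_cong[OF o]) (simp add: in_chart_dchart J_form_def o_def jc_def dchart_inverse[OF M p, unfolded o_def])
qed

lemma wedge_with_pair_left:
 "wedge_with (%X (r::real). r *\<^sub>R X) (%vs. (a1 vs, a2 vs)) c vs =
  (wedge_with (%X r. r *\<^sub>R X) a1 c vs, wedge_with (%X r. r *\<^sub>R X) a2 c vs)"
 by (simp add: wedge_with_def prod_eq_iff fst_sum snd_sum)

lemma wedge_with_sum_pairing:
 "wedge_with (%X Y. b1 (fst X) (fst Y) + (b2 (snd X) (snd Y) :: 'w::real_vector)) (%vs. (a1 vs, a2 vs)) (%vs. (c1 vs, c2 vs)) vs =
  wedge_with b1 a1 c1 vs + wedge_with b2 a2 c2 vs"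
 by (simp add: wedge_with_def scaleR_add_right sum.distrib)

text \<open>The complex numbers \<pi> + i \<sigma> and R + i I are both multiplied by the phase c +
  i s, so the conjugate of the first times the second is unchanged. Its imaginary part, with
  opposite sign, and its real part are the two identities.\<close>

lemma rotate_torsion:
 fixes c s :: real
 assumes "c * c + s * s = 1"
 shows "(c * \<sigma> + s * \<pi>) * (c * R - s * I) - (c * \<pi> - s * \<sigma>) * (c * I + s * R) = \<sigma> * R - \<pi> * I"
  "(c * \<pi> - s * \<sigma>) * (c * R - s * I) + (c * \<sigma> + s * \<pi>) * (c * I + s * R) = \<pi> * R + \<sigma> * I"
proof -
 have "(c * \<sigma> + s * \<pi>) * (c * R - s * I) - (c * \<pi> - s * \<sigma>) * (c * I + s * R) = (c * c + s * s) * (\<sigma> * R - \<pi> * I)"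
  "(c * \<pi> - s * \<sigma>) * (c * R - s * I) + (c * \<sigma> + s * \<pi>) * (c * I + s * R) = (c * c + s * s) * (\<pi> * R + \<sigma> * I)"
  by (simp_all add: algebra_simps)
 then show "(c * \<sigma> + s * \<pi>) * (c * R - s * I) - (c * \<pi> - s * \<sigma>) * (c * I + s * R) = \<sigma> * R - \<pi> * I"
  "(c * \<pi> - s * \<sigma>) * (c * R - s * I) + (c * \<sigma> + s * \<pi>) * (c * I + s * R) = \<pi> * R + \<sigma> * I"
  using assms by simp_all
qed

locale su3_circle_bundle =
 fixes Q :: "('q, real^6) mfd" and g :: "'q => real^6 => real^6 => real" and J :: "'q => real^6 => real^6"
  and \<omega> :: "'q => (real^6) list => real" and \<Upsilon> :: "'q => (real^6) list => complex"
  and \<pi>0 \<sigma>0 :: "'q => real" and \<pi>1 \<nu>1 \<pi>2 \<sigma>2 \<nu>3 :: "'q => (real^6) list => real"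
  and S :: "('m, real^7, 'q, real^6, complex, real) pbundle" and \<eta> :: "'m => (real^7) list => real"
  and \<kappa> :: "'q => (real^6) list => real" and t :: real
 assumes Q: "smooth_manifold Q" and su3: "su3_structure Q g J \<omega> \<Upsilon>"
  and torsion: "su3_torsion_forms Q J \<omega> \<Upsilon> \<pi>0 \<sigma>0 \<pi>1 \<nu>1 \<pi>2 \<sigma>2 \<nu>3"
  and \<sigma>2: "\<And>q vs. q \<in> points Q ==> \<sigma>2 q vs = 0" and \<pi>2: "\<And>q vs. q \<in> points Q ==> \<pi>2 q vs = 0"
  and \<pi>1: "\<And>q vs. q \<in> points Q ==> \<pi>1 q vs = 2 * \<nu>1 q vs"
  and S: "principal_bundle S" and base: "base S = Q" and circle: "sgroup S = circle_lie"
  and \<eta>: "principal_connection S \<eta>" and \<kappa>: "smooth_form Q 2 \<kappa>"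
  and d\<eta>: "\<And>p vs. p \<in> points (total S) ==> ext_d (total S) \<eta> p vs = lift_form S \<kappa> p vs"
  and \<kappa>8: "\<And>q. q \<in> points Q ==> in_Lambda2_8 (J q) (\<omega> q) (\<kappa> q)"

begin

abbreviation "M \<equiv> total S"

abbreviation "\<phi> \<equiv> phi_t S \<eta> \<omega> \<Upsilon> t"

abbreviation "L p \<equiv> tangent_map M Q (proj S) p"

abbreviation "T\<omega> \<equiv> su3_T J \<omega> \<Upsilon> \<pi>0 \<sigma>0 \<nu>1 \<nu>3"

abbreviation "p' q \<equiv> cos t * \<pi>0 q - sin t * \<sigma>0 q"

abbreviation "s' q \<equiv> cos t * \<sigma>0 q + sin t * \<pi>0 q"

abbreviation "Re\<Upsilon> \<equiv> (%q vs. Re (cis t * \<Upsilon> q vs))"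

abbreviation "Im\<Upsilon> \<equiv> (%q vs. Im (cis t * \<Upsilon> q vs))"

section \<open>Lifting the structure from \<open>Q\<close> to the circle bundle\<close>

lemmas AS = principal_bundle_atlas[OF S, unfolded base]

lemma lift: "lift_form S \<alpha> p = (%vs. \<alpha> (proj S p) (map (L p) vs))"
 by (rule ext) (simp add: lift_form_def pullback_def base)

lemma projQ: "p \<in> points M ==> proj S p \<in> points Q" using proj_points[OF S] base by simp

lemma smooth_proj: "p \<in> points M ==> smooth_at M Q (proj S) p" using smooth_at_proj[OF S] base by simp

lemma linL: "p \<in> points M ==> linear (L p)" by (rule tangent_map_linear[OF smooth_proj])

lemma surjL: "p \<in> points M ==> surj (L p)" using tangent_map_proj_surj[OF S] base by simp

lemma smooth_lift: "smooth_form Q k \<alpha> ==> smooth_form M k (lift_form S \<alpha>)"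
 unfolding lift_form_def base by (rule smooth_form_pullback[OF AS(1,2) smooth_proj])

lemma ext_d_lift: "smooth_form Q k \<alpha> ==> p \<in> points M ==> ext_d M (lift_form S \<alpha>) p vs = lift_form S (ext_d Q \<alpha>) p vs"
 unfolding lift_form_def base by (rule ext_d_pullback[OF AS(1,2) smooth_proj])

lemma su3D: "riemannian_metric Q g" "almost_complex_structure Q J" "smooth_form Q 2 \<omega>" "smooth_form Q 3 \<Upsilon>"
 using su3 by (simp_all add: su3_structure_def)

lemma torsionD: "smooth_fun Q \<pi>0" "smooth_fun Q \<sigma>0" "smooth_form Q 1 \<nu>1" "smooth_form Q 3 \<nu>3"
 "q \<in> points Q ==> in_Lambda3_12 (\<omega> q) (\<Upsilon> q) (\<nu>3 q)"
 using torsion by (simp_all add: su3_torsion_forms_def)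

lemma su3_point: "q \<in> points Q ==> cmod u = 1 ==> su3_point (g q) (J q) (\<omega> q) (\<Upsilon> q) u"
 using su3 smooth_form_alt[OF su3D(3)] smooth_form_alt[OF su3D(4)]
 by (intro su3_point.intro) (simp_all add: su3_structure_def riemannian_metric_def almost_complex_structure_def)

lemma smooth_rotated: "smooth_form Q 3 Re\<Upsilon>" "smooth_form Q 3 Im\<Upsilon>"
proof -
 have "bounded_linear (%z. Re (cis t * z))" "bounded_linear (%z. Im (cis t * z))"
  using bounded_linear_compose[OF bounded_linear_Re bounded_linear_mult_right[of "cis t"]]
   bounded_linear_compose[OF bounded_linear_Im bounded_linear_mult_right[of "cis t"]] by simp_all
 from this[THEN smooth_form_bounded_linear[OF AS(2) _ su3D(4)]] show "smooth_form Q 3 Re\<Upsilon>" "smooth_form Q 3 Im\<Upsilon>" .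
qed

lemma smooth_\<eta>: "smooth_form M 1 \<eta>" using \<eta> by (simp add: principal_connection_def)

lemma d\<omega>: "q \<in> points Q ==> ext_d Q \<omega> q vs =
  - (3/2) * s' q * Re\<Upsilon> q vs + (3/2) * p' q * Im\<Upsilon> q vs + (\<nu>1 q \<^bold>\<and> \<omega> q) vs + \<nu>3 q vs"
proof -
 assume q: "q \<in> points Q"
 have "ext_d Q \<omega> q vs = - (3/2) * \<sigma>0 q * Re (\<Upsilon> q vs) + (3/2) * \<pi>0 q * Im (\<Upsilon> q vs) + (\<nu>1 q \<^bold>\<and> \<omega> q) vs + \<nu>3 q vs"
  using torsion q by (simp add: su3_torsion_forms_def)
 then show ?thesis
  using rotate_torsion(1)[of "cos t" "sin t" "\<sigma>0 q" "\<pi>0 q" "Re (\<Upsilon> q vs)" "Im (\<Upsilon> q vs)"] sin_cos_squared_add3[of t]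
  by (simp add: algebra_simps)
qed

lemma d\<Upsilon>:
 assumes q: "q \<in> points Q"
 shows "ext_d Q Re\<Upsilon> q vs = p' q * (\<omega> q \<^bold>\<and> \<omega> q) vs + 2 * (\<nu>1 q \<^bold>\<and> Re\<Upsilon> q) vs"
  "ext_d Q Im\<Upsilon> q vs = s' q * (\<omega> q \<^bold>\<and> \<omega> q) vs + 2 * (\<nu>1 q \<^bold>\<and> Im\<Upsilon> q) vs"
proof -
 have bl: "bounded_linear (%z. Re (cis t * z))" "bounded_linear (%z. Im (cis t * z))"
  using bounded_linear_compose[OF bounded_linear_Re bounded_linear_mult_right[of "cis t"]]
   bounded_linear_compose[OF bounded_linear_Im bounded_linear_mult_right[of "cis t"]] by simp_all
 note e = ext_d_bounded_linear[OF AS(2) _ su3D(4) q]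
 have w1: "(\<pi>1 q \<^bold>\<and> a) vs = 2 * (\<nu>1 q \<^bold>\<and> a) vs" for a
  using wedge_with_scale_left[OF bilinear_mult_real, of 2 "\<nu>1 q" a vs] \<pi>1[OF q] by (simp add: ext[of "\<pi>1 q" "%vs. 2 * \<nu>1 q vs"])
 have w0: "(\<pi>2 q \<^bold>\<and> a) vs = 0" "(\<sigma>2 q \<^bold>\<and> a) vs = 0" for a
  using wedge_with_zero_left[OF bilinear_mult_real, of a vs] \<pi>2[OF q] \<sigma>2[OF q]
  by (simp_all add: ext[of "\<pi>2 q" "%vs. 0"] ext[of "\<sigma>2 q" "%vs. 0"])
 have R: "Re (ext_d Q \<Upsilon> q vs) = \<pi>0 q * (\<omega> q \<^bold>\<and> \<omega> q) vs + 2 * (\<nu>1 q \<^bold>\<and> (%ws. Re (\<Upsilon> q ws))) vs"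
  using torsion q e[OF bounded_linear_Re, of vs] by (simp add: su3_torsion_forms_def w1 w0)
 have I: "Im (ext_d Q \<Upsilon> q vs) = \<sigma>0 q * (\<omega> q \<^bold>\<and> \<omega> q) vs + 2 * (\<nu>1 q \<^bold>\<and> (%ws. Im (\<Upsilon> q ws))) vs"
  using torsion q e[OF bounded_linear_Im, of vs] by (simp add: su3_torsion_forms_def w1 w0)
 have wl: "(\<nu>1 q \<^bold>\<and> Re\<Upsilon> q) vs = cos t * (\<nu>1 q \<^bold>\<and> (%ws. Re (\<Upsilon> q ws))) vs - sin t * (\<nu>1 q \<^bold>\<and> (%ws. Im (\<Upsilon> q ws))) vs"
  "(\<nu>1 q \<^bold>\<and> Im\<Upsilon> q) vs = cos t * (\<nu>1 q \<^bold>\<and> (%ws. Im (\<Upsilon> q ws))) vs + sin t * (\<nu>1 q \<^bold>\<and> (%ws. Re (\<Upsilon> q ws))) vs"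
  by (simp_all add: wedge_with_add_right[OF bilinear_mult_real] wedge_with_diff_right[OF bilinear_mult_real]
   wedge_with_scale_right[OF bilinear_mult_real, unfolded real_scaleR_def])
 show "ext_d Q Re\<Upsilon> q vs = p' q * (\<omega> q \<^bold>\<and> \<omega> q) vs + 2 * (\<nu>1 q \<^bold>\<and> Re\<Upsilon> q) vs"
  unfolding e[OF bl(1)] wl by (simp add: R I algebra_simps)
 show "ext_d Q Im\<Upsilon> q vs = s' q * (\<omega> q \<^bold>\<and> \<omega> q) vs + 2 * (\<nu>1 q \<^bold>\<and> Im\<Upsilon> q) vs"
  unfolding e[OF bl(2)] wl by (simp add: R I algebra_simps)
qed

lemma g2_torsion_at:
 assumes p: "p \<in> points M"
 obtains g7 xi f1 f2 f3 f4 f5 f6 where "g2_torsion g7 xi f1 f2 f3 f4 f5 f6 (\<eta> p) (lift_form S \<omega> p)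
  (lift_form S Re\<Upsilon> p) (lift_form S Im\<Upsilon> p) (lift_form S \<kappa> p) (lift_form S \<nu>1 p) (lift_form S \<nu>3 p)
  (lift_form S (%q. J_form (J q) (\<nu>1 q)) p) (lift_form S (%q. J_form (J q) (\<nu>3 q)) p)"
proof -
 have q: "proj S p \<in> points Q" by (rule projQ[OF p])
 \<comment> \<open>The generator of the circle action with velocity 1: the projection kills it, and
   a connection form takes the value 1 on it.\<close>
 let ?xi = "tangent_map (lmfd (sgroup S)) M (act S p) \<one>\<^bsub>lgroup (sgroup S)\<^esub> 1"
 have x: "L p ?xi = 0" using tangent_map_proj_vertical[OF S p, of 1] base by simp
 have e: "\<eta> p [?xi] = 1" using \<eta> p unfolding principal_connection_def by blast
 have "su3_point (g (proj S p)) (J (proj S p)) (\<omega> (proj S p)) (\<Upsilon> (proj S p)) (cis t)"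
  by (rule su3_point[OF q]) simp
 then show thesis
  by (rule su3_point.g2_torsion_lift[OF _ linL[OF p] surjL[OF p] smooth_form_alt[OF smooth_\<eta> p] x e
   \<kappa>8[OF q] smooth_form_alt[OF torsionD(3) q] torsionD(5)[OF q]]) (rule that, simp add: lift)
qed

section \<open>The forms on the circle bundle and their derivatives\<close>

lemma phi_eq: "\<phi> p vs = (\<eta> p \<^bold>\<and> lift_form S \<omega> p) vs + lift_form S Re\<Upsilon> p vs"
 by (simp add: phi_t_def lift)

lemma smooth_phi: "smooth_form M 3 \<phi>"
proof -
 have "smooth_form M 3 (%p. \<eta> p \<^bold>\<and> lift_form S \<omega> p)"
  using smooth_form_wedge_with[OF AS(1) bounded_bilinear_mult smooth_\<eta> smooth_lift[OF su3D(3)]] by (simp add: numeral_3_eq_3)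
 from smooth_form_add[OF AS(1) this smooth_lift[OF smooth_rotated(1)]] show ?thesis
  by (rule smooth_form_cong[OF AS(1)]) (rule phi_eq[symmetric])
qed

lemma grade_\<eta>: "p \<in> points M ==> (grade_sgn (\<eta> p) \<^bold>\<and> c) vs = - (\<eta> p \<^bold>\<and> c) vs"
 using homog_grade_sgn[OF alt_form_homog[OF smooth_form_alt[OF smooth_\<eta>]], of p]
  wedge_with_minus_left[OF bilinear_mult_real, of "\<eta> p" c vs] by simp

lemma d\<eta>_eq: "p \<in> points M ==> ext_d M \<eta> p = lift_form S \<kappa> p" by (rule ext) (rule d\<eta>)

lemma lift_wedge: "lift_form S (%q. \<alpha> q \<^bold>\<and> \<beta> q) p vs = (lift_form S \<alpha> p \<^bold>\<and> lift_form S \<beta> p) vs"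
 unfolding lift_form_def by (rule pullback_wedge)

lemma ext_d_\<eta>_wedge:
 assumes p: "p \<in> points M" and a: "smooth_form Q k \<alpha>"
 shows "ext_d M (%p. \<eta> p \<^bold>\<and> lift_form S \<alpha> p) p vs =
  (lift_form S \<kappa> p \<^bold>\<and> lift_form S \<alpha> p) vs - (\<eta> p \<^bold>\<and> lift_form S (ext_d Q \<alpha>) p) vs"
proof -
 have "ext_d M (lift_form S \<alpha>) p = lift_form S (ext_d Q \<alpha>) p" by (rule ext) (rule ext_d_lift[OF a p])
 then show ?thesis
  using ext_d_wedge_with[OF AS(1) bounded_bilinear_mult smooth_\<eta> smooth_lift[OF a] p, of vs]
  by (simp add: d\<eta>_eq[OF p] grade_\<eta>[OF p])
qed

lemma smooth_\<eta>_wedge: "smooth_form Q k \<alpha> ==> smooth_form M (1 + k) (%p. \<eta> p \<^bold>\<and> lift_form S \<alpha> p)"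
 by (rule smooth_form_wedge_with[OF AS(1) bounded_bilinear_mult smooth_\<eta> smooth_lift])

lemma ext_d_phi:
 assumes p: "p \<in> points M"
 shows "ext_d M \<phi> p vs = (lift_form S \<kappa> p \<^bold>\<and> lift_form S \<omega> p) vs - (\<eta> p \<^bold>\<and> lift_form S (ext_d Q \<omega>) p) vs + lift_form S (ext_d Q Re\<Upsilon>) p vs"
proof -
 have "ext_d M \<phi> p vs = ext_d M (%p vs. (\<eta> p \<^bold>\<and> lift_form S \<omega> p) vs + lift_form S Re\<Upsilon> p vs) p vs"
  by (rule ext_d_cong[OF AS(1) p]) (rule phi_eq)
 also have "\<dots> = ext_d M (%p. \<eta> p \<^bold>\<and> lift_form S \<omega> p) p vs + ext_d M (lift_form S Re\<Upsilon>) p vs"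
  by (rule ext_d_add[OF AS(1) smooth_\<eta>_wedge[OF su3D(3)] smooth_lift[OF smooth_rotated(1)] p])
 finally show ?thesis unfolding ext_d_\<eta>_wedge[OF p su3D(3)] ext_d_lift[OF smooth_rotated(1) p] .
qed

lemma lift_T\<omega>:
 assumes p: "p \<in> points M"
 shows "lift_form S T\<omega> p vs = p' (proj S p) / 2 * lift_form S Re\<Upsilon> p vs + s' (proj S p) / 2 * lift_form S Im\<Upsilon> p vs +
  (lift_form S (%q. J_form (J q) (\<nu>1 q)) p \<^bold>\<and> lift_form S \<omega> p) vs + lift_form S (%q. J_form (J q) (\<nu>3 q)) p vs"
proof -
 have "2 * (p' q / 2 * Re\<Upsilon> q ws + s' q / 2 * Im\<Upsilon> q ws) = 2 * (\<pi>0 q / 2 * Re (\<Upsilon> q ws) + \<sigma>0 q / 2 * Im (\<Upsilon> q ws))" for q ws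
  using rotate_torsion(2)[of "cos t" "sin t" "\<pi>0 q" "\<sigma>0 q" "Re (\<Upsilon> q ws)" "Im (\<Upsilon> q ws)"] sin_cos_squared_add3[of t]
  by (simp add: distrib_left)
 then have r: "\<pi>0 q / 2 * Re (\<Upsilon> q ws) + \<sigma>0 q / 2 * Im (\<Upsilon> q ws) = p' q / 2 * Re\<Upsilon> q ws + s' q / 2 * Im\<Upsilon> q ws" for q ws
  by (metis mult_left_cancel zero_neq_numeral)
 show ?thesis unfolding lift_wedge[symmetric] unfolding lift su3_T_def r ..
qed

text \<open>The frame, and with it the interpretation of the locale, depends on \<open>p\<close>,
  but the conclusions do not mention it. Hence the formulas for \<open>g2_psi\<close> and
  \<open>g2_T\<close> hold at every point and may be differentiated afterwards.\<close>

lemma structure_at: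
 assumes p: "p \<in> points M"
 shows "is_g2_form (\<phi> p)"
  and "g2_psi \<phi> p vs = (1/2) * (lift_form S \<omega> p \<^bold>\<and> lift_form S \<omega> p) vs - (\<eta> p \<^bold>\<and> lift_form S Im\<Upsilon> p) vs"
  and "g2_T M \<phi> p vs = (\<eta> p \<^bold>\<and> lift_form S \<kappa> p) vs + lift_form S T\<omega> p vs"
  and "(lift_form S \<kappa> p \<^bold>\<and> g2_psi \<phi> p) vs = 0"
  and "(1/2) * ((lift_form S (ext_d Q \<omega>) p \<^bold>\<and> lift_form S \<omega> p) vs + (lift_form S \<omega> p \<^bold>\<and> lift_form S (ext_d Q \<omega>) p) vs)
   - ((lift_form S \<kappa> p \<^bold>\<and> lift_form S Im\<Upsilon> p) vs - (\<eta> p \<^bold>\<and> lift_form S (ext_d Q Im\<Upsilon>) p) vs) =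
   ((%ws. 4 * g2_tau1 M \<phi> p ws) \<^bold>\<and> g2_psi \<phi> p) vs"
proof -
 let ?q = "proj S p"
 have q: "?q \<in> points Q" by (rule projQ[OF p])
 obtain g7 xi f1 f2 f3 f4 f5 f6 where "g2_torsion g7 xi f1 f2 f3 f4 f5 f6 (\<eta> p) (lift_form S \<omega> p)
  (lift_form S Re\<Upsilon> p) (lift_form S Im\<Upsilon> p) (lift_form S \<kappa> p) (lift_form S \<nu>1 p) (lift_form S \<nu>3 p)
  (lift_form S (%q. J_form (J q) (\<nu>1 q)) p) (lift_form S (%q. J_form (J q) (\<nu>3 q)) p)"
  by (rule g2_torsion_at[OF p])
 then interpret x: g2_torsion g7 xi f1 f2 f3 f4 f5 f6 "\<eta> p" "lift_form S \<omega> p"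
  "lift_form S Re\<Upsilon> p" "lift_form S Im\<Upsilon> p" "lift_form S \<kappa> p" "lift_form S \<nu>1 p" "lift_form S \<nu>3 p"
  "lift_form S (%q. J_form (J q) (\<nu>1 q)) p" "lift_form S (%q. J_form (J q) (\<nu>3 q)) p" "p' ?q" "s' ?q" .
 have phi: "\<phi> p = x.phi" by (rule ext) (simp only: phi_eq x.phi_def)
 have w: "lift_form S \<nu>1 p \<^bold>\<and> lift_form S \<alpha> p = (%vs. (\<nu>1 ?q \<^bold>\<and> \<alpha> ?q) (map (L p) vs))" for \<alpha>
  by (rule ext) (simp only: lift_wedge[symmetric], simp only: lift)
 have ww: "lift_form S \<omega> p \<^bold>\<and> lift_form S \<omega> p = (%vs. (\<omega> ?q \<^bold>\<and> \<omega> ?q) (map (L p) vs))"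
  by (rule ext) (simp only: lift_wedge[symmetric], simp only: lift)
 have dW: "lift_form S (ext_d Q \<omega>) p = x.dW"
  by (rule ext) (simp only: x.dW_def w, simp only: lift d\<omega>[OF q])
 have dP: "lift_form S (ext_d Q Re\<Upsilon>) p = x.dP"
  by (rule ext) (simp only: x.dP_def w ww, simp only: lift d\<Upsilon>[OF q])
 have dM: "lift_form S (ext_d Q Im\<Upsilon>) p = x.dM"
  by (rule ext) (simp only: x.dM_def w ww, simp only: lift d\<Upsilon>[OF q])
 have D: "ext_d M \<phi> p = x.D" by (rule ext) (simp only: ext_d_phi[OF p] x.D_def dW dP)
 have psi: "g2_psi \<phi> p = x.psi" by (rule ext) (simp only: g2_psi_def phi x.psi_eq)
 have tau: "g2_tau1 M \<phi> p = x.tau" by (rule ext) (simp only: g2_tau1_def phi D x.tau_eq)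
 show "is_g2_form (\<phi> p)" unfolding phi by (rule x.is_g2_phi)
 show "g2_psi \<phi> p vs = (1/2) * (lift_form S \<omega> p \<^bold>\<and> lift_form S \<omega> p) vs - (\<eta> p \<^bold>\<and> lift_form S Im\<Upsilon> p) vs"
  unfolding psi x.psi_def ..
 show "g2_T M \<phi> p vs = (\<eta> p \<^bold>\<and> lift_form S \<kappa> p) vs + lift_form S T\<omega> p vs"
  unfolding g2_T_def phi D tau x.T_eq lift_T\<omega>[OF p] x.T_def ..
 show "(lift_form S \<kappa> p \<^bold>\<and> g2_psi \<phi> p) vs = 0" unfolding psi by (rule x.K_psi)
 show "(1/2) * ((lift_form S (ext_d Q \<omega>) p \<^bold>\<and> lift_form S \<omega> p) vs + (lift_form S \<omega> p \<^bold>\<and> lift_form S (ext_d Q \<omega>) p) vs)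
   - ((lift_form S \<kappa> p \<^bold>\<and> lift_form S Im\<Upsilon> p) vs - (\<eta> p \<^bold>\<and> lift_form S (ext_d Q Im\<Upsilon>) p) vs) =
   ((%ws. 4 * g2_tau1 M \<phi> p ws) \<^bold>\<and> g2_psi \<phi> p) vs"
  unfolding dW dM psi tau by (rule x.dpsi_eq)
qed

lemma ext_d_psi:
 assumes p: "p \<in> points M"
 shows "ext_d M (g2_psi \<phi>) p vs = ((%ws. 4 * g2_tau1 M \<phi> p ws) \<^bold>\<and> g2_psi \<phi> p) vs"
proof -
 let ?W = "lift_form S \<omega>"
 have bl: "bounded_linear (%x::real. (1/2) * x)" "bounded_linear (%x::real. - x)"
  by (rule bounded_linear_mult_right, rule bounded_linear_minus[OF bounded_linear_ident])
 have sW: "smooth_form M 2 ?W" by (rule smooth_lift[OF su3D(3)])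
 have sWW: "smooth_form M (2 + 2) (%p. ?W p \<^bold>\<and> ?W p)" by (rule smooth_form_wedge_with[OF AS(1) bounded_bilinear_mult sW sW])
 have sI: "smooth_form M (1 + 3) (%p. \<eta> p \<^bold>\<and> lift_form S Im\<Upsilon> p)" by (rule smooth_\<eta>_wedge[OF smooth_rotated(2)])
 have dW: "ext_d M ?W p = lift_form S (ext_d Q \<omega>) p" by (rule ext) (rule ext_d_lift[OF su3D(3) p])
 have gW: "grade_sgn (?W p) = ?W p"
  using homog_grade_sgn[OF alt_form_homog[OF smooth_form_alt[OF sW p]]] by simp
 have "ext_d M (g2_psi \<phi>) p vs = ext_d M (%p vs. (1/2) * (?W p \<^bold>\<and> ?W p) vs + - (\<eta> p \<^bold>\<and> lift_form S Im\<Upsilon> p) vs) p vs"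
  by (rule ext_d_cong[OF AS(1) p]) (simp only: structure_at(2) diff_conv_add_uminus)
 also have "\<dots> = (1/2) * ext_d M (%p. ?W p \<^bold>\<and> ?W p) p vs + - ext_d M (%p. \<eta> p \<^bold>\<and> lift_form S Im\<Upsilon> p) p vs"
  unfolding ext_d_add[OF AS(1) smooth_form_bounded_linear[OF AS(1) bl(1) sWW] smooth_form_bounded_linear[OF AS(1) bl(2) sI] p]
   ext_d_bounded_linear[OF AS(1) bl(1) sWW p] ext_d_bounded_linear[OF AS(1) bl(2) sI p] ..
 also have "\<dots> = ((%ws. 4 * g2_tau1 M \<phi> p ws) \<^bold>\<and> g2_psi \<phi> p) vs"
  unfolding structure_at(5)[OF p, symmetric] ext_d_\<eta>_wedge[OF p smooth_rotated(2)]
   ext_d_wedge_with[OF AS(1) bounded_bilinear_mult sW sW p] dW gW by simp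
 finally show ?thesis .
qed

lemma smooth_T\<omega>: "smooth_form Q 3 T\<omega>"
proof -
 have bl: "bounded_linear (%z. (1/2) * Re z)" "bounded_linear (%z. (1/2) * Im z)"
  using bounded_linear_compose[OF bounded_linear_mult_right[of "1/2::real"] bounded_linear_Re]
   bounded_linear_compose[OF bounded_linear_mult_right[of "1/2::real"] bounded_linear_Im] by simp_all
 note J = smooth_form_J_form[OF AS(2) su3D(2)]
 have w: "smooth_form Q 3 (%q. J_form (J q) (\<nu>1 q) \<^bold>\<and> \<omega> q)"
  using smooth_form_wedge_with[OF AS(2) bounded_bilinear_mult J[OF torsionD(3)] su3D(3)] by (simp add: numeral_3_eq_3)
 show ?thesis
  by (rule smooth_form_cong[OF AS(2) smooth_form_add[OF AS(2) smooth_form_add[OF AS(2) smooth_form_add[OF AS(2)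
   smooth_form_scale_fun[OF AS(2) torsionD(1) smooth_form_bounded_linear[OF AS(2) bl(1) su3D(4)]]
   smooth_form_scale_fun[OF AS(2) torsionD(2) smooth_form_bounded_linear[OF AS(2) bl(2) su3D(4)]]] w] J[OF torsionD(4)]]])
   (simp add: su3_T_def)
qed

text \<open>The derivative of \<eta> \<and> \<kappa> is \<kappa> \<and> \<kappa> - \<eta> \<and>
  d\<kappa>, and the lift of d\<kappa> is dd\<eta>, which is zero.\<close>

lemma ext_d_T:
 assumes p: "p \<in> points M"
 shows "ext_d M (g2_T M \<phi>) p vs = (lift_form S \<kappa> p \<^bold>\<and> lift_form S \<kappa> p) vs + lift_form S (ext_d Q T\<omega>) p vs"
proof -
 have "lift_form S (ext_d Q \<kappa>) p ws = 0" for ws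
 proof -
  have "lift_form S (ext_d Q \<kappa>) p ws = ext_d M (lift_form S \<kappa>) p ws" by (rule ext_d_lift[OF \<kappa> p, symmetric])
  also have "\<dots> = ext_d M (ext_d M \<eta>) p ws" by (rule ext_d_cong[OF AS(1) p]) (rule d\<eta>[symmetric])
  also have "\<dots> = 0" by (rule ext_d_ext_d_1form[OF AS(1) smooth_\<eta> p])
  finally show ?thesis .
 qed
 then have z: "lift_form S (ext_d Q \<kappa>) p = (%_. 0)" by (rule ext)
 have "ext_d M (g2_T M \<phi>) p vs = ext_d M (%p vs. (\<eta> p \<^bold>\<and> lift_form S \<kappa> p) vs + lift_form S T\<omega> p vs) p vs"
  by (rule ext_d_cong[OF AS(1) p]) (rule structure_at(3))
 also have "\<dots> = ext_d M (%p. \<eta> p \<^bold>\<and> lift_form S \<kappa> p) p vs + ext_d M (lift_form S T\<omega>) p vs"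
  by (rule ext_d_add[OF AS(1) smooth_\<eta>_wedge[OF \<kappa>] smooth_lift[OF smooth_T\<omega>] p])
 finally show ?thesis
  unfolding ext_d_\<eta>_wedge[OF p \<kappa>] ext_d_lift[OF smooth_T\<omega> p] z by (simp add: wedge_with_zero_right[OF bilinear_mult_real])
qed

text \<open>The structure group is one-dimensional, so the quadratic term drops out.\<close>

lemma curvature_\<eta>:
 assumes p: "p \<in> points M"
 shows "curvature S \<eta> p vs = lift_form S \<kappa> p vs"
proof -
 have "lie_bracket (sgroup S) X Y = 0" for X Y
  using lie_bracket_1_dimensional[of "sgroup S"] principal_bundle_group_acts(1)[OF S] by blast
 then show ?thesis by (simp add: curvature_def d\<eta>[OF p] wedge_with_def)
qed

end

section \<open>The heterotic \<open>G\<^sub>2\<close>-system\<close>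

locale heterotic_lift = su3_circle_bundle Q g J \<omega> \<Upsilon> \<pi>0 \<sigma>0 \<pi>1 \<nu>1 \<pi>2 \<sigma>2 \<nu>3 S \<eta> \<kappa> t
 for Q :: "('q, real^6) mfd" and g J \<omega> \<Upsilon> \<pi>0 \<sigma>0 \<pi>1 \<nu>1 \<pi>2 \<sigma>2 \<nu>3
  and S :: "('m, real^7, 'q, real^6, complex, real) pbundle" and \<eta> \<kappa> t +
 fixes P :: "('p, 'pe::findim_normed_vector, 'q, real^6, 'g, 'ge::findim_normed_vector) pbundle"
  and A :: "'p => 'pe list => 'ge" and b :: "'ge => 'ge => real"
 assumes P: "principal_bundle P" and baseP: "base P = Q"
  and instanton: "su3_instanton P \<omega> \<Upsilon> A" and b: "invariant_pairing (sgroup P) b"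
  and bianchi: "bianchi_identity P A b (su3_T J \<omega> \<Upsilon> \<pi>0 \<sigma>0 \<nu>1 \<nu>3)"

begin

sublocale product_pullback S P \<eta> A
 by unfold_locales (use P base baseP instanton in \<open>simp_all add: su3_instanton_def S \<eta>\<close>)

lemma curvature_R:
 assumes z: "z \<in> points TR"
 shows "curvature R B z = (%vs. (lift_form S \<kappa> (fst z) (map (tangent_map TR TS fst z) vs),
  curvature P A (F2 z) (map (tangent_map TR TP F2 z) vs)))"
proof
 fix vs
 have z1: "F1 z \<in> points TS" using z[unfolded TR_iff] by simp
 have "pullback TR TS F1 (curvature S \<eta>) z vs = pullback TR TS F1 (lift_form S \<kappa>) z vs"
  unfolding pullback_def by (rule curvature_\<eta>[OF z1])
 also have "\<dots> = pullback TR TS fst (lift_form S \<kappa>) z vs" by (rule pullback_via_base(1)[OF z])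
 finally show "curvature R B z vs = (lift_form S \<kappa> (fst z) (map (tangent_map TR TS fst z) vs),
   curvature P A (F2 z) (map (tangent_map TR TP F2 z) vs))"
  unfolding curvature_B[OF z] unfolding pullback_def by (rule arg_cong2[where f = Pair, OF _ refl])
qed

lemma lift_change:
 assumes z: "z \<in> points TR"
 shows "lift_form S \<alpha> (fst z) (map (tangent_map TR TS fst z) vs) = lift_form P \<alpha> (F2 z) (map (tangent_map TR TP F2 z) vs)"
 using pullback_via_base(2)[OF z, of \<alpha> vs] unfolding pullback_def by (rule sym)

text \<open>The instanton condition concerns the unrotated \<Upsilon>, so the type argument is
  applied with phase 1. Real and imaginary parts are then both annihilated, and with them every
  rotated part.\<close>

lemma curvature_Im:
 assumes p: "p \<in> points TP"
 shows "wedge_with (%X r. r *\<^sub>R X) (curvature P A p) (lift_form P Im\<Upsilon> p) vs = 0"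
proof -
 have q: "proj P p \<in> points Q" using proj_points[OF P p] baseP by simp
 let ?L = "tangent_map TP Q (proj P) p" and ?F = "curvature P A p" and ?b = "%(X::'ge) (r::real). r *\<^sub>R X"
 have linP: "linear ?L" using tangent_map_linear[OF smooth_at_proj[OF P p]] baseP by simp
 have surjP: "surj ?L" using tangent_map_proj_surj[OF P p] baseP by simp
 have A: "principal_connection P A" using instanton by (simp add: su3_instanton_def)
 have zR: "wedge_with ?b ?F (%vs. Re (\<Upsilon> (proj P p) (map ?L vs))) vs = 0" for vs
  using instanton p unfolding su3_instanton_def curvature_wedge_vanishes_def lift_form_def pullback_def[abs_def] baseP by blast
 have zI: "wedge_with ?b ?F (%vs. Im (\<Upsilon> (proj P p) (map ?L vs))) vs = 0" for vs
  using su3_point.wedge_Re_imp_Im[OF su3_point[OF q, of 1] linP surjP alt_form_curvature[OF P A p], of vs] zR by simp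
 have "lift_form P Im\<Upsilon> p = (%vs. cos t *\<^sub>R Im (\<Upsilon> (proj P p) (map ?L vs)) + sin t *\<^sub>R Re (\<Upsilon> (proj P p) (map ?L vs)))"
  by (rule ext) (simp add: lift_form_def pullback_def baseP)
 then show ?thesis
  by (simp only: wedge_with_add_right[OF bilinear_scaleR_flip] wedge_with_scale_right[OF bilinear_scaleR_flip] zR zI scaleR_zero_right add_0)
qed

text \<open>The \<open>U(1)\<close> component is the algebraic identity \<open>K_psi\<close>. For
  the other component the obstacle is that \<psi> contains \<eta>, which does not come from the
  base: \<eta> is moved to the right, so that the curvature meets the imaginary part of the rotated
  \<Upsilon> first, and the remaining forms are transferred from \<open>S\<close> to
  \<open>P\<close> along the common base.\<close>

lemma curvature_psi: "curvature_wedge_vanishes R B (g2_psi \<phi>)"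
 unfolding curvature_wedge_vanishes_def
proof (intro ballI allI)
 fix z vs assume z: "z \<in> points TR"
 let ?b = "%(X::'ge) (r::real). r *\<^sub>R X"
 have m: "fst z \<in> points TS" and p: "F2 z \<in> points TP" using z[unfolded TR_iff] by auto
 let ?l = "tangent_map TR TS fst z" and ?k = "tangent_map TR TP F2 z"
 let ?psi = "%vs. g2_psi \<phi> (fst z) (map ?l vs)"
 let ?G = "%vs. curvature P A (F2 z) (map ?k vs)"
 have psi: "lift_form R (g2_psi \<phi>) z = ?psi" by (rule ext) (simp add: lift_form_def pullback_def)
 have "(%(X::real) r. r *\<^sub>R X) = (*)" by (intro ext) (simp add: mult.commute)
 then have 1: "wedge_with (%(X::real) r. r *\<^sub>R X) (%vs. lift_form S \<kappa> (fst z) (map ?l vs)) ?psi vs = 0"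
  using wedge_with_map[of "(*)" "lift_form S \<kappa> (fst z)" ?l "g2_psi \<phi> (fst z)" vs] structure_at(4)[OF m] by simp
 let ?I = "%vs. lift_form S Im\<Upsilon> (fst z) (map ?l vs)" and ?e = "%vs. \<eta> (fst z) (map ?l vs)"
 let ?W = "%vs. (lift_form S \<omega> (fst z) \<^bold>\<and> lift_form S \<omega> (fst z)) (map ?l vs)"
 have smI: "alt_form 3 ?I"
  by (rule alt_form_map[OF smooth_form_alt[OF smooth_lift[OF smooth_rotated(2)] m] tangent_map_linear[OF smooth_m[OF z]]])
 have sme: "alt_form 1 ?e"
  by (rule alt_form_map[OF smooth_form_alt[OF smooth_\<eta> m] tangent_map_linear[OF smooth_m[OF z]]])
 have mc: "(%x y. y * x) = ((*) :: real => real => real)" by (intro ext) (rule mult.commute)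
 \<comment> \<open>The degrees 1 and 3 give the sign -1, which cancels the minus sign in front of
   this product in \<psi>.\<close>
 have comm: "(?e \<^bold>\<and> ?I) vs = - (?I \<^bold>\<and> ?e) vs" for vs
  using wedge_with_commute[OF bilinear_mult_real alt_form_homog[OF sme] alt_form_homog[OF smI], of vs] unfolding mc by simp
 have P': "?psi = (%vs. (1/2) *\<^sub>R ?W vs + (?I \<^bold>\<and> ?e) vs)"
 proof
  fix vs
  show "?psi vs = (1/2) *\<^sub>R ?W vs + (?I \<^bold>\<and> ?e) vs"
   unfolding structure_at(2)[OF m] using comm[of vs] wedge_with_map[of "(*)" "\<eta> (fst z)" ?l "lift_form S Im\<Upsilon> (fst z)" vs] by simp
 qed
 have "?W vs = lift_form P (%q. \<omega> q \<^bold>\<and> \<omega> q) (F2 z) (map ?k vs)" for vs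
  unfolding lift_wedge[symmetric] by (rule lift_change[OF z])
 then have W': "?W = (%vs. lift_form P (%q. \<omega> q \<^bold>\<and> \<omega> q) (F2 z) (map ?k vs))" by (rule ext)
 have zW: "wedge_with ?b ?G ?W vs = 0" for vs
  unfolding W' wedge_with_map[of ?b "curvature P A (F2 z)" ?k] using instanton p
  unfolding su3_instanton_def curvature_wedge_vanishes_def by blast
 have I': "?I = (%vs. lift_form P Im\<Upsilon> (F2 z) (map ?k vs))" by (rule ext) (rule lift_change[OF z])
 have zI: "wedge_with ?b ?G ?I = (%_. 0)"
  by (rule ext) (unfold I' wedge_with_map[of ?b "curvature P A (F2 z)" ?k], rule curvature_Im[OF p])
 have "wedge_with ?b ?G (?I \<^bold>\<and> ?e) vs = wedge_with ?b (wedge_with ?b ?G ?I) ?e vs"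
  by (rule wedge_with_assoc[OF bilinear_scaleR_flip bilinear_scaleR_flip bilinear_mult_real bilinear_scaleR_flip, symmetric]) (simp add: mult.commute)
 also have "\<dots> = 0" unfolding zI by (rule wedge_with_zero_left[OF bilinear_scaleR_flip])
 finally have 2: "wedge_with ?b ?G ?psi vs = 0"
  unfolding P' wedge_with_add_right[OF bilinear_scaleR_flip] wedge_with_scale_right[OF bilinear_scaleR_flip] zW by simp
 show "wedge_with (%X r. r *\<^sub>R X) (curvature R B z) (lift_form R (g2_psi \<phi>) z) vs = 0"
  unfolding curvature_R[OF z] psi wedge_with_pair_left 1 2 by (simp add: zero_prod_def)
qed

text \<open>The weight of the circle factor is 1, because d\<eta> \<and> d\<eta> enters the
  derivative of \<open>T_\<phi>\<close> with coefficient 1.\<close>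

abbreviation "b' \<equiv> %X Y. fst X * fst Y + b (snd X) (snd Y)"

lemma invariant_b': "invariant_pairing (sgroup R) b'"
proof -
 have G: "lie_group (sgroup S)" "lie_group (sgroup P)" by (rule principal_bundle_group_acts(1)[OF S], rule principal_bundle_group_acts(1)[OF P])
 have bb: "bilinear b" and sym: "\<And>X Y. b X Y = b Y X" and nd: "\<And>X. (\<And>Y. b X Y = 0) ==> X = 0"
  and inv: "\<And>X Y Z. b (lie_bracket (sgroup P) X Y) Z + b Y (lie_bracket (sgroup P) X Z) = 0"
  using b unfolding invariant_pairing_def by blast+
 have "bilinear b'"
  by (simp add: bilinear_def linear_iff bilinear_ladd[OF bb] bilinear_radd[OF bb] bilinear_lmul[OF bb] bilinear_rmul[OF bb] algebra_simps)
 moreover have "X = 0" if X: "\<forall>Y. b' X Y = 0" for X :: "real \<times> 'ge"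
 proof -
  have "fst X = 0" using X[rule_format, of "(1, 0)"] by (simp add: bilinear_rzero[OF bb])
  moreover have "snd X = 0" by (rule nd) (use X[rule_format, of "(0, Y)" for Y] in simp)
  ultimately show ?thesis by (simp add: prod_eq_iff)
 qed
 moreover have "b' (lie_bracket (sgroup R) X Y) Z + b' Y (lie_bracket (sgroup R) X Z) = 0" for X Y Z
  unfolding group_R lie_bracket_prod[OF G] using inv by (simp add: lie_bracket_1_dimensional[OF G(1)])
 moreover have "b' X Y = b' Y X" for X Y :: "real \<times> 'ge" using sym by (simp add: mult.commute)
 ultimately show ?thesis unfolding invariant_pairing_def by blast
qed

lemma bianchi_R: "bianchi_identity R B b' (g2_T M \<phi>)"
 unfolding bianchi_identity_def
proof (intro ballI allI)
 fix z vs assume z: "z \<in> points TR"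
 have m: "fst z \<in> points TS" and p: "F2 z \<in> points TP" using z[unfolded TR_iff] by auto
 let ?l = "tangent_map TR TS fst z" and ?k = "tangent_map TR TP F2 z"
 have "lift_form R (ext_d (base R) (g2_T M \<phi>)) z vs = ext_d M (g2_T M \<phi>) (fst z) (map ?l vs)"
  by (simp add: lift_form_def pullback_def)
 also have "\<dots> = (lift_form S \<kappa> (fst z) \<^bold>\<and> lift_form S \<kappa> (fst z)) (map ?l vs) + lift_form S (ext_d Q T\<omega>) (fst z) (map ?l vs)"
  by (rule ext_d_T[OF m])
 also have "lift_form S (ext_d Q T\<omega>) (fst z) (map ?l vs) = lift_form P (ext_d Q T\<omega>) (F2 z) (map ?k vs)"
  by (rule lift_change[OF z])
 also have "\<dots> = wedge_with b (curvature P A (F2 z)) (curvature P A (F2 z)) (map ?k vs)"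
  using bianchi p unfolding bianchi_identity_def baseP by blast
 finally show "lift_form R (ext_d (base R) (g2_T M \<phi>)) z vs = wedge_with b' (curvature R B z) (curvature R B z) vs"
  unfolding curvature_R[OF z]
   wedge_with_sum_pairing[of "(*)" b "%vs. lift_form S \<kappa> (fst z) (map ?l vs)" "%vs. curvature P A (F2 z) (map ?k vs)"]
   wedge_with_map[of "(*)" "lift_form S \<kappa> (fst z)" ?l "lift_form S \<kappa> (fst z)"]
   wedge_with_map[of b "curvature P A (F2 z)" ?k "curvature P A (F2 z)"] .
qed

lemma heterotic: "heterotic_g2_system M \<phi> R B"
 unfolding heterotic_g2_system_def
 using principal_bundle_group_acts(5)[OF S] smooth_phi structure_at(1) principal_R principal_connection_B ext_d_psi
  curvature_psi invariant_b' bianchi_R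
 by (intro conjI exI[of _ b'] ballI allI) simp_all

end

theorem theorem4p3:
  fixes Q :: "('q, real^6) mfd"
    and g :: "'q \<Rightarrow> real^6 \<Rightarrow> real^6 \<Rightarrow> real"
    and J :: "'q \<Rightarrow> real^6 \<Rightarrow> real^6"
    and \<omega> :: "'q \<Rightarrow> (real^6) list \<Rightarrow> real"
    and \<Upsilon> :: "'q \<Rightarrow> (real^6) list \<Rightarrow> complex"
    and \<pi>0 \<sigma>0 :: "'q \<Rightarrow> real"
    and \<pi>1 \<nu>1 \<pi>2 \<sigma>2 \<nu>3 :: "'q \<Rightarrow> (real^6) list \<Rightarrow> real"
    and S :: "('m, real^7, 'q, real^6, complex, real) pbundle"
    and M :: "('m, real^7) mfd"
    and \<eta> :: "'m \<Rightarrow> (real^7) list \<Rightarrow> real"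
    and \<kappa> :: "'q \<Rightarrow> (real^6) list \<Rightarrow> real"
    and P :: "('p, 'pe::findim_normed_vector, 'q, real^6, 'g, 'ge::findim_normed_vector) pbundle"
    and A :: "'p \<Rightarrow> 'pe list \<Rightarrow> 'ge"
    and b :: "'ge \<Rightarrow> 'ge \<Rightarrow> real"
    and t :: real
  assumes "smooth_manifold Q" and "su3_structure Q g J \<omega> \<Upsilon>"
    and "su3_torsion_forms Q J \<omega> \<Upsilon> \<pi>0 \<sigma>0 \<pi>1 \<nu>1 \<pi>2 \<sigma>2 \<nu>3"
    and "\<And>q vs. q \<in> points Q \<Longrightarrow> \<sigma>2 q vs = 0"
    and "\<And>q vs. q \<in> points Q \<Longrightarrow> \<pi>2 q vs = 0"
    and "\<And>q vs. q \<in> points Q \<Longrightarrow> \<pi>1 q vs = 2 * \<nu>1 q vs"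
    and "principal_bundle S" and "base S = Q" and "total S = M" and "sgroup S = circle_lie"
    and "principal_connection S \<eta>"
    and "smooth_form Q 2 \<kappa>"
    and "\<And>p vs. p \<in> points M \<Longrightarrow> ext_d M \<eta> p vs = lift_form S \<kappa> p vs"
    and "\<And>q. q \<in> points Q \<Longrightarrow> in_Lambda2_8 (J q) (\<omega> q) (\<kappa> q)"
    and "principal_bundle P" and "base P = Q"
    and "su3_instanton P \<omega> \<Upsilon> A"
    and "invariant_pairing (sgroup P) b"
    and "bianchi_identity P A b (su3_T J \<omega> \<Upsilon> \<pi>0 \<sigma>0 \<nu>1 \<nu>3)"
    and "0 \<le> t" and "t < 2 * pi"
  shows "heterotic_g2_system M (phi_t S \<eta> \<omega> \<Upsilon> t)
           (pullback_bundle M (proj S) (product_bundle S P))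
           (pullback_connection M (proj S) (product_bundle S P) (product_connection S P \<eta> A))"
proof -
 interpret heterotic_lift Q g J \<omega> \<Upsilon> \<pi>0 \<sigma>0 \<pi>1 \<nu>1 \<pi>2 \<sigma>2 \<nu>3 S \<eta> \<kappa> t P A b
  by unfold_locales (use assms in \<open>simp_all\<close>)
 show ?thesis using heterotic assms(9) by simp
qed

end
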